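(* Let $\mu$ be a probability distribution on $\mathbb{R}$ with finite first moment such that, for every $t_0\in[0,1)$, the variance of the posterior distribution $\mu_{t,z}$ is bounded over $(t,z)\in[0,t_0]\times\mathbb{R}$. Let $$v(t,z)=\sup_{\tau\in\mathcal{T}^Z_{1-t}}\mathbb{E}\left[Z^{t,z}_{t+\tau}\right],\qquad(t,z)\in[0,1)\times\mathbb{R},$$ let $\mathcal{C}:=\{(t,z)\in[0,1)\times\mathbb{R}: v(t,z)>z\}$, $\mathcal{D}:=([0,1]\times\mathbb{R})\setminus\mathcal{C}$, and $\tau_{\mathcal{D}}:=\inf\{s\ge0:(t+s,Z^{t,z}_{t+s})\in\mathcal{D}\}$. Then: (i) The stopping time $\tau_{\mathcal{D}}$ is optimal, i.e. $v(t,z)=\mathbb{E}[Z^{t,z}_{t+\tau_{\mathcal{D}}}]$ for all $(t,z)\in[0,1)\times\mathbb{R}$. (ii) The value function $v$ is continuous on $[0,1)\times\mathbb{R}$. (iii) The value function $v$ satisfies $$\begin{cases}\partial_1v+\mathcal{L}v=0,&(t,z)\in\mathcal{C},\\ v(t,z)=z,&(t,z)\in\mathcal{D},\end{cases}$$ where $\mathcal{L}=\frac{h(t,z)-z}{1-t}\,\partial_2+\frac12\,\partial_2^2$.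
   Context: For $(t,z)\in[0,1)\times\mathbb{R}$, $$\mu_{t,z}(du):=\frac{e^{\frac{uz}{1-t}-\frac{tu^2}{2(1-t)}}\,\mu(du)}{\int_{\mathbb{R}}e^{\frac{uz}{1-t}-\frac{tu^2}{2(1-t)}}\,\mu(du)},\qquad h(t,z):=\int_{\mathbb{R}}u\,\mu_{t,z}(du).$$ The assumption on the variance of $\mu_{t,z}$ includes that $\mu_{t,z}$ is well defined for all $(t,z)\in[0,1)\times\mathbb{R}$. The process $Z^{t,z}$ is the solution of $$dZ_{t+s}=\frac{h(t+s,Z_{t+s})-Z_{t+s}}{1-(t+s)}\,ds+d\hat W_{t+s},\quad0\le s<1-t,\qquad Z_t=z,$$ with $\hat W$ a standard Brownian motion, extended to time $1$ by its a.s. limit; equivalently, in law, it is a Brownian bridge started at time $t$ from $z$ whose (unknown) pinning point at time $1$ has distribution $\mu_{t,z}$. $\mathcal{T}^Z_{1-t}$ denotes the set of $[0,1-t]$-valued stopping times with respect to the filtration generated by $s\mapsto Z^{t,z}_{t+s}$. $\partial_1,\partial_2$ denote partial derivatives in the first (time) and second (space) variable. In (iii), the identity $v(t,z)=z$ on $\mathcal{D}$ refers to points of $\mathcal{D}$ with $t<1$, where $v$ is defined. *)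

theory Defs
  imports "HOL-Probability.Probability"
begin

definition weight :: "real \<Rightarrow> real \<Rightarrow> real \<Rightarrow> real" where
  "weight t z u = exp (u * z / (1 - t) - t * u\<^sup>2 / (2 * (1 - t)))"

definition posterior :: "real measure \<Rightarrow> real \<Rightarrow> real \<Rightarrow> real measure" where
  "posterior \<mu> t z = density \<mu> (\<lambda>u. ennreal (weight t z u / (\<integral>x. weight t z x \<partial>\<mu>)))"

definition posterior_mean :: "real measure \<Rightarrow> real \<Rightarrow> real \<Rightarrow> real" where
  "posterior_mean \<mu> t z = (\<integral>u. u \<partial>posterior \<mu> t z)"

definition posterior_variance :: "real measure \<Rightarrow> real \<Rightarrow> real \<Rightarrow> real" where
  "posterior_variance \<mu> t z = (\<integral>u. (u - posterior_mean \<mu> t z)\<^sup>2 \<partial>posterior \<mu> t z)"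

(* The integrability clauses say that the posterior is well defined and has a finite variance;
   without them the Bochner integrals above would silently be 0. *)
definition bounded_posterior_variance :: "real measure \<Rightarrow> bool" where
  "bounded_posterior_variance \<mu> \<longleftrightarrow>
     (\<forall>t\<in>{0..<1}. \<forall>z. integrable \<mu> (weight t z)
                      \<and> integrable (posterior \<mu> t z) (\<lambda>u. u\<^sup>2)) \<and>
     (\<forall>t0\<in>{0..<1}. \<exists>C. \<forall>t\<in>{0..t0}. \<forall>z. posterior_variance \<mu> t z \<le> C)"

definition standard_brownian_motion :: "'w measure \<Rightarrow> (real \<Rightarrow> 'w \<Rightarrow> real) \<Rightarrow> bool" where
  "standard_brownian_motion M W \<longleftrightarrow>
     prob_space M \<and>
     (\<forall>s\<ge>0. W s \<in> borel_measurable M) \<and>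
     (AE \<omega> in M. W 0 \<omega> = 0 \<and> continuous_on {0..} (\<lambda>s. W s \<omega>)) \<and>
     (\<forall>r s. 0 \<le> r \<and> r < s \<longrightarrow>
        distributed M lborel (\<lambda>\<omega>. W s \<omega> - W r \<omega>) (normal_density 0 (sqrt (s - r)))) \<and>
     (\<forall>(n::nat) (p::nat \<Rightarrow> real). 0 \<le> p 0 \<and> (\<forall>i<n. p i < p (Suc i)) \<longrightarrow>
        prob_space.indep_vars M (\<lambda>_. borel) (\<lambda>i \<omega>. W (p (Suc i)) \<omega> - W (p i) \<omega>) {..<n})"

definition drift :: "real measure \<Rightarrow> real \<Rightarrow> real \<Rightarrow> real" where
  "drift \<mu> t z = (posterior_mean \<mu> t z - z) / (1 - t)"

(* X solves the SDE started from z at time t, on [t,1), driven by W, and is extended to time 1 by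
   its almost sure limit.  X is indexed by absolute time, so Z_(t+s) is X (t + s).  The noise being
   additive, the SDE in integral form holds pathwise and involves no stochastic integral. *)
definition bridge_solution ::
  "real measure \<Rightarrow> 'w measure \<Rightarrow> (real \<Rightarrow> 'w \<Rightarrow> real) \<Rightarrow> real \<Rightarrow> real \<Rightarrow> (real \<Rightarrow> 'w \<Rightarrow> real) \<Rightarrow> bool" where
  "bridge_solution \<mu> M W t z X \<longleftrightarrow>
     (\<forall>s\<in>{t..1}. X s \<in> borel_measurable M) \<and>
     (\<forall>\<omega>\<in>space M. continuous_on {t..<1} (\<lambda>s. X s \<omega>)) \<and>
     (AE \<omega> in M. X t \<omega> = z \<and>
        (\<forall>s\<in>{t..<1}.
           set_integrable lborel {t..s} (\<lambda>r. drift \<mu> r (X r \<omega>)) \<and>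
           X s \<omega> = z + (LINT r:{t..s}|lborel. drift \<mu> r (X r \<omega>)) + (W s \<omega> - W t \<omega>))) \<and>
     (AE \<omega> in M. ((\<lambda>s. X s \<omega>) \<longlongrightarrow> X 1 \<omega>) (at_left 1))"

(* The filtration generated by s |-> X (t + s), 0 <= s <= 1 - t. *)
definition generated_filtration ::
  "'w measure \<Rightarrow> real \<Rightarrow> (real \<Rightarrow> 'w \<Rightarrow> real) \<Rightarrow> real \<Rightarrow> 'w measure" where
  "generated_filtration M t X s =
     sigma (space M) {X (t + r) -` A \<inter> space M | r A. 0 \<le> r \<and> r \<le> s \<and> r \<le> 1 - t \<and> A \<in> sets borel}"

definition stopping_times :: "'w measure \<Rightarrow> real \<Rightarrow> (real \<Rightarrow> 'w \<Rightarrow> real) \<Rightarrow> ('w \<Rightarrow> real) set" where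
  "stopping_times M t X =
     {\<tau>. stopping_time (generated_filtration M t X) \<tau> \<and> (\<forall>\<omega>\<in>space M. \<tau> \<omega> \<in> {0..1 - t})}"

definition stopped :: "real \<Rightarrow> (real \<Rightarrow> 'w \<Rightarrow> real) \<Rightarrow> ('w \<Rightarrow> real) \<Rightarrow> 'w \<Rightarrow> real" where
  "stopped t X \<tau> \<omega> = X (t + \<tau> \<omega>) \<omega>"

(* In the following, Z t z is the process started from z at time t. *)

definition value_fun ::
  "'w measure \<Rightarrow> (real \<Rightarrow> real \<Rightarrow> real \<Rightarrow> 'w \<Rightarrow> real) \<Rightarrow> real \<Rightarrow> real \<Rightarrow> real" where
  "value_fun M Z t z = (SUP \<tau>\<in>stopping_times M t (Z t z). \<integral>\<omega>. stopped t (Z t z) \<tau> \<omega> \<partial>M)"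

definition continuation_set ::
  "'w measure \<Rightarrow> (real \<Rightarrow> real \<Rightarrow> real \<Rightarrow> 'w \<Rightarrow> real) \<Rightarrow> (real \<times> real) set" where
  "continuation_set M Z = {(t, z). t \<in> {0..<1} \<and> value_fun M Z t z > z}"

definition stopping_set ::
  "'w measure \<Rightarrow> (real \<Rightarrow> real \<Rightarrow> real \<Rightarrow> 'w \<Rightarrow> real) \<Rightarrow> (real \<times> real) set" where
  "stopping_set M Z = {0..1} \<times> UNIV - continuation_set M Z"

(* For t in [0,1) the infimum is over a nonempty set, since s = 1 - t always qualifies. *)
definition hitting_time ::
  "'w measure \<Rightarrow> (real \<Rightarrow> real \<Rightarrow> real \<Rightarrow> 'w \<Rightarrow> real) \<Rightarrow> real \<Rightarrow> real \<Rightarrow> 'w \<Rightarrow> real" where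
  "hitting_time M Z t z \<omega> = Inf {s. 0 \<le> s \<and> (t + s, Z t z (t + s) \<omega>) \<in> stopping_set M Z}"

end

theory Submission
  imports Defs "HOL-Complex_Analysis.Complex_Analysis"
begin

text \<open>
  Disintegrating the bridge over its pinning point gives an explicit transition kernel \<open>K\<close>, the
  \<open>h\<close>-transform of the heat kernel by a caloric function \<open>g\<close>.  An Euler scheme for the SDE, compared
  with \<open>K\<close> on complex exponentials, shows that every solution is Markov with kernel \<open>K\<close>; no uniqueness
  theory is needed.  The value function \<open>V\<close> is then built from \<open>K\<close> alone, as the supremum of the
  dynamic programming recursions on dyadic grids.  It is the smallest excessive majorant of the payoff,
  it is continuous, and in the continuation region its defect from harmonicity over a time step \<open>\<delta>\<close> is
  \<open>O(\<delta>\<^sup>2)\<close>.  Discrete optional sampling turns the first property into optimality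
  bounds, the last one into optimality of the hitting time.

  For the equation, \<open>g V\<close> is a heat integral of the terminal value plus the heat potentials of the
  defects.  Near a continuation point only defects at a distance matter in the limit, and their heat
  potentials extend to a common complex neighbourhood with uniform bounds, so Montel's theorem makes
  \<open>V\<close> analytic in space, uniformly in time.  A Taylor expansion under \<open>K\<close> then yields the time
  derivative and the equation.
\<close>

text \<open>The obstacle is time 1: the drift is Lipschitz only on [0,T] with T < 1, the payoff is
  unbounded, and the kernel exists only below 1. Moments near time 1 are therefore controlled by
  quadratic functions of the distance to the hidden pinning point, which the kernel transforms in
  closed form; two supermartingales of this kind, \<open>Fm\<close> and \<open>R\<close>, carry all
  estimates, and (V - z)^2 is bounded by a quantity that vanishes in the mean near time 1. Complex
  exponentials serve as test functions because the variance bound gives their kernel averages a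
  holomorphic continuation to a strip around the real axis, uniformly in time, hence uniform Taylor
  bounds. An Euler step of length d then errs by order d^(3/2), summable over 1/d steps. The defect
  of order d^2 is summable likewise: from a continuation point stopping pays only after a fixed
  displacement, whose mean square is of order d, during a time of order d. The filtration is raw,
  neither completed nor right-continuous. Hitting times are stopping times because paths are
  continuous for every sample point before 1; stopping times are discretised to values below
  1.\<close>

definition heat :: "real => real => real" where
 "heat \<tau> x = normal_density 0 (sqrt \<tau>) x"

abbreviation gaussian :: "real measure" where
 "gaussian \<equiv> density lborel (%x. ennreal (std_normal_density x))"

lemma heat_eq: "0 < \<tau> ==> heat \<tau> x = exp (- x\<^sup>2 / (2 * \<tau>)) / sqrt (2 * pi * \<tau>)"
 by (simp add: heat_def normal_density_def)

lemma heat_pos: "0 < \<tau> ==> 0 < heat \<tau> x"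
 by (simp add: heat_def normal_density_pos)

lemma heat_nonneg [simp]: "0 <= heat \<tau> x"
 by (simp add: heat_def)

lemma heat_measurable [measurable]:
 assumes [measurable]: "f \<in> borel_measurable N" "k \<in> borel_measurable N"
 shows "(%x. heat (f x) (k x)) \<in> borel_measurable N"
 unfolding heat_def normal_density_def by measurable

text \<open>Completing the square in y: the joint density of two Gaussian steps is the density of
  the whole step times the law of a Brownian bridge at the intermediate time. The exact formulas for
  the kernel rest on this.\<close>

lemma heat_bridge:
 assumes a: "0 < a" and b: "0 < b"
 shows "heat a (y - z) * heat b (u - y) =
  heat (a + b) (u - z) * normal_density (z + a / (a + b) * (u - z)) (sqrt (a * b / (a + b))) y"
proof -
 have ab: "0 < a + b" using a b by simp
 have e: "- (y - z)\<^sup>2 / (2 * a) + - (u - y)\<^sup>2 / (2 * b) =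
  - (u - z)\<^sup>2 / (2 * (a + b)) + - (y - (z + a / (a + b) * (u - z)))\<^sup>2 / (2 * (a * b / (a + b)))"
 proof -
  have "- (y - (z + a / (a + b) * (u - z)))\<^sup>2 / (2 * (a * b / (a + b))) =
   - ((a + b) * (y - z) - a * (u - z))\<^sup>2 / (2 * a * b * (a + b))"
  proof -
   have 1: "y - (z + a / (a + b) * (u - z)) = ((a + b) * (y - z) - a * (u - z)) / (a + b)"
    using a b ab by (simp add: field_simps)
   show ?thesis
    unfolding 1 power_divide using a b ab by (simp add: divide_simps power2_eq_square)
  qed
  moreover have "p\<^sup>2 / (2 * a) + q^2 / (2 * b) = (p + q)^2 / (2 * (a + b)) + ((a + b) * p - a * (p + q))\<^sup>2 / (2 * a * b * (a + b))"
   for p q :: real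
  proof -
   have "(p + q)\<^sup>2 / (2 * (a + b)) + ((a + b) * p - a * (p + q))\<^sup>2 / (2 * a * b * (a + b)) =
    (a * b * (p + q)^2 + ((a + b) * p - a * (p + q))\<^sup>2) / (2 * a * b * (a + b))"
    using a b ab by (simp add: add_divide_distrib)
   also have "a * b * (p + q)^2 + ((a + b) * p - a * (p + q))\<^sup>2 = (a + b) * (b * p^2 + a * q^2)"
    by (simp add: power2_eq_square algebra_simps)
   also have "... / (2 * a * b * (a + b)) = (b * p^2 + a * q^2) / (2 * a * b)"
    using a b ab by simp
   also have "... = p^2 / (2 * a) + q^2 / (2 * b)"
    using a b by (simp add: add_divide_distrib)
   finally show ?thesis by simp
  qed
  from this[of "y - z" "u - y"] have "(y - z)\<^sup>2 / (2 * a) + (u - y)^2 / (2 * b) =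
   (u - z)\<^sup>2 / (2 * (a + b)) + ((a + b) * (y - z) - a * (u - z))\<^sup>2 / (2 * a * b * (a + b))"
   by simp
  ultimately show ?thesis by simp
 qed
 have r: "sqrt (2 * pi * a) * sqrt (2 * pi * b) = sqrt (2 * pi * (a + b)) * sqrt (2 * pi * (a * b / (a + b)))"
  using a b ab by (simp flip: real_sqrt_mult add: field_simps)
 have "heat a (y - z) * heat b (u - y) =
  exp (- (y - z)\<^sup>2 / (2 * a) + - (u - y)\<^sup>2 / (2 * b)) / (sqrt (2 * pi * a) * sqrt (2 * pi * b))"
  using a b by (simp only: heat_eq exp_add) simp
 also have "... = heat (a + b) (u - z) * normal_density (z + a / (a + b) * (u - z)) (sqrt (a * b / (a + b))) y"
  unfolding e r exp_add using a b ab by (simp add: heat_eq normal_density_def)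
 finally show ?thesis .
qed

lemma prob_space_gaussian: "prob_space gaussian"
 by (rule prob_space_normal_density) simp

lemma nn_integral_normal_density_affine:
 assumes [measurable]: "f \<in> borel_measurable borel" and "0 < \<sigma>"
 shows "(\<integral>\<^sup>+x. f x * ennreal (normal_density m \<sigma> x) \<partial>lborel) = (\<integral>\<^sup>+x. f (m + \<sigma> * x) \<partial>gaussian)"
proof -
 have "(\<integral>\<^sup>+x. f x * ennreal (normal_density m \<sigma> x) \<partial>lborel) =
  ennreal \<sigma> * (\<integral>\<^sup>+x. f (m + \<sigma> * x) * ennreal (normal_density m \<sigma> (m + \<sigma> * x)) \<partial>lborel)"
  using \<open>0 < \<sigma>\<close> by (subst nn_integral_real_affine[where c=\<sigma> and t=m]) auto
 also have "... = (\<integral>\<^sup>+x. f (m + \<sigma> * x) * ennreal (std_normal_density x) \<partial>lborel)"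
  using \<open>0 < \<sigma>\<close>
  by (subst nn_integral_cmult[symmetric], measurable)
   (auto intro!: nn_integral_cong simp: normal_density_def power_mult_distrib real_sqrt_mult
     ennreal_mult'[symmetric] mult.left_commute[of "ennreal \<sigma>"] divide_simps)
 also have "... = (\<integral>\<^sup>+x. f (m + \<sigma> * x) \<partial>gaussian)"
  by (simp add: nn_integral_density mult.commute)
 finally show ?thesis .
qed

lemma gaussian_moments:
 "integrable gaussian (%x. x ^ k)"
 "(LINT x|gaussian. x) = 0" "(LINT x|gaussian. x\<^sup>2) = 1" "(LINT x|gaussian. x ^ 3) = 0" "(LINT x|gaussian. x ^ 4) = 3"
proof -
 show "integrable gaussian (%x. x ^ k)"
  using integrable_std_normal_moment[of k] by (simp add: integrable_density)
 show "(LINT x|gaussian. x) = 0"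
  using integral_std_normal_moment_odd[of 0] by (simp add: integral_density)
 show "(LINT x|gaussian. x\<^sup>2) = 1"
  using integral_std_normal_moment_even[of 1] by (simp add: integral_density)
 show "(LINT x|gaussian. x ^ 3) = 0"
  using integral_std_normal_moment_odd[of 1] by (simp add: integral_density)
 show "(LINT x|gaussian. x ^ 4) = 3"
  using integral_std_normal_moment_even[of 2] by (simp add: integral_density fact_numeral)
qed

lemma integrable_dominated:
 fixes f :: "'a => 'b::{banach, second_countable_topology}"
 assumes "integrable M g" "f \<in> borel_measurable M" "!!x. x \<in> space M ==> norm (f x) <= g x"
 shows "integrable M f"
 by (rule Bochner_Integration.integrable_bound[OF assms(1,2)])
  (auto intro!: AE_I2 order_trans[OF assms(3)])

text \<open>Quadratic growth is the class that contains the payoff and the value functions, is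
  integrable against the kernel and is mapped into itself by it (\<open>tame_K\<close>).\<close>

definition tame :: "(real => real) => bool" where
 "tame f \<longleftrightarrow> f \<in> borel_measurable borel \<and> (\<exists>c. \<forall>y. \<bar>f y\<bar> <= c * (1 + y^2))"

text \<open>Mean at time r of the Brownian bridge from z at time s to u at time 1;
  \<open>bridge_sd\<close> is its standard deviation.\<close>

definition bridge_mean :: "real => real => real => real => real" where
 "bridge_mean s r z u = z + (r - s) / (1 - s) * (u - z)"

definition bridge_sd :: "real => real => real" where
 "bridge_sd s r = sqrt ((r - s) * (1 - r) / (1 - s))"

lemma bridge_sd_pos: "s < r ==> r < 1 ==> 0 < bridge_sd s r"
 by (simp add: bridge_sd_def)

lemma power4_add_le: "(a + b :: real) ^ 4 <= 8 * a ^ 4 + 8 * b ^ 4"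
proof -
 have 1: "(a + b)\<^sup>2 <= 2 * a^2 + 2 * b^2"
  using zero_le_power2[of "a - b"] by (simp add: power2_eq_square algebra_simps)
 have "(a + b) ^ 4 = ((a + b)^2)\<^sup>2" by simp
 also have "... <= (2 * a^2 + 2 * b^2)\<^sup>2" by (rule power_mono[OF 1]) simp
 also have "... <= 8 * a ^ 4 + 8 * b ^ 4"
  using zero_le_power2[of "a\<^sup>2 - b\<^sup>2"] by (simp add: power2_eq_square algebra_simps power4_eq_xxxx)
 finally show ?thesis .
qed

lemma power_div_fact_le_exp:
 fixes x :: real
 assumes "0 <= x"
 shows "x ^ k / fact k <= exp x"
proof -
 have "(\<Sum>i\<in>{k}. x ^ i /\<^sub>R fact i) <= (\<Sum>i. x ^ i /\<^sub>R fact i)"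
  using assms by (intro sum_le_suminf summable_exp_generic) auto
 then show ?thesis by (simp add: exp_def divide_inverse_commute)
qed

section \<open>Posterior distributions: exponential moments and normalisation\<close>

locale bounded_posterior =
 fixes \<mu> :: "real measure"
 assumes distr: "real_distribution \<mu>" and bounded: "bounded_posterior_variance \<mu>"
begin

sublocale real_distribution \<mu> by (rule distr)

text \<open>At time 0 the weight is the exponential of c * u, so well-definedness of the posterior
  at time 0 for every starting point already says that \<mu> has all exponential moments.\<close>

lemma integrable_exp: "integrable \<mu> (%u. exp (c * u))"
proof -
 have "integrable \<mu> (weight 0 c)"
  using bounded by (auto simp: bounded_posterior_variance_def)
 then show ?thesis by (simp add: weight_def[abs_def] mult.commute)
qed

lemma integrable_exp_abs: "integrable \<mu> (%u. \<bar>u\<bar> ^ k * exp (c * \<bar>u\<bar>))"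
proof (rule integrable_dominated)
 show "integrable \<mu> (%u. fact k * (exp ((c + 1) * u) + exp (- (c + 1) * u)))"
  using integrable_exp by simp
 fix u :: real
 have "\<bar>u\<bar> ^ k / fact k <= exp \<bar>u\<bar>"
  by (rule power_div_fact_le_exp) simp
 then have "\<bar>u\<bar> ^ k <= fact k * exp \<bar>u\<bar>" by (simp add: field_simps)
 then have "\<bar>u\<bar> ^ k * exp (c * \<bar>u\<bar>) <= fact k * exp \<bar>u\<bar> * exp (c * \<bar>u\<bar>)"
  by (rule mult_right_mono) simp
 also have "... = fact k * exp ((c + 1) * \<bar>u\<bar>)" by (simp add: algebra_simps flip: exp_add)
 also have "... <= fact k * (exp ((c + 1) * u) + exp (- (c + 1) * u))"
 proof (cases "u \<ge> 0")
  case False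
  then have "(c + 1) * \<bar>u\<bar> = - (c + 1) * u" by (simp add: algebra_simps)
  then show ?thesis by (intro mult_left_mono) (simp_all add: \<open>(c + 1) * \<bar>u\<bar> = - (c + 1) * u\<close>)
 qed (simp add: add_increasing2)
 finally show "norm (\<bar>u\<bar> ^ k * exp (c * \<bar>u\<bar>)) <= fact k * (exp ((c + 1) * u) + exp (- (c + 1) * u))"
  by simp
qed simp

definition D :: "real => real => real" where "D s z = (LINT u|\<mu>. weight s z u)"

lemma weight_measurable [measurable]:
 assumes [measurable]: "f \<in> borel_measurable N" "k \<in> borel_measurable N" "m \<in> borel_measurable N"
 shows "(%x. weight (f x) (k x) (m x)) \<in> borel_measurable N"
 unfolding weight_def by measurable

lemma weight_pos: "0 < weight s z u"
 by (simp add: weight_def)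

text \<open>For s >= 0 the Gaussian factor of the weight is at most 1; what remains is bounded
  uniformly for times up to T and bounded positions, in the form that dominated convergence asks
  for.\<close>

lemma weight_le:
 assumes "0 <= s" "s <= T" "T < 1" "\<bar>z\<bar> <= b"
 shows "weight s z u <= exp (b / (1 - T) * \<bar>u\<bar>)"
proof -
 have "u * z / (1 - s) <= b / (1 - T) * \<bar>u\<bar>"
 proof -
  have "u * z <= \<bar>u\<bar> * b" 
  proof -
   have "u * z <= \<bar>u\<bar> * \<bar>z\<bar>" by (simp add: abs_mult[symmetric])
   also have "... <= \<bar>u\<bar> * b" using assms(4) by (intro mult_left_mono) auto
   finally show ?thesis .
  qed
  then have "u * z / (1 - s) <= \<bar>u\<bar> * b / (1 - s)" using assms by (simp add: divide_right_mono)
  also have "... <= \<bar>u\<bar> * b / (1 - T)" using assms by (intro divide_left_mono) auto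
  finally show ?thesis by (simp add: mult.commute)
 qed
 moreover have "0 <= s * u^2 / (2 * (1 - s))" using assms by simp
 ultimately show ?thesis by (simp add: weight_def)
qed

lemma integrable_weight_abs:
 assumes "0 <= s" "s < 1"
 shows "integrable \<mu> (%u. \<bar>u\<bar> ^ k * exp (c * \<bar>u\<bar>) * weight s z u)"
proof (rule integrable_dominated)
 show "integrable \<mu> (%u. \<bar>u\<bar> ^ k * exp ((c + \<bar>z\<bar> / (1 - s)) * \<bar>u\<bar>))" by (rule integrable_exp_abs)
 fix u
 have "weight s z u <= exp (\<bar>z\<bar> / (1 - s) * \<bar>u\<bar>)" using assms by (intro weight_le) auto
 then have "\<bar>u\<bar> ^ k * exp (c * \<bar>u\<bar>) * weight s z u <= \<bar>u\<bar> ^ k * exp (c * \<bar>u\<bar>) * exp (\<bar>z\<bar> / (1 - s) * \<bar>u\<bar>)"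
  by (rule mult_left_mono) simp
 then show "norm (\<bar>u\<bar> ^ k * exp (c * \<bar>u\<bar>) * weight s z u) <= \<bar>u\<bar> ^ k * exp ((c + \<bar>z\<bar> / (1 - s)) * \<bar>u\<bar>)"
  using less_imp_le[OF weight_pos] by (simp add: abs_mult distrib_right exp_add mult.assoc)
qed simp

lemma integrable_weight: "0 <= s ==> s < 1 ==> integrable \<mu> (weight s z)"
 using integrable_weight_abs[of s 0 0 z] by simp

lemma D_pos:
 assumes "0 <= s" "s < 1" shows "0 < D s z"
proof -
 have "D s z ~= 0"
 proof
  assume "D s z = 0"
  then have "AE u in \<mu>. weight s z u = 0"
   using integral_nonneg_eq_0_iff_AE[OF integrable_weight[OF assms]] less_imp_le[OF weight_pos]
   by (auto simp: D_def)
  then have "AE u in \<mu>. False"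
   by eventually_elim (use weight_pos[of s z] in \<open>simp add: less_le\<close>)
  then show False by simp
 qed
 moreover have "0 <= D s z" unfolding D_def using less_imp_le[OF weight_pos] by simp
 ultimately show ?thesis by simp
qed

definition post :: "real => real => real measure" where "post s z = posterior \<mu> s z"

lemma post_eq: "post s z = density \<mu> (%u. ennreal (weight s z u / D s z))"
 by (simp add: post_def posterior_def D_def)

lemma sets_post [simp, measurable_cong]: "sets (post s z) = sets borel" and space_post [simp]: "space (post s z) = UNIV"
 by (simp_all add: post_eq)

lemma prob_space_post: assumes "0 <= s" "s < 1" shows "prob_space (post s z)"
proof
 have "emeasure (post s z) (space (post s z)) = (\<integral>\<^sup>+u. ennreal (weight s z u / D s z) \<partial>\<mu>)"
  by (simp add: post_eq emeasure_density)
 also have "... = ennreal (LINT u|\<mu>. weight s z u / D s z)"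
  using D_pos[OF assms, of z] less_imp_le[OF weight_pos] integrable_weight[OF assms]
  by (intro nn_integral_eq_integral) auto
 also have "... = 1" using D_pos[OF assms, of z] by (simp add: D_def)
 finally show "emeasure (post s z) (space (post s z)) = 1" .
qed

lemma integral_post:
 fixes f :: "real => 'b::{banach, second_countable_topology}"
 assumes "0 <= s" "s < 1" "f \<in> borel_measurable borel"
 shows "(LINT u|post s z. f u) = (LINT u|\<mu>. (weight s z u / D s z) *\<^sub>R f u)"
  and "integrable (post s z) f \<longleftrightarrow> integrable \<mu> (%u. (weight s z u / D s z) *\<^sub>R f u)"
 using D_pos[OF assms(1,2), of z] less_imp_le[OF weight_pos] assms(3)
 by (auto simp: post_eq integral_density integrable_density)

lemma integrable_post:
 fixes f :: "real => 'b::{banach, second_countable_topology}"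
 assumes "0 <= s" "s < 1" and [measurable]: "f \<in> borel_measurable borel"
  and le: "!!u. norm (f u) <= C * (1 + \<bar>u\<bar> ^ k) * exp (c * \<bar>u\<bar>)"
 shows "integrable (post s z) f"
 unfolding integral_post(2)[OF assms(1-3)]
proof (rule integrable_dominated)
 show "integrable \<mu> (%u. C / D s z * (\<bar>u\<bar> ^ 0 * exp (c * \<bar>u\<bar>) * weight s z u + \<bar>u\<bar> ^ k * exp (c * \<bar>u\<bar>) * weight s z u))"
  by (rule integrable_mult_right[OF Bochner_Integration.integrable_add[OF integrable_weight_abs integrable_weight_abs]])
   (use assms in auto)
 fix u
 have "norm ((weight s z u / D s z) *\<^sub>R f u) <= weight s z u / D s z * (C * (1 + \<bar>u\<bar> ^ k) * exp (c * \<bar>u\<bar>))"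
  using le[of u] D_pos[OF assms(1,2), of z] weight_pos[of s z u] by (simp add: mult_left_mono divide_right_mono less_imp_le)
 then show "norm ((weight s z u / D s z) *\<^sub>R f u) <= C / D s z * (\<bar>u\<bar> ^ 0 * exp (c * \<bar>u\<bar>) * weight s z u + \<bar>u\<bar> ^ k * exp (c * \<bar>u\<bar>) * weight s z u)"
  by (simp add: algebra_simps)
qed simp

lemma integrable_post_power:
 assumes "0 <= s" "s < 1"
 shows "integrable (post s z) (%u. u ^ k)"
 by (rule integrable_post[OF assms, of _ 1 k 0]) (auto simp: power_abs)

definition h :: "real => real => real" where "h s z = posterior_mean \<mu> s z"

lemma h_eq: "h s z = (LINT u|post s z. u)"
 by (simp add: h_def posterior_mean_def post_def)

text \<open>Mean squared distance from the present position to the unknown pinning point. Along the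
  process it evolves in closed form (\<open>K_\<rho>\<close>) and becomes small in the mean near
  time 1.\<close>

definition \<rho> :: "real => real => real" where "\<rho> s z = (LINT u|post s z. (u - z)\<^sup>2)"

lemma \<rho>_nonneg: "0 <= \<rho> s z" by (simp add: \<rho>_def)

subsection \<open>The transition kernel\<close>

text \<open>The second factor is the reciprocal of the standard normal density at u. So
  \<open>lam\<close> is the density at u of a Brownian endpoint seen from (s, z), relative to the
  one seen from (0, 0). It differs from \<open>weight\<close> by a factor free of u, hence yields
  the same posterior, and its \<mu>-integral \<open>g\<close> solves the backward heat
  equation.\<close>

definition lam :: "real => real => real => real" where
 "lam s z u = heat (1 - s) (u - z) * (sqrt (2 * pi) * exp (u^2 / 2))"

definition g :: "real => real => real" where "g s z = (LINT u|\<mu>. lam s z u)"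

lemma lam_eq_weight:
 assumes "s < 1"
 shows "lam s z u = exp (- z\<^sup>2 / (2 * (1 - s))) / sqrt (1 - s) * weight s z u"
proof -
 have "- (u - z)\<^sup>2 / (2 * (1 - s)) + u^2 / 2 = - z\<^sup>2 / (2 * (1 - s)) + (u * z / (1 - s) - s * u^2 / (2 * (1 - s)))"
  using assms by (simp add: divide_simps) (simp add: power2_eq_square algebra_simps)
 then have "exp (- (u - z)\<^sup>2 / (2 * (1 - s))) * exp (u^2 / 2) = exp (- z\<^sup>2 / (2 * (1 - s))) * weight s z u"
  by (simp only: weight_def exp_add[symmetric])
 then show ?thesis
  using assms real_sqrt_mult[of "2 * pi" "1 - s"] by (simp add: lam_def heat_eq divide_simps mult_ac)
qed

lemma lam_measurable [measurable]:
 assumes [measurable]: "f \<in> borel_measurable N" "k \<in> borel_measurable N" "m \<in> borel_measurable N"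
 shows "(%x. lam (f x) (k x) (m x)) \<in> borel_measurable N"
 unfolding lam_def by measurable

lemma lam_nonneg: "0 <= lam s z u"
 by (simp add: lam_def)

lemma g_eq: "s < 1 ==> g s z = exp (- z\<^sup>2 / (2 * (1 - s))) / sqrt (1 - s) * D s z"
 by (simp add: g_def D_def lam_eq_weight)

lemma g_pos: "0 <= s ==> s < 1 ==> 0 < g s z"
 using D_pos[of s z] by (simp add: g_eq)

lemma g_nonneg: "0 <= g s z"
 unfolding g_def using lam_nonneg by simp

lemma g_measurable [measurable]:
 assumes [measurable]: "f \<in> borel_measurable N" "k \<in> borel_measurable N"
 shows "(%x. g (f x) (k x)) \<in> borel_measurable N"
 unfolding g_def by measurable

lemma D_measurable [measurable]:
 assumes [measurable]: "f \<in> borel_measurable N" "k \<in> borel_measurable N"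
 shows "(%x. D (f x) (k x)) \<in> borel_measurable N"
 unfolding D_def by measurable

lemma lam_over_g: "0 <= s ==> s < 1 ==> lam s z u / g s z = weight s z u / D s z"
 by (simp add: lam_eq_weight g_eq)

lemma integrable_lam: "0 <= s ==> s < 1 ==> integrable \<mu> (lam s z)"
 using integrable_weight[of s z] by (subst Bochner_Integration.integrable_cong[OF refl lam_eq_weight]) auto

lemma post_lam: "0 <= s ==> s < 1 ==> post s z = density \<mu> (%u. ennreal (lam s z u / g s z))"
 by (simp add: post_eq lam_over_g)

definition ker :: "real => real => real => real => real" where
 "ker s z r y = heat (r - s) (y - z) * g r y / g s z"

definition K :: "real => real => real => real measure" where
 "K s z r = density lborel (%y. ennreal (ker s z r y))"

lemma ker_nonneg: "0 <= ker s z r y"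
 by (simp add: ker_def g_nonneg)

lemma ker_measurable [measurable]:
 assumes [measurable]: "f \<in> borel_measurable N" "k \<in> borel_measurable N" "m \<in> borel_measurable N" "n \<in> borel_measurable N"
 shows "(%x. ker (f x) (k x) (m x) (n x)) \<in> borel_measurable N"
 unfolding ker_def by measurable

lemma sets_K [simp, measurable_cong]: "sets (K s z r) = sets borel" and space_K [simp]: "space (K s z r) = UNIV"
 by (simp_all add: K_def)

lemma nn_integral_K:
 assumes [measurable]: "f \<in> borel_measurable borel"
 shows "(\<integral>\<^sup>+y. f y \<partial>K s z r) = (\<integral>\<^sup>+y. ennreal (ker s z r y) * f y \<partial>lborel)"
 by (simp add: K_def nn_integral_density)

lemma integral_K:
 fixes f :: "real => 'b::{banach, second_countable_topology}"
 assumes [measurable]: "f \<in> borel_measurable borel"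
 shows "(LINT y|K s z r. f y) = (LINT y|lborel. ker s z r y *\<^sub>R f y)"
  and "integrable (K s z r) f \<longleftrightarrow> integrable lborel (%y. ker s z r y *\<^sub>R f y)"
 by (auto simp: K_def integral_density integrable_density ker_nonneg)

lemma nn_integral_K_post:
 assumes "0 <= s" "s < r" "r < 1" and [measurable]: "(%(y, u). \<phi> y u) \<in> borel_measurable (borel \<Otimes>\<^sub>M borel)"
 shows "(\<integral>\<^sup>+y. (\<integral>\<^sup>+u. \<phi> y u \<partial>post r y) \<partial>K s z r) =
  (\<integral>\<^sup>+u. (\<integral>\<^sup>+x. \<phi> (bridge_mean s r z u + bridge_sd s r * x) u \<partial>gaussian) \<partial>post s z)"
proof -
 interpret P: pair_sigma_finite \<mu> lborel ..
 have gp: "g r y > 0" "g s z > 0" for y using g_pos assms by auto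
 have sd: "bridge_sd s r > 0" using assms by (intro bridge_sd_pos) auto
 have br: "heat (r - s) (y - z) * lam r y u = lam s z u * normal_density (bridge_mean s r z u) (bridge_sd s r) y" for y u
  using heat_bridge[of "r - s" "1 - r" y z u] assms by (simp add: lam_def bridge_mean_def bridge_sd_def)
 have ps: "sets (borel \<Otimes>\<^sub>M \<mu>) = sets (borel \<Otimes>\<^sub>M borel)" by (intro sets_pair_measure_cong) auto
 have ps': "sets (\<mu> \<Otimes>\<^sub>M borel) = sets (borel \<Otimes>\<^sub>M borel)" by (intro sets_pair_measure_cong) auto
 have [measurable]: "(%(y, u). \<phi> y u) \<in> borel_measurable (borel \<Otimes>\<^sub>M \<mu>)"
  unfolding measurable_cong_sets[OF ps refl] by (rule assms)
 have [measurable]: "(%p. \<phi> (snd p) (fst p)) \<in> borel_measurable (\<mu> \<Otimes>\<^sub>M borel)"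
  using measurable_compose[OF measurable_Pair[OF measurable_snd measurable_fst] assms(4)]
  unfolding measurable_cong_sets[OF ps' refl] by simp
 have m1 [measurable]: "\<phi> y \<in> borel_measurable borel" for y
  using measurable_compose[OF measurable_Pair1'[of y borel borel] assms(4)] by simp
 have m2 [measurable]: "(%y. \<phi> y u) \<in> borel_measurable borel" for u
  using measurable_compose[OF measurable_Pair2'[of u borel borel] assms(4)] by simp
 have "(\<integral>\<^sup>+y. (\<integral>\<^sup>+u. \<phi> y u \<partial>post r y) \<partial>K s z r) =
   (\<integral>\<^sup>+y. (\<integral>\<^sup>+u. ennreal (ker s z r y) * (ennreal (lam r y u / g r y) * \<phi> y u) \<partial>\<mu>) \<partial>lborel)"
  using assms by (subst nn_integral_K) (auto simp: post_lam nn_integral_density nn_integral_cmult intro!: nn_integral_cong)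
 also have "... = (\<integral>\<^sup>+y. (\<integral>\<^sup>+u. ennreal (lam s z u / g s z) * (\<phi> y u * ennreal (normal_density (bridge_mean s r z u) (bridge_sd s r) y)) \<partial>\<mu>) \<partial>lborel)"
 proof (intro nn_integral_cong)
  fix y u
  \<comment> \<open>The factor \<open>g r y\<close> of the kernel cancels the normalisation of the
    posterior at time r; what is left is a bridge density by \<open>br\<close>.\<close>
  have "ker s z r y * (lam r y u / g r y) = lam s z u / g s z * normal_density (bridge_mean s r z u) (bridge_sd s r) y"
   using br[of y u] gp(1)[of y] by (simp add: ker_def)
  then have "ennreal (ker s z r y) * ennreal (lam r y u / g r y) = ennreal (lam s z u / g s z) * ennreal (normal_density (bridge_mean s r z u) (bridge_sd s r) y)"
   using gp lam_nonneg by (simp add: ennreal_mult'[symmetric] ker_nonneg less_imp_le)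
  then show "ennreal (ker s z r y) * (ennreal (lam r y u / g r y) * \<phi> y u) = ennreal (lam s z u / g s z) * (\<phi> y u * ennreal (normal_density (bridge_mean s r z u) (bridge_sd s r) y))"
   by (metis mult.assoc mult.commute)
 qed
 also have "... = (\<integral>\<^sup>+u. (\<integral>\<^sup>+y. ennreal (lam s z u / g s z) * (\<phi> y u * ennreal (normal_density (bridge_mean s r z u) (bridge_sd s r) y)) \<partial>lborel) \<partial>\<mu>)"
  unfolding bridge_mean_def normal_density_def by (rule P.Fubini') measurable
 also have "... = (\<integral>\<^sup>+u. ennreal (lam s z u / g s z) * (\<integral>\<^sup>+x. \<phi> (bridge_mean s r z u + bridge_sd s r * x) u \<partial>gaussian) \<partial>\<mu>)"
  using sd by (intro nn_integral_cong) (simp add: nn_integral_cmult nn_integral_normal_density_affine)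
 also have "... = (\<integral>\<^sup>+u. (\<integral>\<^sup>+x. \<phi> (bridge_mean s r z u + bridge_sd s r * x) u \<partial>gaussian) \<partial>post s z)"
 proof -
  interpret G: prob_space gaussian by (rule prob_space_gaussian)
  have "(%p. \<phi> (bridge_mean s r z (fst p) + bridge_sd s r * snd p) (fst p)) \<in> borel_measurable (borel \<Otimes>\<^sub>M borel)"
  proof -
   have "(%p. (bridge_mean s r z (fst p) + bridge_sd s r * snd p, fst p)) \<in> borel \<Otimes>\<^sub>M borel \<rightarrow>\<^sub>M borel \<Otimes>\<^sub>M (borel :: real measure)"
    unfolding bridge_mean_def by measurable
   from measurable_compose[OF this assms(4)] show ?thesis by simp
  qed
  moreover have "sets (borel \<Otimes>\<^sub>M gaussian) = sets (borel \<Otimes>\<^sub>M borel)" by (intro sets_pair_measure_cong) auto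
  ultimately have "(%p. \<phi> (bridge_mean s r z (fst p) + bridge_sd s r * snd p) (fst p)) \<in> borel_measurable (borel \<Otimes>\<^sub>M gaussian)"
   by (simp cong: measurable_cong_sets)
  then have "(%u. \<integral>\<^sup>+x. \<phi> (bridge_mean s r z u + bridge_sd s r * x) u \<partial>gaussian) \<in> borel_measurable borel"
   by (intro G.borel_measurable_nn_integral) (simp add: split_beta')
  then show ?thesis using assms by (simp add: post_lam nn_integral_density)
 qed
 finally show ?thesis .
qed

end

context bounded_posterior
begin

text \<open>The kernel is a mixture of bridges: the joint identity for a test function that ignores
  the pinning point.\<close>

lemma emeasure_K:
 assumes "0 <= s" "s < r" "r < 1" and [measurable]: "f \<in> borel_measurable borel"
 shows "(\<integral>\<^sup>+y. f y \<partial>K s z r) =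
  (\<integral>\<^sup>+u. (\<integral>\<^sup>+x. f (bridge_mean s r z u + bridge_sd s r * x) \<partial>gaussian) \<partial>post s z)"
proof -
 have "(\<integral>\<^sup>+y. f y \<partial>K s z r) = (\<integral>\<^sup>+y. (\<integral>\<^sup>+u. f y \<partial>post r y) \<partial>K s z r)"
  using assms prob_space.emeasure_space_1[OF prob_space_post[of r]]
  by (intro nn_integral_cong) (simp add: nn_integral_const)
 then show ?thesis
  using nn_integral_K_post[OF assms(1-3), where \<phi> = "%y u. f y"] by simp
qed

lemma prob_space_K:
 assumes "0 <= s" "s < r" "r < 1" shows "prob_space (K s z r)"
proof
 interpret G: prob_space gaussian by (rule prob_space_gaussian)
 interpret P: prob_space "post s z" using assms by (intro prob_space_post) auto
 have "emeasure (K s z r) (space (K s z r)) = (\<integral>\<^sup>+y. 1 \<partial>K s z r)" by simp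
 also have "... = 1"
  using G.emeasure_space_1 P.emeasure_space_1 by (subst emeasure_K[OF assms]) auto
 finally show "emeasure (K s z r) (space (K s z r)) = 1" .
qed

text \<open>With the kernel realised as an image of posterior times Gaussian, Bochner integrals of
  signed and complex functions can be transferred too.\<close>

lemma K_eq_distr:
 assumes "0 <= s" "s < r" "r < 1"
 shows "K s z r = distr (post s z \<Otimes>\<^sub>M gaussian) borel (%(u, x). bridge_mean s r z u + bridge_sd s r * x)"
proof (rule measure_eqI)
 interpret G: prob_space gaussian by (rule prob_space_gaussian)
 interpret P: prob_space "post s z" using assms by (intro prob_space_post) auto
 have sp: "sets (post s z \<Otimes>\<^sub>M gaussian) = sets (borel \<Otimes>\<^sub>M borel)" by (intro sets_pair_measure_cong) auto
 have m: "(%(u, x). bridge_mean s r z u + bridge_sd s r * x) \<in> borel_measurable (post s z \<Otimes>\<^sub>M gaussian)"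
  unfolding measurable_cong_sets[OF sp refl] bridge_mean_def by measurable
 fix A assume "A \<in> sets (K s z r)"
 then have [measurable]: "A \<in> sets borel" by simp
 have "emeasure (K s z r) A = (\<integral>\<^sup>+y. indicator A y \<partial>K s z r)" by simp
 also have "... = (\<integral>\<^sup>+u. (\<integral>\<^sup>+x. indicator A (bridge_mean s r z u + bridge_sd s r * x) \<partial>gaussian) \<partial>post s z)"
  by (rule emeasure_K[OF assms]) simp
 also have "... = (\<integral>\<^sup>+p. indicator A (case p of (u, x) => bridge_mean s r z u + bridge_sd s r * x) \<partial>(post s z \<Otimes>\<^sub>M gaussian))"
 proof (subst G.nn_integral_fst[symmetric])
  show "(%p. indicator A (case p of (u, x) => bridge_mean s r z u + bridge_sd s r * x) :: ennreal) \<in> borel_measurable (post s z \<Otimes>\<^sub>M gaussian)"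
   using measurable_compose[OF m borel_measurable_indicator[of A]] by simp
 qed simp
 also have "... = emeasure (distr (post s z \<Otimes>\<^sub>M gaussian) borel (%(u, x). bridge_mean s r z u + bridge_sd s r * x)) A"
  using nn_integral_distr[OF m, of "indicator A"] m by simp
 finally show "emeasure (K s z r) A = ..." .
qed simp

lemma integral_K_bridge:
 fixes f :: "real => 'b::{banach, second_countable_topology}"
 assumes s: "0 <= s" "s < r" "r < 1" and f: "integrable (K s z r) f"
 shows "(LINT y|K s z r. f y) = (LINT u|post s z. (LINT x|gaussian. f (bridge_mean s r z u + bridge_sd s r * x)))"
proof -
 interpret G: prob_space gaussian by (rule prob_space_gaussian)
 interpret P: prob_space "post s z" using s by (intro prob_space_post) auto
 interpret PG: pair_sigma_finite "post s z" gaussian ..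
 have sp: "sets (post s z \<Otimes>\<^sub>M gaussian) = sets (borel \<Otimes>\<^sub>M borel)" by (intro sets_pair_measure_cong) auto
 have m: "(%(u, x). bridge_mean s r z u + bridge_sd s r * x) \<in> borel_measurable (post s z \<Otimes>\<^sub>M gaussian)"
  unfolding measurable_cong_sets[OF sp refl] bridge_mean_def by measurable
 have [measurable]: "f \<in> borel_measurable borel" using borel_measurable_integrable[OF f] by simp
 have i: "integrable (post s z \<Otimes>\<^sub>M gaussian) (%p. f (case p of (u, x) => bridge_mean s r z u + bridge_sd s r * x))"
  using f integrable_distr_eq[OF m, of f] unfolding K_eq_distr[OF s] by simp
 have "(LINT y|K s z r. f y) = (LINT p|(post s z \<Otimes>\<^sub>M gaussian). f (case p of (u, x) => bridge_mean s r z u + bridge_sd s r * x))"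
  unfolding K_eq_distr[OF s] by (rule integral_distr[OF m]) simp
 also have "... = (LINT u|post s z. (LINT x|gaussian. f (bridge_mean s r z u + bridge_sd s r * x)))"
  using PG.integral_fst'[OF i] by simp
 finally show ?thesis .
qed

lemma gaussian_integral_poly:
 "(LINT x|gaussian. c + b * x) = c" "(LINT x|gaussian. (c + b * x)\<^sup>2) = c^2 + b^2" 
 "(LINT x|gaussian. (b * x) ^ 4) = 3 * b ^ 4"
proof -
 interpret G: prob_space gaussian by (rule prob_space_gaussian)
 have i: "integrable gaussian (%x. x)" "integrable gaussian (%x. x\<^sup>2)" "integrable gaussian (%x. x ^ 4)"
  using gaussian_moments(1)[of 1] gaussian_moments(1)[of 2] gaussian_moments(1)[of 4] by simp_all
 show "(LINT x|gaussian. c + b * x) = c"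
  using i gaussian_moments(2) G.prob_space by simp
 have "(%x. (c + b * x)\<^sup>2) = (%x. c\<^sup>2 + (2 * c * b) * x + b^2 * x^2)"
  by (auto simp: power2_eq_square algebra_simps)
 then show "(LINT x|gaussian. (c + b * x)\<^sup>2) = c^2 + b^2"
  using i gaussian_moments(2,3) G.prob_space by simp
 show "(LINT x|gaussian. (b * x) ^ 4) = 3 * b ^ 4"
  using i gaussian_moments(5) by (simp add: power_mult_distrib)
qed

lemma gaussian_nn_integral_power4: "(\<integral>\<^sup>+x. ennreal ((c + b * x) ^ 4) \<partial>gaussian) <= ennreal (8 * c ^ 4 + 24 * b ^ 4)"
proof -
 interpret G: prob_space gaussian by (rule prob_space_gaussian)
 have i: "integrable gaussian (%x. x ^ 4)" using gaussian_moments(1)[of 4] by simp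
 have "(\<integral>\<^sup>+x. ennreal ((c + b * x) ^ 4) \<partial>gaussian) <= (\<integral>\<^sup>+x. ennreal (8 * c ^ 4 + 8 * (b * x) ^ 4) \<partial>gaussian)"
  by (intro nn_integral_mono ennreal_leI power4_add_le)
 also have "... = ennreal (LINT x|gaussian. 8 * c ^ 4 + 8 * (b * x) ^ 4)"
  using i by (intro nn_integral_eq_integral) (auto simp: power_mult_distrib intro!: AE_I2)
 also have "(LINT x|gaussian. 8 * c ^ 4 + 8 * (b * x) ^ 4) = 8 * c ^ 4 + 24 * b ^ 4"
  using i gaussian_integral_poly(3)[of b] G.prob_space by (simp add: power_mult_distrib gaussian_moments(5))
 finally show ?thesis .
qed

text \<open>Given the pinning point, the increment is affine in a standard Gaussian, so its fourth
  moment splits into a posterior part and a bridge part.\<close>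

lemma
 assumes s: "0 <= s" "s < r" "r < 1"
 shows integrable_K_power4: "integrable (K s z r) (%y. (y - z) ^ 4)"
  and K_power4_le: "(LINT y|K s z r. (y - z) ^ 4) <= 8 * ((r - s) / (1 - s)) ^ 4 * (LINT u|post s z. (u - z) ^ 4) + 24 * bridge_sd s r ^ 4"
proof -
 interpret P: prob_space "post s z" using s by (intro prob_space_post) auto
 let ?a = "(r - s) / (1 - s)" and ?b = "bridge_sd s r"
 let ?I = "8 * ?a ^ 4 * (LINT u|post s z. (u - z) ^ 4) + 24 * ?b ^ 4"
 have i4: "integrable (post s z) (%u. (u - z) ^ 4)"
 proof (rule integrable_post[where C = "8 + 8 * z ^ 4" and k = 4 and c = 0])
  fix u
  have "(u - z) ^ 4 <= 8 * u ^ 4 + 8 * z ^ 4" using power4_add_le[of u "- z"] by simp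
  also have "... <= (8 + 8 * z ^ 4) * (1 + u ^ 4)" by (simp add: algebra_simps)
  finally show "norm ((u - z) ^ 4) <= (8 + 8 * z ^ 4) * (1 + \<bar>u\<bar> ^ 4) * exp (0 * \<bar>u\<bar>)"
   by simp
 qed (use s in auto)
 have "(\<integral>\<^sup>+y. ennreal ((y - z) ^ 4) \<partial>K s z r) =
   (\<integral>\<^sup>+u. (\<integral>\<^sup>+x. ennreal ((?a * (u - z) + ?b * x) ^ 4) \<partial>gaussian) \<partial>post s z)"
  by (subst emeasure_K[OF s]) (auto simp: bridge_mean_def intro!: nn_integral_cong)
 also have "... <= (\<integral>\<^sup>+u. ennreal (8 * ?a ^ 4 * (u - z) ^ 4 + 24 * ?b ^ 4) \<partial>post s z)"
  by (intro nn_integral_mono order_trans[OF gaussian_nn_integral_power4]) (simp add: power_mult_distrib power_divide)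
 also have "... = ennreal (LINT u|post s z. 8 * ?a ^ 4 * (u - z) ^ 4 + 24 * ?b ^ 4)"
  using i4 by (intro nn_integral_eq_integral) (auto intro!: AE_I2)
 also have "(LINT u|post s z. 8 * ?a ^ 4 * (u - z) ^ 4 + 24 * ?b ^ 4) = ?I"
  using i4 P.prob_space by simp
 finally have le: "(\<integral>\<^sup>+y. ennreal ((y - z) ^ 4) \<partial>K s z r) <= ennreal ?I" .
 show "integrable (K s z r) (%y. (y - z) ^ 4)"
  using le by (intro integrableI_bounded) (auto simp: power_abs[symmetric] intro: le_less_trans)
 then have "ennreal (LINT y|K s z r. (y - z) ^ 4) <= ennreal ?I"
  using le by (subst (asm) nn_integral_eq_integral) auto
 then show "(LINT y|K s z r. (y - z) ^ 4) <= ?I"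
  by (subst (asm) ennreal_le_iff) (auto intro!: add_nonneg_nonneg mult_nonneg_nonneg)
qed

lemma integrable_K_tame4:
 fixes f :: "real => 'b::{banach, second_countable_topology}"
 assumes s: "0 <= s" "s < r" "r < 1" and f: "f \<in> borel_measurable borel" and le: "!!y. norm (f y) <= c * (1 + y ^ 4)"
 shows "integrable (K s z r) f"
proof (rule integrable_dominated)
 interpret P: prob_space "K s z r" using s by (intro prob_space_K) auto
 show "integrable (K s z r) (%y. \<bar>c\<bar> * (1 + 8 * (y - z) ^ 4 + 8 * z ^ 4))"
  using integrable_K_power4[OF s] by simp
 show "f \<in> borel_measurable (K s z r)" using f by simp
 fix y
 have "norm (f y) <= c * (1 + y ^ 4)" by (rule le)
 also have "... <= \<bar>c\<bar> * (1 + y ^ 4)" by (intro mult_right_mono) auto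
 also have "... <= \<bar>c\<bar> * (1 + 8 * (y - z) ^ 4 + 8 * z ^ 4)"
  using power4_add_le[of "y - z" z] by (intro mult_left_mono) auto
 finally show "norm (f y) <= \<bar>c\<bar> * (1 + 8 * (y - z) ^ 4 + 8 * z ^ 4)" .
qed

lemma integrable_K_tame:
 assumes s: "0 <= s" "s < r" "r < 1" and f: "tame f"
 shows "integrable (K s z r) f"
proof -
 obtain c where c: "!!y. \<bar>f y\<bar> <= c * (1 + y^2)" and m: "f \<in> borel_measurable borel"
  using f by (auto simp: tame_def)
 have c0: "0 <= c" using c[of 0] by simp
 show ?thesis
 proof (rule integrable_K_tame4[OF s m, of "2 * c"])
  fix y
  have "norm (f y) <= c * (1 + y^2)" using c by simp
  also have "... <= c * (2 * (1 + y ^ 4))"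
  proof (rule mult_left_mono[OF _ c0])
   show "1 + y^2 <= 2 * (1 + y ^ 4)"
    using zero_le_power2[of "y\<^sup>2 - 1"] zero_le_power2[of "y\<^sup>2"] by (simp add: power2_eq_square power4_eq_xxxx algebra_simps)
  qed
  finally show "norm (f y) <= 2 * c * (1 + y ^ 4)" by (simp add: algebra_simps)
 qed
qed

lemma integrable_K_power: "0 <= s ==> s < r ==> r < 1 ==> integrable (K s z r) (%y. y)"
  "0 <= s ==> s < r ==> r < 1 ==> integrable (K s z r) (%y. (y - c)\<^sup>2)"
proof -
 have "\<bar>y\<bar> <= 1 * (1 + y^2)" for y :: real
  using zero_le_power2[of "\<bar>y\<bar> - 1"] by (simp add: power2_eq_square algebra_simps)
 then have 1: "tame (%y. y)" unfolding tame_def by (auto intro!: exI[of _ 1])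
 have "(y - c)\<^sup>2 <= (2 + 2 * c^2) * (1 + y^2)" for y :: real
  using zero_le_power2[of "y + c"] mult_nonneg_nonneg[OF zero_le_power2[of c] zero_le_power2[of y]] by (simp add: power2_eq_square algebra_simps)
 then have 2: "tame (%y. (y - c)\<^sup>2)" unfolding tame_def by (auto intro!: borel_measurable_power borel_measurable_diff)
 show "0 <= s ==> s < r ==> r < 1 ==> integrable (K s z r) (%y. y)"
  "0 <= s ==> s < r ==> r < 1 ==> integrable (K s z r) (%y. (y - c)\<^sup>2)"
  using integrable_K_tame[OF _ _ _ 1] integrable_K_tame[OF _ _ _ 2] by auto
qed

lemma integrable_post_sq: "0 <= s ==> s < 1 ==> integrable (post s z) (%u. (u - c)\<^sup>2)"
 using integrable_post_power[of s z 1] integrable_post_power[of s z 2] prob_space_post[of s z]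
 by (auto simp: power2_diff prob_space.finite_measure finite_measure.integrable_const)

text \<open>Every bridge has a linear mean. Hence the mean increment is the step length times the
  drift at its start, exactly and for steps of any length.\<close>

lemma K_mean:
 assumes s: "0 <= s" "s < r" "r < 1"
 shows "(LINT y|K s z r. y) = z + (r - s) / (1 - s) * (h s z - z)"
proof -
 interpret P: prob_space "post s z" using s by (intro prob_space_post) auto
 have i: "integrable (post s z) (%u. u)" using integrable_post_power[of s z 1] s by simp
 have "(LINT y|K s z r. y) = (LINT u|post s z. bridge_mean s r z u)"
  using s by (subst integral_K_bridge[OF s integrable_K_power(1)[OF s]]) (simp add: gaussian_integral_poly)
 also have "... = z + (r - s) / (1 - s) * (h s z - z)"
  unfolding bridge_mean_def h_eq using i P.prob_space by simp
 finally show ?thesis .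
qed

lemma K_second_moment:
 assumes s: "0 <= s" "s < r" "r < 1"
 defines "a \<equiv> (r - s) / (1 - s)"
 shows "(LINT y|K s z r. (y - c)\<^sup>2) = (z - c)^2 + 2 * a * (z - c) * (h s z - z) + a^2 * \<rho> s z + (r - s) * (1 - r) / (1 - s)"
proof -
 interpret P: prob_space "post s z" using s by (intro prob_space_post) auto
 have i: "integrable (post s z) (%u. u)" using integrable_post_power[of s z 1] s by simp
 have i2: "integrable (post s z) (%u. (u - z)\<^sup>2)" using integrable_post_sq s by simp
 have "(LINT y|K s z r. (y - c)\<^sup>2) = (LINT u|post s z. (LINT x|gaussian. ((bridge_mean s r z u - c) + bridge_sd s r * x)\<^sup>2))"
  by (subst integral_K_bridge[OF s integrable_K_power(2)[OF s]]) (simp add: algebra_simps)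
 also have "... = (LINT u|post s z. (bridge_mean s r z u - c)\<^sup>2 + (bridge_sd s r)^2)"
  by (simp add: gaussian_integral_poly)
 also have "... = (LINT u|post s z. (z - c)\<^sup>2 + 2 * a * (z - c) * (u - z) + a^2 * (u - z)^2 + (bridge_sd s r)^2)"
  by (intro Bochner_Integration.integral_cong refl) (simp add: bridge_mean_def a_def[symmetric] power2_eq_square algebra_simps)
 also have "... = (z - c)^2 + 2 * a * (z - c) * (h s z - z) + a^2 * \<rho> s z + (bridge_sd s r)^2"
  using i i2 P.prob_space by (simp add: h_eq \<rho>_def)
 also have "(bridge_sd s r)\<^sup>2 = (r - s) * (1 - r) / (1 - s)"
  using s by (simp add: bridge_sd_def)
 finally show ?thesis .
qed

lemma \<rho>_measurable [measurable]: "\<rho> s \<in> borel_measurable borel" if "0 <= s" "s < 1"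
proof -
 have "\<rho> s = (%z. (LINT u|\<mu>. (weight s z u / D s z) *\<^sub>R (u - z)\<^sup>2))"
  unfolding \<rho>_def using that by (intro ext integral_post) auto
 then show ?thesis by simp
qed

text \<open>As conditional expectation of a fixed function of the pinning point it is a martingale
  along the process (\<open>K_msq\<close>).\<close>

definition msq :: "real => real => real => real" where "msq c s z = (LINT u|post s z. (u - c)\<^sup>2)"

lemma msq_measurable [measurable]: "msq c s \<in> borel_measurable borel" if "0 <= s" "s < 1"
proof -
 have "msq c s = (%z. (LINT u|\<mu>. (weight s z u / D s z) *\<^sub>R (u - c)\<^sup>2))"
  unfolding msq_def using that by (intro ext integral_post) auto
 then show ?thesis by simp
qed

lemma h_measurable [measurable]: "h s \<in> borel_measurable borel" if "0 <= s" "s < 1"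
proof -
 have "h s = (%z. (LINT u|\<mu>. (weight s z u / D s z) *\<^sub>R u))"
  unfolding h_eq using that by (intro ext integral_post) auto
 then show ?thesis by simp
qed

lemma
 assumes s: "0 <= s" "s < r" "r < 1"
 shows integrable_K_msq: "integrable (K s z r) (msq c r)" and K_msq: "(LINT y|K s z r. msq c r y) = msq c s z"
proof -
 interpret G: prob_space gaussian by (rule prob_space_gaussian)
 have m [measurable]: "msq c r \<in> borel_measurable borel" using s by (intro msq_measurable) auto
 have n: "0 <= msq c s z" for s z by (simp add: msq_def)
 have "(\<integral>\<^sup>+y. ennreal (msq c r y) \<partial>K s z r) = (\<integral>\<^sup>+y. (\<integral>\<^sup>+u. ennreal ((u - c)^2) \<partial>post r y) \<partial>K s z r)"
  unfolding msq_def using s by (intro nn_integral_cong nn_integral_eq_integral[symmetric] integrable_post_sq) auto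
 also have "... = (\<integral>\<^sup>+u. ennreal ((u - c)^2) \<partial>post s z)"
  using G.emeasure_space_1 by (subst nn_integral_K_post[OF s]) auto
 also have "... = ennreal (msq c s z)"
  unfolding msq_def using s by (intro nn_integral_eq_integral integrable_post_sq) auto
 finally have *: "(\<integral>\<^sup>+y. ennreal (msq c r y) \<partial>K s z r) = ennreal (msq c s z)" .
 show "integrable (K s z r) (msq c r)"
  using * n by (intro integrableI_bounded) auto
 then show "(LINT y|K s z r. msq c r y) = msq c s z"
  using * n by (subst (asm) nn_integral_eq_integral) auto
qed

text \<open>Seen from the pinning point, the bridge is the contracted initial distance plus
  independent noise (\<open>br\<close>). Averaging the square gives an exact recursion whose value
  tends to 0 as r tends to 1.\<close>

lemma
 assumes s: "0 <= s" "s < r" "r < 1"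
 shows integrable_K_\<rho>: "integrable (K s z r) (\<rho> r)"
  and K_\<rho>: "(LINT y|K s z r. \<rho> r y) = ((1 - r) / (1 - s))\<^sup>2 * \<rho> s z + (r - s) * (1 - r) / (1 - s)"
proof -
 interpret P: prob_space "post s z" using s by (intro prob_space_post) auto
 have m [measurable]: "\<rho> r \<in> borel_measurable borel" using s by (intro \<rho>_measurable) auto
 let ?b = "bridge_sd s r" and ?I = "((1 - r) / (1 - s))\<^sup>2 * \<rho> s z + (bridge_sd s r)^2"
 have br: "bridge_mean s r z u + ?b * x - u = (1 - r) / (1 - s) * (z - u) + ?b * x" for u x
  using s by (simp add: bridge_mean_def field_simps)
 have ig: "integrable gaussian (%x. (c + b * x)\<^sup>2)" for c b
 proof -
  have "(%x. (c + b * x)\<^sup>2) = (%x. c\<^sup>2 * x ^ 0 + (2 * c * b) * x ^ 1 + b^2 * x^2)"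
   by (auto simp: power2_eq_square algebra_simps)
  then show ?thesis
   by (simp only:) (intro Bochner_Integration.integrable_add integrable_mult_right; rule gaussian_moments(1))
 qed
 have "(\<integral>\<^sup>+y. ennreal (\<rho> r y) \<partial>K s z r) = (\<integral>\<^sup>+y. (\<integral>\<^sup>+u. ennreal ((y - u)^2) \<partial>post r y) \<partial>K s z r)"
 proof (intro nn_integral_cong)
  fix y
  show "ennreal (\<rho> r y) = (\<integral>\<^sup>+u. ennreal ((y - u)^2) \<partial>post r y)"
   unfolding \<rho>_def power2_commute[of y] using s by (intro nn_integral_eq_integral[symmetric] integrable_post_sq) auto
 qed
 also have "... = (\<integral>\<^sup>+u. (\<integral>\<^sup>+x. ennreal (((1 - r) / (1 - s) * (z - u) + ?b * x)\<^sup>2) \<partial>gaussian) \<partial>post s z)"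
  by (subst nn_integral_K_post[OF s]) (auto simp: br)
 also have "... = (\<integral>\<^sup>+u. ennreal (((1 - r) / (1 - s))\<^sup>2 * (u - z)^2 + ?b\<^sup>2) \<partial>post s z)"
  by (subst nn_integral_eq_integral[OF ig])
   (auto simp: gaussian_integral_poly power_mult_distrib power_divide power2_commute[of z] intro!: nn_integral_cong)
 also have "... = ennreal (LINT u|post s z. ((1 - r) / (1 - s))\<^sup>2 * (u - z)^2 + ?b\<^sup>2)"
  using integrable_post_sq[of s z z] s by (intro nn_integral_eq_integral) auto
 also have "(LINT u|post s z. ((1 - r) / (1 - s))\<^sup>2 * (u - z)^2 + ?b\<^sup>2) = ?I"
  using integrable_post_sq[of s z z] s P.prob_space by (simp add: \<rho>_def)
 finally have *: "(\<integral>\<^sup>+y. ennreal (\<rho> r y) \<partial>K s z r) = ennreal ?I" .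
 show "integrable (K s z r) (\<rho> r)"
  using * \<rho>_nonneg by (intro integrableI_bounded) auto
 then have "(LINT y|K s z r. \<rho> r y) = ?I"
  using * \<rho>_nonneg
  by (subst (asm) nn_integral_eq_integral) (auto simp del: ennreal_plus simp: ennreal_inj intro!: add_nonneg_nonneg mult_nonneg_nonneg)
 moreover have "(bridge_sd s r)\<^sup>2 = (r - s) * (1 - r) / (1 - s)"
  using s by (simp add: bridge_sd_def)
 ultimately show "(LINT y|K s z r. \<rho> r y) = ((1 - r) / (1 - s))\<^sup>2 * \<rho> s z + (r - s) * (1 - r) / (1 - s)"
  by simp
qed

lemma heat_convolution:
 assumes "0 < a" "0 < b"
 shows "(\<integral>\<^sup>+y. ennreal (heat a (y - z)) * ennreal (heat b (u - y)) \<partial>lborel) = ennreal (heat (a + b) (u - z))"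
proof -
 let ?m = "z + a / (a + b) * (u - z)" and ?s = "sqrt (a * b / (a + b))"
 have "(\<integral>\<^sup>+y. ennreal (heat a (y - z)) * ennreal (heat b (u - y)) \<partial>lborel) =
   (\<integral>\<^sup>+y. ennreal (heat (a + b) (u - z)) * ennreal (normal_density ?m ?s y) \<partial>lborel)"
  using heat_bridge[OF assms, of _ z u] by (intro nn_integral_cong) (simp add: ennreal_mult'[symmetric])
 also have "... = ennreal (heat (a + b) (u - z)) * (\<integral>\<^sup>+y. ennreal (normal_density ?m ?s y) \<partial>lborel)"
  by (simp add: nn_integral_cmult)
 also have "(\<integral>\<^sup>+y. ennreal (normal_density ?m ?s y) \<partial>lborel) = 1"
  using prob_space.emeasure_space_1[OF prob_space_normal_density[of ?s ?m]] assms
  by (simp add: emeasure_density)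
 finally show ?thesis by simp
qed

text \<open>Chapman-Kolmogorov: in the product of two transformed densities the intermediate value
  of \<open>g\<close> cancels and the two heat kernels convolve.\<close>

lemma nn_integral_K_K:
 assumes s: "0 <= s" "s < r" "r < q" "q < 1" and [measurable]: "f \<in> borel_measurable borel"
 shows "(\<integral>\<^sup>+y. (\<integral>\<^sup>+x. f x \<partial>K r y q) \<partial>K s z r) = (\<integral>\<^sup>+x. f x \<partial>K s z q)"
proof -
 have gp: "g r y > 0" "g q y > 0" "g s y > 0" for y using g_pos s by auto
 have "(\<integral>\<^sup>+y. (\<integral>\<^sup>+x. f x \<partial>K r y q) \<partial>K s z r) =
  (\<integral>\<^sup>+y. (\<integral>\<^sup>+x. ennreal (ker s z r y) * (ennreal (ker r y q x) * f x) \<partial>lborel) \<partial>lborel)"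
  by (simp add: nn_integral_K nn_integral_cmult)
 also have "... = (\<integral>\<^sup>+y. (\<integral>\<^sup>+x. (ennreal (g q x / g s z) * f x) * (ennreal (heat (r - s) (y - z)) * ennreal (heat (q - r) (x - y))) \<partial>lborel) \<partial>lborel)"
 proof (intro nn_integral_cong)
  fix y x
  have "ker s z r y * ker r y q x = g q x / g s z * (heat (r - s) (y - z) * heat (q - r) (x - y))"
   using gp(1)[of y] by (simp add: ker_def)
  then have "ennreal (ker s z r y) * ennreal (ker r y q x) = ennreal (g q x / g s z) * (ennreal (heat (r - s) (y - z)) * ennreal (heat (q - r) (x - y)))"
   using gp by (simp add: ennreal_mult'[symmetric] ker_nonneg less_imp_le g_nonneg)
  then show "ennreal (ker s z r y) * (ennreal (ker r y q x) * f x) = (ennreal (g q x / g s z) * f x) * (ennreal (heat (r - s) (y - z)) * ennreal (heat (q - r) (x - y)))"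
   by (metis mult.assoc mult.commute)
 qed
 also have "... = (\<integral>\<^sup>+x. (\<integral>\<^sup>+y. (ennreal (g q x / g s z) * f x) * (ennreal (heat (r - s) (y - z)) * ennreal (heat (q - r) (x - y))) \<partial>lborel) \<partial>lborel)"
  by (rule lborel_pair.Fubini') measurable
 also have "... = (\<integral>\<^sup>+x. ennreal (g q x / g s z) * f x * ennreal (heat (q - s) (x - z)) \<partial>lborel)"
  using s by (intro nn_integral_cong) (simp add: nn_integral_cmult heat_convolution)
 also have "... = (\<integral>\<^sup>+x. ennreal (ker s z q x) * f x \<partial>lborel)"
 proof (intro nn_integral_cong)
  fix x
  have "ennreal (g q x / g s z) * ennreal (heat (q - s) (x - z)) = ennreal (ker s z q x)"
   using gp by (simp add: ker_def ennreal_mult'[symmetric] less_imp_le mult.commute)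
  then show "ennreal (g q x / g s z) * f x * ennreal (heat (q - s) (x - z)) = ennreal (ker s z q x) * f x"
   by (metis mult.assoc mult.commute)
 qed
 finally show ?thesis by (simp add: nn_integral_K)
qed

lemma integral_K_measurable [measurable]:
 fixes f :: "real => 'b::{banach, second_countable_topology}"
 assumes [measurable]: "f \<in> borel_measurable borel"
 shows "(%y. \<integral>x. f x \<partial>K s y r) \<in> borel_measurable borel"
 unfolding integral_K(1)[OF assms] by measurable

lemma integral_K_K:
 fixes f :: "real => 'b::{banach, second_countable_topology}"
 assumes s: "0 <= s" "s < r" "r < q" "q < 1" and f: "integrable (K s z q) f"
 shows "(LINT y|K s z r. (LINT x|K r y q. f x)) = (LINT x|K s z q. f x)"
  and "(!!y. integrable (K r y q) f) ==> integrable (K s z r) (%y. \<integral>x. f x \<partial>K r y q)"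
proof -
 have [measurable]: "f \<in> borel_measurable borel" using borel_measurable_integrable[OF f] by simp
 have gp: "g r y > 0" "g q y > 0" "g s y > 0" for y using g_pos s by auto
 let ?F = "%(x, y). (ker s z r y * ker r y q x) *\<^sub>R f x"
 have fin: "(\<integral>\<^sup>+y. (\<integral>\<^sup>+x. ennreal (norm (f x)) \<partial>K r y q) \<partial>K s z r) < \<infinity>"
  using f s by (simp add: nn_integral_K_K integrable_iff_bounded)
 have iF: "integrable (lborel \<Otimes>\<^sub>M lborel) ?F"
 proof (rule integrableI_bounded)
  have "(\<integral>\<^sup>+p. ennreal (norm (?F p)) \<partial>(lborel \<Otimes>\<^sub>M lborel)) = (\<integral>\<^sup>+y. (\<integral>\<^sup>+x. ennreal (norm (?F (x, y))) \<partial>lborel) \<partial>lborel)"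
   by (subst lborel_pair.nn_integral_snd[symmetric]) auto
  also have "... = (\<integral>\<^sup>+y. (\<integral>\<^sup>+x. ennreal (norm (f x)) \<partial>K r y q) \<partial>K s z r)"
   by (simp add: nn_integral_K nn_integral_cmult[symmetric] ennreal_mult'[symmetric] ker_nonneg abs_mult mult.assoc)
  finally show "(\<integral>\<^sup>+p. ennreal (norm (?F p)) \<partial>(lborel \<Otimes>\<^sub>M lborel)) < \<infinity>" using fin by simp
 qed simp
 have CK: "(LINT y|lborel. ker s z r y * ker r y q x) = ker s z q x"
  and iCK: "integrable lborel (%y. ker s z r y * ker r y q x)" for x
 proof -
  have 1: "ker s z r y * ker r y q x = g q x / g s z * (heat (r - s) (y - z) * heat (q - r) (x - y))" for y
   using gp(1)[of y] by (simp add: ker_def)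
  have *: "(\<integral>\<^sup>+y. ennreal (heat (r - s) (y - z) * heat (q - r) (x - y)) \<partial>lborel) = ennreal (heat (q - s) (x - z))"
   using heat_convolution[of "r - s" "q - r" z x] s by (simp add: ennreal_mult')
  then have "integrable lborel (%y. heat (r - s) (y - z) * heat (q - r) (x - y))"
   by (intro integrableI_nn_integral_finite) auto
  then show "integrable lborel (%y. ker s z r y * ker r y q x)" unfolding 1 by simp
  have "(LINT y|lborel. heat (r - s) (y - z) * heat (q - r) (x - y)) = heat (q - s) (x - z)"
   using * by (subst integral_eq_nn_integral) auto
  then show "(LINT y|lborel. ker s z r y * ker r y q x) = ker s z q x" unfolding 1 by (simp add: ker_def)
 qed
 have "(LINT x|K s z q. f x) = (LINT x|lborel. (LINT y|lborel. ker s z r y * ker r y q x) *\<^sub>R f x)"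
  by (simp add: integral_K CK)
 also have "... = (LINT x|lborel. (LINT y|lborel. (ker s z r y * ker r y q x) *\<^sub>R f x))"
  using iCK by (simp only: integral_scaleR_left)
 also have "... = (LINT y|lborel. (LINT x|lborel. (ker s z r y * ker r y q x) *\<^sub>R f x))"
  using lborel_pair.Fubini_integral[of "%x y. (ker s z r y * ker r y q x) *\<^sub>R f x"] iF by simp
 also have "... = (LINT y|K s z r. (LINT x|K r y q. f x))"
  by (simp add: integral_K scaleR_scaleR[symmetric] del: scaleR_scaleR)
 finally show "(LINT y|K s z r. (LINT x|K r y q. f x)) = (LINT x|K s z q. f x)" by simp
 show "integrable (K s z r) (%y. \<integral>x. f x \<partial>K r y q)" if "!!y. integrable (K r y q) f"
 proof (rule integrableI_bounded)
  have "(\<integral>\<^sup>+y. ennreal (norm (LINT x|K r y q. f x)) \<partial>K s z r) <= (\<integral>\<^sup>+y. (\<integral>\<^sup>+x. ennreal (norm (f x)) \<partial>K r y q) \<partial>K s z r)"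
   by (intro nn_integral_mono integral_norm_bound_ennreal that)
  then show "(\<integral>\<^sup>+y. ennreal (norm (LINT x|K r y q. f x)) \<partial>K s z r) < \<infinity>" using fin by (rule le_less_trans)
 qed simp
qed

end

section \<open>Continuity and differentiation of posterior integrals; Lipschitz drift\<close>

lemma continuous_on_integral_dominated:
 fixes f :: "'p::metric_space => 'a => 'b::{banach, second_countable_topology}"
 assumes m: "!!p. p \<in> S ==> f p \<in> borel_measurable M"
  and c: "!!u. u \<in> space M ==> continuous_on S (%p. f p u)"
  and d: "!!p. p \<in> S ==> \<exists>e>0. \<exists>w. integrable M w \<and> (\<forall>q\<in>S. dist q p < e --> (\<forall>u\<in>space M. norm (f q u) <= w u))"
 shows "continuous_on S (%p. \<integral>u. f p u \<partial>M)"
 unfolding continuous_on_sequentially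
proof (intro allI ballI impI)
 fix x p assume p: "p \<in> S" and x: "(\<forall>n. x n \<in> S) \<and> x \<longlonglongrightarrow> p"
 obtain e w where e: "e > 0" "integrable M w" "!!q u. q \<in> S ==> dist q p < e ==> u \<in> space M ==> norm (f q u) <= w u"
  using d[OF p] by auto
 obtain N where N: "!!n. n \<ge> N ==> dist (x n) p < e"
  using metric_LIMSEQ_D[OF conjunct2[OF x] e(1)] by auto
 have "(%n. \<integral>u. f (x (n + N)) u \<partial>M) \<longlonglongrightarrow> (LINT u|M. f p u)"
 proof (rule integral_dominated_convergence[where w = w])
  show "AE u in M. (%n. f (x (n + N)) u) \<longlonglongrightarrow> f p u"
  proof (rule AE_I2)
   fix u assume "u \<in> space M"
   from c[OF this] x p have "((%p. f p u) \<circ> x) \<longlonglongrightarrow> f p u"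
    unfolding continuous_on_sequentially by blast
   then show "(%n. f (x (n + N)) u) \<longlonglongrightarrow> f p u"
    using LIMSEQ_ignore_initial_segment[of "%n. f (x n) u" _ N] by (simp add: comp_def)
  qed
  show "AE u in M. norm (f (x (n + N)) u) <= w u" for n
   using e(3)[of "x (n + N)"] N[of "n + N"] x by (intro AE_I2) auto
 qed (use m x p e in auto)
 then have "(%n. \<integral>u. f (x n) u \<partial>M) \<longlonglongrightarrow> (LINT u|M. f p u)"
  by (rule LIMSEQ_offset)
 then show "((%p. \<integral>u. f p u \<partial>M) \<circ> x) \<longlonglongrightarrow> (LINT u|M. f p u)" by (simp add: comp_def)
qed

lemma norm_exp_minus_linear_le: "cmod (exp x - 1 - x) <= (cmod x)\<^sup>2 * exp (cmod x)"
proof -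
 have "cmod (exp x - (\<Sum>i\<le>1. exp 0 * (x - 0) ^ i / fact i)) <= exp (cmod x) * cmod (x - 0) ^ Suc 1 / fact 1"
 proof (rule complex_Taylor[where S = "cball 0 (cmod x)" and f = "%i. exp"])
  show "cmod (exp y) <= exp (cmod x)" if "y \<in> cball 0 (cmod x)" for y
   using norm_exp[of y] that by (auto intro: order_trans)
 qed (auto intro!: derivative_eq_intros)
 then show ?thesis by (simp add: power2_eq_square algebra_simps)
qed

lemma cos_ge_one_minus_half_sq: "1 - x\<^sup>2 / 2 <= cos (x::real)"
proof -
 have "cos x = 1 - 2 * (sin (x / 2))\<^sup>2" using cos_double_sin[of "x / 2"] by simp
 moreover have "(sin (x / 2))\<^sup>2 <= (x / 2)\<^sup>2"
  using abs_sin_x_le_abs_x[of "x / 2"] by (subst abs_le_square_iff[symmetric])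
 ultimately show ?thesis by (simp add: power2_eq_square)
qed

context bounded_posterior
begin

text \<open>Near (s, z) the time stays below (1 + s) / 2 and the position within |z| + 1, where
  \<open>weight_le\<close> provides one exponential majorant.\<close>

lemma continuous_weight_integral:
 fixes \<phi> :: "real \<times> real => real => 'b::{banach, second_countable_topology}"
 assumes m: "!!p. \<phi> p \<in> borel_measurable borel"
  and c: "!!u. continuous_on ({0..<1} \<times> UNIV) (%p. \<phi> p u)"
  and le: "!!p u. p \<in> {0..<1} \<times> UNIV ==> norm (\<phi> p u) <= C * (1 + \<bar>u\<bar> ^ k)"
 shows "continuous_on ({0..<1} \<times> UNIV) (%p. \<integral>u. weight (fst p) (snd p) u *\<^sub>R \<phi> p u \<partial>\<mu>)"
proof (rule continuous_on_integral_dominated)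
 show "continuous_on ({0..<1} \<times> UNIV) (%p. weight (fst p) (snd p) u *\<^sub>R \<phi> p u)" for u
  unfolding weight_def by (intro continuous_intros c) auto
 show "(%u. weight (fst p) (snd p) u *\<^sub>R \<phi> p u) \<in> borel_measurable \<mu>" for p
  using m[of p] by measurable
 fix p :: "real \<times> real" assume p: "p \<in> {0..<1} \<times> UNIV"
 obtain s z where sz: "p = (s, z)" "0 <= s" "s < 1" using p by (cases p) auto
 define T where "T = (1 + s) / 2"
 define b where "b = \<bar>z\<bar> + 1"
 have T: "s < T" "T < 1" using sz by (auto simp: T_def)
 show "\<exists>e>0. \<exists>w. integrable \<mu> w \<and> (\<forall>q\<in>{0..<1} \<times> UNIV. dist q p < e --> (\<forall>u\<in>space \<mu>. norm (weight (fst q) (snd q) u *\<^sub>R \<phi> q u) <= w u))"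
 proof (intro exI conjI ballI impI)
  show "min 1 (T - s) > 0" using T by simp
  show "integrable \<mu> (%u. C * (\<bar>u\<bar> ^ 0 * exp (b / (1 - T) * \<bar>u\<bar>) + \<bar>u\<bar> ^ k * exp (b / (1 - T) * \<bar>u\<bar>)))"
   by (intro integrable_mult_right Bochner_Integration.integrable_add integrable_exp_abs)
  fix q u assume q: "q \<in> {0..<1::real} \<times> (UNIV::real set)" "dist q p < min 1 (T - s)"
  have "\<bar>fst q - s\<bar> < T - s" "\<bar>snd q - z\<bar> < 1"
   using q dist_fst_le[of q p] dist_snd_le[of q p] by (auto simp: sz dist_real_def)
  then have "fst q <= T" "\<bar>snd q\<bar> <= b" "0 <= fst q" using q by (auto simp: b_def)
  then have "weight (fst q) (snd q) u <= exp (b / (1 - T) * \<bar>u\<bar>)" using T by (intro weight_le) auto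
  then have "weight (fst q) (snd q) u * norm (\<phi> q u) <= exp (b / (1 - T) * \<bar>u\<bar>) * (C * (1 + \<bar>u\<bar> ^ k))"
   using le[OF q(1), of u] weight_pos by (intro mult_mono) (auto simp: less_imp_le)
  then show "norm (weight (fst q) (snd q) u *\<^sub>R \<phi> q u) <= C * (\<bar>u\<bar> ^ 0 * exp (b / (1 - T) * \<bar>u\<bar>) + \<bar>u\<bar> ^ k * exp (b / (1 - T) * \<bar>u\<bar>))"
   using weight_pos[of "fst q" "snd q" u] by (simp add: algebra_simps)
 qed
qed

lemma continuous_D: "continuous_on ({0..<1} \<times> UNIV) (%p. D (fst p) (snd p))"
 using continuous_weight_integral[of "%_ _. 1 :: real" 1 0] by (simp add: D_def continuous_intros)

lemma continuous_post_integral: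
 fixes \<phi> :: "real \<times> real => real => 'b::{banach, second_countable_topology}"
 assumes "!!p. \<phi> p \<in> borel_measurable borel"
  and "!!u. continuous_on ({0..<1} \<times> UNIV) (%p. \<phi> p u)"
  and "!!p u. p \<in> {0..<1} \<times> UNIV ==> norm (\<phi> p u) <= C * (1 + \<bar>u\<bar> ^ k)"
 shows "continuous_on ({0..<1} \<times> UNIV) (%p. \<integral>u. \<phi> p u \<partial>post (fst p) (snd p))"
proof -
 have "continuous_on ({0..<1} \<times> UNIV) (%p. (1 / D (fst p) (snd p)) *\<^sub>R (LINT u|\<mu>. weight (fst p) (snd p) u *\<^sub>R \<phi> p u))"
  using D_pos by (intro continuous_intros continuous_D continuous_weight_integral[OF assms]) (auto simp: less_imp_neq[symmetric])
 then show ?thesis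
 proof (rule continuous_on_eq)
  fix p :: "real \<times> real" assume "p \<in> {0..<1} \<times> UNIV"
  then have p: "0 <= fst p" "fst p < 1" by auto
  have "(LINT u|post (fst p) (snd p). \<phi> p u) = (LINT u|\<mu>. (1 / D (fst p) (snd p)) *\<^sub>R (weight (fst p) (snd p) u *\<^sub>R \<phi> p u))"
   by (subst integral_post[OF p assms(1)]) simp
  then show "(1 / D (fst p) (snd p)) *\<^sub>R (LINT u|\<mu>. weight (fst p) (snd p) u *\<^sub>R \<phi> p u) = (LINT u|post (fst p) (snd p). \<phi> p u)"
   by (simp only: integral_scaleR_right)
 qed
qed

lemma continuous_h: "continuous_on ({0..<1} \<times> UNIV) (%p. h (fst p) (snd p))"
 unfolding h_eq by (rule continuous_post_integral[where C = 1 and k = 1]) (auto intro!: continuous_intros)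

lemma continuous_g: "continuous_on ({0..<1} \<times> UNIV) (%p. g (fst p) (snd p))"
proof -
 have "continuous_on ({0..<1} \<times> UNIV) (%p::real\<times>real. exp (- (snd p)\<^sup>2 / (2 * (1 - fst p))) / sqrt (1 - fst p) * D (fst p) (snd p))"
  by (intro continuous_intros continuous_D) auto
 then show ?thesis by (rule continuous_on_eq) (auto simp: g_eq)
qed

text \<open>Complex differentiation of a Laplace transform of \<mu>, directly from the second-order
  remainder of the exponential; the exponential moments make that remainder integrable.\<close>

lemma exp_integral_deriv:
 fixes q :: "real => complex"
 assumes [measurable]: "q \<in> borel_measurable borel" and le: "!!u. cmod (q u) <= C * (1 + \<bar>u\<bar> ^ k)"
 shows "integrable \<mu> (%u. q u * exp (ze * of_real u))"
  and "((%ze. \<integral>u. q u * exp (ze * of_real u) \<partial>\<mu>) has_field_derivative (LINT u|\<mu>. q u * of_real u * exp (ze * of_real u))) (at ze)"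
proof -
 have C0: "0 <= C"
  using order_trans[OF norm_ge_zero le[of 1]] by simp
 have i: "integrable \<mu> (%u. q' u * exp (ze * of_real u))"
  if [measurable]: "q' \<in> borel_measurable borel" and le: "!!u. cmod (q' u) <= C * (1 + \<bar>u\<bar> ^ k) * \<bar>u\<bar> ^ j" for q' C k j and ze :: complex
 proof (rule integrable_dominated)
  show "integrable \<mu> (%u. C * (\<bar>u\<bar> ^ j * exp (cmod ze * \<bar>u\<bar>) + \<bar>u\<bar> ^ (k + j) * exp (cmod ze * \<bar>u\<bar>)))"
   by (intro integrable_mult_right Bochner_Integration.integrable_add integrable_exp_abs)
  fix u :: real
  have "cmod (exp (ze * of_real u)) <= exp (cmod ze * \<bar>u\<bar>)"
   using norm_exp[of "ze * of_real u"] by (simp add: norm_mult)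
  then have "cmod (q' u) * cmod (exp (ze * of_real u)) <= C * (1 + \<bar>u\<bar> ^ k) * \<bar>u\<bar> ^ j * exp (cmod ze * \<bar>u\<bar>)"
   by (intro mult_mono le) (auto intro: order_trans[OF norm_ge_zero le])
  then show "norm (q' u * exp (ze * of_real u)) <= C * (\<bar>u\<bar> ^ j * exp (cmod ze * \<bar>u\<bar>) + \<bar>u\<bar> ^ (k + j) * exp (cmod ze * \<bar>u\<bar>))"
   by (simp add: norm_mult algebra_simps power_add)
 qed simp
 show i0: "integrable \<mu> (%u. q u * exp (ze * of_real u))" for ze
  using i[of q C k 0] le by simp
 have i1: "integrable \<mu> (%u. q u * of_real u * exp (ze * of_real u))" for ze
  by (rule i[of _ C k 1]) (auto simp: norm_mult intro!: mult_right_mono le)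
 define W where "W u = C * (\<bar>u\<bar> ^ 2 * exp ((cmod ze + 1) * \<bar>u\<bar>) + \<bar>u\<bar> ^ (k + 2) * exp ((cmod ze + 1) * \<bar>u\<bar>))" for u
 have iW: "integrable \<mu> W" unfolding W_def
  by (intro integrable_mult_right Bochner_Integration.integrable_add integrable_exp_abs)
 have est: "cmod (((LINT u|\<mu>. q u * exp ((ze + x) * of_real u)) - (LINT u|\<mu>. q u * exp (ze * of_real u))) / x - (LINT u|\<mu>. q u * of_real u * exp (ze * of_real u)))
  <= cmod x * (LINT u|\<mu>. W u)" if x: "cmod x <= 1" "x ~= 0" for x
 proof -
  let ?R = "%u::real. q u * exp (ze * of_real u) * (exp (x * of_real u) - 1 - x * of_real u)"
  have R: "?R u = q u * exp ((ze + x) * of_real u) - q u * exp (ze * of_real u) - x * (q u * of_real u * exp (ze * of_real u))" for u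
   by (simp add: algebra_simps exp_add)
  have iR: "integrable \<mu> ?R" unfolding R using i0 i1 by simp
  have "(LINT u|\<mu>. ?R u) = (LINT u|\<mu>. q u * exp ((ze + x) * of_real u)) - (LINT u|\<mu>. q u * exp (ze * of_real u)) - x * (LINT u|\<mu>. q u * of_real u * exp (ze * of_real u))"
   unfolding R using i0 i1 by simp
  then have e: "((LINT u|\<mu>. q u * exp ((ze + x) * of_real u)) - (LINT u|\<mu>. q u * exp (ze * of_real u))) / x - (LINT u|\<mu>. q u * of_real u * exp (ze * of_real u)) = (LINT u|\<mu>. ?R u) / x"
   using x by (simp add: field_simps)
  have "cmod (LINT u|\<mu>. ?R u) <= (LINT u|\<mu>. (cmod x)\<^sup>2 * W u)"
  proof (rule order_trans[OF integral_norm_bound integral_mono])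
   fix u
   have "cmod (exp (x * of_real u) - 1 - x * of_real u) <= (cmod x * \<bar>u\<bar>)\<^sup>2 * exp (cmod x * \<bar>u\<bar>)"
    using norm_exp_minus_linear_le[of "x * of_real u"] by (simp add: norm_mult)
   also have "... <= (cmod x * \<bar>u\<bar>)\<^sup>2 * exp (1 * \<bar>u\<bar>)"
    using x by (intro mult_left_mono exp_le_cancel_iff[THEN iffD2] mult_right_mono) auto
   finally have 1: "cmod (exp (x * of_real u) - 1 - x * of_real u) <= (cmod x * \<bar>u\<bar>)\<^sup>2 * exp \<bar>u\<bar>" by simp
   have 2: "cmod (exp (ze * of_real u)) <= exp (cmod ze * \<bar>u\<bar>)"
    using norm_exp[of "ze * of_real u"] by (simp add: norm_mult)
   have "cmod (?R u) <= C * (1 + \<bar>u\<bar> ^ k) * exp (cmod ze * \<bar>u\<bar>) * ((cmod x * \<bar>u\<bar>)^2 * exp \<bar>u\<bar>)"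
    unfolding norm_mult using C0 by (intro mult_mono le 1 2 mult_nonneg_nonneg) auto
   also have "... = (cmod x)^2 * W u"
    by (simp add: W_def algebra_simps power_mult_distrib exp_add power_add power2_eq_square)
   finally show "cmod (?R u) <= (cmod x)\<^sup>2 * W u" .
  qed (use iR iW in auto)
  also have "... = (cmod x)^2 * (LINT u|\<mu>. W u)" by simp
  finally show ?thesis
   unfolding e using x by (simp add: norm_divide divide_le_eq power2_eq_square mult_ac)
 qed
 show "((%ze. \<integral>u. q u * exp (ze * of_real u) \<partial>\<mu>) has_field_derivative (LINT u|\<mu>. q u * of_real u * exp (ze * of_real u))) (at ze)"
  unfolding DERIV_def
 proof (subst Lim_null, rule Lim_null_comparison)
  show "\<forall>\<^sub>F x in at 0. norm (((LINT u|\<mu>. q u * exp ((ze + x) * of_real u)) - (LINT u|\<mu>. q u * exp (ze * of_real u))) / x - (LINT u|\<mu>. q u * of_real u * exp (ze * of_real u))) <= cmod x * (LINT u|\<mu>. W u)"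
   unfolding eventually_at by (rule exI[of _ 1]) (use est in \<open>auto simp: dist_norm\<close>)
  show "((%x. cmod x * (LINT u|\<mu>. W u)) \<longlongrightarrow> 0) (at 0)"
   by (auto intro!: tendsto_eq_intros)
 qed
qed

text \<open>The part of the weight free of z. It is bounded by 1, so integrals against the weight
  become Laplace transforms in z / (1 - s), which are entire functions of z.\<close>

definition gauss_factor :: "real => real => real" where
 "gauss_factor s u = exp (- s * u^2 / (2 * (1 - s)))"

lemma weight_gauss_factor: "weight s z u = gauss_factor s u * exp (z / (1 - s) * u)"
 by (simp add: weight_def gauss_factor_def mult.commute flip: exp_add)

lemma gauss_factor_le: "0 <= s ==> s < 1 ==> gauss_factor s u <= 1"
 by (simp add: gauss_factor_def)

lemma gauss_factor_pos: "0 < gauss_factor s u"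
 by (simp add: gauss_factor_def)

lemma gauss_factor_measurable [measurable]: "gauss_factor s \<in> borel_measurable borel"
 unfolding gauss_factor_def[abs_def] by measurable

lemma weight_moment_deriv:
 assumes s: "0 <= s" "s < 1"
 shows "((%z. \<integral>u. u ^ k * weight s z u \<partial>\<mu>) has_real_derivative (LINT u|\<mu>. u ^ Suc k * weight s z u) / (1 - s)) (at z)"
proof -
 define q where "q u = complex_of_real (u ^ k * gauss_factor s u)" for u
 have [measurable]: "q \<in> borel_measurable borel" unfolding q_def by measurable
 have le: "cmod (q u) <= 1 * (1 + \<bar>u\<bar> ^ k)" for u
 proof -
  have "\<bar>u\<bar> ^ k * gauss_factor s u <= \<bar>u\<bar> ^ k * 1"
   using gauss_factor_le[OF s] by (intro mult_left_mono) auto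
  then show ?thesis using gauss_factor_pos[of s u] by (simp add: q_def norm_mult norm_power)
 qed
 let ?F = "%ze. \<integral>u. q u * exp (ze * of_real u) \<partial>\<mu>"
 let ?F' = "%ze. \<integral>u. q u * of_real u * exp (ze * of_real u) \<partial>\<mu>"
 have F: "Re (?F (of_real x)) = (LINT u|\<mu>. u ^ k * weight s (x * (1 - s)) u)" for x
 proof -
  have e: "(%u. q u * exp (of_real x * of_real u)) = (%u. complex_of_real (u ^ k * weight s (x * (1 - s)) u))"
   using s by (auto simp: q_def weight_gauss_factor exp_of_real[symmetric])
  show ?thesis unfolding e integral_complex_of_real by simp
 qed
 have F': "Re (?F' (of_real x)) = (LINT u|\<mu>. u ^ Suc k * weight s (x * (1 - s)) u)" for x
 proof -
  have e: "(%u. q u * of_real u * exp (of_real x * of_real u)) = (%u. complex_of_real (u ^ Suc k * weight s (x * (1 - s)) u))"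
   using s by (auto simp: q_def weight_gauss_factor exp_of_real[symmetric])
  show ?thesis unfolding e integral_complex_of_real by simp
 qed
 have "((%x. ?F (of_real x)) has_vector_derivative ?F' (of_real x)) (at x)" for x
  by (rule has_vector_derivative_real_field) (rule exp_integral_deriv(2)[OF _ le], measurable)
 then have "((%x. Re (?F (of_real x))) has_vector_derivative Re (?F' (of_real x))) (at x)" for x
  by (rule bounded_linear.has_vector_derivative[OF bounded_linear_Re])
 then have d: "((%x. \<integral>u. u ^ k * weight s (x * (1 - s)) u \<partial>\<mu>) has_real_derivative (LINT u|\<mu>. u ^ Suc k * weight s (x * (1 - s)) u)) (at x)" for x
  unfolding F F' has_real_derivative_iff_has_vector_derivative .
 have "((%z. z / (1 - s)) has_real_derivative 1 / (1 - s)) (at z)"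
  using s by (auto intro!: derivative_eq_intros)
 from DERIV_chain2[OF d this] show ?thesis using s by simp
qed

definition var :: "real => real => real" where "var s z = (LINT u|post s z. (u - h s z)\<^sup>2)"

lemma var_bounded:
 assumes "T < 1"
 obtains C where "0 <= C" "!!s z. 0 <= s ==> s <= T ==> var s z <= C"
proof (cases "0 <= T")
 case True
 have v: "var s z = posterior_variance \<mu> s z" for s z
  by (simp add: var_def posterior_variance_def post_def h_def)
 have "\<forall>t0\<in>{0..<1}. \<exists>C. \<forall>t\<in>{0..t0}. \<forall>z. posterior_variance \<mu> t z <= C"
  using bounded unfolding bounded_posterior_variance_def by (rule conjunct2)
 from bspec[OF this, of T] True assms obtain C where "\<forall>t\<in>{0..T}. \<forall>z. posterior_variance \<mu> t z <= C"
  by auto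
 then have C: "!!s z. 0 <= s ==> s <= T ==> var s z <= C"
  unfolding v by auto
 have "0 <= var 0 0" by (simp add: var_def)
 then have "0 <= C" using C[of 0 0] True by simp
 then show ?thesis using C that by auto
next
 case False
 show ?thesis by (rule that[of 0]) (use False in auto)
qed

text \<open>The posteriors at a fixed time form an exponential family in z: the logarithmic
  derivative of \<open>D s\<close> is the mean, and the derivative of the mean is the variance, each
  divided by 1 - s. Here the variance hypothesis turns into a Lipschitz bound for the drift.\<close>

lemma D_deriv:
 assumes s: "0 <= s" "s < 1"
 shows "(D s has_real_derivative D s z * h s z / (1 - s)) (at z)"
  and "(h s has_real_derivative var s z / (1 - s)) (at z)"
proof -
 let ?M = "%k z. \<integral>u. u ^ k * weight s z u \<partial>\<mu>"
 have M0: "?M 0 = D s" by (auto simp: D_def)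
 have Mk: "(LINT u|post s z. u ^ k) = ?M k z / D s z" for k z
  by (subst integral_post[OF s]) (auto simp: mult.commute)
 have h: "h s z = ?M 1 z / D s z" for z using Mk[of z 1] by (simp add: h_eq)
 have Dp: "D s z > 0" for z using D_pos[OF s] .
 show 1: "(D s has_real_derivative D s z * h s z / (1 - s)) (at z)" for z
  using weight_moment_deriv[OF s, of 0 z] Dp[of z] unfolding M0 by (simp add: h)
 interpret P: prob_space "post s z" by (rule prob_space_post[OF s])
 have i: "integrable (post s z) (%u. u)" "integrable (post s z) (%u. u\<^sup>2)"
  using integrable_post_power[OF s, of z 1] integrable_post_power[OF s, of z 2] by simp_all
 have v: "var s z = ?M 2 z / D s z - (h s z)\<^sup>2"
 proof -
  have "var s z = (LINT u|post s z. u\<^sup>2 - 2 * h s z * u + (h s z)^2)"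
   unfolding var_def by (simp add: power2_diff algebra_simps)
  also have "... = (LINT u|post s z. u\<^sup>2) - (h s z)\<^sup>2"
   using i P.prob_space by (simp add: h_eq power2_eq_square)
  finally show ?thesis using Mk[of z 2] by simp
 qed
 have M1: "(?M 1 has_real_derivative ?M 2 z / (1 - s)) (at z)"
  using weight_moment_deriv[OF s, of 1 z] by (simp add: numeral_2_eq_2)
 have "((%z. ?M 1 z / D s z) has_real_derivative (?M 2 z / (1 - s) * D s z - ?M 1 z * (D s z * h s z / (1 - s))) / (D s z * D s z)) (at z)"
  using Dp[of z] by (intro DERIV_divide M1 1) simp
 moreover have "(%z. ?M 1 z / D s z) = h s" by (auto simp: h)
 moreover have "(?M 2 z / (1 - s) * D s z - ?M 1 z * (D s z * h s z / (1 - s))) / (D s z * D s z) = var s z / (1 - s)"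
 proof -
  have "?M 2 z / (1 - s) * D s z - ?M 1 z * (D s z * h s z / (1 - s)) = (?M 2 z * D s z - ?M 1 z * ?M 1 z) / (1 - s)"
   unfolding h using Dp[of z] by (simp add: diff_divide_distrib)
  moreover have "var s z = (?M 2 z * D s z - ?M 1 z * ?M 1 z) / (D s z * D s z)"
   unfolding v h using Dp[of z] by (simp add: diff_divide_distrib power2_eq_square)
  ultimately show ?thesis by simp
 qed
 ultimately show "(h s has_real_derivative var s z / (1 - s)) (at z)" by simp
qed

lemma h_lipschitz:
 assumes "T < 1"
 obtains L where "0 <= L" "!!s z z'. 0 <= s ==> s <= T ==> \<bar>h s z - h s z'\<bar> <= L * \<bar>z - z'\<bar>"
proof -
 obtain C where C: "0 <= C" "!!s z. 0 <= s ==> s <= T ==> var s z <= C" using var_bounded[OF assms] by blast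
 show ?thesis
 proof (rule that[of "C / (1 - T)"])
  show "0 <= C / (1 - T)" using C assms by simp
  fix s z z' :: real assume s: "0 <= s" "s <= T"
  have "norm (h s z - h s z') <= C / (1 - T) * norm (z - z')"
  proof (rule field_differentiable_bound[of UNIV _ "%z. var s z / (1 - s)"])
   show "(h s has_real_derivative var s z / (1 - s)) (at z within UNIV)" for z
    using D_deriv(2)[of s z] s assms by simp
   have "0 <= var s z" for z by (simp add: var_def)
   then show "norm (var s z / (1 - s)) <= C / (1 - T)" for z
    using C s assms by (auto intro!: frac_le)
  qed auto
  then show "\<bar>h s z - h s z'\<bar> <= C / (1 - T) * \<bar>z - z'\<bar>" by simp
 qed
qed

lemma h_growth:
 assumes "T < 1"
 obtains C where "0 <= C" "!!s z. 0 <= s ==> s <= T ==> \<bar>h s z\<bar> <= C * (1 + \<bar>z\<bar>)"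
proof -
 obtain L where L: "0 <= L" "!!s z z'. 0 <= s ==> s <= T ==> \<bar>h s z - h s z'\<bar> <= L * \<bar>z - z'\<bar>"
  using h_lipschitz[OF assms] by blast
 have "continuous_on {0..T} ((%p. h (fst p) (snd p)) \<circ> (%s. (s, 0)))"
  using assms by (intro continuous_on_compose continuous_intros continuous_on_subset[OF continuous_h]) auto
 then have "compact ((%s. h s 0) ` {0..T})" by (intro compact_continuous_image) (auto simp: comp_def)
 then have "\<exists>B. \<forall>x\<in>(%s. h s 0) ` {0..T}. \<bar>x\<bar> <= B"
  by (intro bounded_real[THEN iffD1] compact_imp_bounded) simp
 then obtain B where "\<forall>s\<in>{0..T}. \<bar>h s 0\<bar> <= B" by auto
 then have B: "!!s. 0 <= s ==> s <= T ==> \<bar>h s 0\<bar> <= B" by auto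
 show ?thesis
 proof (rule that[of "\<bar>B\<bar> + L"])
  fix s z :: real assume s: "0 <= s" "s <= T"
  have "\<bar>h s z\<bar> <= \<bar>h s 0\<bar> + L * \<bar>z\<bar>" using L(2)[OF s, of z 0] by simp
  also have "... <= (\<bar>B\<bar> + L) * (1 + \<bar>z\<bar>)"
  proof -
   have "0 <= \<bar>B\<bar> * \<bar>z\<bar>" by simp
   moreover have "(\<bar>B\<bar> + L) * (1 + \<bar>z\<bar>) = \<bar>B\<bar> + \<bar>B\<bar> * \<bar>z\<bar> + L + L * \<bar>z\<bar>" by (simp add: algebra_simps)
   ultimately show ?thesis using B[OF s] L(1) by linarith
  qed
  finally show "\<bar>h s z\<bar> <= (\<bar>B\<bar> + L) * (1 + \<bar>z\<bar>)" .
 qed (use L in auto)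
qed

lemma \<rho>_eq_var: 
 assumes s: "0 <= s" "s < 1"
 shows "\<rho> s z = var s z + (h s z - z)^2"
proof -
 interpret P: prob_space "post s z" by (rule prob_space_post[OF s])
 have i: "integrable (post s z) (%u. u)" "integrable (post s z) (%u. (u - h s z)\<^sup>2)"
  using integrable_post_power[OF s, of z 1] integrable_post_sq[OF s] by simp_all
 have "\<rho> s z = (LINT u|post s z. (u - h s z)\<^sup>2 + 2 * (h s z - z) * (u - h s z) + (h s z - z)^2)"
  unfolding \<rho>_def by (intro Bochner_Integration.integral_cong) (auto simp: power2_eq_square algebra_simps)
 also have "... = var s z + (h s z - z)^2"
  using i P.prob_space by (simp add: var_def h_eq)
 finally show ?thesis .
qed

lemma \<rho>_growth:
 assumes "T < 1"
 obtains C where "0 <= C" "!!s z. 0 <= s ==> s <= T ==> \<rho> s z <= C * (1 + z^2)"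
proof -
 obtain B where B: "0 <= B" "!!s z. 0 <= s ==> s <= T ==> \<bar>h s z\<bar> <= B * (1 + \<bar>z\<bar>)" using h_growth[OF assms] by blast
 obtain V where V: "0 <= V" "!!s z. 0 <= s ==> s <= T ==> var s z <= V" using var_bounded[OF assms] by blast
 show ?thesis
 proof (rule that[of "V + (B + 1)^2 * 2"])
  fix s z :: real assume s: "0 <= s" "s <= T"
  have "\<bar>h s z - z\<bar> <= B * (1 + \<bar>z\<bar>) + \<bar>z\<bar>" using B(2)[OF s, of z] by simp
  also have "... <= (B + 1) * (1 + \<bar>z\<bar>)" by (simp add: algebra_simps)
  finally have "(h s z - z)\<^sup>2 <= ((B + 1) * (1 + \<bar>z\<bar>))\<^sup>2" using B(1) by (intro abs_le_square_iff[THEN iffD1]) simp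
  also have "... <= (B + 1)\<^sup>2 * (2 * (1 + z^2))"
  proof -
   have "(1 + \<bar>z\<bar>)\<^sup>2 <= 2 * (1 + z^2)"
    using zero_le_power2[of "1 - \<bar>z\<bar>"] by (simp add: power2_eq_square algebra_simps)
   then show ?thesis by (simp add: power_mult_distrib mult_left_mono)
  qed
  finally have "\<rho> s z <= V + (B + 1)^2 * (2 * (1 + z^2))"
   using V(2)[OF s, of z] \<rho>_eq_var[of s z] s assms by simp
  also have "... <= (V + (B + 1)^2 * 2) * (1 + z^2)"
   using V(1) by (simp add: algebra_simps)
  finally show "\<rho> s z <= (V + (B + 1)^2 * 2) * (1 + z^2)" .
 qed (use V in auto)
qed

lemma post_exp_integral:
 assumes s: "0 <= s" "s < 1"
 shows "(LINT u|post s z. exp (e * u)) = D s (z + e * (1 - s)) / D s z"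
proof -
 have "weight s z u * exp (e * u) = weight s (z + e * (1 - s)) u" for u
 proof -
  have "(z + e * (1 - s)) / (1 - s) * u = z / (1 - s) * u + e * u" using s by (simp add: field_simps)
  then show ?thesis by (simp add: weight_gauss_factor exp_add)
 qed
 then show ?thesis by (subst integral_post[OF s]) (auto simp: D_def)
qed

text \<open>The Lipschitz bound on \<open>h\<close> controls the logarithm of \<open>D s\<close> to
  first order, hence the exponential moments of u - h at exponents 1 and -1, hence the centred
  fourth moment.\<close>

lemma post_power4_growth:
 assumes "T < 1"
 obtains C where "0 <= C" "!!s z. 0 <= s ==> s <= T ==> (LINT u|post s z. (u - z) ^ 4) <= C * (1 + z ^ 4)"
proof -
 obtain L where L: "0 <= L" "!!s z z'. 0 <= s ==> s <= T ==> \<bar>h s z - h s z'\<bar> <= L * \<bar>z - z'\<bar>"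
  using h_lipschitz[OF assms] by blast
 obtain B where B: "0 <= B" "!!s z. 0 <= s ==> s <= T ==> \<bar>h s z\<bar> <= B * (1 + \<bar>z\<bar>)" using h_growth[OF assms] by blast
 define C where "C = 8 * (48 * exp L) + 8 * (8 * (B + 1) ^ 4)"
 have C0: "0 <= C" unfolding C_def by (intro add_nonneg_nonneg) auto
 have "(LINT u|post s z. (u - z) ^ 4) <= C * (1 + z ^ 4)" if s: "0 <= s" "s <= T" for s z
 proof -
  have s1: "s < 1" using s assms by simp
  interpret P: prob_space "post s z" by (rule prob_space_post[OF s(1) s1])
  \<comment> \<open>Multiplying the weight by exp (e * u) amounts to shifting z by e * (1 - s). The
    shift stays within distance 1 of z, where \<open>h s\<close> changes by at most L.\<close>
  have ex: "(LINT u|post s z. exp (e * (u - h s z))) <= exp L" if e: "\<bar>e\<bar> = 1" for e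
  proof -
   have der: "((%x. ln (D s x)) has_real_derivative h s x / (1 - s)) (at x)" for x
    using DERIV_chain2[OF DERIV_ln_divide[OF D_pos[OF s(1) s1]] D_deriv(1)[OF s(1) s1, of x]] D_pos[OF s(1) s1, of x]
    by simp
   have "norm ((ln (D s (z + e * (1 - s))) - h s z / (1 - s) * (z + e * (1 - s))) - (ln (D s z) - h s z / (1 - s) * z))
    <= L / (1 - s) * norm (z + e * (1 - s) - z)"
   proof (rule field_differentiable_bound[of "cball z 1" "%x. ln (D s x) - h s z / (1 - s) * x" "%x. h s x / (1 - s) - h s z / (1 - s)"])
    show "((%x. ln (D s x) - h s z / (1 - s) * x) has_real_derivative h s x / (1 - s) - h s z / (1 - s)) (at x within cball z 1)" for x
     by (rule has_field_derivative_at_within) (intro DERIV_diff der DERIV_cmult_Id)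
    fix x assume "x \<in> cball z 1"
    then have "L * \<bar>x - z\<bar> <= L * 1" using L by (intro mult_left_mono) (auto simp: dist_real_def)
    then have "\<bar>h s x - h s z\<bar> <= L" using L(2)[OF s, of x z] by simp
    then show "norm (h s x / (1 - s) - h s z / (1 - s)) <= L / (1 - s)"
     using s1 by (simp add: diff_divide_distrib[symmetric] divide_right_mono)
   qed (use e s s1 in \<open>auto simp: dist_real_def abs_mult\<close>)
   then have "ln (D s (z + e * (1 - s))) - ln (D s z) - e * h s z <= L"
   proof -
    have "h s z / (1 - s) * (z + e * (1 - s)) = h s z / (1 - s) * z + e * h s z" using s1 by (simp add: field_simps)
    moreover have "L / (1 - s) * norm (z + e * (1 - s) - z) = L" using s1 e by (simp add: abs_mult)
    moreover note \<open>norm _ <= L / (1 - s) * norm (z + e * (1 - s) - z)\<close>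
    ultimately show ?thesis unfolding real_norm_def by linarith
   qed
   then have "exp (ln (D s (z + e * (1 - s))) - ln (D s z) - e * h s z) <= exp L" by simp
   then have "D s (z + e * (1 - s)) / D s z * exp (- (e * h s z)) <= exp L"
    using D_pos[OF s(1) s1] by (simp add: exp_diff exp_minus divide_inverse)
   then show ?thesis
    unfolding post_exp_integral[OF s(1) s1, symmetric] by (simp add: algebra_simps exp_diff exp_minus divide_inverse)
  qed
  have iex: "integrable (post s z) (%u. exp (e * (u - h s z)))" if "\<bar>e\<bar> = 1" for e
  proof (rule integrable_post[where C = "exp \<bar>h s z\<bar>" and k = 0 and c = 1])
   fix u
   have "e * (u - h s z) <= \<bar>e\<bar> * \<bar>u - h s z\<bar>" by (simp add: abs_mult[symmetric])
   also have "... <= \<bar>h s z\<bar> + \<bar>u\<bar>" using that by simp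
   finally have "exp (e * (u - h s z)) <= exp \<bar>h s z\<bar> * exp (\<bar>u\<bar>)" by (simp flip: exp_add)
   also have "... <= exp \<bar>h s z\<bar> * (1 + \<bar>u\<bar> ^ 0) * exp (1 * \<bar>u\<bar>)" by simp
   finally show "norm (exp (e * (u - h s z))) <= exp \<bar>h s z\<bar> * (1 + \<bar>u\<bar> ^ 0) * exp (1 * \<bar>u\<bar>)" by simp
  qed (use s s1 in auto)
  have "(LINT u|post s z. (u - z) ^ 4) <= (LINT u|post s z. 8 * (24 * (exp (1 * (u - h s z)) + exp ((-1) * (u - h s z)))) + 8 * (h s z - z) ^ 4)"
  proof (rule integral_mono')
   show "integrable (post s z) (%u. 8 * (24 * (exp (1 * (u - h s z)) + exp ((-1) * (u - h s z)))) + 8 * (h s z - z) ^ 4)"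
    using iex[of 1] iex[of "-1"] by simp
   fix u
   have "\<bar>u - h s z\<bar> ^ 4 / fact 4 <= exp \<bar>u - h s z\<bar>" by (rule power_div_fact_le_exp) simp
   then have "(u - h s z) ^ 4 <= 24 * exp \<bar>u - h s z\<bar>" by (simp add: fact_numeral)
   also have "exp \<bar>u - h s z\<bar> <= exp (1 * (u - h s z)) + exp ((-1) * (u - h s z))"
    by (cases "u \<ge> h s z") (auto simp: add_increasing add_increasing2 abs_if)
   finally have "(u - h s z) ^ 4 <= 24 * (exp (1 * (u - h s z)) + exp ((-1) * (u - h s z)))" by simp
   then show "(u - z) ^ 4 <= 8 * (24 * (exp (1 * (u - h s z)) + exp ((-1) * (u - h s z)))) + 8 * (h s z - z) ^ 4"
    using power4_add_le[of "u - h s z" "h s z - z"] by simp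
  qed (auto intro!: add_nonneg_nonneg)
  also have "... = 8 * (24 * ((LINT u|post s z. exp (1 * (u - h s z))) + (LINT u|post s z. exp ((-1) * (u - h s z))))) + 8 * (h s z - z) ^ 4"
   using iex[of 1] iex[of "-1"] P.prob_space by simp
  also have "... <= 8 * (48 * exp L) + 8 * (h s z - z) ^ 4"
   using ex[of 1] ex[of "-1"] by simp
  also have "(h s z - z) ^ 4 <= 8 * (B + 1) ^ 4 * (1 + z ^ 4)"
  proof -
   have "\<bar>h s z - z\<bar> <= (B + 1) * (1 + \<bar>z\<bar>)" using B(2)[OF s, of z] by (simp add: algebra_simps)
   then have "\<bar>h s z - z\<bar> ^ 4 <= ((B + 1) * (1 + \<bar>z\<bar>)) ^ 4" by (rule power_mono) simp
   also have "... = (B + 1) ^ 4 * (1 + \<bar>z\<bar>) ^ 4" by (simp add: power_mult_distrib)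
   also have "... <= (B + 1) ^ 4 * (8 * 1 ^ 4 + 8 * \<bar>z\<bar> ^ 4)"
    by (intro mult_left_mono power4_add_le) auto
   finally show ?thesis by (simp add: algebra_simps)
  qed
  also have "8 * (48 * exp L) + 8 * (8 * (B + 1) ^ 4 * (1 + z ^ 4)) <= C * (1 + z ^ 4)"
   by (simp add: C_def algebra_simps)
  finally show ?thesis by simp
 qed
 with C0 show ?thesis by (rule that)
qed


subsection \<open>Complex transforms of the kernel\<close>

text \<open>Divided by \<open>char_den\<close>, the continuation to complex starting points of the
  posterior characteristic function at frequency \<open>\<theta> * ((r - s) / (1 - s))\<close>.
  Numerator and normalisation are kept apart because both are entire and only the zeros of the
  latter matter.\<close>

definition char_num :: "real => real => real => complex => complex" where
 "char_num \<theta> r s ze = (LINT u|\<mu>. (exp (\<i> * of_real (\<theta> * ((r - s) / (1 - s)) * u)) * of_real (gauss_factor s u)) * exp (ze / of_real (1 - s) * of_real u))"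

definition char_den :: "real => complex => complex" where
 "char_den s ze = (LINT u|\<mu>. of_real (gauss_factor s u) * exp (ze / of_real (1 - s) * of_real u))"

text \<open>The characteristic function at \<theta> of the kernel from time s to time r, continued
  to complex starting points (see \<open>char_fun_K\<close>): the exponential collects the starting
  point and the variance of the bridge, the quotient averages over the pinning point.\<close>

definition char_fun :: "real => real => real => complex => complex" where
 "char_fun \<theta> r s ze = exp (\<i> * of_real (\<theta> * ((1 - r) / (1 - s))) * ze - of_real (\<theta>\<^sup>2 * ((r - s) * (1 - r) / (1 - s)) / 2))
  * (char_num \<theta> r s ze / char_den s ze)"

lemma char_holomorphic:
 assumes s: "0 <= s" "s < 1"
 shows "(char_num \<theta> r s) holomorphic_on A" and "(char_den s) holomorphic_on A"
proof -
 have m: "norm (complex_of_real (gauss_factor s u)) <= 1 * (1 + \<bar>u\<bar> ^ 0)" for u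
  using gauss_factor_le[OF s, of u] gauss_factor_pos[of s u] by simp
 have d: "((%ze. ze / complex_of_real (1 - s)) has_field_derivative 1 / of_real (1 - s)) (at ze)" for ze
  using s by (auto intro!: derivative_eq_intros)
 have *: "(%ze. \<integral>u. q u * exp (ze / complex_of_real (1 - s) * of_real u) \<partial>\<mu>) holomorphic_on A"
  if "q \<in> borel_measurable borel" "!!u. cmod (q u) <= 1 * (1 + \<bar>u\<bar> ^ 0)" for q
  by (rule holomorphic_onI)
   (rule field_differentiable_at_within, unfold field_differentiable_def,
    rule exI, rule DERIV_chain2[OF exp_integral_deriv(2)[OF that] d])
 show "(char_num \<theta> r s) holomorphic_on A"
  unfolding char_num_def[abs_def] by (rule *) (use m in \<open>auto simp: norm_mult\<close>)
 show "(char_den s) holomorphic_on A"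
  unfolding char_den_def[abs_def] by (rule *) (use m in auto)
qed

lemma weight_complex_exp:
 assumes s: "0 <= s" "s < 1"
 shows "of_real (gauss_factor s u) * exp (ze / of_real (1 - s) * of_real u) =
  of_real (weight s (Re ze) u) * exp (\<i> * of_real (Im ze / (1 - s) * u))"
proof -
 have "ze / of_real (1 - s) * of_real u = of_real (Re ze / (1 - s) * u) + \<i> * of_real (Im ze / (1 - s) * u)"
  using s by (simp add: complex_eq_iff)
 then have "exp (ze / of_real (1 - s) * of_real u) = of_real (exp (Re ze / (1 - s) * u)) * exp (\<i> * of_real (Im ze / (1 - s) * u))"
  by (simp only: exp_add exp_of_real)
 then show ?thesis by (simp only: weight_gauss_factor of_real_mult mult.assoc)
qed

lemma char_den_of_real: "0 <= s ==> s < 1 ==> char_den s (of_real y) = of_real (D s y)"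
proof -
 assume s: "0 <= s" "s < 1"
 have "char_den s (of_real y) = (LINT u|\<mu>. complex_of_real (weight s y u))"
  unfolding char_den_def weight_complex_exp[OF s] by simp
 then show ?thesis by (simp only: integral_complex_of_real D_def)
qed

lemma norm_char_num_le:
 assumes s: "0 <= s" "s < 1" shows "cmod (char_num \<theta> r s ze) <= D s (Re ze)"
proof -
 have "cmod (char_num \<theta> r s ze) <= (LINT u|\<mu>. norm ((exp (\<i> * of_real (\<theta> * ((r - s) / (1 - s)) * u)) * of_real (gauss_factor s u)) * exp (ze / of_real (1 - s) * of_real u)))"
  unfolding char_num_def by (rule integral_norm_bound)
 also have "... = D s (Re ze)"
  unfolding D_def mult.assoc weight_complex_exp[OF s] using weight_pos
  by (intro Bochner_Integration.integral_cong) (auto simp: norm_mult less_imp_le)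
 finally show ?thesis .
qed

text \<open>Rotated by the phase of the posterior mean, the continued \<open>D\<close> has real part
  \<open>D s x\<close> times the posterior mean of cos (\<tau> * (u - h)), which is at least 1 -
  \<tau>^2 * var / 2. So the variance bound yields a zero-free strip whose width is uniform in the
  starting point.\<close>

lemma norm_char_den_ge:
 assumes s: "0 <= s" "s < 1" and v: "var s (Re ze) <= C" "0 <= C" and im: "(C + 1) * (Im ze)^2 <= (1 - s)\<^sup>2"
 shows "D s (Re ze) / 2 <= cmod (char_den s ze)"
proof -
 define x where "x = Re ze"
 define \<tau> where "\<tau> = Im ze / (1 - s)"
 have \<tau>: "\<tau>\<^sup>2 * C <= 1"
 proof -
  have "C * (Im ze)^2 <= (C + 1) * (Im ze)^2" by (simp add: algebra_simps)
  with im have "C * (Im ze)^2 <= (1 - s)\<^sup>2" by simp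
  then show ?thesis using s by (simp add: \<tau>_def power_divide divide_le_eq mult.commute)
 qed
 interpret P: prob_space "post s x" by (rule prob_space_post[OF s])
 let ?f = "%u. complex_of_real (weight s x u) * exp (\<i> * of_real (\<tau> * u))"
 have "integrable \<mu> (%u. complex_of_real (gauss_factor s u) * exp (ze / of_real (1 - s) * of_real u))"
  using gauss_factor_le[OF s] gauss_factor_pos by (intro exp_integral_deriv(1)[where C = 1 and k = 0]) (auto simp: less_imp_le intro: order_trans[of _ 1])
 then have i: "integrable \<mu> ?f" unfolding weight_complex_exp[OF s] x_def \<tau>_def .
 have den: "char_den s ze = (LINT u|\<mu>. ?f u)"
  unfolding char_den_def weight_complex_exp[OF s] x_def \<tau>_def ..
 have iq: "integrable (post s x) (%u. (u - h s x)\<^sup>2)" by (rule integrable_post_sq[OF s])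
 have ic: "integrable (post s x) (%u. cos (\<tau> * (u - h s x)))"
  by (rule P.integrable_const_bound[where B = 1]) auto
 have "D s x / 2 <= D s x * (1 - \<tau>\<^sup>2 / 2 * var s x)"
 proof -
  have "\<tau>\<^sup>2 * var s x <= \<tau>\<^sup>2 * C" using v by (intro mult_left_mono) (auto simp: x_def)
  then have "1 / 2 <= 1 - \<tau>\<^sup>2 / 2 * var s x" using \<tau> by simp
  then have "D s x * (1 / 2) <= D s x * (1 - \<tau>\<^sup>2 / 2 * var s x)"
   using D_pos[OF s, of x] by (intro mult_left_mono) auto
  then show ?thesis by simp
 qed
 also have "1 - \<tau>\<^sup>2 / 2 * var s x = (LINT u|post s x. 1 - \<tau>\<^sup>2 / 2 * (u - h s x)^2)"
  using iq P.prob_space by (simp add: var_def)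
 also have "D s x * ... <= D s x * (LINT u|post s x. cos (\<tau> * (u - h s x)))"
  using D_pos[OF s, of x] cos_ge_one_minus_half_sq[of "\<tau> * (_ - h s x)"] iq ic
  by (intro mult_left_mono integral_mono) (auto simp: power_mult_distrib)
 also have "... = (LINT u|\<mu>. weight s x u * cos (\<tau> * (u - h s x)))"
 proof -
  have "D s x * (LINT u|post s x. cos (\<tau> * (u - h s x))) = (LINT u|\<mu>. D s x * ((weight s x u / D s x) *\<^sub>R cos (\<tau> * (u - h s x))))"
   unfolding integral_mult_right_zero by (subst integral_post[OF s]) auto
  also have "... = (LINT u|\<mu>. weight s x u * cos (\<tau> * (u - h s x)))"
   using D_pos[OF s, of x] by (intro Bochner_Integration.integral_cong refl) simp
  finally show ?thesis .
 qed
 also have "... = (LINT u|\<mu>. Re (exp (- (\<i> * of_real (\<tau> * h s x))) * ?f u))"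
 proof (intro Bochner_Integration.integral_cong refl)
  fix u
  have "exp (- (\<i> * of_real (\<tau> * h s x))) * ?f u = of_real (weight s x u) * exp (\<i> * of_real (\<tau> * (u - h s x)))"
   by (simp add: exp_add[symmetric] algebra_simps)
  then show "weight s x u * cos (\<tau> * (u - h s x)) = Re (exp (- (\<i> * of_real (\<tau> * h s x))) * ?f u)"
   by (simp only: cis_conv_exp[symmetric]) simp
 qed
 also have "... = Re (exp (- (\<i> * of_real (\<tau> * h s x))) * char_den s ze)"
  unfolding den using i by (simp only: integral_Re integrable_mult_right integral_mult_right_zero)
 also have "... <= cmod (exp (- (\<i> * of_real (\<tau> * h s x))) * char_den s ze)" by (rule complex_Re_le_cmod)
 also have "... = cmod (char_den s ze)"
  using norm_exp_i_times[of "- (\<tau> * h s x)"] by (simp add: norm_mult)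
 finally show ?thesis by (simp add: x_def)
qed

text \<open>Cauchy estimates on discs of radius \<eta> / 2 inside the zero-free strip bound the
  first three derivatives on the real line, uniformly in starting time and position.\<close>

lemma char_fun_taylor:
 assumes r: "0 <= r" "r < 1"
 obtains B where "0 <= B"
  "!!s y. 0 <= s ==> s <= r ==> \<exists>a b. cmod a <= B \<and> cmod b <= B \<and>
   (\<forall>d::real. cmod (char_fun \<theta> r s (of_real (y + d)) - char_fun \<theta> r s (of_real y) - a * of_real d - b * of_real (d^2)) <= B * \<bar>d\<bar> ^ 3)"
  "!!s y. 0 <= s ==> s <= r ==> cmod (char_fun \<theta> r s (of_real y)) <= B"
proof -
 obtain C where C: "0 <= C" "!!s z. 0 <= s ==> s <= r ==> var s z <= C" using var_bounded[OF r(2)] by blast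
 \<comment> \<open>The half-width that \<open>norm_char_den_ge\<close> allows at the latest starting
   time r, hence at all earlier ones.\<close>
 define \<eta> where "\<eta> = (1 - r) / sqrt (C + 1)"
 have \<eta>: "0 < \<eta>" "(C + 1) * \<eta>\<^sup>2 = (1 - r)^2" using C r by (auto simp: \<eta>_def power_divide)
 define B0 where "B0 = exp (\<bar>\<theta>\<bar> * \<eta>) * 2"
 define S where "S = {ze. \<bar>Im ze\<bar> <= \<eta>}"
 have den: "D s (Re ze) / 2 <= cmod (char_den s ze)" if "0 <= s" "s <= r" "ze \<in> S" for s ze
 proof (rule norm_char_den_ge)
  have "(Im ze)\<^sup>2 <= \<eta>\<^sup>2" using that \<eta> by (intro abs_le_square_iff[THEN iffD1]) (auto simp: S_def)
  then have "(C + 1) * (Im ze)^2 <= (C + 1) * \<eta>\<^sup>2" using C by (intro mult_left_mono) auto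
  also have "... <= (1 - s)\<^sup>2" unfolding \<eta> using that r by (intro power_mono) auto
  finally show "(C + 1) * (Im ze)^2 <= (1 - s)\<^sup>2" .
 qed (use that r C in auto)
 have bd: "cmod (char_fun \<theta> r s ze) <= B0" if s: "0 <= s" "s <= r" and ze: "ze \<in> S" for s ze
 proof -
  have s1: "s < 1" using s r by simp
  have Dp: "0 < D s (Re ze)" by (rule D_pos[OF s(1) s1])
  have "cmod (char_num \<theta> r s ze / char_den s ze) <= D s (Re ze) / (D s (Re ze) / 2)"
   unfolding norm_divide using den[OF s ze] Dp norm_char_num_le[OF s(1) s1] by (intro frac_le) auto
  then have 1: "cmod (char_num \<theta> r s ze / char_den s ze) <= 2" using Dp by simp
  have "cmod (exp (\<i> * of_real (\<theta> * ((1 - r) / (1 - s))) * ze - of_real (\<theta>\<^sup>2 * ((r - s) * (1 - r) / (1 - s)) / 2)))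
   = exp (- (\<theta> * ((1 - r) / (1 - s))) * Im ze - \<theta>\<^sup>2 * ((r - s) * (1 - r) / (1 - s)) / 2)"
   by (simp add: norm_exp_eq_Re)
  also have "... <= exp (\<bar>\<theta>\<bar> * \<eta>)"
  proof -
   have "- (\<theta> * ((1 - r) / (1 - s))) * Im ze <= \<bar>\<theta> * ((1 - r) / (1 - s)) * Im ze\<bar>" by (metis abs_ge_minus_self mult_minus_left)
   also have "... = \<bar>\<theta>\<bar> * (((1 - r) / (1 - s)) * \<bar>Im ze\<bar>)" using s s1 r by (simp add: abs_mult)
   also have "... <= \<bar>\<theta>\<bar> * (1 * \<eta>)"
    using ze s s1 r by (intro mult_left_mono mult_mono) (auto simp: S_def)
   finally have "- (\<theta> * ((1 - r) / (1 - s))) * Im ze <= \<bar>\<theta>\<bar> * \<eta>" by simp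
   moreover have "0 <= \<theta>\<^sup>2 * ((r - s) * (1 - r) / (1 - s)) / 2" using s s1 r by simp
   ultimately show ?thesis by simp
  qed
  finally show ?thesis unfolding char_fun_def norm_mult B0_def using 1 by (intro mult_mono) auto
 qed
 have hol: "(char_fun \<theta> r s) holomorphic_on S" if s: "0 <= s" "s <= r" for s
 proof -
  have s1: "s < 1" using s r by simp
  have "char_den s ze ~= 0" if "ze \<in> S" for ze using den[OF s that] D_pos[OF s(1) s1, of "Re ze"] by auto
  then show ?thesis
   unfolding char_fun_def[abs_def] by (intro holomorphic_intros char_holomorphic[OF s(1) s1]) auto
 qed
 define B where "B = max B0 (6 * B0 / (\<eta> / 2) ^ 3 + B0 / (\<eta> / 2) + 2 * B0 / (\<eta> / 2)^2)"
 have B0: "0 < B0" by (simp add: B0_def)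
 have pos: "0 <= 6 * B0 / (\<eta> / 2) ^ 3" "0 <= B0 / (\<eta> / 2)" "0 <= 2 * B0 / (\<eta> / 2)^2" using B0 \<eta> by auto
 show ?thesis
 proof (rule that[of B])
  show "0 <= B" using B0 by (simp add: B_def)
  show "cmod (char_fun \<theta> r s (of_real y)) <= B" if "0 <= s" "s <= r" for s y
   using bd[OF that, of "of_real y"] \<eta> by (simp add: S_def B_def)
  fix s y :: real assume s: "0 <= s" "s <= r"
  let ?w = "char_fun \<theta> r s" and ?R = "{ze. Im ze = 0}"
  have sub: "cball x (\<eta> / 2) \<subseteq> S" if "x \<in> ?R" for x
  proof
   fix ze assume "ze \<in> cball x (\<eta> / 2)"
   then have "cmod (ze - x) <= \<eta> / 2" by (simp add: dist_norm norm_minus_commute)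
   then show "ze \<in> S" using abs_Im_le_cmod[of "ze - x"] that \<eta>(1) by (simp add: S_def)
  qed
  have op: "open {ze. \<bar>Im ze\<bar> < \<eta>}"
   by (intro open_Collect_less continuous_intros)
  have holo: "?w holomorphic_on {ze. \<bar>Im ze\<bar> < \<eta>}"
   by (rule holomorphic_on_subset[OF hol[OF s]]) (auto simp: S_def)
  have cau: "cmod ((deriv ^^ n) ?w x) <= fact n * B0 / (\<eta> / 2) ^ n" if "x \<in> ?R" for x n
  proof (rule Cauchy_inequality)
   show "?w holomorphic_on ball x (\<eta> / 2)"
    using sub[OF that] ball_subset_cball by (intro holomorphic_on_subset[OF hol[OF s]]) blast
   show "continuous_on (cball x (\<eta> / 2)) ?w"
    using sub[OF that] by (intro holomorphic_on_imp_continuous_on holomorphic_on_subset[OF hol[OF s]]) blast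
   show "norm (?w y) <= B0" if "norm (x - y) = \<eta> / 2" for y
    using that sub[OF \<open>x \<in> ?R\<close>] by (intro bd[OF s]) (auto simp: dist_norm)
  qed (use \<eta> in auto)
  let ?a = "deriv ?w (of_real y)" and ?b = "(deriv ^^ 2) ?w (of_real y) / 2"
  have t1: "cmod ((deriv ^^ 0) ?w (of_real (y + d)) - (\<Sum>i\<le>2. (deriv ^^ i) ?w (of_real y) * (of_real (y + d) - of_real y) ^ i / fact i))
   <= 6 * B0 / (\<eta> / 2) ^ 3 * cmod (of_real (y + d) - of_real y) ^ Suc 2 / fact 2" for d
  proof (rule complex_Taylor[where S = ?R and f = "%i. (deriv ^^ i) ?w" and n = 2])
   show "convex ?R"
   proof -
    have e: "?R = Im -` {0}" by auto
    show ?thesis unfolding e by (rule convex_linear_vimage[OF bounded_linear.linear[OF bounded_linear_Im]]) simp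
   qed
   fix x :: complex assume "x \<in> ?R"
   then have x: "x \<in> ?R" "x \<in> {ze. \<bar>Im ze\<bar> < \<eta>}" using \<eta> by auto
   show "((deriv ^^ i) ?w has_field_derivative (deriv ^^ Suc i) ?w x) (at x within ?R)" for i
    using holomorphic_derivI[OF holomorphic_higher_deriv[OF holo op, of i] op x(2)]
    unfolding funpow.simps comp_def by (rule has_field_derivative_at_within)
   show "cmod ((deriv ^^ Suc 2) ?w x) <= 6 * B0 / (\<eta> / 2) ^ 3"
   proof -
    have e: "Suc 2 = 3" and f: "fact 3 = (6 :: real)" by (simp_all add: fact_numeral)
    show ?thesis using cau[OF x(1), of "Suc 2"] unfolding e f .
   qed
  qed simp_all
  have t2: "?w (of_real (y + d)) - ?w (of_real y) - ?a * of_real d - ?b * of_real (d^2) =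
   (deriv ^^ 0) ?w (of_real (y + d)) - (\<Sum>i\<le>2. (deriv ^^ i) ?w (of_real y) * (of_real (y + d) - of_real y) ^ i / fact i)" for d
  proof -
   have "(\<Sum>i\<le>2. F i) = F 0 + F 1 + F 2" for F :: "nat => complex" by (simp add: numeral_2_eq_2)
   then show ?thesis by (simp add: fact_numeral)
  qed
  have t3: "cmod (of_real (y + d) - of_real y) ^ Suc 2 = \<bar>d\<bar> ^ 3" for d
   by (simp add: numeral_3_eq_3 numeral_2_eq_2)
  have t4: "cmod (?w (of_real (y + d)) - ?w (of_real y) - ?a * of_real d - ?b * of_real (d^2)) <= 6 * B0 / (\<eta> / 2) ^ 3 * \<bar>d\<bar> ^ 3 / 2" for d
   unfolding t2 using t1[of d] unfolding t3 by simp
  have t5: "6 * B0 / (\<eta> / 2) ^ 3 * \<bar>d\<bar> ^ 3 / 2 <= B * \<bar>d\<bar> ^ 3" for d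
  proof -
   have "6 * B0 / (\<eta> / 2) ^ 3 * \<bar>d\<bar> ^ 3 / 2 <= 6 * B0 / (\<eta> / 2) ^ 3 * \<bar>d\<bar> ^ 3"
   proof -
    have "x / 2 <= x" if "0 <= x" for x :: real using that by simp
    then show ?thesis using mult_nonneg_nonneg[OF pos(1) zero_le_power[OF abs_ge_zero[of d], of 3]] by blast
   qed
   also have "... <= B * \<bar>d\<bar> ^ 3" using pos by (intro mult_right_mono) (auto simp: B_def)
   finally show ?thesis .
  qed
  have "cmod ?a <= B0 / (\<eta> / 2)" using cau[of "of_real y" 1] by simp
  then have a: "cmod ?a <= B" using pos unfolding B_def by linarith
  have "cmod ((deriv ^^ 2) ?w (of_real y)) <= fact 2 * B0 / (\<eta> / 2)^2" by (rule cau) simp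
  then have "cmod ?b <= 2 * B0 / (\<eta> / 2)^2" unfolding norm_divide fact_2 by (simp only: norm_numeral) (use pos in linarith)
  then have b: "cmod ?b <= B" using pos unfolding B_def by linarith
  show "\<exists>a b. cmod a <= B \<and> cmod b <= B \<and>
   (\<forall>d::real. cmod (?w (of_real (y + d)) - ?w (of_real y) - a * of_real d - b * of_real (d^2)) <= B * \<bar>d\<bar> ^ 3)"
   by (rule exI[of _ ?a], rule exI[of _ ?b]) (intro conjI allI a b order_trans[OF t4 t5])
 qed
qed

lemma char_fun_eq:
 assumes s: "0 <= s" "s < 1"
 shows "char_fun \<theta> r s (of_real y) = exp (\<i> * of_real (\<theta> * ((1 - r) / (1 - s)) * y) - of_real (\<theta>\<^sup>2 * ((r - s) * (1 - r) / (1 - s)) / 2))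
  * (LINT u|post s y. exp (\<i> * of_real (\<theta> * ((r - s) / (1 - s)) * u)))"
proof -
 have "char_num \<theta> r s (of_real y) = (LINT u|\<mu>. of_real (weight s y u) * exp (\<i> * of_real (\<theta> * ((r - s) / (1 - s)) * u)))"
  unfolding char_num_def mult.assoc weight_complex_exp[OF s] by (simp add: mult_ac)
 also have "... = of_real (D s y) * (LINT u|post s y. exp (\<i> * of_real (\<theta> * ((r - s) / (1 - s)) * u)))"
 proof -
  let ?f = "%u. exp (\<i> * complex_of_real (\<theta> * ((r - s) / (1 - s)) * u))"
  have "of_real (D s y) * (LINT u|post s y. ?f u) = (LINT u|\<mu>. of_real (D s y) * ((weight s y u / D s y) *\<^sub>R ?f u))"
   unfolding integral_mult_right_zero by (subst integral_post[OF s]) auto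
  also have "... = (LINT u|\<mu>. of_real (weight s y u) * ?f u)"
   using D_pos[OF s, of y] by (intro Bochner_Integration.integral_cong refl) (simp add: scaleR_conv_of_real)
  finally show ?thesis ..
 qed
 finally show ?thesis
  using D_pos[OF s, of y] by (simp add: char_fun_def char_den_of_real[OF s] mult.assoc)
qed

lemma continuous_char_fun:
 assumes r: "r < 1"
 shows "continuous_on ({0..<1} \<times> UNIV) (%p. char_fun \<theta> r (fst p) (of_real (snd p)))"
proof -
 have "continuous_on ({0..<1} \<times> UNIV) (%p. exp (\<i> * of_real (\<theta> * ((1 - r) / (1 - fst p)) * snd p) - of_real (\<theta>\<^sup>2 * ((r - fst p) * (1 - r) / (1 - fst p)) / 2))
  * (LINT u|post (fst p) (snd p). exp (\<i> * of_real (\<theta> * ((r - fst p) / (1 - fst p)) * u))))"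
  by (intro continuous_intros continuous_post_integral[where C = 1 and k = 0]) auto
 then show ?thesis by (rule continuous_on_eq) (auto simp: char_fun_eq)
qed

lemma char_fun_end: "0 <= r ==> r < 1 ==> char_fun \<theta> r r (of_real y) = exp (\<i> * of_real (\<theta> * y))"
 using prob_space.prob_space[OF prob_space_post[of r y]] by (subst char_fun_eq) auto

lemma gaussian_char: "(LINT x|gaussian. exp (\<i> * of_real (c * x))) = exp (of_real (- c\<^sup>2 / 2))"
 unfolding exp_of_real using fun_cong[OF char_std_normal_distribution, of c] by (simp add: char_def)

lemma char_fun_K:
 assumes s: "0 <= s" "s < r" "r < 1"
 shows "(LINT x|K s y r. exp (\<i> * of_real (\<theta> * x))) = char_fun \<theta> r s (of_real y)"
proof -
 interpret Kp: prob_space "K s y r" by (rule prob_space_K[OF s])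
 have i: "integrable (K s y r) (%x. exp (\<i> * complex_of_real (\<theta> * x)))"
  by (rule Kp.integrable_const_bound[where B = 1]) auto
 let ?m = "bridge_mean s r y" and ?b = "bridge_sd s r"
 have "(LINT x|K s y r. exp (\<i> * of_real (\<theta> * x))) = (LINT u|post s y. (LINT x|gaussian. exp (\<i> * of_real (\<theta> * (?m u + ?b * x)))))"
  by (rule integral_K_bridge[OF s i])
 also have "... = (LINT u|post s y. exp (\<i> * of_real (\<theta> * ?m u)) * exp (of_real (- (\<theta> * ?b)\<^sup>2 / 2)))"
  unfolding gaussian_char[symmetric] by (simp add: algebra_simps exp_add)
 also have "... = (LINT u|post s y. exp (\<i> * of_real (\<theta> * ((1 - r) / (1 - s)) * y) - of_real (\<theta>\<^sup>2 * ((r - s) * (1 - r) / (1 - s)) / 2))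
   * exp (\<i> * of_real (\<theta> * ((r - s) / (1 - s)) * u)))"
 proof (intro Bochner_Integration.integral_cong refl)
  fix u
  have m: "?m u = (1 - r) / (1 - s) * y + (r - s) / (1 - s) * u"
  proof -
   have "(1 - r) / (1 - s) = 1 - (r - s) / (1 - s)" using s by (simp add: field_simps)
   moreover have "y + a * (u - y) = (1 - a) * y + a * u" for a :: real by (simp add: algebra_simps)
   ultimately show ?thesis by (simp only: bridge_mean_def)
  qed
  have b: "?b\<^sup>2 = (r - s) * (1 - r) / (1 - s)" using s by (simp add: bridge_sd_def)
  show "exp (\<i> * of_real (\<theta> * ?m u)) * exp (of_real (- (\<theta> * ?b)\<^sup>2 / 2)) = exp (\<i> * of_real (\<theta> * ((1 - r) / (1 - s)) * y) - of_real (\<theta>\<^sup>2 * ((r - s) * (1 - r) / (1 - s)) / 2))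
   * exp (\<i> * of_real (\<theta> * ((r - s) / (1 - s)) * u))"
   unfolding m power_mult_distrib b exp_add[symmetric] by (simp add: algebra_simps)
 qed
 also have "... = char_fun \<theta> r s (of_real y)"
  using s by (subst char_fun_eq) auto
 finally show ?thesis .
qed

end

section \<open>One Euler step compared with one step of the kernel\<close>

lemma taylor_moments:
 fixes F :: "real => complex" and d :: "real => real"
 assumes "prob_space N" and i4: "integrable N (%x. d x ^ 4)" and [measurable]: "d \<in> borel_measurable N" "F \<in> borel_measurable N"
  and le: "!!x. cmod (F x - w - a * of_real (d x) - b * of_real ((d x)^2)) <= B * \<bar>d x\<bar> ^ 3"
  and B: "0 <= B" and dl: "0 < dl"
 shows "integrable N (%x. (d x)\<^sup>2)" and "integrable N d" and "integrable N F"
  and "cmod ((LINT x|N. F x) - w - a * of_real (LINT x|N. d x) - b * of_real (LINT x|N. (d x)\<^sup>2))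
   <= B * (sqrt dl * (LINT x|N. (d x)\<^sup>2) + (LINT x|N. d x ^ 4) / sqrt dl)"
proof -
 interpret N: prob_space N by fact
 have sq: "x\<^sup>2 <= 1 + x ^ 4" for x :: real
  using zero_le_power2[of "x\<^sup>2 - 1"] zero_le_power2[of "x\<^sup>2"] by (simp add: power2_eq_square power4_eq_xxxx algebra_simps)
 have ab: "\<bar>x\<bar> <= 1 + x^2" for x :: real
  using zero_le_power2[of "\<bar>x\<bar> - 1"] zero_le_power2[of x] by (simp add: power2_eq_square algebra_simps)
 show i2: "integrable N (%x. (d x)\<^sup>2)"
  by (rule integrable_dominated[of _ "%x. 1 + d x ^ 4"]) (use i4 sq in auto)
 show i1: "integrable N d"
  by (rule integrable_dominated[of _ "%x. 1 + (d x)^2"]) (use i2 ab in auto)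
 \<comment> \<open>The weight sqrt dl is balanced so that second moments of order dl and fourth
   moments of order dl^2 both contribute order dl * sqrt dl.\<close>
 have cube: "\<bar>x\<bar> ^ 3 <= sqrt dl * x^2 + x ^ 4 / sqrt dl" for x :: real
 proof -
  have s: "sqrt dl > 0" using dl by simp
  have "0 <= (sqrt dl - \<bar>x\<bar>)\<^sup>2" by simp
  then have "2 * (\<bar>x\<bar> * sqrt dl) <= (sqrt dl)\<^sup>2 + x^2" by (simp add: power2_diff mult_ac)
  then have "\<bar>x\<bar> * sqrt dl <= (sqrt dl)\<^sup>2 + x^2" using s by (smt (verit) abs_ge_zero mult_nonneg_nonneg)
  then have "x\<^sup>2 * (\<bar>x\<bar> * sqrt dl) <= x\<^sup>2 * ((sqrt dl)^2 + x^2)" by (rule mult_left_mono) simp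
  then have "\<bar>x\<bar> ^ 3 * sqrt dl <= (sqrt dl * x^2 + x ^ 4 / sqrt dl) * sqrt dl"
   using s by (simp add: power2_eq_square power3_eq_cube power4_eq_xxxx distrib_right distrib_left mult_ac)
  then show ?thesis using s by (simp only: mult_le_cancel_right_pos)
 qed
 define R where "R x = F x - w - a * of_real (d x) - b * of_real ((d x)^2)" for x
 have [measurable]: "R \<in> borel_measurable N" unfolding R_def by measurable
 have leR: "cmod (R x) <= B * (sqrt dl * (d x)^2 + d x ^ 4 / sqrt dl)" for x
  using le[of x] mult_left_mono[OF cube[of "d x"] B] by (simp add: R_def)
 have ib: "integrable N (%x. B * (sqrt dl * (d x)^2 + d x ^ 4 / sqrt dl))"
  using i2 i4 by simp
 have iR: "integrable N R" by (rule integrable_dominated[OF ib]) (use leR in auto)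
 have F: "F = (%x. R x + w + a * of_real (d x) + b * of_real ((d x)^2))" by (auto simp: R_def)
 have ic: "integrable N (%x. a * complex_of_real (d x))" "integrable N (%x. b * complex_of_real ((d x)^2))"
  by (intro integrable_mult_right integrable_of_real i1 i2)+
 show "integrable N F" unfolding F using iR ic by (intro Bochner_Integration.integrable_add) auto
 have "(LINT x|N. F x) = (LINT x|N. R x) + w + a * of_real (LINT x|N. d x) + b * of_real (LINT x|N. (d x)\<^sup>2)"
  unfolding F using iR ic N.prob_space
  by (simp only: Bochner_Integration.integral_add Bochner_Integration.integrable_add N.integrable_const integral_mult_right_zero integral_complex_of_real lebesgue_integral_const scaleR_one)
 then have "cmod ((LINT x|N. F x) - w - a * of_real (LINT x|N. d x) - b * of_real (LINT x|N. (d x)\<^sup>2)) = cmod (LINT x|N. R x)"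
  by simp
 also have "... <= (LINT x|N. B * (sqrt dl * (d x)^2 + d x ^ 4 / sqrt dl))"
  by (rule order_trans[OF integral_norm_bound integral_mono]) (use iR ib leR in auto)
 also have "... = B * (sqrt dl * (LINT x|N. (d x)\<^sup>2) + (LINT x|N. d x ^ 4) / sqrt dl)"
  using i2 i4 by simp
 finally show "cmod ((LINT x|N. F x) - w - a * of_real (LINT x|N. d x) - b * of_real (LINT x|N. (d x)\<^sup>2))
   <= B * (sqrt dl * (LINT x|N. (d x)\<^sup>2) + (LINT x|N. d x ^ 4) / sqrt dl)" .
qed

context bounded_posterior
begin

definition b :: "real => real => real" where "b s y = drift \<mu> s y"

lemma b_eq: "b s y = (h s y - y) / (1 - s)"
 by (simp add: b_def drift_def h_def)

lemma b_measurable [measurable]: "b s \<in> borel_measurable borel" if "0 <= s" "s < 1"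
 unfolding b_eq using h_measurable[OF that] by measurable

lemma continuous_b: "continuous_on ({0..<1} \<times> UNIV) (%p. b (fst p) (snd p))"
 unfolding b_eq by (intro continuous_intros continuous_h) auto

lemma b_bounds:
 assumes "T < 1"
 obtains L where "0 <= L" "!!s y y'. 0 <= s ==> s <= T ==> \<bar>b s y - b s y'\<bar> <= L * \<bar>y - y'\<bar>"
  "!!s y. 0 <= s ==> s <= T ==> \<bar>b s y\<bar> <= L * (1 + \<bar>y\<bar>)"
proof -
 obtain L where L: "0 <= L" "!!s z z'. 0 <= s ==> s <= T ==> \<bar>h s z - h s z'\<bar> <= L * \<bar>z - z'\<bar>"
  using h_lipschitz[OF assms] by blast
 obtain B where B: "0 <= B" "!!s z. 0 <= s ==> s <= T ==> \<bar>h s z\<bar> <= B * (1 + \<bar>z\<bar>)" using h_growth[OF assms] by blast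
 define Q where "Q = (L + B + 1) / (1 - T)"
 have div: "\<bar>x / (1 - s)\<bar> <= (c / (1 - T))" if "0 <= s" "s <= T" "\<bar>x\<bar> <= c" for x c s
  using that assms by (auto intro!: frac_le)
 show ?thesis
 proof (rule that[of Q])
  show "0 <= Q" using L B assms by (simp add: Q_def)
  fix s assume s: "0 <= s" "s <= T"
  show "\<bar>b s y - b s y'\<bar> <= Q * \<bar>y - y'\<bar>" for y y'
  proof -
   have "\<bar>(h s y - y) - (h s y' - y')\<bar> <= L * \<bar>y - y'\<bar> + \<bar>y - y'\<bar>" using L(2)[OF s, of y y'] by linarith
   also have "... <= (L + B + 1) * \<bar>y - y'\<bar>" using B(1) by (simp add: algebra_simps)
   finally show ?thesis using div[OF s] unfolding b_eq Q_def by (metis diff_divide_distrib times_divide_eq_left)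
  qed
  show "\<bar>b s y\<bar> <= Q * (1 + \<bar>y\<bar>)" for y
  proof -
   have "\<bar>h s y - y\<bar> <= B * (1 + \<bar>y\<bar>) + \<bar>y\<bar>" using B(2)[OF s, of y] by linarith
   also have "... <= (L + B + 1) * (1 + \<bar>y\<bar>)" using L(1) by (simp add: algebra_simps)
   finally show ?thesis using div[OF s] unfolding b_eq Q_def by (metis times_divide_eq_left)
  qed
 qed
qed

text \<open>The bridge part has Gaussian order dl^2; the part from the pinning point carries even
  dl^4.\<close>

lemma K_increment_power4:
 assumes "T < 1"
 obtains C where "0 <= C" "!!s dl y. 0 <= s ==> 0 < dl ==> s + dl <= T ==> (LINT x|K s y (s + dl). (x - y) ^ 4) <= dl\<^sup>2 * C * (1 + y\<^sup>2)^2"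
proof -
 obtain C4 where C4: "0 <= C4" "!!s z. 0 <= s ==> s <= T ==> (LINT u|post s z. (u - z) ^ 4) <= C4 * (1 + z ^ 4)"
  using post_power4_growth[OF assms] by blast
 define q where "q = 1 / (1 - T)"
 have q: "0 < q" using assms by (simp add: q_def)
 define C where "C = 8 * q ^ 4 * C4 + 24"
 have "0 <= C" using C4 q by (simp add: C_def)
 moreover have "(LINT x|K s y (s + dl). (x - y) ^ 4) <= dl\<^sup>2 * C * (1 + y\<^sup>2)^2" if s: "0 <= s" "0 < dl" "s + dl <= T" for s dl y
 proof -
  have y4: "1 + y ^ 4 <= (1 + y^2)\<^sup>2" by (simp add: power2_eq_square power4_eq_xxxx algebra_simps)
  have A1: "1 <= (1 + y^2)\<^sup>2" using power_mono[of 1 "1 + y^2" 2] by simp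
  have dl: "dl <= 1" using s assms by simp
  have "(LINT x|K s y (s + dl). (x - y) ^ 4) <= 8 * ((s + dl - s) / (1 - s)) ^ 4 * (LINT u|post s y. (u - y) ^ 4) + 24 * bridge_sd s (s + dl) ^ 4"
   using s assms by (intro K_power4_le) auto
  also have "... <= 8 * (dl * q) ^ 4 * (C4 * (1 + y\<^sup>2)^2) + 24 * dl^2"
  proof (intro add_mono mult_mono)
   show "((s + dl - s) / (1 - s)) ^ 4 <= (dl * q) ^ 4"
    using s assms by (intro power_mono) (auto simp: q_def intro!: divide_left_mono)
   show "(LINT u|post s y. (u - y) ^ 4) <= C4 * (1 + y\<^sup>2)^2"
    using C4(2)[of s y] s mult_left_mono[OF y4 C4(1)] by simp
   have "dl * (1 - (s + dl)) / (1 - s) <= dl"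
    using s assms by (simp add: divide_le_eq) 
   then have "(bridge_sd s (s + dl))\<^sup>2 <= dl" using s assms by (simp add: bridge_sd_def)
   from power_mono[OF this, of 2] show "bridge_sd s (s + dl) ^ 4 <= dl\<^sup>2" by simp
  qed (use q in auto)
  also have "... <= dl\<^sup>2 * (8 * q ^ 4 * C4) * (1 + y\<^sup>2)^2 + dl^2 * 24 * (1 + y\<^sup>2)^2"
  proof (rule add_mono)
   have "dl ^ 4 <= dl\<^sup>2" using s dl by (intro power_decreasing) auto
   then have "dl ^ 4 * ((8 * q ^ 4 * C4) * (1 + y\<^sup>2)^2) <= dl\<^sup>2 * ((8 * q ^ 4 * C4) * (1 + y\<^sup>2)^2)"
    using C4 q by (intro mult_right_mono) auto
   then show "8 * (dl * q) ^ 4 * (C4 * (1 + y\<^sup>2)^2) <= dl\<^sup>2 * (8 * q ^ 4 * C4) * (1 + y\<^sup>2)^2"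
    by (simp add: power_mult_distrib mult_ac)
   have "24 * dl^2 * 1 <= 24 * dl^2 * (1 + y\<^sup>2)^2" by (rule mult_left_mono[OF A1]) simp
   then show "24 * dl^2 <= dl\<^sup>2 * 24 * (1 + y\<^sup>2)^2" by (simp add: mult_ac)
  qed
  also have "... = dl^2 * C * (1 + y\<^sup>2)^2" by (simp add: C_def algebra_simps)
  finally show ?thesis .
 qed
 ultimately show ?thesis by (rule that)
qed

text \<open>The kernel step reproduces \<open>char_fun\<close> exactly (fact \<open>exact\<close>,
  by Chapman-Kolmogorov). Euler step and kernel step have the same mean increment, and their second
  moments agree up to order dl^2; after a second-order Taylor expansion only terms of order dl *
  sqrt dl survive.\<close>

lemma euler_one_step:
 assumes r: "0 <= r" "r < 1"
 obtains C where "0 <= C"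
  "!!s dl y. 0 <= s ==> 0 < dl ==> s + dl <= r ==>
   cmod ((LINT x|gaussian. char_fun \<theta> r (s + dl) (of_real (y + dl * b s y + sqrt dl * x))) - char_fun \<theta> r s (of_real y)) <= C * (dl * sqrt dl) * (1 + y\<^sup>2)^2"
proof -
 obtain B where B: "0 <= B" "!!s y. 0 <= s ==> s <= r ==> \<exists>a b. cmod a <= B \<and> cmod b <= B \<and>
   (\<forall>d::real. cmod (char_fun \<theta> r s (of_real (y + d)) - char_fun \<theta> r s (of_real y) - a * of_real d - b * of_real (d^2)) <= B * \<bar>d\<bar> ^ 3)"
  using char_fun_taylor[OF r, of \<theta>] by metis
 obtain L where L: "0 <= L" "!!s y. 0 <= s ==> s <= r ==> \<bar>b s y\<bar> <= L * (1 + \<bar>y\<bar>)"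
  using b_bounds[OF r(2)] by metis
 obtain R where R: "0 <= R" "!!s z. 0 <= s ==> s <= r ==> \<rho> s z <= R * (1 + z^2)" using \<rho>_growth[OF r(2)] by blast
 obtain C4 where C4: "0 <= C4" "!!s dl y. 0 <= s ==> 0 < dl ==> s + dl <= r ==> (LINT x|K s y (s + dl). (x - y) ^ 4) <= dl\<^sup>2 * C4 * (1 + y\<^sup>2)^2"
  using K_increment_power4[OF r(2)] by blast
 define q where "q = 1 / (1 - r)"
 have q: "0 < q" using r by (simp add: q_def)
 \<comment> \<open>The summands, in order: mismatch of the second moments, Taylor remainder under
   the Euler step, Taylor remainder under the kernel.\<close>
 define C where "C = B * (2 * L^2 + q^2 * R + q) + B * ((2 * L^2 + 1) + (32 * L ^ 4 + 24)) + B * ((q^2 * R + 1) + C4)"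
 have "0 <= C" unfolding C_def using B L R C4 q by (intro add_nonneg_nonneg mult_nonneg_nonneg) auto
 moreover have "cmod ((LINT x|gaussian. char_fun \<theta> r (s + dl) (of_real (y + dl * b s y + sqrt dl * x))) - char_fun \<theta> r s (of_real y)) <= C * (dl * sqrt dl) * (1 + y\<^sup>2)^2"
  if s: "0 <= s" "0 < dl" "s + dl <= r" for s dl y
 proof -
  let ?w = "%x::real. char_fun \<theta> r (s + dl) (of_real x)"
  let ?A = "1 + y^2"
  have s': "0 <= s" "s < s + dl" "s + dl < 1" "s < 1" "s <= r" using s r by auto
  have dl: "dl <= 1" "0 < sqrt dl" using s r by auto
  have dd: "dl\<^sup>2 <= dl * sqrt dl"
  proof -
   have "dl <= sqrt dl" using s dl by (simp add: real_le_rsqrt power2_eq_square mult_left_le)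
   then show ?thesis using s by (simp add: power2_eq_square mult_left_mono)
  qed
  have A: "1 <= ?A" "?A <= ?A\<^sup>2" using self_le_power[of ?A 2] by auto
  have wm: "(%x. ?w x) \<in> borel_measurable borel"
  proof (rule borel_measurable_continuous_onI)
   have "continuous_on UNIV ((%p. char_fun \<theta> r (fst p) (of_real (snd p))) \<circ> (%x. (s + dl, x)))"
    using s' by (intro continuous_on_compose continuous_intros continuous_on_subset[OF continuous_char_fun[OF r(2)]]) auto
   then show "continuous_on UNIV ?w" by (simp add: comp_def)
  qed
  obtain a c where ac: "cmod a <= B" "cmod c <= B" and T: "!!d::real. cmod (?w (y + d) - ?w y - a * of_real d - c * of_real (d^2)) <= B * \<bar>d\<bar> ^ 3"
   using B(2)[of "s + dl" y] s by auto
  have bL: "\<bar>b s y\<bar> <= L * (1 + \<bar>y\<bar>)" by (rule L(2)) (use s' in auto)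
  have b2: "(b s y)\<^sup>2 <= 2 * L^2 * ?A"
  proof -
   have "(b s y)\<^sup>2 <= (L * (1 + \<bar>y\<bar>))\<^sup>2" using bL L by (intro abs_le_square_iff[THEN iffD1]) simp
   also have "... = L^2 * (1 + \<bar>y\<bar>)^2" by (simp add: power_mult_distrib)
   also have "... <= L\<^sup>2 * (2 * ?A)"
    using zero_le_power2[of "1 - \<bar>y\<bar>"] by (intro mult_left_mono) (simp_all add: power2_eq_square algebra_simps)
   finally show ?thesis by (simp add: algebra_simps)
  qed
  have b4: "b s y ^ 4 <= 4 * L ^ 4 * ?A\<^sup>2"
   using power_mono[OF b2, of 2] by (simp add: power_mult_distrib)
  have \<rho>A: "\<rho> s y <= R * ?A" using R(2)[of s y] s' by simp
  have qs: "1 / (1 - s) <= q" "0 < 1 / (1 - s)" using s' r by (auto simp: q_def intro!: divide_left_mono)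
  have qs2: "(1 / (1 - s))\<^sup>2 <= q\<^sup>2" using qs by (intro power_mono) auto
  interpret G: prob_space gaussian by (rule prob_space_gaussian)
  define d where "d x = dl * b s y + sqrt dl * x" for x
  have ig: "integrable gaussian (%x. x ^ k)" for k by (rule gaussian_moments(1))
  have d4: "d x ^ 4 <= 8 * (dl * b s y) ^ 4 + 8 * dl^2 * x ^ 4" for x
   using power4_add_le[of "dl * b s y" "sqrt dl * x"] s power_mult[of "sqrt dl" 2 2] by (simp add: d_def power_mult_distrib)
  have id4: "integrable gaussian (%x. d x ^ 4)"
   by (rule integrable_dominated[of _ "%x. 8 * (dl * b s y) ^ 4 + 8 * dl^2 * x ^ 4"]) (use ig d4 in \<open>auto simp: d_def\<close>)
  have md: "(LINT x|gaussian. d x) = dl * b s y" unfolding d_def by (rule gaussian_integral_poly)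
  have md2: "(LINT x|gaussian. (d x)\<^sup>2) = dl^2 * (b s y)^2 + dl" unfolding d_def using s by (simp add: gaussian_integral_poly power_mult_distrib)
  have md4: "(LINT x|gaussian. d x ^ 4) <= dl\<^sup>2 * (32 * L ^ 4 + 24) * ?A\<^sup>2"
  proof -
   have "(LINT x|gaussian. d x ^ 4) <= (LINT x|gaussian. 8 * (dl * b s y) ^ 4 + 8 * dl^2 * x ^ 4)"
    by (rule integral_mono) (use ig id4 d4 in auto)
   also have "... = 8 * dl ^ 4 * b s y ^ 4 + 24 * dl^2"
    using ig G.prob_space gaussian_moments(5) by (simp add: power_mult_distrib)
   also have "... <= 8 * dl^2 * (4 * L ^ 4 * ?A\<^sup>2) + 24 * dl^2 * ?A\<^sup>2"
   proof (rule add_mono)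
    have "8 * dl ^ 4 <= 8 * dl^2" using s dl by (simp add: power_decreasing)
    then show "8 * dl ^ 4 * b s y ^ 4 <= 8 * dl^2 * (4 * L ^ 4 * ?A\<^sup>2)" by (rule mult_mono[OF _ b4]) auto
    have "24 * dl^2 * 1 <= 24 * dl^2 * ?A\<^sup>2" using A by (intro mult_left_mono) auto
    then show "24 * dl^2 <= 24 * dl^2 * ?A\<^sup>2" by simp
   qed
   finally show ?thesis by (simp add: algebra_simps)
  qed
  have Tq: "cmod ((LINT x|gaussian. ?w (y + d x)) - ?w y - a * of_real (LINT x|gaussian. d x) - c * of_real (LINT x|gaussian. (d x)\<^sup>2))
   <= B * (sqrt dl * (LINT x|gaussian. (d x)\<^sup>2) + (LINT x|gaussian. d x ^ 4) / sqrt dl)"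
  proof (rule taylor_moments(4)[OF prob_space_gaussian id4])
   show dm: "d \<in> borel_measurable gaussian" unfolding d_def[abs_def] by measurable
   show "(%x. ?w (y + d x)) \<in> borel_measurable gaussian"
    using dm by (intro measurable_compose[OF _ wm] borel_measurable_add) auto
  qed (use s B in \<open>simp_all only: T\<close>)
  have iK4: "integrable (K s y (s + dl)) (%x. (x - y) ^ 4)" by (rule integrable_K_power4) (use s' in auto)
  have TK: "cmod ((LINT x|K s y (s + dl). ?w (y + (x - y))) - ?w y - a * of_real (LINT x|K s y (s + dl). x - y) - c * of_real (LINT x|K s y (s + dl). (x - y)\<^sup>2))
   <= B * (sqrt dl * (LINT x|K s y (s + dl). (x - y)\<^sup>2) + (LINT x|K s y (s + dl). (x - y) ^ 4) / sqrt dl)"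
  proof (rule taylor_moments(4)[OF prob_space_K iK4])
   show "(%x. ?w (y + (x - y))) \<in> borel_measurable (K s y (s + dl))"
    by (intro measurable_compose[OF _ wm]) auto
  qed (use s s' B in \<open>simp_all only: T\<close>, measurable)
  have mK: "(LINT x|K s y (s + dl). x - y) = dl * b s y"
  proof -
   interpret Kp: prob_space "K s y (s + dl)" by (rule prob_space_K) (use s' in auto)
   have "(LINT x|K s y (s + dl). x - y) = (LINT x|K s y (s + dl). x) - y"
    using integrable_K_power(1)[of s "s + dl" y] s' Kp.prob_space by simp
   then show ?thesis using K_mean[of s "s + dl" y] s' by (simp add: b_eq)
  qed
  have mK2: "(LINT x|K s y (s + dl). (x - y)\<^sup>2) = dl^2 * ((1 / (1 - s))\<^sup>2 * \<rho> s y - 1 / (1 - s)) + dl"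
  proof -
   have "dl * (1 - (s + dl)) / (1 - s) = dl - dl\<^sup>2 * (1 / (1 - s))"
    using s' by (simp add: field_simps power2_eq_square)
   then show ?thesis
    using K_second_moment[of s "s + dl" y y] s' by (simp add: power_divide algebra_simps)
  qed
  have mK4: "(LINT x|K s y (s + dl). (x - y) ^ 4) <= dl\<^sup>2 * C4 * ?A\<^sup>2" by (rule C4(2)) (use s in auto)
  have exact: "(LINT x|K s y (s + dl). ?w (y + (x - y))) = char_fun \<theta> r s (of_real y)"
  \<comment> \<open>At the last step no kernel is left to compose with; the transform at time r is
    the exponential itself.\<close>
  proof (cases "s + dl = r")
   case True
   have "(LINT x|K s y (s + dl). ?w (y + (x - y))) = (LINT x|K s y r. exp (\<i> * of_real (\<theta> * x)))"
    unfolding True char_fun_end[OF r] by simp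
   then show ?thesis using char_fun_K[of s r y \<theta>] s' True by simp
  next
   case False
   then have lt: "s + dl < r" using s by simp
   interpret Kp: prob_space "K s y r" by (rule prob_space_K) (use s' lt r in auto)
   have i: "integrable (K s y r) (%x. exp (\<i> * complex_of_real (\<theta> * x)))"
    by (rule Kp.integrable_const_bound[where B = 1]) auto
   have "(LINT x|K s y (s + dl). ?w x) = (LINT x|K s y (s + dl). (LINT x'|K (s + dl) x r. exp (\<i> * of_real (\<theta> * x'))))"
    using s' lt r by (intro Bochner_Integration.integral_cong refl char_fun_K[symmetric]) auto
   also have "... = (LINT x'|K s y r. exp (\<i> * of_real (\<theta> * x')))"
    using s' lt r by (intro integral_K_K(1)[OF _ _ _ _ i]) auto
   also have "... = char_fun \<theta> r s (of_real y)" using s' lt r by (intro char_fun_K) auto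
   finally show ?thesis by simp
  qed
  have rem: "B * (sqrt dl * m2 + m4 / sqrt dl) <= B * (c2 + c4) * (dl * sqrt dl) * ?A\<^sup>2"
   if "m2 <= dl * c2 * ?A" "m4 <= dl\<^sup>2 * c4 * ?A\<^sup>2" "0 <= c2" for m2 m4 c2 c4
  proof -
   have "sqrt dl * m2 <= sqrt dl * (dl * c2 * ?A)" using that dl by (intro mult_left_mono) auto
   also have "... <= sqrt dl * (dl * c2 * ?A\<^sup>2)" using that s dl A by (intro mult_left_mono) auto
   finally have 1: "sqrt dl * m2 <= c2 * (dl * sqrt dl) * ?A\<^sup>2" by (simp add: mult_ac)
   have "m4 / sqrt dl <= dl\<^sup>2 * c4 * ?A\<^sup>2 / sqrt dl" using that dl by (intro divide_right_mono) auto
   also have "... = (dl / sqrt dl) * dl * c4 * ?A\<^sup>2" by (simp add: power2_eq_square)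
   also have "dl / sqrt dl = sqrt dl" using s by (simp add: real_div_sqrt)
   finally have "m4 / sqrt dl <= c4 * (dl * sqrt dl) * ?A\<^sup>2" by (simp add: mult_ac)
   with 1 have "sqrt dl * m2 + m4 / sqrt dl <= (c2 + c4) * (dl * sqrt dl) * ?A\<^sup>2" by (simp add: algebra_simps)
   from mult_left_mono[OF this B(1)] show ?thesis by (simp add: mult_ac)
  qed
  have rq: "B * (sqrt dl * (LINT x|gaussian. (d x)\<^sup>2) + (LINT x|gaussian. d x ^ 4) / sqrt dl) <= B * ((2 * L^2 + 1) + (32 * L ^ 4 + 24)) * (dl * sqrt dl) * ?A\<^sup>2"
  proof (rule rem[OF _ md4])
   have "dl\<^sup>2 * (b s y)^2 + dl <= dl * (2 * L^2 * ?A) + dl * ?A"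
    using b2 A s dl by (intro add_mono mult_mono) (auto simp: power2_eq_square mult_left_le)
   then show "(LINT x|gaussian. (d x)\<^sup>2) <= dl * (2 * L^2 + 1) * ?A" unfolding md2 by (simp add: algebra_simps)
  qed simp
  have rK: "B * (sqrt dl * (LINT x|K s y (s + dl). (x - y)\<^sup>2) + (LINT x|K s y (s + dl). (x - y) ^ 4) / sqrt dl) <= B * ((q^2 * R + 1) + C4) * (dl * sqrt dl) * ?A\<^sup>2"
  proof (rule rem[OF _ mK4])
   have "dl\<^sup>2 * ((1 / (1 - s))\<^sup>2 * \<rho> s y - 1 / (1 - s)) <= dl\<^sup>2 * ((1 / (1 - s))\<^sup>2 * \<rho> s y)"
    using qs by (intro mult_left_mono) auto
   also have "... <= dl * (q^2 * (R * ?A))"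
    using qs2 \<rho>A \<rho>_nonneg s dl by (intro mult_mono) (auto simp: power2_eq_square mult_left_le)
   finally have "dl\<^sup>2 * ((1 / (1 - s))\<^sup>2 * \<rho> s y - 1 / (1 - s)) + dl <= dl * (q^2 * (R * ?A)) + dl * ?A"
    using A s by (intro add_mono) auto
   then show "(LINT x|K s y (s + dl). (x - y)\<^sup>2) <= dl * (q^2 * R + 1) * ?A" unfolding mK2 by (simp add: algebra_simps)
  qed (use R q in auto)
  have md: "cmod (c * of_real ((LINT x|gaussian. (d x)\<^sup>2) - (LINT x|K s y (s + dl). (x - y)\<^sup>2))) <= B * (2 * L^2 + q^2 * R + q) * (dl * sqrt dl) * ?A\<^sup>2"
  proof -
   have eqd: "(LINT x|gaussian. (d x)\<^sup>2) - (LINT x|K s y (s + dl). (x - y)\<^sup>2) = dl^2 * ((b s y)^2 - (1 / (1 - s))\<^sup>2 * \<rho> s y + 1 / (1 - s))"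
    unfolding md2 mK2 by (simp add: algebra_simps)
   have led: "\<bar>(b s y)\<^sup>2 - (1 / (1 - s))\<^sup>2 * \<rho> s y + 1 / (1 - s)\<bar> <= 2 * L^2 * ?A + q^2 * (R * ?A) + q * ?A"
   proof -
    have "(1 / (1 - s))\<^sup>2 * \<rho> s y <= q\<^sup>2 * (R * ?A)" using qs2 \<rho>A \<rho>_nonneg by (intro mult_mono) auto
    moreover have "0 <= (1 / (1 - s))\<^sup>2 * \<rho> s y" using \<rho>_nonneg by simp
    moreover have "1 / (1 - s) <= q * ?A" using qs(1) mult_left_mono[OF A(1) less_imp_le[OF q]] by linarith
    moreover have "0 <= (b s y)\<^sup>2" by simp
    ultimately show ?thesis using b2 qs(2) by linarith
   qed
   have "\<bar>(LINT x|gaussian. (d x)\<^sup>2) - (LINT x|K s y (s + dl). (x - y)\<^sup>2)\<bar> <= dl\<^sup>2 * ((2 * L^2 + q^2 * R + q) * ?A)"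
   proof -
    have c: "(2 * L^2 + q^2 * R + q) * ?A = 2 * L^2 * ?A + q^2 * (R * ?A) + q * ?A" by (simp add: algebra_simps)
    show ?thesis unfolding eqd c abs_mult using led by (intro mult_mono) auto
   qed
   also have "... <= (dl * sqrt dl) * ((2 * L^2 + q^2 * R + q) * ?A\<^sup>2)"
    using dd A q R s dl by (intro mult_mono add_nonneg_nonneg mult_nonneg_nonneg) auto
   finally show ?thesis unfolding norm_mult norm_of_real using ac(2) B(1)
    by (intro order_trans[OF mult_mono[of "cmod c" B]]) (auto simp: mult_ac)
  qed
  have eq: "(LINT x|gaussian. ?w (y + dl * b s y + sqrt dl * x)) - char_fun \<theta> r s (of_real y) =
   ((LINT x|gaussian. ?w (y + d x)) - ?w y - a * of_real (dl * b s y) - c * of_real (LINT x|gaussian. (d x)\<^sup>2))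
   - ((LINT x|K s y (s + dl). ?w (y + (x - y))) - ?w y - a * of_real (dl * b s y) - c * of_real (LINT x|K s y (s + dl). (x - y)\<^sup>2))
   + c * of_real ((LINT x|gaussian. (d x)\<^sup>2) - (LINT x|K s y (s + dl). (x - y)\<^sup>2))"
   unfolding exact by (simp add: d_def algebra_simps)
  have "cmod ((LINT x|gaussian. ?w (y + dl * b s y + sqrt dl * x)) - char_fun \<theta> r s (of_real y))
   <= B * ((2 * L^2 + 1) + (32 * L ^ 4 + 24)) * (dl * sqrt dl) * ?A\<^sup>2
    + B * ((q^2 * R + 1) + C4) * (dl * sqrt dl) * ?A\<^sup>2
    + B * (2 * L^2 + q^2 * R + q) * (dl * sqrt dl) * ?A\<^sup>2"
   unfolding eq
   by (intro norm_triangle_le[OF add_mono[OF norm_triangle_le_diff[OF add_mono] md]])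
    (use order_trans[OF Tq rq] order_trans[OF TK rK] in \<open>simp_all add: \<open>(LINT x|gaussian. d x) = dl * b s y\<close> mK\<close>)
  also have "... = C * (dl * sqrt dl) * ?A\<^sup>2" by (simp add: C_def algebra_simps)
  finally show ?thesis .
 qed
 ultimately show ?thesis by (rule that)
qed

text \<open>The growth factor per step has the form exp (const * dl), so the product over all steps
  stays bounded. The moment is the weight that occurs in \<open>euler_one_step\<close>.\<close>

lemma euler_moment_step:
 assumes L: "0 <= L" "\<bar>\<beta>\<bar> <= L * (1 + \<bar>y\<bar>)" and dl: "0 < dl" "dl <= 1"
 shows "(\<integral>\<^sup>+x. ennreal ((1 + (y + dl * \<beta> + sqrt dl * x)^2)\<^sup>2) \<partial>gaussian) <= ennreal (exp ((5 + 8 * L) * dl) * (1 + y\<^sup>2)^2)"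
proof -
 interpret G: prob_space gaussian by (rule prob_space_gaussian)
 define A where "A = y + dl * \<beta>"
 have ig: "integrable gaussian (%x. x ^ k)" for k by (rule gaussian_moments(1))
 have e: "(1 + (y + dl * \<beta> + sqrt dl * x)^2)\<^sup>2 = (1 + A\<^sup>2)^2 + 4 * A * sqrt dl * (1 + A^2) * x ^ 1 + (2 * dl + 6 * A^2 * dl) * x ^ 2 + 4 * A * sqrt dl * dl * x ^ 3 + dl^2 * x ^ 4" for x
 proof -
  have a: "\<bar>dl\<bar> = dl" and "sqrt dl * sqrt dl = dl" using dl by simp_all
  then have sd: "sqrt dl * (sqrt dl * c) = dl * c" for c by (simp add: mult.assoc[symmetric])
  show ?thesis unfolding A_def[symmetric] 
   by (simp add: power2_eq_square power3_eq_cube power4_eq_xxxx algebra_simps sd a)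
 qed
 have "(\<integral>\<^sup>+x. ennreal ((1 + (y + dl * \<beta> + sqrt dl * x)^2)\<^sup>2) \<partial>gaussian) = ennreal (LINT x|gaussian. (1 + (y + dl * \<beta> + sqrt dl * x)^2)\<^sup>2)"
 proof (rule nn_integral_eq_integral)
  show "integrable gaussian (%x. (1 + (y + dl * \<beta> + sqrt dl * x)^2)\<^sup>2)"
   unfolding e by (intro Bochner_Integration.integrable_add integrable_mult_right ig G.integrable_const)
 qed simp
 also have "(LINT x|gaussian. (1 + (y + dl * \<beta> + sqrt dl * x)^2)\<^sup>2) = (1 + A\<^sup>2)^2 + 2 * dl + 6 * A^2 * dl + 3 * dl^2"
  unfolding e using ig G.prob_space gaussian_moments(2-5) by (simp add: ig[of 1, simplified])
 also have "... <= (1 + A^2)\<^sup>2 * (1 + 5 * dl)"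
 proof -
  have "3 * dl^2 <= 3 * dl" using dl by (simp add: power2_eq_square)
  moreover have "0 <= A\<^sup>2 * dl" "0 <= A ^ 4 * dl" using dl by auto
  moreover have "(1 + A^2)\<^sup>2 * (1 + 5 * dl) = (1 + A\<^sup>2)^2 + 5 * dl + 10 * (A^2 * dl) + 5 * (A ^ 4 * dl)"
   by (simp add: power2_eq_square power4_eq_xxxx algebra_simps)
  ultimately show ?thesis by (simp add: mult_ac)
 qed
 also have "... <= (exp (8 * L * dl) * (1 + y\<^sup>2)^2) * exp (5 * dl)"
 proof (intro mult_mono)
  \<comment> \<open>With sqrt (1 + y^2) read as the Euclidean norm of (1, y), the triangle
    inequality shows that the drift multiplies it by at most 1 + 2 * L * dl.\<close>
  have "\<bar>\<beta>\<bar> <= 2 * L * sqrt (1 + y^2)"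
  proof -
   have "1 + \<bar>y\<bar> <= 2 * sqrt (1 + y^2)"
   proof -
    have "1 <= sqrt (1 + y^2)" by simp
    moreover have "\<bar>y\<bar> <= sqrt (1 + y^2)" using real_sqrt_le_mono[of "y\<^sup>2" "1 + y^2"] by simp
    ultimately show ?thesis by linarith
   qed
   from order_trans[OF L(2) mult_left_mono[OF this L(1)]] show ?thesis by simp
  qed
  then have "\<bar>dl * \<beta>\<bar> <= dl * (2 * L * sqrt (1 + y^2))" using dl by (simp add: abs_mult mult_left_mono)
  moreover have "sqrt (1 + A^2) <= sqrt (1 + y^2) + \<bar>dl * \<beta>\<bar>"
   using real_sqrt_sum_squares_triangle_ineq[of 1 0 y "dl * \<beta>"] by (simp add: A_def)
  ultimately have "sqrt (1 + A^2) <= sqrt (1 + y^2) * (1 + 2 * L * dl)" by (simp add: algebra_simps)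
  also have "... <= sqrt (1 + y^2) * exp (2 * L * dl)"
   using exp_ge_add_one_self[of "2 * L * dl"] by (intro mult_left_mono) auto
  finally have "sqrt (1 + A^2) ^ 4 <= (sqrt (1 + y^2) * exp (2 * L * dl)) ^ 4" by (rule power_mono) simp
  moreover have "sqrt (1 + x^2) ^ 4 = (1 + x\<^sup>2)^2" for x :: real
   using power_mult[of "sqrt (1 + x^2)" 2 2] by simp
  moreover have "exp (2 * L * dl) ^ 4 = exp (8 * L * dl)" by (simp flip: exp_of_nat_mult)
  ultimately show "(1 + A^2)\<^sup>2 <= exp (8 * L * dl) * (1 + y\<^sup>2)^2"
   by (simp add: power_mult_distrib mult.commute)
  show "1 + 5 * dl <= exp (5 * dl)" by (rule exp_ge_add_one_self)
 qed (use dl in auto)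
 also have "... = exp ((5 + 8 * L) * dl) * (1 + y\<^sup>2)^2" by (simp add: distrib_right exp_add)
 finally show ?thesis by (simp add: ennreal_leI)
qed

end

subsection \<open>The Euler scheme and the Markov property\<close>

locale bridge_sde = bounded_posterior +
 fixes M :: "'w measure" and W :: "real => 'w => real" and t z :: real and X :: "real => 'w => real"
 assumes sbm: "standard_brownian_motion M W" and t: "0 <= t" "t < 1" and sol: "bridge_solution \<mu> M W t z X"
begin

sublocale P: prob_space M
 using sbm by (simp add: standard_brownian_motion_def)

lemma W_measurable [measurable]: "0 <= s ==> W s \<in> borel_measurable M"
 using sbm by (simp add: standard_brownian_motion_def)

lemma X_measurable: "t <= s ==> s <= 1 ==> X s \<in> borel_measurable M"
 using sol by (simp add: bridge_solution_def)

lemma X_continuous: "om \<in> space M ==> continuous_on {t..<1} (%s. X s om)"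
 using sol by (simp add: bridge_solution_def)

lemma X_equation: "AE om in M. X t om = z \<and>
    (\<forall>s\<in>{t..<1}. set_integrable lborel {t..s} (%r. b r (X r om)) \<and>
     X s om = z + (LINT r:{t..s}|lborel. b r (X r om)) + (W s om - W t om))"
 using sol by (simp add: bridge_solution_def b_def)

lemma W_indep_increments:
 fixes p :: "nat => real"
 assumes "0 <= p 0" "!!i. i < n ==> p i < p (Suc i)"
 shows "P.indep_vars (%_. borel) (%i om. W (p (Suc i)) om - W (p i) om) {..<n}"
 using sbm assms unfolding standard_brownian_motion_def by blast

lemma W_increment: "0 <= r ==> r < s ==> distributed M lborel (%om. W s om - W r om) (normal_density 0 (sqrt (s - r)))"
 using sbm unfolding standard_brownian_motion_def by blast

lemma X_start: "AE om in M. X t om = z"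
 using X_equation by eventually_elim simp

definition dt :: "real => nat => real" where "dt r N = (r - t) / real N"
definition pt :: "real => nat => nat => real" where "pt r N k = t + real k * dt r N"
definition dW :: "real => nat => 'w => nat => real" where "dW r N om k = W (pt r N (Suc k)) om - W (pt r N k) om"

text \<open>The scheme is a function of the sequence of noise increments rather than of the sample
  point, so measurability and independence become statements about product spaces. Stage k reads
  only the entries below k (\<open>eul_cong\<close>).\<close>

primrec eul :: "real => nat => nat => (nat => real) => real" where
 "eul r N 0 x = z"
| "eul r N (Suc k) x = eul r N k x + dt r N * b (pt r N k) (eul r N k x) + x k"

abbreviation seq_space :: "nat => (nat => real) measure" where
 "seq_space k \<equiv> PiM {..<k} (%_. borel)"

context
 fixes r :: real and N :: nat
 assumes r: "t < r" "r < 1" and N: "0 < N"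
begin

lemma dt_pos: "0 < dt r N" and dt_le: "dt r N <= 1"
proof -
 show "0 < dt r N" using r N by (simp add: dt_def)
 have "r - t <= 1 * real N" using r t N by (simp add: order_trans[of "r - t" 1])
 then show "dt r N <= 1" using N by (simp add: dt_def divide_le_eq)
qed

lemma pt_Suc: "pt r N (Suc k) = pt r N k + dt r N"
 by (simp add: pt_def algebra_simps)

lemma pt_N: "pt r N N = r"
 using N by (simp add: pt_def dt_def)

lemma pt_ge: "t <= pt r N k" and pt_nonneg: "0 <= pt r N k"
 using dt_pos t by (simp_all add: pt_def)

lemma pt_mono: "j <= k ==> pt r N j <= pt r N k"
 using dt_pos by (simp add: pt_def mult_right_mono)

lemma pt_le: "k <= N ==> pt r N k <= r"
 using pt_mono[of k N] pt_N by simp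

lemma pt_less1: "k <= N ==> pt r N k < 1"
 using pt_le[of k] r by simp

lemma eul_measurable: "k <= N ==> k <= n ==> eul r N k \<in> borel_measurable (seq_space n)"
proof (induction k)
 case 0
 have "eul r N 0 = (%_. z)" by auto
 then show ?case by simp
next
 case (Suc k)
 have [measurable]: "eul r N k \<in> borel_measurable (seq_space n)" using Suc by simp
 have [measurable]: "b (pt r N k) \<in> borel_measurable borel"
  using pt_nonneg pt_less1[of k] Suc by (intro b_measurable) auto
 have [measurable]: "(%x. x k) \<in> borel_measurable (seq_space n)"
  using Suc by (intro measurable_component_singleton) auto
 show ?case by simp
qed

lemma eul_cong: "(!!i. i < k ==> x i = y i) ==> eul r N k x = eul r N k y"
 by (induction k) auto

text \<open>The restriction makes the first k increments a point of \<open>seq_space k\<close>, the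
  space on which independence of the next increment is expressed.\<close>

definition \<xi> :: "nat => 'w => nat => real" where "\<xi> k om = restrict (dW r N om) {..<k}"

lemma eul_\<xi>: "j <= k ==> eul r N j (\<xi> k om) = eul r N j (dW r N om)"
 by (rule eul_cong) (simp add: \<xi>_def)

lemma dW_measurable [measurable]: "(%om. dW r N om k) \<in> borel_measurable M"
 unfolding dW_def using pt_nonneg by measurable

lemma \<xi>_measurable [measurable]: "\<xi> k \<in> M \<rightarrow>\<^sub>M seq_space k"
 unfolding \<xi>_def by measurable

text \<open>Independence of Brownian increments in the form of a product law, ready for Fubini to
  integrate out the next increment.\<close>

lemma increment_law:
 "distr M (seq_space k \<Otimes>\<^sub>M borel) (%om. (\<xi> k om, dW r N om k)) =
  distr M (seq_space k) (\<xi> k) \<Otimes>\<^sub>M distr gaussian borel (%x. sqrt (dt r N) * x)"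
proof -
 have "P.indep_vars (%_. borel) (%i om. W (pt r N (Suc i)) om - W (pt r N i) om) {..<Suc k}"
  using pt_nonneg[of 0] dt_pos by (intro W_indep_increments) (auto simp: pt_Suc)
 then have iv: "P.indep_vars (%_. borel) (%i om. dW r N om i) {..<Suc k}" by (simp add: dW_def)
 have "P.indep_var (seq_space k) (%om. restrict (%i. dW r N om i) {..<k}) (PiM {k} (%_. borel)) (%om. restrict (%i. dW r N om i) {k})"
  by (rule P.indep_var_restrict[OF iv]) auto
 then have ind: "distr M (seq_space k) (\<xi> k) \<Otimes>\<^sub>M distr M (PiM {k} (%_. borel)) (%om. restrict (%i. dW r N om i) {k}) =
   distr M (seq_space k \<Otimes>\<^sub>M PiM {k} (%_. borel)) (%om. (\<xi> k om, restrict (%i. dW r N om i) {k}))"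
  unfolding P.indep_var_distribution_eq by (simp add: \<xi>_def[abs_def])
 have mk: "(%x. x k) \<in> PiM {k} (%_. borel :: real measure) \<rightarrow>\<^sub>M borel"
  by (rule measurable_component_singleton) simp
 have mr [measurable]: "(%om. restrict (%i. dW r N om i) {k}) \<in> M \<rightarrow>\<^sub>M PiM {k} (%_. borel)"
  by measurable
 have dk: "distr (distr M (PiM {k} (%_. borel)) (%om. restrict (%i. dW r N om i) {k})) borel (%x. x k) = distr M borel (%om. dW r N om k)"
  by (subst distr_distr[OF mk mr]) (simp add: comp_def)
 interpret D': prob_space "distr M borel (%om. dW r N om k)" by (rule P.prob_space_distr) simp
 have "distr M (seq_space k \<Otimes>\<^sub>M borel) (%om. (\<xi> k om, dW r N om k)) =
  distr (distr M (seq_space k \<Otimes>\<^sub>M PiM {k} (%_. borel)) (%om. (\<xi> k om, restrict (%i. dW r N om i) {k}))) (seq_space k \<Otimes>\<^sub>M borel) (%(x, y). (x, y k))"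
 proof (subst distr_distr)
  show "(%(x, y). (x, y k)) \<in> seq_space k \<Otimes>\<^sub>M PiM {k} (%_. borel :: real measure) \<rightarrow>\<^sub>M seq_space k \<Otimes>\<^sub>M borel"
   using measurable_compose[OF measurable_snd mk] by measurable
 qed (simp_all add: comp_def)
 also have "... = distr (distr M (seq_space k) (\<xi> k)) (seq_space k) (%x. x) \<Otimes>\<^sub>M distr (distr M (PiM {k} (%_. borel)) (%om. restrict (%i. dW r N om i) {k})) borel (%x. x k)"
  unfolding ind[symmetric] using D'.sigma_finite_measure_axioms mk
  by (intro pair_measure_distr[symmetric]) (simp_all add: dk)
 also have "... = distr M (seq_space k) (\<xi> k) \<Otimes>\<^sub>M distr M borel (%om. dW r N om k)"
  unfolding dk by (subst distr_distr) (simp_all add: comp_def)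
 finally have "distr M (seq_space k) (\<xi> k) \<Otimes>\<^sub>M distr M borel (%om. dW r N om k) = distr M (seq_space k \<Otimes>\<^sub>M borel) (%om. (\<xi> k om, dW r N om k))"
  by simp
 moreover have "distr M borel (%om. dW r N om k) = distr gaussian borel (%x. sqrt (dt r N) * x)"
 proof -
  have "distributed M lborel (%om. W (pt r N (Suc k)) om - W (pt r N k) om) (normal_density 0 (sqrt (pt r N (Suc k) - pt r N k)))"
   using pt_nonneg[of k] dt_pos by (intro W_increment) (auto simp: pt_Suc)
  then have "distr M lborel (%om. dW r N om k) = density lborel (%x. ennreal (normal_density 0 (sqrt (dt r N)) x))"
   by (simp add: distributed_def pt_Suc dW_def)
  moreover have "density lborel (%x. ennreal (normal_density 0 (sqrt (dt r N)) x)) = distr gaussian borel (%x. sqrt (dt r N) * x)"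
  proof (rule measure_eqI)
   fix A assume "A \<in> sets (density lborel (%x. ennreal (normal_density 0 (sqrt (dt r N)) x)))"
   then have [measurable]: "A \<in> sets borel" by simp
   have "emeasure (density lborel (%x. ennreal (normal_density 0 (sqrt (dt r N)) x))) A = (\<integral>\<^sup>+x. indicator A x * ennreal (normal_density 0 (sqrt (dt r N)) x) \<partial>lborel)"
    by (simp add: emeasure_density mult.commute)
   also have "... = (\<integral>\<^sup>+x. indicator A (0 + sqrt (dt r N) * x) \<partial>gaussian)"
    using dt_pos by (intro nn_integral_normal_density_affine) auto
   also have "... = (\<integral>\<^sup>+x. indicator A x \<partial>distr gaussian borel (%x. sqrt (dt r N) * x))"
    by (subst nn_integral_distr) auto
   finally show "emeasure (density lborel (%x. ennreal (normal_density 0 (sqrt (dt r N)) x))) A = emeasure (distr gaussian borel (%x. sqrt (dt r N) * x)) A"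
    by simp
  qed simp
  moreover have "distr M borel (%om. dW r N om k) = distr M lborel (%om. dW r N om k)"
   by (rule distr_cong) auto
  ultimately show ?thesis by simp
 qed
 ultimately show ?thesis by simp
qed

lemma nn_integral_step:
 assumes F [measurable]: "F \<in> borel_measurable (seq_space k \<Otimes>\<^sub>M borel)"
 shows "(\<integral>\<^sup>+om. F (\<xi> k om, dW r N om k) \<partial>M) = (\<integral>\<^sup>+om. (\<integral>\<^sup>+x. F (\<xi> k om, sqrt (dt r N) * x) \<partial>gaussian) \<partial>M)"
proof -
 interpret G: prob_space gaussian by (rule prob_space_gaussian)
 interpret G': prob_space "distr gaussian borel (%x. sqrt (dt r N) * x)" by (rule G.prob_space_distr) simp
 have s: "sets (distr M (seq_space k) (\<xi> k) \<Otimes>\<^sub>M distr gaussian borel (%x. sqrt (dt r N) * x)) = sets (seq_space k \<Otimes>\<^sub>M borel)"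
  by (intro sets_pair_measure_cong) auto
 have F': "F \<in> borel_measurable (distr M (seq_space k) (\<xi> k) \<Otimes>\<^sub>M distr gaussian borel (%x. sqrt (dt r N) * x))"
  unfolding measurable_cong_sets[OF s refl] by fact
 have Fx [measurable]: "(%x. F (y, x)) \<in> borel_measurable borel" if "y \<in> space (seq_space k)" for y
  using that by measurable
 have mm: "(%y. \<integral>\<^sup>+x. F (y, sqrt (dt r N) * x) \<partial>gaussian) \<in> borel_measurable (seq_space k)"
 proof (rule G.borel_measurable_nn_integral)
  have "sets (seq_space k \<Otimes>\<^sub>M gaussian) = sets (seq_space k \<Otimes>\<^sub>M borel)" by (intro sets_pair_measure_cong) auto
  then show "(%(y, x). F (y, sqrt (dt r N) * x)) \<in> borel_measurable (seq_space k \<Otimes>\<^sub>M gaussian)"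
   by (simp cong: measurable_cong_sets)
 qed
 have "(\<integral>\<^sup>+om. F (\<xi> k om, dW r N om k) \<partial>M) = (\<integral>\<^sup>+p. F p \<partial>distr M (seq_space k \<Otimes>\<^sub>M borel) (%om. (\<xi> k om, dW r N om k)))"
  by (subst nn_integral_distr) auto
 also have "... = (\<integral>\<^sup>+y. (\<integral>\<^sup>+x. F (y, x) \<partial>distr gaussian borel (%x. sqrt (dt r N) * x)) \<partial>distr M (seq_space k) (\<xi> k))"
  unfolding increment_law by (rule G'.nn_integral_fst[OF F', symmetric])
 also have "... = (\<integral>\<^sup>+y. (\<integral>\<^sup>+x. F (y, sqrt (dt r N) * x) \<partial>gaussian) \<partial>distr M (seq_space k) (\<xi> k))"
 proof (intro nn_integral_cong)
  fix y assume "y \<in> space (distr M (seq_space k) (\<xi> k))"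
  then have "(%x. F (y, x)) \<in> borel_measurable borel" by (intro Fx) simp
  then show "(\<integral>\<^sup>+x. F (y, x) \<partial>distr gaussian borel (%x. sqrt (dt r N) * x)) = (\<integral>\<^sup>+x. F (y, sqrt (dt r N) * x) \<partial>gaussian)"
   by (intro nn_integral_distr) auto
 qed
 also have "... = (\<integral>\<^sup>+om. (\<integral>\<^sup>+x. F (\<xi> k om, sqrt (dt r N) * x) \<partial>gaussian) \<partial>M)"
  using mm by (subst nn_integral_distr) auto
 finally show ?thesis .
qed

lemma integral_step:
 fixes F :: "(nat => real) \<times> real => complex"
 assumes F [measurable]: "F \<in> borel_measurable (seq_space k \<Otimes>\<^sub>M borel)" and bd: "!!p. cmod (F p) <= C"
 shows "(LINT om|M. F (\<xi> k om, dW r N om k)) = (LINT om|M. (LINT x|gaussian. F (\<xi> k om, sqrt (dt r N) * x)))"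
  and "(%om. (LINT x|gaussian. F (\<xi> k om, sqrt (dt r N) * x))) \<in> borel_measurable M"
proof -
 interpret G: prob_space gaussian by (rule prob_space_gaussian)
 interpret G': prob_space "distr gaussian borel (%x. sqrt (dt r N) * x)" by (rule G.prob_space_distr) simp
 interpret X': prob_space "distr M (seq_space k) (\<xi> k)" by (rule P.prob_space_distr) simp
 interpret PG: pair_prob_space "distr M (seq_space k) (\<xi> k)" "distr gaussian borel (%x. sqrt (dt r N) * x)" ..
 have s: "sets (distr M (seq_space k) (\<xi> k) \<Otimes>\<^sub>M distr gaussian borel (%x. sqrt (dt r N) * x)) = sets (seq_space k \<Otimes>\<^sub>M borel)"
  by (intro sets_pair_measure_cong) auto
 have F': "F \<in> borel_measurable (distr M (seq_space k) (\<xi> k) \<Otimes>\<^sub>M distr gaussian borel (%x. sqrt (dt r N) * x))"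
  unfolding measurable_cong_sets[OF s refl] by fact
 have iF: "integrable (distr M (seq_space k) (\<xi> k) \<Otimes>\<^sub>M distr gaussian borel (%x. sqrt (dt r N) * x)) F"
  by (rule PG.P.integrable_const_bound[where B = C]) (use F' bd in auto)
 have Fx [measurable]: "(%x. F (y, x)) \<in> borel_measurable borel" if "y \<in> space (seq_space k)" for y
  using that by measurable
 have mm: "(%y. \<integral>x. F (y, sqrt (dt r N) * x) \<partial>gaussian) \<in> borel_measurable (seq_space k)"
 proof (rule G.borel_measurable_lebesgue_integral)
  have "sets (seq_space k \<Otimes>\<^sub>M gaussian) = sets (seq_space k \<Otimes>\<^sub>M borel)" by (intro sets_pair_measure_cong) auto
  then show "(%(y, x). F (y, sqrt (dt r N) * x)) \<in> borel_measurable (seq_space k \<Otimes>\<^sub>M gaussian)"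
   by (simp cong: measurable_cong_sets)
 qed
 show "(%om. (LINT x|gaussian. F (\<xi> k om, sqrt (dt r N) * x))) \<in> borel_measurable M"
  by (rule measurable_compose[OF \<xi>_measurable mm])
 have "(LINT om|M. F (\<xi> k om, dW r N om k)) = (LINT p|distr M (seq_space k \<Otimes>\<^sub>M borel) (%om. (\<xi> k om, dW r N om k)). F p)"
  by (subst integral_distr) auto
 also have "... = (LINT y|distr M (seq_space k) (\<xi> k). (LINT x|distr gaussian borel (%x. sqrt (dt r N) * x). F (y, x)))"
  unfolding increment_law by (rule PG.integral_fst'[OF iF, symmetric])
 also have "... = (LINT y|distr M (seq_space k) (\<xi> k). (LINT x|gaussian. F (y, sqrt (dt r N) * x)))"
 proof (rule Bochner_Integration.integral_cong[OF refl])
  fix y assume "y \<in> space (distr M (seq_space k) (\<xi> k))"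
  then have "(%x. F (y, x)) \<in> borel_measurable borel" by (intro Fx) simp
  then show "(LINT x|distr gaussian borel (%x. sqrt (dt r N) * x). F (y, x)) = (LINT x|gaussian. F (y, sqrt (dt r N) * x))"
   by (intro integral_distr) auto
 qed
 also have "... = (LINT om|M. (LINT x|gaussian. F (\<xi> k om, sqrt (dt r N) * x)))"
  using mm by (subst integral_distr) auto
 finally show "(LINT om|M. F (\<xi> k om, dW r N om k)) = (LINT om|M. (LINT x|gaussian. F (\<xi> k om, sqrt (dt r N) * x)))" .
qed

lemma eul_dW_measurable: "k <= N ==> (%om. eul r N k (dW r N om)) \<in> borel_measurable M"
 using measurable_compose[OF \<xi>_measurable eul_measurable[of k k]] eul_\<xi>[of k k] by simp

lemma euler_moment:
 assumes L: "0 <= L" "!!s y. 0 <= s ==> s <= r ==> \<bar>b s y\<bar> <= L * (1 + \<bar>y\<bar>)"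
 shows "k <= N ==> (\<integral>\<^sup>+om. ennreal ((1 + (eul r N k (dW r N om))\<^sup>2)\<^sup>2) \<partial>M) <= ennreal (exp ((5 + 8 * L) * (real k * dt r N)) * (1 + z\<^sup>2)^2)"
proof (induction k)
 case 0 then show ?case using P.emeasure_space_1 by simp
next
 case (Suc k)
 let ?c = "exp ((5 + 8 * L) * dt r N)"
 have k: "k < N" using Suc by simp
 have [measurable]: "eul r N k \<in> borel_measurable (seq_space k)" using k by (intro eul_measurable) auto
 have [measurable]: "b (pt r N k) \<in> borel_measurable borel"
  using pt_nonneg pt_less1[of k] k by (intro b_measurable) auto
 define F where "F = (%(x, v). ennreal ((1 + (eul r N k x + dt r N * b (pt r N k) (eul r N k x) + v)\<^sup>2)\<^sup>2))"
 have [measurable]: "F \<in> borel_measurable (seq_space k \<Otimes>\<^sub>M borel)" unfolding F_def by measurable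
 have "(\<integral>\<^sup>+om. ennreal ((1 + (eul r N (Suc k) (dW r N om))\<^sup>2)\<^sup>2) \<partial>M) = (\<integral>\<^sup>+om. F (\<xi> k om, dW r N om k) \<partial>M)"
  by (simp add: F_def eul_\<xi>)
 also have "... = (\<integral>\<^sup>+om. (\<integral>\<^sup>+x. F (\<xi> k om, sqrt (dt r N) * x) \<partial>gaussian) \<partial>M)"
  by (rule nn_integral_step) measurable
 also have "... <= (\<integral>\<^sup>+om. ennreal (?c * (1 + (eul r N k (dW r N om))\<^sup>2)\<^sup>2) \<partial>M)"
  unfolding F_def prod.case eul_\<xi>[OF order_refl] using L pt_nonneg pt_le[of k] k dt_pos dt_le
  by (intro nn_integral_mono euler_moment_step) auto
 also have "... = ennreal ?c * (\<integral>\<^sup>+om. ennreal ((1 + (eul r N k (dW r N om))\<^sup>2)\<^sup>2) \<partial>M)"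
  using eul_dW_measurable[of k] k by (simp add: ennreal_mult' nn_integral_cmult)
 also have "... <= ennreal ?c * ennreal (exp ((5 + 8 * L) * (real k * dt r N)) * (1 + z\<^sup>2)^2)"
  using Suc by (intro mult_left_mono) auto
 also have "... = ennreal (exp ((5 + 8 * L) * (real (Suc k) * dt r N)) * (1 + z\<^sup>2)^2)"
 proof -
  have "(5 + 8 * L) * (real (Suc k) * dt r N) = (5 + 8 * L) * dt r N + (5 + 8 * L) * (real k * dt r N)"
   by (simp add: algebra_simps)
  then have "?c * (exp ((5 + 8 * L) * (real k * dt r N)) * (1 + z\<^sup>2)^2) = exp ((5 + 8 * L) * (real (Suc k) * dt r N)) * (1 + z\<^sup>2)^2"
   by (simp only: exp_add mult.assoc)
  then show ?thesis by (subst ennreal_mult'[symmetric]) auto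
 qed
 finally show ?case .
qed

text \<open>An arbitrary bounded function \<open>G\<close> of the first k increments plays the role
  of conditioning. Integrating out the next increment leaves the one-step error of
  \<open>euler_one_step\<close>, weighted by a moment that \<open>euler_moment\<close>
  bounds.\<close>

lemma euler_weak_step:
 fixes G :: "(nat => real) => real"
 assumes L: "0 <= L" "!!s y. 0 <= s ==> s <= r ==> \<bar>b s y\<bar> <= L * (1 + \<bar>y\<bar>)"
  and C: "0 <= C" "!!s dl y. 0 <= s ==> 0 < dl ==> s + dl <= r ==>
   cmod ((LINT x|gaussian. char_fun \<theta> r (s + dl) (of_real (y + dl * b s y + sqrt dl * x))) - char_fun \<theta> r s (of_real y)) <= C * (dl * sqrt dl) * (1 + y\<^sup>2)^2"
  and B: "!!s y. 0 <= s ==> s <= r ==> cmod (char_fun \<theta> r s (of_real y)) <= B"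
  and G: "G \<in> borel_measurable (seq_space k)" "!!x. G (restrict x {..<k}) = G x" "!!x. \<bar>G x\<bar> <= 1" and k: "k < N"
 shows "cmod (LINT om|M. of_real (G (dW r N om)) * (char_fun \<theta> r (pt r N (Suc k)) (of_real (eul r N (Suc k) (dW r N om)))
   - char_fun \<theta> r (pt r N k) (of_real (eul r N k (dW r N om))))) <= C * (dt r N * sqrt (dt r N)) * (exp (5 + 8 * L) * (1 + z\<^sup>2)^2)"
proof -
 interpret Ga: prob_space gaussian by (rule prob_space_gaussian)
 let ?w = "%k y. char_fun \<theta> r (pt r N k) (of_real y)"
 let ?Y = "%om. eul r N k (dW r N om)"
 let ?d = "dt r N"
 have [measurable]: "G \<in> borel_measurable (seq_space k)" by fact
 have wm: "?w j \<in> borel_measurable borel" if "j <= N" for j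
 proof (rule borel_measurable_continuous_onI)
  have "continuous_on UNIV ((%p. char_fun \<theta> r (fst p) (of_real (snd p))) \<circ> (%x. (pt r N j, x)))"
   using that pt_nonneg pt_less1[OF that] r by (intro continuous_on_compose continuous_intros continuous_on_subset[OF continuous_char_fun]) auto
  then show "continuous_on UNIV (?w j)" by (simp add: comp_def)
 qed
 have [measurable]: "?w k \<in> borel_measurable borel" "?w (Suc k) \<in> borel_measurable borel" using wm k by auto
 have [measurable]: "eul r N k \<in> borel_measurable (seq_space k)" using k by (intro eul_measurable) auto
 have [measurable]: "b (pt r N k) \<in> borel_measurable borel"
  using pt_nonneg pt_less1[of k] k by (intro b_measurable) auto
 have Ym [measurable]: "?Y \<in> borel_measurable M" using k by (intro eul_dW_measurable) auto
 have wB: "cmod (?w j y) <= B" if "j <= N" for j y using B[of "pt r N j" y] pt_nonneg pt_le[OF that] by simp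
 define F where "F = (%(x, v). complex_of_real (G x) * (?w (Suc k) (eul r N k x + ?d * b (pt r N k) (eul r N k x) + v) - ?w k (eul r N k x)))"
 have [measurable]: "F \<in> borel_measurable (seq_space k \<Otimes>\<^sub>M borel)" unfolding F_def by measurable
 have Fbd: "cmod (F p) <= 1 * (B + B)" for p
  unfolding F_def split_beta norm_mult norm_of_real using k
  by (intro mult_mono G(3) order_trans[OF norm_triangle_ineq4 add_mono] wB) auto
 have "(LINT om|M. of_real (G (dW r N om)) * (?w (Suc k) (eul r N (Suc k) (dW r N om)) - ?w k (?Y om))) = (LINT om|M. F (\<xi> k om, dW r N om k))"
  unfolding F_def prod.case eul_\<xi>[OF order_refl] eul.simps by (simp add: \<xi>_def G(2))
 also have "... = (LINT om|M. (LINT x|gaussian. F (\<xi> k om, sqrt ?d * x)))"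
  by (rule integral_step(1)[OF _ Fbd]) measurable
 finally have eq: "(LINT om|M. of_real (G (dW r N om)) * (?w (Suc k) (eul r N (Suc k) (dW r N om)) - ?w k (?Y om))) = (LINT om|M. (LINT x|gaussian. F (\<xi> k om, sqrt ?d * x)))" .
 have inner: "cmod (LINT x|gaussian. F (\<xi> k om, sqrt ?d * x)) <= C * (?d * sqrt ?d) * (1 + (?Y om)^2)\<^sup>2" for om
 proof -
  have i: "integrable gaussian (%x. ?w (Suc k) (?Y om + ?d * b (pt r N k) (?Y om) + sqrt ?d * x))"
  proof (rule Ga.integrable_const_bound[where B = B])
   show "AE x in gaussian. norm (?w (Suc k) (?Y om + ?d * b (pt r N k) (?Y om) + sqrt ?d * x)) <= B"
    using k by (intro AE_I2 wB) auto
   show "(%x. ?w (Suc k) (?Y om + ?d * b (pt r N k) (?Y om) + sqrt ?d * x)) \<in> borel_measurable gaussian"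
    using k by (intro measurable_compose[OF _ wm]) auto
  qed
  have "(LINT x|gaussian. F (\<xi> k om, sqrt ?d * x)) = of_real (G (\<xi> k om)) * ((LINT x|gaussian. ?w (Suc k) (?Y om + ?d * b (pt r N k) (?Y om) + sqrt ?d * x)) - ?w k (?Y om))"
   unfolding F_def prod.case eul_\<xi>[OF order_refl] using i Ga.prob_space
   by (simp only: integral_mult_right_zero Bochner_Integration.integral_diff Ga.integrable_const lebesgue_integral_const scaleR_one)
  then have "cmod (LINT x|gaussian. F (\<xi> k om, sqrt ?d * x)) = \<bar>G (\<xi> k om)\<bar> * cmod ((LINT x|gaussian. ?w (Suc k) (?Y om + ?d * b (pt r N k) (?Y om) + sqrt ?d * x)) - ?w k (?Y om))"
   by (simp only: norm_mult norm_of_real)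
  also have "... <= 1 * (C * (?d * sqrt ?d) * (1 + (?Y om)^2)\<^sup>2)"
   unfolding pt_Suc using pt_nonneg[of k] dt_pos pt_le[of "Suc k"] k by (intro mult_mono G C(2)) (auto simp: pt_Suc)
  finally show ?thesis by simp
 qed
 have mom: "(\<integral>\<^sup>+om. ennreal ((1 + (?Y om)^2)\<^sup>2) \<partial>M) <= ennreal (exp (5 + 8 * L) * (1 + z\<^sup>2)^2)"
 proof (rule order_trans[OF euler_moment[OF L]])
  have "real k * ?d <= 1"
   using pt_less1[of k] t k by (simp add: pt_def)
  then have "(5 + 8 * L) * (real k * ?d) <= (5 + 8 * L) * 1" using L by (intro mult_left_mono) auto
  then show "ennreal (exp ((5 + 8 * L) * (real k * ?d)) * (1 + z\<^sup>2)^2) <= ennreal (exp (5 + 8 * L) * (1 + z\<^sup>2)^2)"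
   by (intro ennreal_leI mult_right_mono) auto
 qed (use k in auto)
 have iY: "integrable M (%om. (1 + (?Y om)^2)\<^sup>2)"
  by (rule integrableI_bounded) (use mom in \<open>auto intro: le_less_trans\<close>)
 have EY: "(LINT om|M. (1 + (?Y om)^2)\<^sup>2) <= exp (5 + 8 * L) * (1 + z\<^sup>2)^2"
  using mom by (subst (asm) nn_integral_eq_integral[OF iY]) auto
 have "cmod (LINT om|M. (LINT x|gaussian. F (\<xi> k om, sqrt ?d * x))) <= (LINT om|M. cmod (LINT x|gaussian. F (\<xi> k om, sqrt ?d * x)))"
  by (rule integral_norm_bound)
 also have "... <= (LINT om|M. C * (?d * sqrt ?d) * (1 + (?Y om)^2)\<^sup>2)"
  by (rule integral_mono') (use iY inner C dt_pos in auto)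
 also have "... = C * (?d * sqrt ?d) * (LINT om|M. (1 + (?Y om)^2)\<^sup>2)" by simp
 also have "... <= C * (?d * sqrt ?d) * (exp (5 + 8 * L) * (1 + z\<^sup>2)^2)"
  using EY C dt_pos by (intro mult_left_mono) auto
 finally show ?thesis unfolding eq .
qed

end
end

section \<open>Pathwise convergence of the scheme and passage to the limit\<close>

context bridge_sde
begin

text \<open>The noise is additive and sampled exactly, so the scheme errs only by freezing the drift
  on each cell. The modulus of continuity of the drift along the path and a discrete Gronwall
  argument give uniform convergence on every path that satisfies the equation.\<close>

lemma euler_pathwise:
 assumes r: "t < r" "r < 1" and om: "om \<in> space M" "X t om = z"
  and eq: "!!s. t <= s ==> s < 1 ==> set_integrable lborel {t..s} (%r. b r (X r om)) \<and>
     X s om = z + (LINT r:{t..s}|lborel. b r (X r om)) + (W s om - W t om)"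
  and e: "0 < e"
 shows "\<exists>N0. \<forall>N\<ge>N0. 0 < N --> (\<forall>k\<le>N. \<bar>X (pt r N k) om - eul r N k (dW r N om)\<bar> <= e)"
proof -
 define c where "c q = b q (X q om)" for q
 have cont: "continuous_on {t..<1} c"
 proof -
  have "continuous_on {t..<1} ((%p. b (fst p) (snd p)) \<circ> (%q. (q, X q om)))"
   using t by (intro continuous_on_compose continuous_intros X_continuous[OF om(1)] continuous_on_subset[OF continuous_b]) auto
  then show ?thesis by (simp add: c_def comp_def)
 qed
 obtain L where L: "0 <= L" "!!s y y'. 0 <= s ==> s <= r ==> \<bar>b s y - b s y'\<bar> <= L * \<bar>y - y'\<bar>"
  using b_bounds[OF r(2)] by metis
 \<comment> \<open>Absorbs the Gronwall factor, the elapsed time being at most 1.\<close>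
 define eps where "eps = e / exp L"
 have eps: "0 < eps" using e by (simp add: eps_def)
 have contr: "continuous_on {t..r} c" by (rule continuous_on_subset[OF cont]) (use r in auto)
 obtain d where d: "0 < d" "!!q q'. q \<in> {t..r} ==> q' \<in> {t..r} ==> dist q' q < d ==> dist (c q') (c q) < eps"
  using compact_uniformly_continuous[OF contr compact_Icc] eps unfolding uniformly_continuous_on_def by metis
 obtain N0 where N0: "1 / d < real N0" using reals_Archimedean2 by blast
 have main: "\<bar>X (pt r N k) om - eul r N k (dW r N om)\<bar> <= eps * (real k * dt r N) * exp (L * (real k * dt r N))"
  if N: "N0 <= N" "0 < N" and k: "k <= N" for N k
  using k
 proof (induction k)
  case 0
  then show ?case using om by (simp add: pt_def)
 next
  case (Suc k)
  note facts = r(1) r(2) N(2)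
  let ?p = "pt r N k" and ?q = "pt r N (Suc k)" and ?d = "dt r N" and ?Y = "eul r N k (dW r N om)"
  have dp: "0 < ?d" by (rule dt_pos[OF facts])
  have pq: "t <= ?p" "?p <= ?q" "?q <= r" "?q = ?p + ?d" "0 <= ?p" "?p <= r"
   using pt_ge[OF facts] pt_mono[OF facts, of k "Suc k"] pt_le[OF facts, of "Suc k"] pt_Suc[OF facts] pt_nonneg[OF facts] pt_le[OF facts, of k] Suc by auto
  have dd: "?d < d"
  proof -
   have "real N0 <= real N" using N by simp
   then have "1 / d < real N" using N0 by linarith
   then have "1 < real N * d" by (rule pos_divide_less_eq[OF d(1), THEN iffD1])
   moreover have "r - t <= 1" using r t by simp
   ultimately show ?thesis using N(2) by (simp add: dt_def divide_less_eq mult.commute)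
  qed
  have int: "(LINT r:{t..s}|lborel. b r (X r om)) = integral {t..s} c" if "t <= s" "s < 1" for s
   using set_borel_integral_eq_integral(2) eq[OF that] by (auto simp: c_def[abs_def])
  have ci: "c integrable_on {t..?q}"
   by (intro integrable_continuous_interval continuous_on_subset[OF cont]) (use pq r in auto)
  have "integral {t..?p} c + integral {?p..?q} c = integral {t..?q} c"
   by (rule Henstock_Kurzweil_Integration.integral_combine) (use pq ci in auto)
  then have Xq: "X ?q om = X ?p om + integral {?p..?q} c + dW r N om k"
   using eq[of ?p] eq[of ?q] int[of ?p] int[of ?q] pq r by (simp add: dW_def)
  have contpq: "continuous_on {?p..?q} c" by (rule continuous_on_subset[OF cont]) (use pq r in auto)
  have "norm (integral {?p..?q} (%q. c q - c ?p)) <= eps * (?q - ?p)"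
  proof (rule integral_bound)
   show "norm (c q - c ?p) <= eps" if "q \<in> {?p..?q}" for q
    using d(2)[of ?p q] that pq dd by (auto simp: dist_real_def)
   show "continuous_on {?p..?q} (%q. c q - c ?p)" by (intro continuous_intros contpq)
  qed (rule pq)
  moreover have "integral {?p..?q} (%q. c q - c ?p) = integral {?p..?q} c - ?d * c ?p"
   using contpq pq by (subst Henstock_Kurzweil_Integration.integral_diff) (auto intro: integrable_continuous_interval)
  ultimately have 1: "\<bar>integral {?p..?q} c - ?d * c ?p\<bar> <= eps * ?d" using pq by simp
  have "\<bar>c ?p - b ?p ?Y\<bar> <= L * \<bar>X ?p om - ?Y\<bar>" unfolding c_def using pq by (intro L(2)) auto
  then have "\<bar>?d * (c ?p - b ?p ?Y)\<bar> <= ?d * (L * \<bar>X ?p om - ?Y\<bar>)"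
   using dp by (simp only: abs_mult abs_of_pos mult_le_cancel_left_pos)
  moreover have "X ?q om - eul r N (Suc k) (dW r N om) = (X ?p om - ?Y) + (integral {?p..?q} c - ?d * c ?p) + ?d * (c ?p - b ?p ?Y)"
   unfolding Xq by (simp add: algebra_simps)
  ultimately have "\<bar>X ?q om - eul r N (Suc k) (dW r N om)\<bar> <= (1 + L * ?d) * \<bar>X ?p om - ?Y\<bar> + eps * ?d"
   using 1 by (simp add: algebra_simps)
  also have "... <= exp (L * ?d) * (eps * (real k * ?d) * exp (L * (real k * ?d))) + eps * ?d * exp (L * (real (Suc k) * ?d))"
  proof (rule add_mono)
   show "(1 + L * ?d) * \<bar>X ?p om - ?Y\<bar> <= exp (L * ?d) * (eps * (real k * ?d) * exp (L * (real k * ?d)))"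
    using Suc by (intro mult_mono exp_ge_add_one_self) auto
   have "eps * ?d * 1 <= eps * ?d * exp (L * (real (Suc k) * ?d))"
    using eps dp L by (intro mult_left_mono) auto
   then show "eps * ?d <= eps * ?d * exp (L * (real (Suc k) * ?d))" by simp
  qed
  also have "... = eps * (real (Suc k) * ?d) * exp (L * (real (Suc k) * ?d))"
  proof -
   have "exp (L * (real (Suc k) * ?d)) = exp (L * ?d) * exp (L * (real k * ?d))"
    by (simp add: exp_add[symmetric] algebra_simps)
   then show ?thesis by (simp add: algebra_simps)
  qed
  finally show ?case .
 qed
 have "\<bar>X (pt r N k) om - eul r N k (dW r N om)\<bar> <= e" if N: "N0 <= N" "0 < N" and k: "k <= N" for N k
 proof -
  have "real k * dt r N <= 1" "0 <= real k * dt r N"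
   using pt_less1[OF r N(2) k] t dt_pos[OF r N(2)] by (auto simp: pt_def)
  then have "eps * (real k * dt r N) * exp (L * (real k * dt r N)) <= eps * 1 * exp (L * 1)"
   using eps L by (intro mult_mono exp_le_cancel_iff[THEN iffD2]) auto
  also have "... = e" by (simp add: eps_def)
  finally show ?thesis using main[OF N k] by simp
 qed
 then show ?thesis by blast
qed

definition idx :: "real => nat => real => nat" where "idx r N q = nat \<lfloor>(q - t) / dt r N\<rfloor>"

lemma idx_bounds:
 assumes "t < r" "r < 1" "0 < N" "t <= q"
 shows "pt r N (idx r N q) <= q" "q < pt r N (idx r N q) + dt r N"
  and "q <= r ==> idx r N q <= N" and "q <= q' ==> idx r N q <= idx r N q'"
proof -
 note d = dt_pos[OF assms(1-3)]
 have nn: "0 <= (q - t) / dt r N" using d assms by simp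
 have i: "real (idx r N q) = of_int \<lfloor>(q - t) / dt r N\<rfloor>" using nn by (simp add: idx_def)
 have "of_int \<lfloor>(q - t) / dt r N\<rfloor> * dt r N <= q - t" using d by (simp add: pos_le_divide_eq[symmetric])
 then show "pt r N (idx r N q) <= q" by (simp add: pt_def i)
 have "(q - t) / dt r N < of_int \<lfloor>(q - t) / dt r N\<rfloor> + 1" by linarith
 then have "q - t < (of_int \<lfloor>(q - t) / dt r N\<rfloor> + 1) * dt r N" by (rule pos_divide_less_eq[OF d, THEN iffD1])
 then show "q < pt r N (idx r N q) + dt r N" by (simp add: pt_def i algebra_simps)
 show mono: "q <= q' ==> idx r N q <= idx r N q'" for q'
  unfolding idx_def using d by (intro nat_mono floor_mono divide_right_mono) auto
 have "idx r N r = N" using assms d by (simp add: idx_def dt_def)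
 then show "q <= r ==> idx r N q <= N" using mono[of r] by simp
qed

lemma euler_point_limit:
 assumes r: "t < r" "r < 1" and om: "om \<in> space M" "X t om = z"
  and eq: "!!s. t <= s ==> s < 1 ==> set_integrable lborel {t..s} (%r. b r (X r om)) \<and>
     X s om = z + (LINT r:{t..s}|lborel. b r (X r om)) + (W s om - W t om)"
  and q: "t <= q" "q <= r"
 shows "(%n. pt r (Suc n) (idx r (Suc n) q)) \<longlonglongrightarrow> q"
  and "(%n. eul r (Suc n) (idx r (Suc n) q) (dW r (Suc n) om)) \<longlonglongrightarrow> X q om"
proof -
 let ?p = "%n. pt r (Suc n) (idx r (Suc n) q)"
 have d0: "(%n. dt r (Suc n)) \<longlonglongrightarrow> 0"
  unfolding dt_def using tendsto_mult[OF tendsto_const LIMSEQ_inverse_real_of_nat, of "r - t"] by (simp add: divide_inverse)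
 show lim: "?p \<longlonglongrightarrow> q"
 proof (rule tendsto_sandwich[of "%n. q - dt r (Suc n)" _ _ "%_. q"])
  show "(%n. q - dt r (Suc n)) \<longlonglongrightarrow> q" using tendsto_diff[OF tendsto_const d0, of q] by simp
 qed (use idx_bounds(1,2)[OF r _ q(1)] in \<open>auto intro!: always_eventually less_imp_le simp: less_diff_eq diff_less_eq\<close>)
 have "(%n. X (?p n) om) \<longlonglongrightarrow> X q om"
 proof (rule continuous_on_tendsto_compose[OF X_continuous[OF om(1)] lim])
  show "q \<in> {t..<1}" using q r by simp
  show "\<forall>\<^sub>F n in sequentially. ?p n \<in> {t..<1}"
   using pt_ge[OF r] pt_less1[OF r _ idx_bounds(3)[OF r _ q(1) q(2)]] by (auto intro!: always_eventually)
 qed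
 moreover have "(%n. X (?p n) om - eul r (Suc n) (idx r (Suc n) q) (dW r (Suc n) om)) \<longlonglongrightarrow> 0"
 proof (rule LIMSEQ_I)
  fix e :: real assume "0 < e"
  from euler_pathwise[OF r om eq half_gt_zero[OF this]]
  obtain N0 where "\<forall>N\<ge>N0. 0 < N --> (\<forall>k\<le>N. \<bar>X (pt r N k) om - eul r N k (dW r N om)\<bar> <= e / 2)" by blast
  then have N0: "!!N k. N0 <= N ==> 0 < N ==> k <= N ==> \<bar>X (pt r N k) om - eul r N k (dW r N om)\<bar> <= e / 2"
   by blast
  have "norm (X (?p n) om - eul r (Suc n) (idx r (Suc n) q) (dW r (Suc n) om) - 0) < e" if "N0 <= n" for n
   using N0[of "Suc n" "idx r (Suc n) q"] idx_bounds(3)[OF r _ q, of "Suc n"] that \<open>0 < e\<close> by simp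
  then show "\<exists>no. \<forall>n\<ge>no. norm (X (?p n) om - eul r (Suc n) (idx r (Suc n) q) (dW r (Suc n) om) - 0) < e" by blast
 qed
 ultimately show "(%n. eul r (Suc n) (idx r (Suc n) q) (dW r (Suc n) om)) \<longlonglongrightarrow> X q om"
  using tendsto_diff[of "%n. X (?p n) om" "X q om" sequentially "%n. X (?p n) om - eul r (Suc n) (idx r (Suc n) q) (dW r (Suc n) om)" 0]
  by simp
qed

text \<open>The Markov property tested on exponentials under product weights of the past. Along the
  scheme, exchanging the exponential for its kernel average is a telescoping sum of one-step errors;
  pathwise convergence carries the identity over to X. The second component of an index in J is a
  mere label that permits several factors at one time.\<close>

lemma markov_char:
 fixes J :: "(real \<times> real) set" and f :: "real \<times> real => real => real"
 assumes J: "finite J" "fst ` J \<subseteq> {t..s}" and f: "!!p. continuous_on UNIV (f p)" "!!p x. \<bar>f p x\<bar> <= 1"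
  and s: "t <= s" "s < r" "r < 1"
 shows "(LINT om|M. of_real (\<Prod>p\<in>J. f p (X (fst p) om)) * exp (\<i> * of_real (\<theta> * X r om))) =
  (LINT om|M. of_real (\<Prod>p\<in>J. f p (X (fst p) om)) * char_fun \<theta> r s (of_real (X s om)))"
proof -
 have r: "t < r" "r < 1" "0 <= r" using s t by auto
 have s0: "0 <= s" using s t by simp
 obtain B where B0: "0 <= B" and B: "!!s y. 0 <= s ==> s <= r ==> cmod (char_fun \<theta> r s (of_real y)) <= B"
  using char_fun_taylor[OF r(3,2), of \<theta>] by metis
 obtain C where C: "0 <= C" "!!s dl y. 0 <= s ==> 0 < dl ==> s + dl <= r ==>
   cmod ((LINT x|gaussian. char_fun \<theta> r (s + dl) (of_real (y + dl * b s y + sqrt dl * x))) - char_fun \<theta> r s (of_real y)) <= C * (dl * sqrt dl) * (1 + y\<^sup>2)^2"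
  using euler_one_step[OF r(3,2), of \<theta>] by blast
 obtain L where L: "0 <= L" "!!s y. 0 <= s ==> s <= r ==> \<bar>b s y\<bar> <= L * (1 + \<bar>y\<bar>)"
  using b_bounds[OF r(2)] by metis
 have fm [measurable]: "f p \<in> borel_measurable borel" for p by (rule borel_measurable_continuous_onI[OF f(1)])
 have wc: "continuous_on UNIV (%y. char_fun \<theta> r q (of_real y))" if "0 <= q" "q <= r" for q
 proof -
  have "continuous_on UNIV ((%p. char_fun \<theta> r (fst p) (of_real (snd p))) \<circ> (%x. (q, x)))"
   using that r by (intro continuous_on_compose continuous_intros continuous_on_subset[OF continuous_char_fun]) auto
  then show ?thesis by (simp add: comp_def)
 qed
 have wm: "(%y. char_fun \<theta> r q (of_real y)) \<in> borel_measurable borel" if "0 <= q" "q <= r" for q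
  by (rule borel_measurable_continuous_onI[OF wc[OF that]])
 have prod1: "\<bar>\<Prod>p\<in>J. f p (y p)\<bar> <= 1" for y
  unfolding abs_prod using f(2) by (intro prod_le_1) auto
 define Y where "Y n k om = eul r (Suc n) k (dW r (Suc n) om)" for n k om
 define G where "G n x = (\<Prod>p\<in>J. f p (eul r (Suc n) (idx r (Suc n) (fst p)) x))" for n x
 define w where "w n k y = char_fun \<theta> r (pt r (Suc n) k) (of_real y)" for n k y
 define j where "j n = idx r (Suc n) s" for n
 define U where "U n om = of_real (G n (dW r (Suc n) om)) * (w n (Suc n) (Y n (Suc n) om) - w n (j n) (Y n (j n) om))" for n om
 have jN: "j n <= Suc n" for n unfolding j_def using s by (intro idx_bounds(3)[OF r(1,2)]) auto
 have idxj: "idx r (Suc n) (fst p) <= j n" if "p \<in> J" for n p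
  unfolding j_def using that J by (intro idx_bounds(4)[OF r(1,2)]) auto
 have idxN: "idx r (Suc n) (fst p) <= Suc n" if "p \<in> J" for n p
  using order_trans[OF idxj[OF that] jN] .
 have Gm: "G n \<in> borel_measurable (seq_space k)" if "j n <= k" for n k
  unfolding G_def
  by (intro borel_measurable_prod measurable_compose[OF _ fm] eul_measurable[OF r(1,2)] idxN order_trans[OF idxj that]) auto
 have Grestr: "G n (restrict x {..<k}) = G n x" if "j n <= k" for n k x
 proof -
  have "eul r (Suc n) (idx r (Suc n) (fst p)) (restrict x {..<k}) = eul r (Suc n) (idx r (Suc n) (fst p)) x" if "p \<in> J" for p
  proof (rule eul_cong[OF r(1,2)])
   fix i assume "i < idx r (Suc n) (fst p)"
   with idxj[OF that, of n] \<open>j n <= k\<close> have "i < k" by linarith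
   then show "restrict x {..<k} i = x i" by simp
  qed simp
  then show ?thesis unfolding G_def by simp
 qed
 have wB: "cmod (w n k y) <= B" if "k <= Suc n" for n k y
  unfolding w_def using pt_nonneg[OF r(1,2)] pt_le[OF r(1,2) _ that] by (intro B) auto
 have Ym: "Y n k \<in> borel_measurable M" if "k <= Suc n" for n k
  unfolding Y_def using that by (intro eul_dW_measurable[OF r(1,2)]) auto
 have wYm: "(%om. w n k (Y n k om)) \<in> borel_measurable M" if "k <= Suc n" for n k
  unfolding w_def using pt_nonneg[OF r(1,2)] pt_le[OF r(1,2) _ that] by (intro measurable_compose[OF Ym[OF that] wm]) auto
 have GWm: "(%om. G n (dW r (Suc n) om)) \<in> borel_measurable M" for n
  unfolding G_def by (intro borel_measurable_prod measurable_compose[OF _ fm] eul_dW_measurable[OF r(1,2)] idxN) auto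
 have Um: "U n \<in> borel_measurable M" for n
  unfolding U_def[abs_def] using wYm jN GWm by (intro borel_measurable_times borel_measurable_diff borel_measurable_of_real) auto
 have UB: "cmod (U n om) <= 1 * (B + B)" for n om
  unfolding U_def norm_mult norm_of_real G_def using jN wB
  by (intro mult_mono prod1 order_trans[OF norm_triangle_ineq4 add_mono]) auto
 have intU: "cmod (LINT om|M. U n om) <= real (Suc n) * (C * (dt r (Suc n) * sqrt (dt r (Suc n))) * (exp (5 + 8 * L) * (1 + z\<^sup>2)^2))" for n
 proof -
  let ?S = "%k om. of_real (G n (dW r (Suc n) om)) * (w n (Suc k) (Y n (Suc k) om) - w n k (Y n k om))"
  let ?c = "C * (dt r (Suc n) * sqrt (dt r (Suc n))) * (exp (5 + 8 * L) * (1 + z\<^sup>2)^2)"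
  have iS: "integrable M (?S k)" if "k < Suc n" for k
  proof (rule P.integrable_const_bound[where B = "1 * (B + B)"])
   show "AE om in M. cmod (?S k om) <= 1 * (B + B)"
    unfolding norm_mult norm_of_real G_def using that
    by (intro AE_I2 mult_mono prod1 order_trans[OF norm_triangle_ineq4 add_mono] wB) auto
   show "?S k \<in> borel_measurable M"
    using that GWm by (intro borel_measurable_times borel_measurable_diff borel_measurable_of_real wYm) auto
  qed
  \<comment> \<open>The weight reads only increments before index \<open>j n\<close>, so it is a
    common factor of all differences from there on.\<close>
  have eqU: "U n om = (\<Sum>k\<in>{j n..<Suc n}. ?S k om)" for om
   unfolding U_def sum_distrib_left[symmetric] sum_Suc_diff'[OF jN[of n], of "%k. w n k (Y n k om)"] ..
  have "(LINT om|M. U n om) = (\<Sum>k\<in>{j n..<Suc n}. \<integral>om. ?S k om \<partial>M)"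
   unfolding eqU by (intro Bochner_Integration.integral_sum iS) auto
  also have "cmod ... <= (\<Sum>k\<in>{j n..<Suc n}. ?c)"
  proof (rule sum_norm_le)
   fix k assume k: "k \<in> {j n..<Suc n}"
   show "cmod (LINT om|M. ?S k om) <= ?c"
    unfolding w_def Y_def using k prod1
    by (intro euler_weak_step[OF r(1,2) _ L C B Gm Grestr]) (auto simp: G_def)
  qed
  also have "... <= real (Suc n) * ?c"
  proof -
   have "0 <= ?c" using C dt_pos[OF r(1,2), of "Suc n"] by simp
   then have "real (card {j n..<Suc n}) * ?c <= real (Suc n) * ?c" by (intro mult_right_mono) auto
   then show ?thesis by simp
  qed
  finally show ?thesis .
 qed
 have "(%n. \<integral>om. U n om \<partial>M) \<longlonglongrightarrow> 0"
 proof (rule Lim_null_comparison[OF always_eventually])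
  let ?c = "(r - t) * C * (exp (5 + 8 * L) * (1 + z\<^sup>2)^2)"
  show "\<forall>n. norm (LINT om|M. U n om) <= ?c * sqrt (dt r (Suc n))"
  proof
   fix n
   \<comment> \<open>The number of steps times dl * sqrt dl is of order sqrt dl.\<close>
   have "real (Suc n) * dt r (Suc n) = r - t" by (simp add: dt_def)
   moreover have "real (Suc n) * (C * (dt r (Suc n) * sqrt (dt r (Suc n))) * (exp (5 + 8 * L) * (1 + z\<^sup>2)^2)) =
     (real (Suc n) * dt r (Suc n)) * C * (exp (5 + 8 * L) * (1 + z\<^sup>2)^2) * sqrt (dt r (Suc n))"
    by (simp only: mult_ac)
   ultimately have e1: "real (Suc n) * (C * (dt r (Suc n) * sqrt (dt r (Suc n))) * (exp (5 + 8 * L) * (1 + z\<^sup>2)^2)) = ?c * sqrt (dt r (Suc n))"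
    by (simp only:)
   show "norm (LINT om|M. U n om) <= ?c * sqrt (dt r (Suc n))" using intU[of n] unfolding e1 .
  qed
  have "(%n. dt r (Suc n)) \<longlonglongrightarrow> 0"
   unfolding dt_def using tendsto_mult[OF tendsto_const LIMSEQ_inverse_real_of_nat, of "r - t"] by (simp add: divide_inverse)
  from tendsto_mult[OF tendsto_const tendsto_real_sqrt[OF this], of ?c]
  show "(%n. ?c * sqrt (dt r (Suc n))) \<longlonglongrightarrow> 0" by simp
 qed
 moreover have "(%n. \<integral>om. U n om \<partial>M) \<longlonglongrightarrow> (LINT om|M. of_real (\<Prod>p\<in>J. f p (X (fst p) om)) * (exp (\<i> * of_real (\<theta> * X r om)) - char_fun \<theta> r s (of_real (X s om))))"
 proof (rule integral_dominated_convergence[where w = "%_. 1 * (B + B)"])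
  show "(%om. of_real (\<Prod>p\<in>J. f p (X (fst p) om)) * (exp (\<i> * of_real (\<theta> * X r om)) - char_fun \<theta> r s (of_real (X s om)))) \<in> borel_measurable M"
  proof -
   have [measurable]: "X r \<in> borel_measurable M" "X s \<in> borel_measurable M" using s by (auto intro: X_measurable)
   have 1: "(%om. \<Prod>p\<in>J. f p (X (fst p) om)) \<in> borel_measurable M"
    using J s by (intro borel_measurable_prod measurable_compose[OF X_measurable fm]) auto
   have 2: "(%om. char_fun \<theta> r s (of_real (X s om))) \<in> borel_measurable M"
    using s s0 by (intro measurable_compose[OF _ wm]) auto
   show ?thesis using 1 2 by measurable
  qed
  show "AE om in M. (%n. U n om) \<longlonglongrightarrow> of_real (\<Prod>p\<in>J. f p (X (fst p) om)) * (exp (\<i> * of_real (\<theta> * X r om)) - char_fun \<theta> r s (of_real (X s om)))"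
   using X_equation AE_space
  proof eventually_elim
   case (elim om)
   have eq: "!!s. t <= s ==> s < 1 ==> set_integrable lborel {t..s} (%r. b r (X r om)) \<and>
     X s om = z + (LINT r:{t..s}|lborel. b r (X r om)) + (W s om - W t om)" using elim(1) by auto
   have om: "om \<in> space M" "X t om = z" using elim by auto
   note lim = euler_point_limit[OF r(1,2) om eq]
   have "(%n. G n (dW r (Suc n) om)) \<longlonglongrightarrow> (\<Prod>p\<in>J. f p (X (fst p) om))"
    unfolding G_def using J s
    by (intro tendsto_prod continuous_on_tendsto_compose[OF f(1)] lim(2)) auto
   moreover have "(%n. w n (Suc n) (Y n (Suc n) om)) \<longlonglongrightarrow> exp (\<i> * of_real (\<theta> * X r om))"
   proof -
    have "idx r (Suc n) r = Suc n" for n using dt_pos[OF r(1,2), of "Suc n"] r by (simp add: idx_def dt_def)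
    then have "(%n. Y n (Suc n) om) \<longlonglongrightarrow> X r om" using lim(2)[of r] r by (simp add: Y_def)
    then have "(%n. char_fun \<theta> r r (of_real (Y n (Suc n) om))) \<longlonglongrightarrow> char_fun \<theta> r r (of_real (X r om))"
     using r by (intro continuous_on_tendsto_compose[OF wc[of r]]) auto
    moreover have "w n (Suc n) y = char_fun \<theta> r r (of_real y)" for n y
     using pt_N[OF r(1,2), of "Suc n"] by (simp add: w_def)
    ultimately show ?thesis using r by (simp add: char_fun_end)
   qed
   moreover have "(%n. w n (j n) (Y n (j n) om)) \<longlonglongrightarrow> char_fun \<theta> r s (of_real (X s om))"
   proof -
    have "(%n. (pt r (Suc n) (j n), Y n (j n) om)) \<longlonglongrightarrow> (s, X s om)"
     unfolding j_def Y_def using s by (intro tendsto_Pair lim) auto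
    moreover have "\<forall>\<^sub>F n in sequentially. (pt r (Suc n) (j n), Y n (j n) om) \<in> {0..<1} \<times> UNIV"
     using pt_nonneg[OF r(1,2)] pt_less1[OF r(1,2) _ jN] by (auto intro!: always_eventually)
    ultimately show ?thesis
     using continuous_on_tendsto_compose[OF continuous_char_fun[OF r(2), of \<theta>], of "%n. (pt r (Suc n) (j n), Y n (j n) om)" "(s, X s om)" sequentially] s s0
     by (simp add: w_def)
   qed
   ultimately show ?case unfolding U_def by (intro tendsto_mult tendsto_of_real tendsto_diff)
  qed
 qed (use Um UB in auto)
 ultimately have "(LINT om|M. of_real (\<Prod>p\<in>J. f p (X (fst p) om)) * (exp (\<i> * of_real (\<theta> * X r om)) - char_fun \<theta> r s (of_real (X s om)))) = 0"
  using LIMSEQ_unique by blast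
 moreover have "integrable M (%om. of_real (\<Prod>p\<in>J. f p (X (fst p) om)) * exp (\<i> * of_real (\<theta> * X r om)))"
  "integrable M (%om. of_real (\<Prod>p\<in>J. f p (X (fst p) om)) * char_fun \<theta> r s (of_real (X s om)))"
 proof -
  have Xm [measurable]: "X r \<in> borel_measurable M" "X s \<in> borel_measurable M" using s by (auto intro: X_measurable)
  have 1 [measurable]: "(%om. \<Prod>p\<in>J. f p (X (fst p) om)) \<in> borel_measurable M"
   using J s by (intro borel_measurable_prod measurable_compose[OF X_measurable fm]) auto
  have 2 [measurable]: "(%om. char_fun \<theta> r s (of_real (X s om))) \<in> borel_measurable M"
   using s s0 by (intro measurable_compose[OF _ wm]) auto
  show "integrable M (%om. of_real (\<Prod>p\<in>J. f p (X (fst p) om)) * exp (\<i> * of_real (\<theta> * X r om)))"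
  proof (rule P.integrable_const_bound[where B = "1 * 1"])
   show "AE om in M. cmod (of_real (\<Prod>p\<in>J. f p (X (fst p) om)) * exp (\<i> * of_real (\<theta> * X r om))) <= 1 * 1"
    unfolding norm_mult norm_of_real by (intro AE_I2 mult_mono prod1) auto
  qed measurable
  show "integrable M (%om. of_real (\<Prod>p\<in>J. f p (X (fst p) om)) * char_fun \<theta> r s (of_real (X s om)))"
  proof (rule P.integrable_const_bound[where B = "1 * B"])
   show "AE om in M. cmod (of_real (\<Prod>p\<in>J. f p (X (fst p) om)) * char_fun \<theta> r s (of_real (X s om))) <= 1 * B"
    unfolding norm_mult norm_of_real using s s0 by (intro AE_I2 mult_mono prod1 B) auto
  qed measurable
 qed
 ultimately show ?thesis by (simp add: right_diff_distrib)
qed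

end

section \<open>From exponentials to the Markov property for the generated filtration\<close>

context bridge_sde
begin

text \<open>The law of x when the sample point carries weight \<Psi> and x is then drawn from
  \<open>K s (X s \<omega>) r\<close>. It is built from a joint density, so that the kernel need not
  be treated as a measure-valued map.\<close>

definition push :: "('w => real) => real => real => real measure" where
 "push \<Psi> s r = distr (density (M \<Otimes>\<^sub>M lborel) (%p. ennreal (\<Psi> (fst p) * ker s (X s (fst p)) r (snd p)))) borel snd"

lemma sets_push [simp]: "sets (push \<Psi> s r) = sets borel"
 by (simp add: push_def)

context
 fixes \<Psi> :: "'w => real" and s r :: real
 assumes \<Psi>: "\<Psi> \<in> borel_measurable M" "!!om. 0 <= \<Psi> om" and s: "t <= s" "s < r" "r < 1"
begin

lemma push_density_measurable: "(%p. \<Psi> (fst p) * ker s (X s (fst p)) r (snd p)) \<in> borel_measurable (M \<Otimes>\<^sub>M lborel)"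
proof -
 have [measurable]: "\<Psi> \<in> borel_measurable M" "X s \<in> borel_measurable M" using \<Psi> s by (auto intro: X_measurable)
 show ?thesis by measurable
qed

lemma nn_integral_push:
 assumes [measurable]: "f \<in> borel_measurable borel"
 shows "(\<integral>\<^sup>+x. f x \<partial>push \<Psi> s r) = (\<integral>\<^sup>+om. ennreal (\<Psi> om) * (\<integral>\<^sup>+x. f x \<partial>K s (X s om) r) \<partial>M)"
proof -
 have [measurable]: "\<Psi> \<in> borel_measurable M" "X s \<in> borel_measurable M" using \<Psi> s by (auto intro: X_measurable)
 note [measurable] = push_density_measurable
 have "(\<integral>\<^sup>+x. f x \<partial>push \<Psi> s r) = (\<integral>\<^sup>+p. ennreal (\<Psi> (fst p) * ker s (X s (fst p)) r (snd p)) * f (snd p) \<partial>(M \<Otimes>\<^sub>M lborel))"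
  unfolding push_def by (subst nn_integral_distr) (auto simp: nn_integral_density)
 also have "... = (\<integral>\<^sup>+om. (\<integral>\<^sup>+x. ennreal (\<Psi> om * ker s (X s om) r x) * f x \<partial>lborel) \<partial>M)"
  by (subst lborel.nn_integral_fst[symmetric]) auto
 also have "... = (\<integral>\<^sup>+om. ennreal (\<Psi> om) * (\<integral>\<^sup>+x. f x \<partial>K s (X s om) r) \<partial>M)"
  using \<Psi>(2) by (intro nn_integral_cong) (simp add: ennreal_mult' mult.assoc nn_integral_cmult nn_integral_K)
 finally show ?thesis .
qed

lemma char_push:
 assumes i: "integrable M \<Psi>"
 shows "char (push \<Psi> s r) \<theta> = (LINT om|M. of_real (\<Psi> om) * char_fun \<theta> r s (of_real (X s om)))"
proof -
 have [measurable]: "\<Psi> \<in> borel_measurable M" "X s \<in> borel_measurable M" using \<Psi> s by (auto intro: X_measurable)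
 note [measurable] = push_density_measurable
 interpret pair_sigma_finite M lborel ..
 let ?g = "%p. (\<Psi> (fst p) * ker s (X s (fst p)) r (snd p)) *\<^sub>R exp (\<i> * complex_of_real (\<theta> * snd p))"
 have s0: "0 <= s" using s t by simp
 have ig: "integrable (M \<Otimes>\<^sub>M lborel) ?g"
 proof (rule integrableI_bounded)
  have "(\<integral>\<^sup>+p. ennreal (norm (?g p)) \<partial>(M \<Otimes>\<^sub>M lborel)) = (\<integral>\<^sup>+om. (\<integral>\<^sup>+x. ennreal (\<Psi> om * ker s (X s om) r x) \<partial>lborel) \<partial>M)"
   using \<Psi>(2) by (subst lborel.nn_integral_fst[symmetric]) (auto simp: ker_nonneg abs_mult)
  also have "... = (\<integral>\<^sup>+om. ennreal (\<Psi> om) * (\<integral>\<^sup>+x. 1 \<partial>K s (X s om) r) \<partial>M)"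
   using \<Psi>(2) by (intro nn_integral_cong) (simp add: ennreal_mult' nn_integral_cmult nn_integral_K del: nn_integral_const)
  also have "... = (\<integral>\<^sup>+om. ennreal (\<Psi> om) \<partial>M)"
   using prob_space.emeasure_space_1[OF prob_space_K[OF s0 s(2,3)]] by simp
  also have "... < \<infinity>" using i \<Psi>(2) by (simp add: nn_integral_eq_integral)
  finally show "(\<integral>\<^sup>+p. ennreal (norm (?g p)) \<partial>(M \<Otimes>\<^sub>M lborel)) < \<infinity>" .
 qed measurable
 have "char (push \<Psi> s r) \<theta> = (LINT p|(M \<Otimes>\<^sub>M lborel). ?g p)"
  unfolding char_def push_def using \<Psi>(2)
  by (subst integral_distr) (auto simp: integral_density ker_nonneg)
 also have "... = (LINT om|M. (LINT x|lborel. (\<Psi> om * ker s (X s om) r x) *\<^sub>R exp (\<i> * complex_of_real (\<theta> * x))))"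
  using integral_fst'[OF ig] by simp
 also have "... = (LINT om|M. of_real (\<Psi> om) * char_fun \<theta> r s (of_real (X s om)))"
 proof (rule Bochner_Integration.integral_cong[OF refl])
  fix om
  have "(LINT x|lborel. (\<Psi> om * ker s (X s om) r x) *\<^sub>R exp (\<i> * complex_of_real (\<theta> * x))) =
   (LINT x|lborel. \<Psi> om *\<^sub>R (ker s (X s om) r x *\<^sub>R exp (\<i> * complex_of_real (\<theta> * x))))" by simp
  also have "... = \<Psi> om *\<^sub>R (LINT x|K s (X s om) r. exp (\<i> * complex_of_real (\<theta> * x)))"
   by (simp only: integral_scaleR_right) (subst integral_K, auto)
  finally show "(LINT x|lborel. (\<Psi> om * ker s (X s om) r x) *\<^sub>R exp (\<i> * complex_of_real (\<theta> * x))) = of_real (\<Psi> om) * char_fun \<theta> r s (of_real (X s om))"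
   by (simp only: char_fun_K[OF s0 s(2,3)] scaleR_conv_of_real)
 qed
 finally show ?thesis .
qed

end

text \<open>The weighted law of X r and its prediction by the kernel have the same characteristic
  function by \<open>markov_char\<close>, so Levy's uniqueness theorem identifies them.\<close>

lemma markov_weight:
 fixes J :: "(real \<times> real) set" and f :: "real \<times> real => real => real"
 assumes J: "finite J" "fst ` J \<subseteq> {t..s}" and f: "!!p. continuous_on UNIV (f p)" "!!p x. 0 <= f p x" "!!p x. f p x <= 1"
  and s: "t <= s" "s < r" "r < 1" and B [measurable]: "B \<in> sets borel"
 shows "(LINT om|M. (\<Prod>p\<in>J. f p (X (fst p) om)) * indicator B (X r om)) =
  (LINT om|M. (\<Prod>p\<in>J. f p (X (fst p) om)) * measure (K s (X s om) r) B)"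
proof -
 define \<Phi> where "\<Phi> om = (\<Prod>p\<in>J. f p (X (fst p) om))" for om
 have s0: "0 <= s" using s t by simp
 have Xm [measurable]: "X r \<in> borel_measurable M" "X s \<in> borel_measurable M" using s by (auto intro: X_measurable)
 have fm [measurable]: "f p \<in> borel_measurable borel" for p by (rule borel_measurable_continuous_onI[OF f(1)])
 have \<Phi>m [measurable]: "\<Phi> \<in> borel_measurable M"
  unfolding \<Phi>_def using J s by (intro borel_measurable_prod measurable_compose[OF X_measurable fm]) auto
 have \<Phi>0: "0 <= \<Phi> om" "\<Phi> om <= 1" for om unfolding \<Phi>_def using f by (auto intro!: prod_nonneg prod_le_1)
 have i\<Phi>: "integrable M \<Phi>" by (rule P.integrable_const_bound[where B = 1]) (use \<Phi>0 in auto)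
 have Kp: "prob_space (K s y r)" for y by (rule prob_space_K[OF s0 s(2,3)])
 define m where "m = (LINT om|M. \<Phi> om)"
 have m0: "0 <= m" unfolding m_def using \<Phi>0 by (intro Bochner_Integration.integral_nonneg) auto
 have eq: "(\<integral>\<^sup>+om. ennreal (\<Phi> om) * indicator B (X r om) \<partial>M) = (\<integral>\<^sup>+om. ennreal (\<Phi> om) * emeasure (K s (X s om) r) B \<partial>M)"
 \<comment> \<open>Uniqueness is a statement about probability measures: for positive mass m the
   weight is normalised, and for m = 0 both sides vanish.\<close>
 proof (cases "m = 0")
  case True
  then have "AE om in M. \<Phi> om = 0"
   using integral_nonneg_eq_0_iff_AE[OF i\<Phi>] \<Phi>0 by (auto simp: m_def)
  then have "(\<integral>\<^sup>+om. ennreal (\<Phi> om) * c om \<partial>M) = (\<integral>\<^sup>+om. 0 \<partial>M)" for c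
   by (intro nn_integral_cong_AE) (auto elim!: eventually_mono)
  then show ?thesis by simp
 next
  case False
  with m0 have mp: "0 < m" by simp
  define \<Psi> where "\<Psi> om = \<Phi> om / m" for om
  have [measurable]: "\<Psi> \<in> borel_measurable M" unfolding \<Psi>_def by measurable
  have \<Psi>0: "0 <= \<Psi> om" for om using \<Phi>0 mp by (simp add: \<Psi>_def)
  have i\<Psi>: "integrable M \<Psi>" unfolding \<Psi>_def using i\<Phi> by simp
  have n\<Psi>: "(\<integral>\<^sup>+om. ennreal (\<Psi> om) \<partial>M) = 1"
  proof -
   have "(LINT om|M. \<Psi> om) = m / m" unfolding \<Psi>_def m_def by simp
   then show ?thesis using i\<Psi> \<Psi>0 mp by (subst nn_integral_eq_integral) auto
  qed
  define N1 where "N1 = distr (density M (%om. ennreal (\<Psi> om))) borel (X r)"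
  define N2 where "N2 = push \<Psi> s r"
  have N1n: "(\<integral>\<^sup>+x. k x \<partial>N1) = (\<integral>\<^sup>+om. ennreal (\<Psi> om) * k (X r om) \<partial>M)" if [measurable]: "k \<in> borel_measurable borel" for k
   unfolding N1_def by (subst nn_integral_distr) (auto simp: nn_integral_density)
  have N2n: "(\<integral>\<^sup>+x. k x \<partial>N2) = (\<integral>\<^sup>+om. ennreal (\<Psi> om) * (\<integral>\<^sup>+x. k x \<partial>K s (X s om) r) \<partial>M)" if "k \<in> borel_measurable borel" for k
   unfolding N2_def using \<Psi>0 s by (intro nn_integral_push that) auto
  have r1: "real_distribution N1"
  proof (intro real_distribution.intro prob_spaceI real_distribution_axioms.intro)
   show "emeasure N1 (space N1) = 1"
    using N1n[of "%_. 1"] n\<Psi> by simp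
  qed (simp add: N1_def)
  have r2: "real_distribution N2"
  proof (intro real_distribution.intro prob_spaceI real_distribution_axioms.intro)
   show "emeasure N2 (space N2) = 1"
    using N2n[of "%_. 1"] n\<Psi> prob_space.emeasure_space_1[OF Kp] by simp
  qed (simp add: N2_def push_def)
  have "char N1 = char N2"
  proof
   fix \<theta>
   have "char N1 \<theta> = (LINT om|M. of_real (\<Psi> om) * exp (\<i> * of_real (\<theta> * X r om)))"
    unfolding char_def N1_def using \<Psi>0
    by (subst integral_distr) (auto simp: integral_density scaleR_conv_of_real)
   also have "... = (LINT om|M. of_real (\<Phi> om) * exp (\<i> * of_real (\<theta> * X r om))) / of_real m"
    unfolding \<Psi>_def by (simp flip: integral_divide_zero)
   also have "... = (LINT om|M. of_real (\<Phi> om) * char_fun \<theta> r s (of_real (X s om))) / of_real m"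
    unfolding \<Phi>_def using J s f by (subst markov_char) (auto simp: abs_le_iff intro: order_trans[of _ 0])
   also have "... = (LINT om|M. of_real (\<Psi> om) * char_fun \<theta> r s (of_real (X s om)))"
    unfolding \<Psi>_def by (simp flip: integral_divide_zero)
   also have "... = char N2 \<theta>"
    unfolding N2_def using \<Psi>0 s i\<Psi> by (intro char_push[symmetric]) auto
   finally show "char N1 \<theta> = char N2 \<theta>" .
  qed
  with r1 r2 have "N1 = N2" by (intro Levy_uniqueness)
  then have "(\<integral>\<^sup>+om. ennreal (\<Psi> om) * indicator B (X r om) \<partial>M) = (\<integral>\<^sup>+om. ennreal (\<Psi> om) * emeasure (K s (X s om) r) B \<partial>M)"
   using N1n[of "indicator B"] N2n[of "indicator B"] by simp
  then have "ennreal m * (\<integral>\<^sup>+om. ennreal (\<Psi> om) * indicator B (X r om) \<partial>M) = ennreal m * (\<integral>\<^sup>+om. ennreal (\<Psi> om) * emeasure (K s (X s om) r) B \<partial>M)"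
   by simp
  moreover have e: "ennreal m * (ennreal (\<Psi> om) * c) = ennreal (\<Phi> om) * c" for om c
   using mp \<Psi>0 by (simp add: mult.assoc[symmetric] ennreal_mult'[symmetric]) (simp add: \<Psi>_def)
  moreover have "(%om. emeasure (K s (X s om) r) B) \<in> borel_measurable M"
  proof -
   have "emeasure (K s y r) B = (\<integral>\<^sup>+x. ennreal (ker s y r x) * indicator B x \<partial>lborel)" for y
    by (simp add: K_def emeasure_density)
   then show ?thesis by simp
  qed
  ultimately show ?thesis by (simp add: nn_integral_cmult[symmetric] e)
 qed
 have "(LINT om|M. \<Phi> om * indicator B (X r om)) = enn2real (\<integral>\<^sup>+om. ennreal (\<Phi> om) * indicator B (X r om) \<partial>M)"
  using \<Phi>0 by (subst integral_eq_nn_integral) (auto simp: ennreal_mult' ennreal_indicator intro!: arg_cong[where f = enn2real] nn_integral_cong)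
 also have "... = enn2real (\<integral>\<^sup>+om. ennreal (\<Phi> om * measure (K s (X s om) r) B) \<partial>M)"
  unfolding eq using \<Phi>0 finite_measure.emeasure_eq_measure[OF prob_space.finite_measure[OF Kp]]
  by (auto simp: ennreal_mult' intro!: arg_cong[where f = enn2real] nn_integral_cong)
 also have "... = (LINT om|M. \<Phi> om * measure (K s (X s om) r) B)"
 proof (rule integral_eq_nn_integral[symmetric])
  have "measure (K s y r) B = (LINT x|lborel. ker s y r x * indicator B x)" for y
  proof -
   have "measure (K s y r) B = (LINT x|K s y r. indicator B x)" by simp
   also have "... = (LINT x|lborel. ker s y r x * indicator B x)" by (subst integral_K) auto
   finally show ?thesis .
  qed
  then show "(%om. \<Phi> om * measure (K s (X s om) r) B) \<in> borel_measurable M" by simp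
 qed (use \<Phi>0 in auto)
 finally show ?thesis by (simp add: \<Phi>_def)
qed

lemma measure_K_measurable [measurable]:
 assumes [measurable]: "B \<in> sets borel" shows "(%y. measure (K s y r) B) \<in> borel_measurable borel"
proof -
 have "measure (K s y r) B = (LINT x|lborel. ker s y r x * indicator B x)" for y
 proof -
  have "measure (K s y r) B = (LINT x|K s y r. indicator B x)" by simp
  also have "... = (LINT x|lborel. ker s y r x * indicator B x)" by (subst integral_K) auto
  finally show ?thesis .
 qed
 then show ?thesis by simp
qed

text \<open>Indexed by pairs of a time and a threshold; for finite J these sets form an
  intersection-stable generator of the past.\<close>

definition cylinder :: "(real \<times> real) set => 'w set" where
 "cylinder J = {om \<in> space M. \<forall>p\<in>J. X (fst p) om <= snd p}"

text \<open>Continuous functions that decrease to the indicator of \<open>{..c}\<close> as k grows,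
  because \<open>markov_weight\<close> takes continuous factors.\<close>

definition soft_step :: "nat => real => real => real" where
 "soft_step k c x = max 0 (1 - real k * max 0 (x - c))"

lemma soft_step_tendsto: "(%k. soft_step k c x) \<longlonglongrightarrow> indicator {..c} x"
proof (cases "x <= c")
 case True
 then show ?thesis by (simp add: soft_step_def)
next
 case False
 then have p: "0 < x - c" by simp
 obtain k0 where k0: "1 / (x - c) < real k0" using reals_Archimedean2 by blast
 have "soft_step k c x = 0" if "k0 <= k" for k
 proof -
  have "1 / (x - c) < real k" using k0 that by linarith
  then have "1 < real k * (x - c)" by (rule pos_divide_less_eq[OF p, THEN iffD1])
  then show ?thesis using p by (simp add: soft_step_def)
 qed
 then show ?thesis using False by (intro tendsto_eventually) (auto simp: eventually_sequentially)
qed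

lemma markov_cylinder:
 assumes J: "finite J" "fst ` J \<subseteq> {t..s}" and s: "t <= s" "s < r" "r < 1" and B [measurable]: "B \<in> sets borel"
 shows "(LINT om|M. indicator (cylinder J) om * indicator B (X r om)) = (\<integral>om. indicator (cylinder J) om * measure (K s (X s om) r) B \<partial>M :: real)"
proof -
 have s0: "0 <= s" using s t by simp
 have Xm [measurable]: "X r \<in> borel_measurable M" "X s \<in> borel_measurable M" using s by (auto intro: X_measurable)
 define \<Phi> where "\<Phi> k om = (\<Prod>p\<in>J. soft_step k (snd p) (X (fst p) om))" for k om
 have ss: "0 <= soft_step k c x" "soft_step k c x <= 1" "continuous_on UNIV (soft_step k c)" for k c x
  unfolding soft_step_def by (auto intro!: continuous_intros)
 have sm: "soft_step k c \<in> borel_measurable borel" for k c by (rule borel_measurable_continuous_onI[OF ss(3)])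
 have \<Phi>m: "\<Phi> k \<in> borel_measurable M" for k
  unfolding \<Phi>_def[abs_def] using J s by (intro borel_measurable_prod measurable_compose[OF X_measurable sm]) auto
 have \<Phi>b: "\<bar>\<Phi> k om\<bar> <= 1" for k om
  unfolding \<Phi>_def using ss by (subst abs_of_nonneg) (auto intro!: prod_nonneg prod_le_1)
 have lim: "(%k. \<Phi> k om) \<longlonglongrightarrow> indicator (cylinder J) om" if "om \<in> space M" for om
 proof -
  have "(%k. \<Phi> k om) \<longlonglongrightarrow> (\<Prod>p\<in>J. indicator {..snd p} (X (fst p) om))"
   unfolding \<Phi>_def by (intro tendsto_prod soft_step_tendsto)
  also have "(\<Prod>p\<in>J. indicator {..snd p} (X (fst p) om)) = (indicator (cylinder J) om :: real)"
   using J(1) that by (auto simp: cylinder_def indicator_def prod.neutral intro!: prod_zero split: if_splits)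
  finally show ?thesis .
 qed
 have cm: "cylinder J \<in> sets M"
 proof -
  have "cylinder J = {om \<in> space M. \<forall>p\<in>J. X (fst p) om \<in> {..snd p}}" by (simp add: cylinder_def)
  moreover have "{om \<in> space M. X (fst p) om \<in> {..snd p}} \<in> sets M" if "p \<in> J" for p
   using that J s by (intro measurable_sets_Collect[OF X_measurable]) auto
  ultimately show ?thesis using J(1) by (auto intro: sets.sets_Collect_finite_All)
 qed
 have conv: "(%k. \<integral>om. \<Phi> k om * H om \<partial>M) \<longlonglongrightarrow> (LINT om|M. indicator (cylinder J) om * H om)"
  if [measurable]: "H \<in> borel_measurable M" and "!!om. \<bar>H om\<bar> <= 1" for H :: "'w => real"
 proof (rule integral_dominated_convergence[where w = "%_. 1"])
  show "(%om. indicator (cylinder J) om * H om) \<in> borel_measurable M" using cm by simp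
  show "(%om. \<Phi> k om * H om) \<in> borel_measurable M" for k using \<Phi>m[of k] by simp
  show "AE om in M. (%k. \<Phi> k om * H om) \<longlonglongrightarrow> indicator (cylinder J) om * H om"
   using lim by (intro AE_I2 tendsto_mult tendsto_const)
  show "AE om in M. norm (\<Phi> k om * H om) <= 1" for k
   unfolding real_norm_def abs_mult using \<Phi>b that(2) by (intro AE_I2 mult_le_one) auto
 qed simp
 have "(%k. \<integral>om. \<Phi> k om * indicator B (X r om) \<partial>M) \<longlonglongrightarrow> (LINT om|M. indicator (cylinder J) om * indicator B (X r om))"
  by (rule conv) (auto simp: indicator_def)
 moreover have "(%k. \<integral>om. \<Phi> k om * measure (K s (X s om) r) B \<partial>M) \<longlonglongrightarrow> (LINT om|M. indicator (cylinder J) om * measure (K s (X s om) r) B)"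
  using prob_space.prob_le_1[OF prob_space_K[OF s0 s(2,3)]] by (intro conv) auto
 moreover have "(LINT om|M. \<Phi> k om * indicator B (X r om)) = (LINT om|M. \<Phi> k om * measure (K s (X s om) r) B)" for k
  unfolding \<Phi>_def using J s B ss by (intro markov_weight) auto
 ultimately show ?thesis using LIMSEQ_unique by simp
qed

lemma filtration_space [simp]: "space (generated_filtration M t X s) = space M"
 by (simp add: generated_filtration_def space_measure_of_conv)

lemma filtration_sets_M: "sets (generated_filtration M t X s) \<subseteq> sets M"
 unfolding generated_filtration_def
 by (subst sets_measure_of) (auto intro!: sets.sigma_sets_subset measurable_sets X_measurable)

lemma filtration_X_measurable:
 assumes "t <= q" "q <= s" "q <= 1"
 shows "X q \<in> borel_measurable (generated_filtration M t X (s - t))"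
proof (rule measurableI)
 fix A :: "real set" assume "A \<in> sets borel"
 then have "X q -` A \<inter> space M \<in> {X (t + r) -` A \<inter> space M |r A. 0 <= r \<and> r <= s - t \<and> r <= 1 - t \<and> A \<in> sets borel}"
  using assms by (intro CollectI exI[of _ "q - t"] exI[of _ A]) auto
 then show "X q -` A \<inter> space (generated_filtration M t X (s - t)) \<in> sets (generated_filtration M t X (s - t))"
  unfolding filtration_space unfolding generated_filtration_def by (subst sets_measure_of) auto
qed simp

text \<open>The sets on which the two integrals agree form a Dynkin system containing the
  intersection-stable cylinders.\<close>

lemma markov_set:
 assumes s: "t <= s" "s < r" "r < 1" and B [measurable]: "B \<in> sets borel" and A: "A \<in> sets (generated_filtration M t X (s - t))"
 shows "(LINT om|M. indicator A om * indicator B (X r om)) = (\<integral>om. indicator A om * measure (K s (X s om) r) B \<partial>M :: real)"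
proof -
 have s0: "0 <= s" using s t by simp
 have Xm [measurable]: "X r \<in> borel_measurable M" "X s \<in> borel_measurable M" using s by (auto intro: X_measurable)
 define E where "E = {cylinder J | J. finite J \<and> fst ` J \<subseteq> {t..s}}"
 have EP: "E \<subseteq> Pow (space M)" by (auto simp: E_def cylinder_def)
 have sub: "sets (generated_filtration M t X (s - t)) \<subseteq> sigma_sets (space M) E"
 proof -
  have "X q -` A \<inter> space M \<in> sigma_sets (space M) E" if q: "t <= q" "q <= s" and A: "A \<in> sets borel" for q A
  proof -
   have "X q \<in> borel_measurable (sigma (space M) E)"
   proof (rule borel_measurable_iff_le[THEN iffD2], rule allI)
    fix a
    have "{om \<in> space (sigma (space M) E). X q om <= a} = cylinder {(q, a)}"
     by (auto simp: cylinder_def space_measure_of_conv)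
    also have "... \<in> E" unfolding E_def using q by (intro CollectI exI[of _ "{(q, a)}"]) auto
    finally show "{om \<in> space (sigma (space M) E). X q om <= a} \<in> sets (sigma (space M) E)"
     using EP by auto
   qed
   from measurable_sets[OF this A] show ?thesis using EP by (simp add: space_measure_of_conv)
  qed
  then have "{X (t + r) -` A \<inter> space M |r A. 0 <= r \<and> r <= s - t \<and> r <= 1 - t \<and> A \<in> sets borel} \<subseteq> sigma_sets (space M) E"
   by auto
  then show ?thesis
   unfolding generated_filtration_def by (subst sets_measure_of) (auto intro!: sigma_sets_mono)
 qed
 have EM: "E \<subseteq> sets M"
 proof
  fix C assume "C \<in> E"
  then obtain J where J: "C = cylinder J" "finite J" "fst ` J \<subseteq> {t..s}" by (auto simp: E_def)
  have "cylinder J = {om \<in> space M. \<forall>p\<in>J. X (fst p) om \<in> {..snd p}}" by (simp add: cylinder_def)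
  moreover have "{om \<in> space M. X (fst p) om \<in> {..snd p}} \<in> sets M" if "p \<in> J" for p
   using that J s by (intro measurable_sets_Collect[OF X_measurable]) auto
  ultimately show "C \<in> sets M" using J by (auto intro: sets.sets_Collect_finite_All)
 qed
 have IE: "Int_stable E"
 proof (rule Int_stableI)
  fix C C' assume "C \<in> E" "C' \<in> E"
  then obtain J J' where "C = cylinder J" "finite J" "fst ` J \<subseteq> {t..s}" "C' = cylinder J'" "finite J'" "fst ` J' \<subseteq> {t..s}"
   by (auto simp: E_def)
  then show "C \<inter> C' \<in> E" unfolding E_def
   by (intro CollectI exI[of _ "J \<union> J'"]) (auto simp: cylinder_def)
 qed
 have sE: "sigma_sets (space M) E \<subseteq> sets M" by (rule sets.sigma_sets_subset[OF EM])
 have i: "integrable M (%om. indicator C om * H om)" if "C \<in> sets M" "H \<in> borel_measurable M" "!!om. \<bar>H om\<bar> <= 1" for C and H :: "'w => real"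
  by (rule P.integrable_const_bound[where B = 1]) (use that in \<open>auto simp: indicator_def\<close>)
 define H where "H om = indicator B (X r om) - measure (K s (X s om) r) B" for om
 have H1: "(%om. indicator B (X r om) :: real) \<in> borel_measurable M" "\<bar>indicator B (X r om) :: real\<bar> <= 1" for om by (auto simp: indicator_def)
 have H2: "(%om. measure (K s (X s om) r) B) \<in> borel_measurable M" "\<bar>measure (K s (X s om) r) B\<bar> <= 1" for om
  using prob_space.prob_le_1[OF prob_space_K[OF s0 s(2,3)]] by auto
 have dH: "(LINT om|M. indicator C om * H om) = (LINT om|M. indicator C om * indicator B (X r om)) - (LINT om|M. indicator C om * measure (K s (X s om) r) B)"
  if "C \<in> sets M" for C
  unfolding H_def right_diff_distrib using i[OF that H1] i[OF that H2] by simp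
 have iH: "integrable M (%om. indicator C om * H om)" if "C \<in> sets M" for C
  unfolding H_def right_diff_distrib using i[OF that H1] i[OF that H2] by simp
 have A': "A \<in> sigma_sets (space M) E" using A sub by auto
 have "(LINT om|M. indicator A om * H om) = 0"
  using IE EP A'
 proof (induction rule: sigma_sets_induct_disjoint)
  case (basic C)
  then obtain J where J: "C = cylinder J" "finite J" "fst ` J \<subseteq> {t..s}" by (auto simp: E_def)
  show ?case using markov_cylinder[OF J(2,3) s B] EM basic by (subst dH) (auto simp: J(1))
 next
  case empty
  then show ?case by simp
 next
  case (compl C)
  have CM: "C \<in> sets M" using compl sE by auto
  have "space M \<in> E" unfolding E_def by (intro CollectI exI[of _ "{}"]) (auto simp: cylinder_def)
  then have "(LINT om|M. indicator (space M) om * H om) = 0"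
  proof -
   have sp: "cylinder {} = space M" by (auto simp: cylinder_def)
   show ?thesis using markov_cylinder[of "{}", OF _ _ s B] by (subst dH) (auto simp: sp)
  qed
  moreover have "(LINT om|M. indicator (space M - C) om * H om) = (LINT om|M. indicator (space M) om * H om - indicator C om * H om)"
   by (intro Bochner_Integration.integral_cong) (auto simp: indicator_def)
  ultimately show ?case using compl iH[OF CM] iH[of "space M"] by simp
 next
  case (union C)
  have CM: "C n \<in> sets M" for n using union sE by auto
  have "(%n. \<integral>om. indicator (\<Union>i<n. C i) om * H om \<partial>M) \<longlonglongrightarrow> (LINT om|M. indicator (\<Union>i. C i) om * H om)"
  proof (rule integral_dominated_convergence[where w = "%_. 2"])
   have Hm: "H \<in> borel_measurable M" unfolding H_def using H1 H2 by simp
   show "(%om. indicator (\<Union>i. C i) om * H om) \<in> borel_measurable M" using CM Hm by auto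
   show "(%om. indicator (\<Union>i<n. C i) om * H om) \<in> borel_measurable M" for n using CM Hm by auto
   have H2b: "\<bar>H om\<bar> <= 2" for om unfolding H_def using H1(2)[of om] H2(2)[of om] by linarith
   show "AE om in M. norm (indicator (\<Union>i<n. C i) om * H om) <= 2" for n
    using H2b by (intro AE_I2) (auto simp: indicator_def)
   show "AE om in M. (%n. indicator (\<Union>i<n. C i) om * H om) \<longlonglongrightarrow> indicator (\<Union>i. C i) om * H om"
    by (intro AE_I2 tendsto_mult tendsto_const LIMSEQ_indicator_UN)
  qed simp
  moreover have "(LINT om|M. indicator (\<Union>i<n. C i) om * H om) = 0" for n
  proof -
   have "indicator (\<Union>i<n. C i) om = (\<Sum>i<n. indicator (C i) om :: real)" for om
    using union(1) by (intro indicator_UN_disjoint) (auto simp: disjoint_family_on_def)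
   then have "(LINT om|M. indicator (\<Union>i<n. C i) om * H om) = (LINT om|M. (\<Sum>i<n. indicator (C i) om * H om))"
    by (simp add: sum_distrib_right)
   also have "... = (\<Sum>i<n. \<integral>om. indicator (C i) om * H om \<partial>M)"
    by (intro Bochner_Integration.integral_sum iH CM)
   finally show ?thesis using union by simp
  qed
  ultimately show ?case by (simp add: LIMSEQ_const_iff)
 qed
 then show ?thesis using dH[of A] A filtration_sets_M by auto
qed

text \<open>Both sides are integrals of f against finite measures on the line, which coincide by
  \<open>markov_set\<close>.\<close>

lemma markov_nn:
 assumes s: "t <= s" "s < r" "r < 1" and A: "A \<in> sets (generated_filtration M t X (s - t))" and f [measurable]: "f \<in> borel_measurable borel"
 shows "(\<integral>\<^sup>+om. indicator A om * f (X r om) \<partial>M) = (\<integral>\<^sup>+om. indicator A om * (\<integral>\<^sup>+x. f x \<partial>K s (X s om) r) \<partial>M)"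
proof -
 have s0: "0 <= s" using s t by simp
 have Xm [measurable]: "X r \<in> borel_measurable M" "X s \<in> borel_measurable M" using s by (auto intro: X_measurable)
 have AM [measurable]: "A \<in> sets M" using A filtration_sets_M by auto
 define N1 where "N1 = distr (density M (indicator A)) borel (X r)"
 define N2 where "N2 = push (indicator A) s r"
 have N1n: "(\<integral>\<^sup>+x. k x \<partial>N1) = (\<integral>\<^sup>+om. indicator A om * k (X r om) \<partial>M)" if [measurable]: "k \<in> borel_measurable borel" for k
  unfolding N1_def by (subst nn_integral_distr) (auto simp: nn_integral_density)
 have N2n: "(\<integral>\<^sup>+x. k x \<partial>N2) = (\<integral>\<^sup>+om. indicator A om * (\<integral>\<^sup>+x. k x \<partial>K s (X s om) r) \<partial>M)" if "k \<in> borel_measurable borel" for k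
  unfolding N2_def using s that by (subst nn_integral_push) (auto simp: ennreal_indicator)
 have "N1 = N2"
 proof (rule measure_eqI)
  fix B assume "B \<in> sets N1"
  then have B [measurable]: "B \<in> sets borel" by (simp add: N1_def)
  have Kp: "prob_space (K s y r)" for y by (rule prob_space_K[OF s0 s(2,3)])
  have i1: "integrable M (%om. indicator A om * indicator B (X r om) :: real)"
   by (rule P.integrable_const_bound[where B = 1]) (auto simp: indicator_def)
  have i2: "integrable M (%om. indicator A om * measure (K s (X s om) r) B)"
   using prob_space.prob_le_1[OF Kp] by (intro P.integrable_const_bound[where B = 1]) (auto simp: indicator_def)
  have "emeasure N1 B = (\<integral>\<^sup>+om. ennreal (indicator A om * indicator B (X r om)) \<partial>M)"
   using N1n[of "indicator B"] B by (simp add: N1_def ennreal_mult' ennreal_indicator)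
  also have "... = ennreal (LINT om|M. indicator A om * indicator B (X r om))"
   using i1 by (intro nn_integral_eq_integral) auto
  also have "... = ennreal (LINT om|M. indicator A om * measure (K s (X s om) r) B)"
   using markov_set[OF s B A] by simp
  also have "... = (\<integral>\<^sup>+om. ennreal (indicator A om * measure (K s (X s om) r) B) \<partial>M)"
   using i2 by (intro nn_integral_eq_integral[symmetric]) auto
  also have "... = (\<integral>\<^sup>+om. indicator A om * emeasure (K s (X s om) r) B \<partial>M)"
   using finite_measure.emeasure_eq_measure[OF prob_space.finite_measure[OF Kp]]
   by (intro nn_integral_cong) (simp add: ennreal_mult' ennreal_indicator)
  also have "... = emeasure N2 B"
   using N2n[of "indicator B"] B by (simp add: N2_def)
  finally show "emeasure N1 B = emeasure N2 B" .
 qed (simp add: N1_def N2_def)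
 then show ?thesis using N1n[OF f] N2n[OF f] by simp
qed

end

subsection \<open>The value function of the stopping problem for the kernel\<close>

lemma tameI:
 assumes "f \<in> borel_measurable borel" "!!y. \<bar>f y\<bar> <= g y" "tame g" shows "tame f"
proof -
 obtain c where "!!y. \<bar>g y\<bar> <= c * (1 + y^2)" using assms(3) by (auto simp: tame_def)
 then have "\<bar>f y\<bar> <= c * (1 + y^2)" for y using assms(2)[of y] by (meson abs_ge_self order_trans)
 with assms(1) show ?thesis by (auto simp: tame_def)
qed

lemma tame_add: "tame f ==> tame g ==> tame (%y. f y + g y)"
 unfolding tame_def
proof safe
 fix c c' assume "\<forall>y. \<bar>f y\<bar> <= c * (1 + y^2)" "\<forall>y. \<bar>g y\<bar> <= c' * (1 + y^2)"
 then have "\<bar>f y\<bar> + \<bar>g y\<bar> <= c * (1 + y^2) + c' * (1 + y^2)" for y by (intro add_mono) auto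
 then have "\<bar>f y + g y\<bar> <= (c + c') * (1 + y^2)" for y
  unfolding distrib_right[of c] by (rule order_trans[OF abs_triangle_ineq])
 then show "\<exists>c. \<forall>y. \<bar>f y + g y\<bar> <= c * (1 + y^2)" by blast
qed simp

lemma tame_cmult: "tame f ==> tame (%y. k * f y)"
 unfolding tame_def
proof safe
 fix c assume c: "\<forall>y. \<bar>f y\<bar> <= c * (1 + y^2)"
 have "\<bar>k * f y\<bar> <= (\<bar>k\<bar> * c) * (1 + y^2)" for y
  using mult_left_mono[OF c[rule_format, of y], of "\<bar>k\<bar>"] by (simp add: abs_mult mult.assoc)
 then show "\<exists>c. \<forall>y. \<bar>k * f y\<bar> <= c * (1 + y^2)" by blast
qed simp

lemma tame_const: "tame (%_. k)"
proof -
 have "\<bar>k\<bar> <= \<bar>k\<bar> * (1 + y^2)" for y :: real by (simp add: algebra_simps)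
 then show ?thesis unfolding tame_def by auto
qed

lemma tame_sq: "tame (%y. (y - c)\<^sup>2)"
proof -
 have "(y - c)\<^sup>2 <= (2 + 2 * c^2) * (1 + y^2)" for y :: real
  using zero_le_power2[of "y + c"] mult_nonneg_nonneg[OF zero_le_power2[of c] zero_le_power2[of y]] by (simp add: power2_eq_square algebra_simps)
 then show ?thesis unfolding tame_def by (auto intro!: borel_measurable_power borel_measurable_diff)
qed

lemma tame_id: "tame (%y. y)"
proof (rule tameI[of _ "%y. 1 + (y - 0)^2"])
 show "\<bar>y\<bar> <= 1 + (y - 0)^2" for y :: real
  using zero_le_power2[of "\<bar>y\<bar> - 1"] zero_le_power2[of y] by (simp add: power2_eq_square algebra_simps)
 show "tame (%y. 1 + (y - 0)^2)" by (intro tame_add tame_const tame_sq)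
qed simp

lemma tame_measurable: "tame f ==> f \<in> borel_measurable borel"
 by (simp add: tame_def)

text \<open>The first multiple of 2^(-n) strictly after s. Strictness makes grid points advance as
  well, so that iteration reaches 1.\<close>

definition nxt :: "nat => real => real" where "nxt n s = (of_int \<lfloor>s * 2 ^ n\<rfloor> + 1) / 2 ^ n"

definition grid :: "nat => real => bool" where "grid n r \<longleftrightarrow> (\<exists>k::int. r = of_int k / 2 ^ n)"

lemma nxt_gt: "s < nxt n s"
proof -
 have "s * 2 ^ n < of_int \<lfloor>s * 2 ^ n\<rfloor> + 1" by linarith
 then show ?thesis by (simp add: nxt_def pos_less_divide_eq)
qed

lemma nxt_le_add: "nxt n s <= s + 1 / 2 ^ n"
proof -
 have "of_int \<lfloor>s * 2 ^ n\<rfloor> + 1 <= s * 2 ^ n + 1" by linarith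
 then have "nxt n s <= (s * 2 ^ n + 1) / 2 ^ n" unfolding nxt_def by (rule divide_right_mono) simp
 then show ?thesis by (simp add: add_divide_distrib)
qed

lemma grid_nxt: "grid n (nxt n s)"
 unfolding grid_def nxt_def by (rule exI[of _ "\<lfloor>s * 2 ^ n\<rfloor> + 1"]) simp

lemma nxt_le_grid: "grid n r ==> s < r ==> nxt n s <= r"
proof -
 assume "grid n r" "s < r"
 then obtain k :: int where k: "r = of_int k / 2 ^ n" by (auto simp: grid_def)
 then have "s * 2 ^ n < of_int k" using \<open>s < r\<close> by (simp add: pos_less_divide_eq)
 then have "\<lfloor>s * 2 ^ n\<rfloor> < k" by (simp add: floor_less_iff)
 then have "of_int \<lfloor>s * 2 ^ n\<rfloor> + 1 <= (of_int k :: real)" by (metis of_int_1 of_int_add of_int_le_iff zless_imp_add1_zle)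
 then show ?thesis unfolding nxt_def k by (rule divide_right_mono) simp
qed

lemma grid_Suc: "grid n r ==> grid (Suc n) r"
 unfolding grid_def
proof (elim exE)
 fix k :: int assume "r = of_int k / 2 ^ n"
 then show "\<exists>k::int. r = of_int k / 2 ^ Suc n" by (intro exI[of _ "2 * k"]) simp
qed

lemma grid_mono: "grid n r ==> n <= m ==> grid m r"
 by (induction m) (auto simp: le_Suc_eq intro: grid_Suc)

lemma grid_dense:
 assumes "a < (c::real)" obtains n r where "grid n r" "a < r" "r < c"
proof -
 obtain n where "(1 / 2 :: real) ^ n < c - a"
  using real_arch_pow_inv[of "c - a" "1 / 2"] assms by auto
 then have "nxt n a < c" using nxt_le_add[of n a] by (simp add: power_divide)
 then show ?thesis using that[OF grid_nxt nxt_gt] by blast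
qed

text \<open>For s in [0,1), the number of grid points of level n strictly between s and 1: the depth
  of the recursion from s.\<close>

definition steps_left :: "nat => real => nat" where "steps_left n s = nat (2 ^ n - 1 - \<lfloor>s * 2 ^ n\<rfloor>)"

lemma steps_left_nxt: "nxt n s < 1 ==> steps_left n s = Suc (steps_left n (nxt n s))"
proof -
 assume "nxt n s < 1"
 then have "of_int (\<lfloor>s * 2 ^ n\<rfloor> + 1) < (2 ^ n :: real)" by (simp add: nxt_def)
 then have l: "\<lfloor>s * 2 ^ n\<rfloor> + 1 < 2 ^ n" by (metis of_int_less_iff of_int_numeral of_int_power)
 have "nxt n s * 2 ^ n = of_int (\<lfloor>s * 2 ^ n\<rfloor> + 1)" by (simp add: nxt_def)
 then have "\<lfloor>nxt n s * 2 ^ n\<rfloor> = \<lfloor>s * 2 ^ n\<rfloor> + 1" by (metis floor_of_int)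
 then show ?thesis using l by (simp add: steps_left_def nat_eq_iff)
qed

lemma steps_left_last: "1 <= nxt n s ==> steps_left n s = 0"
proof -
 assume "1 <= nxt n s"
 then have "(2 ^ n :: real) <= of_int (\<lfloor>s * 2 ^ n\<rfloor> + 1)" by (simp add: nxt_def)
 then have "2 ^ n <= \<lfloor>s * 2 ^ n\<rfloor> + 1" by (metis of_int_le_iff of_int_numeral of_int_power)
 then show ?thesis by (simp add: steps_left_def)
qed

text \<open>Backward induction in time along the grid, available from any real s and not only from
  grid points.\<close>

lemma grid_induct [consumes 1, case_names last step]:
 assumes "0 <= s" and last: "!!s. 0 <= s ==> 1 <= nxt n s ==> Q s"
  and step: "!!s. 0 <= s ==> nxt n s < 1 ==> Q (nxt n s) ==> Q s"
 shows "Q s"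
 using \<open>0 <= s\<close>
proof (induction "steps_left n s" arbitrary: s)
 case 0
 then show ?case using last steps_left_nxt[of n s] by (cases "nxt n s < 1") auto
next
 case (Suc j)
 then have lt: "nxt n s < 1" using steps_left_last[of n s] by (cases "nxt n s < 1") auto
 then have "j = steps_left n (nxt n s)" using steps_left_nxt[OF lt] Suc by simp
 then have "Q (nxt n s)" using Suc nxt_gt[of s n] by simp
 then show ?case using step Suc lt by simp
qed

lemma grid_induct_to [consumes 4, case_names last step]:
 assumes "grid n r" "r < 1" "0 <= s" "s < r" and last: "!!s. 0 <= s ==> s < r ==> nxt n s = r ==> Q s"
  and step: "!!s. 0 <= s ==> s < r ==> nxt n s < r ==> Q (nxt n s) ==> Q s"
 shows "Q s"
proof -
 have "s < r --> Q s"
  using \<open>0 <= s\<close>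
 proof (induction s rule: grid_induct[where n = n])
  case (last s)
  then show ?case using nxt_le_grid[OF assms(1), of s] assms(2) by auto
 next
  case (step s)
  show ?case
  proof
   assume sr: "s < r"
   show "Q s"
   proof (cases "nxt n s = r")
    case True then show ?thesis using last step sr assms(5) by auto
   next
    case False
    then have "nxt n s < r" using nxt_le_grid[OF assms(1) sr] by simp
    then show ?thesis using step sr assms(6) by auto
   qed
  qed
 qed
 then show ?thesis using assms(4) by simp
qed

section \<open>Dynamic programming on dyadic grids and its limit\<close>

context bounded_posterior
begin

text \<open>Stopping is allowed now and at the later grid points before 1. When none of these is
  left one stops at once, so time 1 never enters and the kernel is applied only below 1.\<close>

primrec vstep :: "nat => nat => real => real => real" where
 "vstep n 0 s z = z"
| "vstep n (Suc j) s z = max z (LINT y|K s z (nxt n s). vstep n j (nxt n s) y)"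

definition Vn :: "nat => real => real => real" where "Vn n s z = vstep n (steps_left n s) s z"

lemma Vn_last: "1 <= nxt n s ==> Vn n s z = z"
 by (simp add: Vn_def steps_left_last)

lemma Vn_step: "nxt n s < 1 ==> Vn n s z = max z (LINT y|K s z (nxt n s). Vn n (nxt n s) y)"
 by (simp add: Vn_def steps_left_nxt)

text \<open>A supermartingale (\<open>K_Fm_le\<close>) that dominates (z - c)^2
  (\<open>Fm_ge\<close>): \<open>msq\<close> is a martingale, and a possible increase of \<rho>, at
  most the length of the step, is paid for by the term 1 - s.\<close>

definition Fm :: "real => real => real => real" where "Fm c s z = 2 * (\<rho> s z + (1 - s)) + 2 * msq c s z"

lemma msq_nonneg: "0 <= msq c s z" by (simp add: msq_def)

lemma sq_le_\<rho>_msq: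
 assumes s: "0 <= s" "s < 1"
 shows "(z - c)\<^sup>2 <= 2 * \<rho> s z + 2 * msq c s z" and "msq c s z <= 2 * \<rho> s z + 2 * (z - c)^2"
proof -
 interpret P: prob_space "post s z" by (rule prob_space_post[OF s])
 have i: "integrable (post s z) (%u. (u - x)\<^sup>2)" for x by (rule integrable_post_sq[OF s])
 have "(LINT u|post s z. (z - c)\<^sup>2) <= (LINT u|post s z. 2 * (u - z)^2 + 2 * (u - c)^2)"
 proof (rule integral_mono)
  fix u
  have "0 <= ((u - z) + (u - c))\<^sup>2" by simp
  then show "(z - c)\<^sup>2 <= 2 * (u - z)^2 + 2 * (u - c)^2" by (simp add: power2_eq_square algebra_simps)
 qed (use i in auto)
 then show "(z - c)\<^sup>2 <= 2 * \<rho> s z + 2 * msq c s z" using i P.prob_space by (simp add: \<rho>_def msq_def)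
 have "(LINT u|post s z. (u - c)\<^sup>2) <= (LINT u|post s z. 2 * (u - z)^2 + 2 * (z - c)^2)"
 proof (rule integral_mono)
  fix u
  have "0 <= ((u - z) - (z - c))\<^sup>2" by simp
  then show "(u - c)\<^sup>2 <= 2 * (u - z)^2 + 2 * (z - c)^2" by (simp add: power2_eq_square algebra_simps)
 qed (use i in auto)
 then show "msq c s z <= 2 * \<rho> s z + 2 * (z - c)^2" using i P.prob_space by (simp add: \<rho>_def msq_def)
qed

lemma tame_\<rho>: assumes "0 <= s" "s < 1" shows "tame (\<rho> s)"
proof -
 obtain C where "!!s' z. 0 <= s' ==> s' <= s ==> \<rho> s' z <= C * (1 + z^2)" using \<rho>_growth[OF assms(2)] by blast
 then show ?thesis using \<rho>_measurable[OF assms] \<rho>_nonneg assms unfolding tame_def by (auto intro!: exI[of _ C])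
qed

lemma tame_msq: assumes s: "0 <= s" "s < 1" shows "tame (msq c s)"
proof (rule tameI)
 show "\<bar>msq c s y\<bar> <= 2 * \<rho> s y + 2 * (y - c)^2" for y using sq_le_\<rho>_msq(2)[OF s] msq_nonneg by simp
qed (use msq_measurable[OF s] in \<open>auto intro!: tame_add tame_cmult tame_\<rho> tame_sq s\<close>)

lemma tame_Fm: "0 <= s ==> s < 1 ==> tame (Fm c s)"
 unfolding Fm_def[abs_def] by (intro tame_add tame_cmult tame_\<rho> tame_msq tame_const)

lemma Fm_ge: "0 <= s ==> s < 1 ==> (z - c)\<^sup>2 <= Fm c s z"
 using sq_le_\<rho>_msq(1)[of s z c] by (simp add: Fm_def)

lemma K_\<rho>_le:
 assumes s: "0 <= s" "s < r" "r < 1"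
 shows "(LINT y|K s z r. \<rho> r y) <= \<rho> s z + (r - s)"
proof -
 have "((1 - r) / (1 - s))\<^sup>2 <= 1" using s by (simp add: power_le_one_iff)
 then have "((1 - r) / (1 - s))\<^sup>2 * \<rho> s z <= 1 * \<rho> s z" by (rule mult_right_mono) (rule \<rho>_nonneg)
 moreover have "(r - s) * (1 - r) / (1 - s) <= r - s"
  using s by (simp add: divide_le_eq)
 ultimately show ?thesis using K_\<rho>[OF s] by simp
qed

lemma K_Fm_le:
 assumes s: "0 <= s" "s < r" "r < 1"
 shows "(LINT y|K s z r. Fm c r y) <= Fm c s z"
proof -
 interpret Kp: prob_space "K s z r" by (rule prob_space_K[OF s])
 have "(LINT y|K s z r. Fm c r y) = 2 * ((LINT y|K s z r. \<rho> r y) + (1 - r)) + 2 * msq c s z"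
  unfolding Fm_def using integrable_K_\<rho>[OF s] integrable_K_msq[OF s] Kp.prob_space by (simp add: K_msq[OF s])
 also have "... <= 2 * (\<rho> s z + (1 - s)) + 2 * msq c s z"
  using K_\<rho>_le[OF s, of z] by simp
 finally show ?thesis by (simp add: Fm_def)
qed

text \<open>A supermartingale for the same reason as \<open>Fm\<close>, chosen to dominate the
  numerator \<open>h s z - z\<close> of the drift.\<close>

definition R :: "real => real => real" where "R s z = 1 + \<rho> s z + (1 - s)"

lemma tame_R: "0 <= s ==> s < 1 ==> tame (R s)"
 unfolding R_def[abs_def] by (intro tame_add tame_\<rho> tame_const)

lemma R_nonneg: "s < 1 ==> 0 <= R s z"
 using \<rho>_nonneg[of s z] by (simp add: R_def)

lemma K_R_le:
 assumes s: "0 <= s" "s < r" "r < 1"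
 shows "(LINT y|K s z r. R r y) <= R s z"
proof -
 interpret Kp: prob_space "K s z r" by (rule prob_space_K[OF s])
 have "(LINT y|K s z r. R r y) = 1 + (LINT y|K s z r. \<rho> r y) + (1 - r)"
  unfolding R_def using integrable_K_\<rho>[OF s] Kp.prob_space by simp
 then show ?thesis using K_\<rho>_le[OF s, of z] unfolding R_def by linarith
qed

lemma K_mono:
 assumes s: "0 <= s" "s < r" "r < 1" and f: "tame f" "tame k" "!!y. f y <= k y"
 shows "(LINT y|K s z r. f y) <= (LINT y|K s z r. k y)"
 using f by (intro integral_mono integrable_K_tame[OF s]) auto

lemma tame_envelope:
 assumes s: "0 <= s" "s < 1" shows "tame (%y. (1 + Fm 0 s y) / 2 + (1 + (y - 0)^2))"
 using tame_add[OF tame_add[OF tame_const[of "1 / 2"] tame_cmult[OF tame_Fm[OF s, of 0], of "1 / 2"]] tame_add[OF tame_const[of 1] tame_sq[of 0]]]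
 by (simp add: add_divide_distrib)

text \<open>The shape of the last premise is that of \<open>Vn_le\<close> and \<open>V_le\<close> at
  c = 0 and eps = 1.\<close>

lemma envelope:
 assumes s: "0 <= s" "s < 1" and "y <= v" "v <= 0 + (1 + Fm 0 s y / 1) / 2"
 shows "\<bar>v\<bar> <= (1 + Fm 0 s y) / 2 + (1 + (y - 0)^2)"
proof (rule abs_leI)
 have y: "\<bar>y\<bar> <= 1 + (y - 0)^2"
  using zero_le_power2[of "\<bar>y\<bar> - 1"] zero_le_power2[of y] by (simp add: power2_eq_square algebra_simps)
 have "0 <= Fm 0 s y" by (rule order_trans[OF zero_le_power2 Fm_ge[OF s, of y 0]])
 then have F: "0 <= (1 + Fm 0 s y) / 2" by simp
 have "v <= (1 + Fm 0 s y) / 2 + 0" using assms(4) by simp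
 also have "... <= (1 + Fm 0 s y) / 2 + (1 + (y - 0)^2)" by (intro add_left_mono) simp
 finally show "v <= (1 + Fm 0 s y) / 2 + (1 + (y - 0)^2)" .
 have "- v <= \<bar>y\<bar>" using assms(3) by linarith
 also have "... <= 0 + (1 + (y - 0)^2)" using y by simp
 also have "... <= (1 + Fm 0 s y) / 2 + (1 + (y - 0)^2)" using F by (rule add_right_mono)
 finally show "- v <= (1 + Fm 0 s y) / 2 + (1 + (y - 0)^2)" .
qed

text \<open>The upper bound linearises c + sqrt Fm by the inequality of arithmetic and geometric
  means. Being affine in \<open>Fm\<close>, it passes through the kernel; eps can be optimised
  afterwards, as in \<open>V_excess_sq\<close>.\<close>

lemma Vn_bounds:
 assumes "0 <= s" "s < 1"
 shows "Vn n s \<in> borel_measurable borel \<and> (\<forall>z. z <= Vn n s z) \<and> (\<forall>z c eps. 0 < eps --> Vn n s z <= c + (eps + Fm c s z / eps) / 2)"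
proof -
 have base: "z <= c + (eps + Fm c s z / eps) / 2" if "0 <= s" "s < 1" "0 < eps" for s z c eps
 proof -
  have "0 <= (eps - (z - c))\<^sup>2" by simp
  then have "2 * eps * (z - c) <= eps\<^sup>2 + (z - c)^2" by (simp add: power2_diff)
  then have "2 * eps * (z - c) <= eps\<^sup>2 + Fm c s z" using Fm_ge[OF that(1,2), of z c] by simp
  then have "z - c <= (eps + Fm c s z / eps) / 2" using that(3) by (simp add: field_simps power2_eq_square)
  then show ?thesis by linarith
 qed
 have "s < 1 --> Vn n s \<in> borel_measurable borel \<and> (\<forall>z. z <= Vn n s z) \<and> (\<forall>z c eps. 0 < eps --> Vn n s z <= c + (eps + Fm c s z / eps) / 2)"
  using assms(1)
 proof (induction s rule: grid_induct[where n = n])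
  case (last s)
  have "Vn n s = (%z. z)" using Vn_last last by auto
  then show ?case using base last by auto
 next
  case (step s)
  let ?r = "nxt n s"
  have r: "0 <= s" "s < ?r" "?r < 1" "s < 1" "0 <= ?r" using step nxt_gt[of s n] by auto
  have IH: "Vn n ?r \<in> borel_measurable borel" "!!z. z <= Vn n ?r z" "!!z c eps. 0 < eps ==> Vn n ?r z <= c + (eps + Fm c ?r z / eps) / 2"
   using step by auto
  have tf: "tame (%y. c + (eps + Fm c ?r y / eps) / 2)" for c eps
   using tame_add[OF tame_const[of "c + eps / 2"] tame_cmult[OF tame_Fm[OF r(5,3), of c], of "1 / eps / 2"]] by (simp add: field_simps)
  have t: "tame (Vn n ?r)"
   by (rule tameI[OF IH(1) envelope[OF r(5,3) IH(2) IH(3)] tame_envelope[OF r(5,3)]]) simp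
  show ?case
  proof (intro impI conjI allI)
   have "Vn n s = (%z. max z (\<integral>y. Vn n ?r y \<partial>K s z ?r))" using Vn_step step by auto
   then show "Vn n s \<in> borel_measurable borel" using IH(1) by simp
   show "z <= Vn n s z" for z using Vn_step step by auto
   fix z c eps :: real assume eps: "0 < eps"
   interpret Kp: prob_space "K s z ?r" by (rule prob_space_K[OF r(1-3)])
   have "(\<integral>y. Vn n ?r y \<partial>K s z ?r) <= (\<integral>y. c + (eps + Fm c ?r y / eps) / 2 \<partial>K s z ?r)"
    by (rule K_mono[OF r(1-3) t tf]) (rule IH(3)[OF eps])
   also have "... = c + (eps + (\<integral>y. Fm c ?r y \<partial>K s z ?r) / eps) / 2"
    using integrable_K_tame[OF r(1-3) tame_Fm[OF r(5,3)]] Kp.prob_space by simp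
   also have "... <= c + (eps + Fm c s z / eps) / 2"
    using K_Fm_le[OF r(1-3)] eps by (simp add: divide_right_mono)
   finally show "Vn n s z <= c + (eps + Fm c s z / eps) / 2"
    using Vn_step[of n s z] step base[OF r(1,4) eps, of z c] by simp
  qed
 qed
 then show ?thesis using assms(2) by simp
qed

lemma
 assumes "0 <= s" "s < 1"
 shows Vn_measurable: "Vn n s \<in> borel_measurable borel" and Vn_ge: "z <= Vn n s z"
  and Vn_le: "0 < eps ==> Vn n s z <= c + (eps + Fm c s z / eps) / 2"
 using Vn_bounds[OF assms, of n] by auto

lemma Vn_envelope:
 assumes s: "0 <= s" "s < 1" shows "\<bar>Vn n s y\<bar> <= (1 + Fm 0 s y) / 2 + (1 + (y - 0)^2)"
 by (rule envelope[OF s Vn_ge[OF s] Vn_le[OF s]]) simp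

lemma tame_Vn: assumes s: "0 <= s" "s < 1" shows "tame (Vn n s)"
 by (rule tameI[OF Vn_measurable[OF s] Vn_envelope[OF s] tame_envelope[OF s]])

lemma tame_K:
 assumes s: "0 <= s" "s < r" "r < 1" and f: "tame f"
 shows "tame (%y. \<integral>x. f x \<partial>K s y r)"
proof -
 obtain c where c: "!!y. \<bar>f y\<bar> <= c * (1 + y^2)" using f by (auto simp: tame_def)
 have c0: "0 <= c" using c[of 0] by simp
 show ?thesis
 proof (rule tameI)
  show "(%y. \<integral>x. f x \<partial>K s y r) \<in> borel_measurable borel" using tame_measurable[OF f] by simp
  show "\<bar>\<integral>x. f x \<partial>K s y r\<bar> <= c * (1 + Fm 0 s y)" for y
  proof -
   interpret Kp: prob_space "K s y r" by (rule prob_space_K[OF s])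
   have "\<bar>\<integral>x. f x \<partial>K s y r\<bar> <= (LINT x|K s y r. \<bar>f x\<bar>)" using integral_norm_bound[of "K s y r" f] by simp
   also have "... <= (LINT x|K s y r. c * (1 + Fm 0 r x))"
   proof (rule integral_mono)
    show "integrable (K s y r) (%x. \<bar>f x\<bar>)" using integrable_K_tame[OF s f] by simp
    show "integrable (K s y r) (%x. c * (1 + Fm 0 r x))" using integrable_K_tame[OF s tame_Fm[of r 0]] s by simp
    show "\<bar>f x\<bar> <= c * (1 + Fm 0 r x)" for x
     using Fm_ge[of r x 0] s by (intro order_trans[OF c mult_left_mono] c0) auto
   qed
   also have "... = c * (1 + (LINT x|K s y r. Fm 0 r x))" using integrable_K_tame[OF s tame_Fm[of r 0]] s Kp.prob_space by simp
   also have "... <= c * (1 + Fm 0 s y)" using K_Fm_le[OF s, of y 0] c0 by (simp add: mult_left_mono)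
   finally show ?thesis .
  qed
  show "tame (%y. c * (1 + Fm 0 s y))" using s by (intro tame_cmult tame_add tame_const tame_Fm) auto
 qed
qed

lemma K_K:
 assumes s: "0 <= s" "s < r" "r < q" "q < 1" and f: "tame f"
 shows "(LINT y|K s z r. (LINT x|K r y q. f x)) = (LINT x|K s z q. f x)"
 using s f by (intro integral_K_K(1) integrable_K_tame) auto

text \<open>Ignoring all grid points before r is one admissible strategy.\<close>

lemma Vn_superharmonic:
 assumes "grid n r" "r < 1" "0 <= s" "s < r"
 shows "(LINT y|K s z r. Vn n r y) <= Vn n s z"
 using assms
proof (induction s arbitrary: z rule: grid_induct_to)
 case (last s)
 then have "nxt n s < 1" using \<open>r < 1\<close> by simp
 from Vn_step[OF this, of z] show ?case unfolding last(3) by simp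
next
 case (step s)
 let ?q = "nxt n s"
 have q: "0 <= s" "s < ?q" "?q < r" "r < 1" "?q < 1" "0 <= ?q" using step \<open>r < 1\<close> nxt_gt[of s n] by auto
 have tr: "tame (Vn n r)" using q by (intro tame_Vn) auto
 have "(LINT y|K s z r. Vn n r y) = (\<integral>y. (\<integral>x. Vn n r x \<partial>K ?q y r) \<partial>K s z ?q)"
  by (rule K_K[OF q(1-4) tr, symmetric])
 also have "... <= (\<integral>y. Vn n ?q y \<partial>K s z ?q)"
  by (rule K_mono[OF q(1,2,5) tame_K[OF q(6,3,4) tr] tame_Vn[OF q(6,5)]]) (rule step.IH)
 also have "... <= Vn n s z" using Vn_step[OF q(5), of z] by simp
 finally show ?case .
qed

lemma Vn_mono:
 assumes "0 <= s" "s < 1" shows "Vn n s z <= Vn (Suc n) s z"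
proof -
 have "s < 1 --> Vn n s z <= Vn (Suc n) s z"
  using assms(1)
 proof (induction s arbitrary: z rule: grid_induct[where n = n])
  case (last s)
  then show ?case using Vn_ge[of s z "Suc n"] by (simp add: Vn_last)
 next
  case (step s)
  let ?q = "nxt n s"
  have q: "0 <= s" "s < ?q" "?q < 1" "0 <= ?q" "s < 1" using step nxt_gt[of s n] by auto
  have "(\<integral>y. Vn n ?q y \<partial>K s z ?q) <= (\<integral>y. Vn (Suc n) ?q y \<partial>K s z ?q)"
   using step.IH q by (intro K_mono tame_Vn) auto
  also have "... <= Vn (Suc n) s z"
   using q by (intro Vn_superharmonic grid_Suc grid_nxt) auto
  finally show ?case using Vn_step[OF q(3), of z] Vn_ge[OF q(1,5), of z "Suc n"] by simp
 qed
 then show ?thesis using assms by simp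
qed

definition V :: "real => real => real" where "V s z = (SUP n. Vn n s z)"

lemma Vn_tendsto:
 assumes s: "0 <= s" "s < 1" shows "(%n. Vn n s z) \<longlonglongrightarrow> V s z" and "Vn n s z <= V s z"
proof -
 have b: "bdd_above (range (%n. Vn n s z))"
  using Vn_le[OF s, of 1 _ z 0] by (intro bdd_aboveI[of _ "0 + (1 + Fm 0 s z / 1) / 2"]) auto
 show "(%n. Vn n s z) \<longlonglongrightarrow> V s z"
  unfolding V_def using Vn_mono[OF s] by (intro LIMSEQ_incseq_SUP b incseq_SucI)
 show "Vn n s z <= V s z" unfolding V_def by (rule cSUP_upper[OF _ b]) simp
qed

lemma
 assumes s: "0 <= s" "s < 1"
 shows V_measurable: "V s \<in> borel_measurable borel" and V_ge: "z <= V s z"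
  and V_le: "0 < eps ==> V s z <= c + (eps + Fm c s z / eps) / 2"
proof -
 show "V s \<in> borel_measurable borel"
  by (rule borel_measurable_LIMSEQ_real[OF Vn_tendsto(1)[OF s] Vn_measurable[OF s]])
 show "z <= V s z" by (rule order_trans[OF Vn_ge[OF s, of z 0] Vn_tendsto(2)[OF s]])
 show "0 < eps ==> V s z <= c + (eps + Fm c s z / eps) / 2"
  by (rule LIMSEQ_le_const2[OF Vn_tendsto(1)[OF s]]) (use Vn_le[OF s] in blast)
qed

lemma V_envelope:
 assumes s: "0 <= s" "s < 1" shows "\<bar>V s y\<bar> <= (1 + Fm 0 s y) / 2 + (1 + (y - 0)^2)"
 by (rule envelope[OF s V_ge[OF s] V_le[OF s]]) simp

lemma tame_V: assumes s: "0 <= s" "s < 1" shows "tame (V s)"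
 by (rule tameI[OF V_measurable[OF s] V_envelope[OF s] tame_envelope[OF s]])

lemma K_Vn_tendsto:
 assumes s: "0 <= s" "s < r" "r < 1"
 shows "(%n. \<integral>y. Vn n r y \<partial>K s z r) \<longlonglongrightarrow> (LINT y|K s z r. V r y)"
proof (rule integral_dominated_convergence)
 have r: "0 <= r" "r < 1" using s by auto
 show "integrable (K s z r) (%y. (1 + Fm 0 r y) / 2 + (1 + (y - 0)^2))"
  by (rule integrable_K_tame[OF s tame_envelope[OF r]])
 show "AE y in K s z r. (%n. Vn n r y) \<longlonglongrightarrow> V r y" using Vn_tendsto(1)[OF r] by simp
 show "AE y in K s z r. norm (Vn n r y) <= (1 + Fm 0 r y) / 2 + (1 + (y - 0)^2)" for n
  using Vn_envelope[OF r] by simp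
qed (use V_measurable[of r] Vn_measurable[of r] s in auto)

lemma V_superharmonic_grid:
 assumes "grid n r" "r < 1" "0 <= s" "s < r"
 shows "(LINT y|K s z r. V r y) <= V s z"
proof (rule LIMSEQ_le[OF K_Vn_tendsto Vn_tendsto(1)])
 show "\<exists>N. \<forall>m\<ge>N. (LINT y|K s z r. Vn m r y) <= Vn m s z"
  using assms by (intro exI[of _ n] allI impI Vn_superharmonic grid_mono[OF assms(1)]) auto
qed (use assms in auto)

text \<open>A converse to superharmonicity: if stopping before r beats waiting until r by at most
  the remaining time times a supermartingale \<Theta>, then so does optimal behaviour. Local rates
  of gain thereby become bounds on the value.\<close>

lemma Vn_excess:
 assumes "grid n r" "r < 1" "0 <= s0" "s0 < r"
  and \<Theta>: "!!s y. s0 <= s ==> s < r ==> 0 <= \<Theta> s y" "!!s. s0 <= s ==> s < r ==> tame (\<Theta> s)"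
   "!!s s' y. s0 <= s ==> s < s' ==> s' < r ==> (LINT x|K s y s'. \<Theta> s' x) <= \<Theta> s y"
  and le: "!!s y. s0 <= s ==> s < r ==> y <= (LINT x|K s y r. Vn n r x) + (r - s) * \<Theta> s y"
 shows "Vn n s0 y <= (LINT x|K s0 y r. Vn n r x) + (r - s0) * \<Theta> s0 y"
proof -
 have "s0 <= s --> Vn n s y <= (LINT x|K s y r. Vn n r x) + (r - s) * \<Theta> s y" if "0 <= s" "s < r" for s
  using assms(1,2) that
 proof (induction s arbitrary: y rule: grid_induct_to)
  case (last s)
  then show ?case using Vn_step[of n s y] assms(2) le[of s y] \<Theta>(1)[of s y] by auto
 next
  case (step s)
  let ?q = "nxt n s"
  have q: "0 <= s" "s < ?q" "?q < r" "?q < 1" "0 <= ?q" "r < 1" using step assms(2) nxt_gt[of s n] by auto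
  have tr: "tame (Vn n r)" using q by (intro tame_Vn) auto
  show ?case
  proof
   assume s0: "s0 <= s"
   have tq: "tame (\<Theta> ?q)" using q s0 by (intro \<Theta>(2)) auto
   have "(\<integral>x. Vn n ?q x \<partial>K s y ?q) <= (\<integral>x. (\<integral>x'. Vn n r x' \<partial>K ?q x r) + (r - ?q) * \<Theta> ?q x \<partial>K s y ?q)"
    using step.IH s0 q by (intro K_mono[OF q(1,2,4)] tame_Vn tame_add tame_cmult tame_K tr tq) auto
   also have "... = (LINT x|K s y r. Vn n r x) + (r - ?q) * (\<integral>x. \<Theta> ?q x \<partial>K s y ?q)"
    using integrable_K_tame[OF q(1,2,4) tame_K[OF q(5,3,6) tr]] integrable_K_tame[OF q(1,2,4) tq] K_K[OF q(1,2,3,6) tr] by simp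
   also have "... <= (LINT x|K s y r. Vn n r x) + (r - s) * \<Theta> s y"
   proof -
    have "(r - ?q) * (\<integral>x. \<Theta> ?q x \<partial>K s y ?q) <= (r - ?q) * \<Theta> s y"
     using \<Theta>(3)[OF s0 q(2,3), of y] q by (intro mult_left_mono) auto
    also have "... <= (r - s) * \<Theta> s y" using \<Theta>(1)[of s y] s0 q by (intro mult_right_mono) auto
    finally show ?thesis by simp
   qed
   finally show "Vn n s y <= (LINT x|K s y r. Vn n r x) + (r - s) * \<Theta> s y"
    using Vn_step[OF q(4), of y] le[of s y] s0 q by simp
  qed
 qed
 then show ?thesis using assms by auto
qed

text \<open>Stopping now instead of waiting can gain at most the expected downward displacement,
  which \<open>K_mean\<close> gives exactly and \<open>R\<close> bounds.\<close>

lemma payoff_excess: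
 assumes s: "0 <= s" "s < r" "r < 1"
 shows "y <= (LINT x|K s y r. Vn n r x) + (r - s) * (R s y / (1 - r))"
proof -
 have "\<bar>h s y - y\<bar> <= 1 + (h s y - y)^2"
  using zero_le_power2[of "\<bar>h s y - y\<bar> - 1"] zero_le_power2[of "h s y - y"] by (simp add: power2_eq_square algebra_simps)
 also have "... <= R s y"
 proof -
  have "0 <= var s y" by (simp add: var_def)
  then show ?thesis using \<rho>_eq_var[of s y] s by (simp add: R_def)
 qed
 finally have "(r - s) * (\<bar>h s y - y\<bar> / (1 - s)) <= (r - s) * (R s y / (1 - r))"
  using s R_nonneg[of s y] by (intro mult_left_mono frac_le) auto
 moreover have "(r - s) / (1 - s) * (h s y - y) \<ge> - ((r - s) * (\<bar>h s y - y\<bar> / (1 - s)))"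
 proof -
  have "(r - s) / (1 - s) * (- \<bar>h s y - y\<bar>) <= (r - s) / (1 - s) * (h s y - y)"
   using s by (intro mult_left_mono) auto
  then show ?thesis by simp
 qed
 moreover have "(LINT x|K s y r. x) <= (LINT x|K s y r. Vn n r x)"
  using Vn_ge[of r _ n] s by (intro K_mono[OF s tame_id tame_Vn]) auto
 moreover have "y <= I + C" if "B <= C" "- B <= D" "m <= I" "m = y + D" for B C D I m :: real
  using that by linarith
 ultimately show ?thesis using K_mean[OF s, of y] by blast
qed

lemma V_le_K_grid:
 assumes "grid n r" "r < 1" "0 <= s" "s < r"
 shows "V s y <= (LINT x|K s y r. V r x) + (r - s) * (R s y / (1 - r))"
proof (rule LIMSEQ_le[OF Vn_tendsto(1)])
 show "(%m. (LINT x|K s y r. Vn m r x) + (r - s) * (R s y / (1 - r))) \<longlonglongrightarrow> (LINT x|K s y r. V r x) + (r - s) * (R s y / (1 - r))"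
  using assms by (intro tendsto_add K_Vn_tendsto tendsto_const) auto
 show "\<exists>N. \<forall>m\<ge>N. Vn m s y <= (LINT x|K s y r. Vn m r x) + (r - s) * (R s y / (1 - r))"
 proof (intro exI[of _ n] allI impI)
  fix m assume "n <= m"
  show "Vn m s y <= (LINT x|K s y r. Vn m r x) + (r - s) * (R s y / (1 - r))"
  proof (rule Vn_excess[where \<Theta> = "%s y. R s y / (1 - r)"])
   show "grid m r" by (rule grid_mono[OF assms(1) \<open>n <= m\<close>])
   show "0 <= R s' y / (1 - r)" if "s <= s'" "s' < r" for s' y using that assms R_nonneg[of s' y] by simp
   show "tame (%y. R s' y / (1 - r))" if "s <= s'" "s' < r" for s'
    using tame_cmult[OF tame_R[of s'], of "1 / (1 - r)"] that assms by simp
   show "(LINT x|K s' y q. R q x / (1 - r)) <= R s' y / (1 - r)" if "s <= s'" "s' < q" "q < r" for s' q y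
    using K_R_le[of s' q y] that assms by (simp add: divide_right_mono)
   show "y <= (LINT x|K s' y r. Vn m r x) + (r - s') * (R s' y / (1 - r))" if "s <= s'" "s' < r" for s' y
    using that assms by (intro payoff_excess) auto
  qed (use assms in auto)
 qed
qed (use assms in auto)

text \<open>A grid time q slightly after r is interposed: \<open>V_le_K_grid\<close> bounds
  \<open>V r\<close> by the kernel average of \<open>V q\<close> up to an error that vanishes as q
  approaches r, and superharmonicity up to q is known.\<close>

lemma V_superharmonic:
 assumes s: "0 <= s" "s < r" "r < 1"
 shows "(LINT y|K s z r. V r y) <= V s z"
proof (rule field_le_epsilon)
 fix e :: real assume e: "0 < e"
 define c where "c = R s z / (1 - (1 + r) / 2)"
 have c0: "0 <= c" unfolding c_def using s R_nonneg[of s z] by simp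
 \<comment> \<open>Keeps q below (1 + r) / 2, where c bounds the error rate, and makes the error at
   most e.\<close>
 define d where "d = min ((1 - r) / 2) (e / (c + 1))"
 have d: "0 < d" using s e c0 by (simp add: d_def)
 obtain n q where q: "grid n q" "r < q" "q < r + d" using grid_dense[of r "r + d"] d by auto
 have "d <= (1 - r) / 2" "d <= e / (c + 1)" by (simp_all only: d_def min.cobounded1 min.cobounded2)
 moreover have "r + (1 - r) / 2 = (1 + r) / 2" by (simp add: field_simps)
 ultimately have qb: "q < (1 + r) / 2" "q - r <= e / (c + 1)" using q by linarith+
 have q1: "q < 1" "0 <= r" "r < 1" "0 <= q" using qb q s by auto
 have tq: "tame (V q)" using q1 by (intro tame_V) auto
 have "(LINT y|K s z r. V r y) <= (LINT y|K s z r. (LINT x|K r y q. V q x) + (q - r) * (1 / (1 - q)) * R r y)"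
 proof (rule K_mono[OF s])
  show "tame (%y. (LINT x|K r y q. V q x) + (q - r) * (1 / (1 - q)) * R r y)"
   using q1 q by (intro tame_add tame_cmult tame_R tame_K tq) auto
  show "V r y <= (LINT x|K r y q. V q x) + (q - r) * (1 / (1 - q)) * R r y" for y
   using V_le_K_grid[OF q(1) q1(1) q1(2) q(2), of y] by simp
 qed (use tame_V q1 in auto)
 also have "... = (LINT x|K s z q. V q x) + (q - r) * (1 / (1 - q)) * (LINT y|K s z r. R r y)"
  using integrable_K_tame[OF s tame_K[OF q1(2) q(2) q1(1) tq]] integrable_K_tame[OF s tame_R[OF q1(2,3)]] K_K[OF s(1,2) q(2) q1(1) tq] by simp
 also have "... <= V s z + e"
 proof (rule add_mono)
  show "(LINT x|K s z q. V q x) <= V s z" using q s q1 by (intro V_superharmonic_grid) auto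
  have "(q - r) * (1 / (1 - q)) * (LINT y|K s z r. R r y) <= (q - r) * (1 / (1 - q)) * R s z"
   using q q1 by (intro mult_left_mono K_R_le[OF s]) auto
  also have "... = (q - r) * (R s z / (1 - q))" by simp
  also have "... <= (e / (c + 1)) * c"
   unfolding c_def[symmetric] using qb q q1 s R_nonneg[of s z] e c0 by (intro mult_mono) (auto simp: c_def intro!: frac_le)
  also have "... <= e" using c0 e by (simp add: divide_le_eq)
  finally show "(q - r) * (1 / (1 - q)) * (LINT y|K s z r. R r y) <= e" .
 qed
 finally show "(LINT y|K s z r. V r y) <= V s z + e" .
qed

end

section \<open>Continuity of the value function and its defect from harmonicity\<close>

lemma heat_dominate:
 assumes s: "0 <= s" "s <= r'" "r' < r" and z: "\<bar>z\<bar> <= b"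
 shows "heat (r - s) (y - z) <= exp (b^2 / (2 * r)) * sqrt (r / (r - r')) * (heat r (y - b) + heat r (y + b))"
proof -
 have r: "0 < r" using s by simp
 have 1: "exp (- (y - z)\<^sup>2 / (2 * (r - s))) <= exp (- (y - z)\<^sup>2 / (2 * r))"
  using s by (auto intro!: divide_left_mono mult_pos_pos)
 have 2: "heat (r - s) (y - z) <= exp (- (y - z)\<^sup>2 / (2 * r)) / sqrt (2 * pi * (r - r'))"
  using s 1 by (subst heat_eq) (auto intro!: frac_le)
 have "y * z <= \<bar>y\<bar> * b"
 proof -
  have "y * z <= \<bar>y\<bar> * \<bar>z\<bar>" by (simp add: abs_mult[symmetric])
  also have "... <= \<bar>y\<bar> * b" using z by (intro mult_left_mono) auto
  finally show ?thesis .
 qed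
 moreover have "0 <= z\<^sup>2" by simp
 moreover have "(y - z)\<^sup>2 = y^2 - 2 * (y * z) + z^2" "(\<bar>y\<bar> - b)\<^sup>2 - b\<^sup>2 = y^2 - 2 * (\<bar>y\<bar> * b)"
  by (simp_all add: power2_diff)
 ultimately have "(\<bar>y\<bar> - b)\<^sup>2 - b\<^sup>2 <= (y - z)\<^sup>2" by linarith
 then have "- (y - z)\<^sup>2 / (2 * r) <= b\<^sup>2 / (2 * r) + - (\<bar>y\<bar> - b)\<^sup>2 / (2 * r)"
  using r by (simp add: divide_simps)
 then have "exp (- (y - z)\<^sup>2 / (2 * r)) <= exp (b^2 / (2 * r)) * exp (- (\<bar>y\<bar> - b)\<^sup>2 / (2 * r))"
  by (simp only: exp_add[symmetric] exp_le_cancel_iff)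
 also have "... <= exp (b^2 / (2 * r)) * (exp (- (y - b)\<^sup>2 / (2 * r)) + exp (- (y + b)\<^sup>2 / (2 * r)))"
 proof (intro mult_left_mono)
  have "(\<bar>y\<bar> - b)\<^sup>2 = (y - b)^2 \<or> (\<bar>y\<bar> - b)\<^sup>2 = (y + b)^2"
   by (cases "0 <= y") (auto simp: power2_eq_square algebra_simps)
  then show "exp (- (\<bar>y\<bar> - b)\<^sup>2 / (2 * r)) <= exp (- (y - b)\<^sup>2 / (2 * r)) + exp (- (y + b)\<^sup>2 / (2 * r))"
   by (elim disjE) (simp_all add: add_increasing add_increasing2)
 qed simp
 finally have "exp (- (y - z)\<^sup>2 / (2 * r)) / sqrt (2 * pi * (r - r')) <=
   exp (b^2 / (2 * r)) * (exp (- (y - b)\<^sup>2 / (2 * r)) + exp (- (y + b)\<^sup>2 / (2 * r))) / sqrt (2 * pi * (r - r'))"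
  using s by (intro divide_right_mono) auto
 also have "... = exp (b^2 / (2 * r)) * sqrt (r / (r - r')) * (heat r (y - b) + heat r (y + b))"
 proof -
  have "sqrt (2 * pi * r) = sqrt (r / (r - r')) * sqrt (2 * pi * (r - r'))"
   using s r by (simp flip: real_sqrt_mult)
  then have "1 / sqrt (2 * pi * (r - r')) = sqrt (r / (r - r')) / sqrt (2 * pi * r)"
   using s r by (simp add: divide_simps)
  then have e: "x / sqrt (2 * pi * (r - r')) = sqrt (r / (r - r')) * (x / sqrt (2 * pi * r))" for x
   by (metis (no_types, opaque_lifting) mult.commute mult.right_neutral times_divide_eq_left times_divide_eq_right)
  show ?thesis unfolding e using r by (simp add: heat_eq add_divide_distrib algebra_simps)
 qed
 finally show ?thesis using 2 by simp
qed

lemma dist_Pair_le: "dist (a, b) (c, d) <= \<bar>a - c\<bar> + \<bar>b - d\<bar>" for a b c d :: real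
 using sqrt_sum_squares_le_sum_abs[of "a - c" "b - d"] by (simp add: dist_Pair_Pair dist_real_def)

context bounded_posterior
begin

text \<open>For starting points near a given one, \<open>heat_dominate\<close> bounds the heat
  kernel by two kernels centred at b and -b that run for the full time r; against these f is
  integrable, by the kernel started at time 0.\<close>

lemma continuous_K_integral:
 assumes r: "0 < r" "r < 1" and f: "tame f"
 shows "continuous_on ({0..<r} \<times> UNIV) (%p. \<integral>y. f y \<partial>K (fst p) (snd p) r)"
proof -
 have [measurable]: "f \<in> borel_measurable borel" using f by (rule tame_measurable)
 have "continuous_on ({0..<r} \<times> UNIV) (%p. \<integral>y. heat (r - fst p) (y - snd p) * (g r y * f y) \<partial>lborel)"
 proof (rule continuous_on_integral_dominated)
  show "continuous_on ({0..<r} \<times> UNIV) (%p. heat (r - fst p) (y - snd p) * (g r y * f y))" for y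
   unfolding heat_def normal_density_def by (intro continuous_intros) auto
  show "(%y. heat (r - fst p) (y - snd p) * (g r y * f y)) \<in> borel_measurable lborel" for p :: "real \<times> real"
   by measurable
  fix p :: "real \<times> real" assume "p \<in> {0..<r} \<times> UNIV"
  then obtain s0 z0 where p: "p = (s0, z0)" "0 <= s0" "s0 < r" by (cases p) auto
  define r' where "r' = (s0 + r) / 2"
  define b where "b = \<bar>z0\<bar> + 1"
  define c where "c = exp (b^2 / (2 * r)) * sqrt (r / (r - r'))"
  have r': "s0 < r'" "r' < r" using p by (auto simp: r'_def)
  have iw: "integrable lborel (%y. heat r (y - x) * (g r y * \<bar>f y\<bar>))" for x
  proof -
   have g0: "0 < g 0 x" by (rule g_pos) auto
   have "integrable (K 0 x r) (%y. \<bar>f y\<bar>)" using integrable_K_tame[OF order_refl r f, of x] by simp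
   then have "integrable lborel (%y. g 0 x * (ker 0 x r y * \<bar>f y\<bar>))" by (subst (asm) integral_K(2)) auto
   moreover have "g 0 x * (ker 0 x r y * \<bar>f y\<bar>) = heat r (y - x) * (g r y * \<bar>f y\<bar>)" for y
    using g0 by (simp add: ker_def)
   ultimately show ?thesis by simp
  qed
  show "\<exists>e>0. \<exists>w. integrable lborel w \<and> (\<forall>q\<in>{0..<r} \<times> UNIV. dist q p < e --> (\<forall>y\<in>space lborel. norm (heat (r - fst q) (y - snd q) * (g r y * f y)) <= w y))"
  proof (intro exI conjI ballI impI)
   show "0 < min 1 (r' - s0)" using r' by simp
   show "integrable lborel (%y. c * (heat r (y - b) * (g r y * \<bar>f y\<bar>) + heat r (y - (- b)) * (g r y * \<bar>f y\<bar>)))"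
    by (intro integrable_mult_right Bochner_Integration.integrable_add iw)
   fix q :: "real \<times> real" and y assume q: "q \<in> {0..<r} \<times> UNIV" "dist q p < min 1 (r' - s0)"
   have "\<bar>fst q - s0\<bar> < r' - s0" "\<bar>snd q - z0\<bar> < 1"
    using q dist_fst_le[of q p] dist_snd_le[of q p] by (auto simp: p dist_real_def)
   then have "heat (r - fst q) (y - snd q) <= c * (heat r (y - b) + heat r (y + b))"
    unfolding c_def using q r' by (intro heat_dominate) (auto simp: b_def)
   then have "heat (r - fst q) (y - snd q) * (g r y * \<bar>f y\<bar>) <= c * (heat r (y - b) + heat r (y + b)) * (g r y * \<bar>f y\<bar>)"
    using g_nonneg by (intro mult_right_mono) auto
   then show "norm (heat (r - fst q) (y - snd q) * (g r y * f y)) <= c * (heat r (y - b) * (g r y * \<bar>f y\<bar>) + heat r (y - (- b)) * (g r y * \<bar>f y\<bar>))"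
    using g_nonneg[of r y] by (simp add: abs_mult algebra_simps)
  qed
 qed
 then have "continuous_on ({0..<r} \<times> UNIV) (%p. (LINT y|lborel. heat (r - fst p) (y - snd p) * (g r y * f y)) / g (fst p) (snd p))"
 proof (intro continuous_intros)
  show "continuous_on ({0..<r} \<times> UNIV) (%p. g (fst p) (snd p))"
   using r by (intro continuous_on_subset[OF continuous_g]) auto
  show "\<forall>p\<in>{0..<r} \<times> UNIV. g (fst p) (snd p) ~= 0"
  proof
   fix p :: "real \<times> real" assume "p \<in> {0..<r} \<times> UNIV"
   then show "g (fst p) (snd p) ~= 0" using g_pos[of "fst p" "snd p"] r by auto
  qed
 qed
 moreover have "(LINT y|lborel. heat (r - fst p) (y - snd p) * (g r y * f y)) / g (fst p) (snd p) = (LINT y|K (fst p) (snd p) r. f y)" for p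
 proof -
  have "(LINT y|K (fst p) (snd p) r. f y) = (LINT y|lborel. heat (r - fst p) (y - snd p) * (g r y * f y) / g (fst p) (snd p))"
   by (subst integral_K) (auto simp: ker_def mult.assoc)
  then show ?thesis by simp
 qed
 ultimately show ?thesis by simp
qed

lemma R_le: "\<rho> s z <= C * (1 + z^2) ==> 0 <= s ==> R s z <= 2 + C * (1 + z^2)"
 by (simp add: R_def)

text \<open>Locally V differs by a uniformly small amount from the kernel average of V at a slightly
  later grid time, and that average is continuous.\<close>

lemma continuous_V: "continuous_on ({0..<1} \<times> UNIV) (%p. V (fst p) (snd p))"
 unfolding continuous_on_iff
proof (intro ballI allI impI)
 fix p :: "real \<times> real" and e :: real assume "p \<in> {0..<1} \<times> UNIV" and e: "0 < e"
 then obtain s0 z0 where p: "p = (s0, z0)" "0 <= s0" "s0 < 1" by (cases p) auto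
 define T where "T = (1 + s0) / 2"
 have T: "s0 < T" "T < 1" using p by (auto simp: T_def)
 obtain C where C: "0 <= C" "!!s z. 0 <= s ==> s <= T ==> \<rho> s z <= C * (1 + z^2)" using \<rho>_growth[OF T(2)] by blast
 define B where "B = 2 + C * (1 + (\<bar>z0\<bar> + 1)^2)"
 have B: "0 < B" using C by (simp add: B_def add_pos_nonneg)
 \<comment> \<open>Allows an error of 2 * e / 7 at either point; together with e / 3 for the kernel
   average the total stays below e.\<close>
 define \<eta> where "\<eta> = min (T - s0) (e * (1 - T) / (7 * B))"
 have \<eta>: "0 < \<eta>" "\<eta> <= T - s0" "\<eta> <= e * (1 - T) / (7 * B)" unfolding \<eta>_def using T e B by auto
 obtain n r where r: "grid n r" "s0 < r" "r < s0 + \<eta>" using grid_dense[of s0 "s0 + \<eta>"] \<eta> by auto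
 have r1: "r < T" "r < 1" "0 < r" using r \<eta> T p by auto
 define \<psi> where "\<psi> q = (LINT y|K (fst q) (snd q) r. V r y)" for q
 have "continuous_on ({0..<r} \<times> UNIV) \<psi>" unfolding \<psi>_def using r1 by (intro continuous_K_integral tame_V) auto
 moreover have pr: "p \<in> {0..<r} \<times> UNIV" using p r by auto
 ultimately obtain d1 where d1: "0 < d1" "!!q. q \<in> {0..<r} \<times> UNIV ==> dist q p < d1 ==> dist (\<psi> q) (\<psi> p) < e / 3"
  unfolding continuous_on_iff using e by (metis zero_less_divide_iff zero_less_numeral)
 have close: "0 <= V s z - \<psi> (s, z) \<and> V s z - \<psi> (s, z) <= 2 * e / 7" if "0 <= s" "s < r" "\<bar>s - s0\<bar> < \<eta>" "\<bar>z - z0\<bar> < 1" for s z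
 proof -
  have "\<psi> (s, z) <= V s z" unfolding \<psi>_def using that r1 by (simp add: V_superharmonic)
  moreover have "V s z - \<psi> (s, z) <= (r - s) * (R s z / (1 - r))"
   using V_le_K_grid[OF r(1) r1(2) that(1,2), of z] by (simp add: \<psi>_def)
  moreover have "(r - s) * (R s z / (1 - r)) <= (2 * \<eta>) * (B / (1 - T))"
  proof (rule mult_mono)
   have "z\<^sup>2 <= (\<bar>z0\<bar> + 1)\<^sup>2" using that by (intro abs_le_square_iff[THEN iffD1]) auto
   then have "C * (1 + z^2) <= C * (1 + (\<bar>z0\<bar> + 1)^2)" using C by (intro mult_left_mono) auto
   then have "R s z <= B" using R_le[OF C(2)[of s z]] that r1 unfolding B_def by simp
   then show "R s z / (1 - r) <= B / (1 - T)" using that r1 T R_nonneg[of s z] B by (intro frac_le) auto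
  qed (use that r r1 R_nonneg[of s z] \<eta> in auto)
  moreover have "(2 * \<eta>) * (B / (1 - T)) <= 2 * e / 7"
   using \<eta>(3) B T by (simp add: field_simps)
  ultimately show ?thesis by (meson order_trans diff_ge_0_iff_ge)
 qed
 show "\<exists>d>0. \<forall>q\<in>{0..<1} \<times> UNIV. dist q p < d --> dist (V (fst q) (snd q)) (V (fst p) (snd p)) < e"
 proof (intro exI[of _ "min (min d1 1) (min (r - s0) \<eta>)"] conjI ballI impI)
  show "0 < min (min d1 1) (min (r - s0) \<eta>)" using d1 r \<eta> by simp
  fix q :: "real \<times> real" assume q: "q \<in> {0..<1} \<times> UNIV" "dist q p < min (min d1 1) (min (r - s0) \<eta>)"
  have sz: "\<bar>fst q - s0\<bar> < r - s0" "\<bar>fst q - s0\<bar> < \<eta>" "\<bar>snd q - z0\<bar> < 1"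
   using q dist_fst_le[of q p] dist_snd_le[of q p] by (auto simp: p dist_real_def)
  have "q \<in> {0..<r} \<times> UNIV" using q sz by (cases q) auto
  then have 1: "\<bar>\<psi> q - \<psi> p\<bar> < e / 3" using d1(2)[of q] q by (simp add: dist_real_def)
  have 2: "0 <= V (fst q) (snd q) - \<psi> q \<and> V (fst q) (snd q) - \<psi> q <= 2 * e / 7"
   using close[of "fst q" "snd q"] q sz by (cases q) auto
  have 3: "0 <= V s0 z0 - \<psi> p \<and> V s0 z0 - \<psi> p <= 2 * e / 7"
   using close[of s0 z0] p r \<eta> by auto
  have "\<bar>V (fst q) (snd q) - V s0 z0\<bar> < e" using 1 2 3 e by linarith
  then show "dist (V (fst q) (snd q)) (V (fst p) (snd p)) < e" by (simp add: dist_real_def p)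
 qed
qed

text \<open>Near y0 waiting beats stopping, so stopping pays only after the path has moved a
  distance \<eta> away. There the rate of gain is at most a multiple of the squared displacement,
  whose mean over [s, r] is of order r - s; the second factor r - s is the time left.\<close>

lemma local_harmonic:
 assumes s0: "0 <= s0" "s0 < 1" and gt: "y0 < V s0 y0"
 obtains A \<eta> where "0 <= A" "0 < \<eta>" "s0 + \<eta> < 1"
  "!!s y r. 0 <= s ==> \<bar>s - s0\<bar> < \<eta> ==> \<bar>y - y0\<bar> < \<eta> ==> s < r ==> r < s0 + \<eta> ==> V s y - (LINT x|K s y r. V r x) <= A * (r - s)^2"
proof -
 define B0 where "B0 = R s0 y0 / (1 - (1 + s0) / 2)"
 have B0: "0 <= B0" using s0 R_nonneg[of s0 y0] by (simp add: B0_def)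
 \<comment> \<open>Waiting from s0 until rr costs at most d0 * B0, no more than half the gain V s0
   y0 - y0, so the average of V at rr still exceeds y0.\<close>
 define d0 where "d0 = min ((1 - s0) / 2) ((V s0 y0 - y0) / (2 * (B0 + 1)))"
 have d0': "d0 <= (1 - s0) / 2" "d0 <= (V s0 y0 - y0) / (2 * (B0 + 1))"
  by (simp_all only: d0_def min.cobounded1 min.cobounded2)
 have "0 < d0" using s0 gt B0 by (simp add: d0_def)
 note d0 = this d0'
 obtain n0 rr where rr: "grid n0 rr" "s0 < rr" "rr < s0 + d0" using grid_dense[of s0 "s0 + d0"] d0 by auto
 have "s0 + (1 - s0) / 2 = (1 + s0) / 2" by (simp add: field_simps)
 then have r1: "rr < (1 + s0) / 2" using rr d0 s0 by linarith
 moreover have "0 < rr" using rr s0 by linarith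
 moreover have "rr < 1" using r1 s0 by (simp add: field_simps)
 ultimately have r1: "rr < (1 + s0) / 2" "rr < 1" "0 < rr" by auto
 have "V s0 y0 <= (LINT x|K s0 y0 rr. V rr x) + (rr - s0) * (R s0 y0 / (1 - rr))"
  by (rule V_le_K_grid[OF rr(1) r1(2) s0(1) rr(2)])
 moreover have "(rr - s0) * (R s0 y0 / (1 - rr)) <= d0 * B0"
  unfolding B0_def using rr r1 s0 R_nonneg[of s0 y0] by (intro mult_mono frac_le) auto
 moreover have "2 * (d0 * B0) <= V s0 y0 - y0"
 proof -
  have "d0 * B0 <= (V s0 y0 - y0) / (2 * (B0 + 1)) * (B0 + 1)" using d0 B0 gt by (intro mult_mono) auto
  moreover have "2 * ((V s0 y0 - y0) / (2 * (B0 + 1)) * (B0 + 1)) = V s0 y0 - y0" using B0 by (simp add: field_simps)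
  ultimately show ?thesis by linarith
 qed
 ultimately have "y0 < (LINT x|K s0 y0 rr. V rr x)" using gt by linarith
 with K_Vn_tendsto[OF s0(1) rr(2) r1(2), of y0] have "\<forall>\<^sub>F n in sequentially. y0 < (LINT x|K s0 y0 rr. Vn n rr x)"
  by (rule order_tendstoD(1))
 \<comment> \<open>One finite level N is fixed, so that a single continuous function \<psi>
   certifies the strict inequality on a whole neighbourhood, and by monotonicity for all levels
   beyond N.\<close>
 then obtain N1 where N1: "!!n. N1 <= n ==> y0 < (LINT x|K s0 y0 rr. Vn n rr x)" by (auto simp: eventually_sequentially)
 define N where "N = max n0 N1"
 have gN: "grid m rr" if "N <= m" for m using that grid_mono[OF rr(1)] by (simp add: N_def)
 define \<psi> where "\<psi> q = (LINT x|K (fst q) (snd q) rr. Vn N rr x) - snd q" for q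
 have "continuous_on ({0..<rr} \<times> UNIV) \<psi>"
  unfolding \<psi>_def using r1 by (intro continuous_intros continuous_K_integral tame_Vn) auto
 moreover have "(s0, y0) \<in> {0..<rr} \<times> UNIV" using rr s0 by auto
 moreover have \<psi>0: "0 < \<psi> (s0, y0)" using N1[of N] by (simp add: \<psi>_def N_def)
 ultimately obtain d where d: "0 < d" "!!q. q \<in> {0..<rr} \<times> UNIV ==> dist q (s0, y0) < d ==> dist (\<psi> q) (\<psi> (s0, y0)) < \<psi> (s0, y0)"
  unfolding continuous_on_iff by metis
 define \<eta> where "\<eta> = min (d / 4) ((rr - s0) / 2)"
 have \<eta>: "0 < \<eta>" "4 * \<eta> <= d" "\<eta> <= (rr - s0) / 2" "s0 + \<eta> < rr" unfolding \<eta>_def using d rr by (auto simp: field_simps min_def)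
 have above: "y < (LINT x|K s y rr. Vn N rr x)" if "0 <= s" "\<bar>s - s0\<bar> < \<eta>" "\<bar>y - y0\<bar> < 2 * \<eta>" for s y
 proof -
  have "dist (s, y) (s0, y0) < d" using dist_Pair_le[of s y s0 y0] that \<eta> by linarith
  then have "dist (\<psi> (s, y)) (\<psi> (s0, y0)) < \<psi> (s0, y0)" using that \<eta> by (intro d(2)) auto
  then have "0 < \<psi> (s, y)" by (simp add: dist_real_def abs_less_iff)
  then show ?thesis by (simp add: \<psi>_def)
 qed
 obtain C where C: "0 <= C" "!!s z. 0 <= s ==> s <= rr ==> \<rho> s z <= C * (1 + z^2)" using \<rho>_growth[OF r1(2)] by blast
 define q where "q = 1 / (1 - rr)"
 have q: "0 < q" using r1 by (simp add: q_def)
 define Y where "Y = \<bar>y0\<bar> + \<eta>"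
 \<comment> \<open>At distance at least \<eta> from y, the bound 2 + C * (1 + x^2) on
   \<open>R\<close> is absorbed into a multiple of (x - y)^2; the factor q bounds 1 / (1 -
   r).\<close>
 define A where "A = ((2 + C * (1 + 2 * Y^2)) / \<eta>\<^sup>2 + 2 * C) * q"
 have A0: "0 <= A" using C q by (simp add: A_def)
 \<comment> \<open>The growth rate of the mean of (x - y)^2 under the kernel, as derived in
   \<open>m2\<close>.\<close>
 define C1 where "C1 = q + q * (1 + q) * (C * (3 + 2 * Y^2)) + 1"
 have C10: "0 <= C1" using C q by (simp add: C1_def)
 have dyadic: "V s y - (LINT x|K s y r. V r x) <= A * exp C1 * C1 * (r - s)^2"
  if st: "0 <= s" "\<bar>s - s0\<bar> < \<eta>" "\<bar>y - y0\<bar> < \<eta>" "s < r" "r < s0 + \<eta>" and gr: "grid m0 r" for s y r m0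
 proof -
  \<comment> \<open>The squared displacement from y, corrected in time to be a supermartingale. At
    the starting point x = y, s' = s it is of order r - s, so the excess
    \<open>(r - s) * \<Theta> s y\<close> is quadratic.\<close>
  define \<Theta> where "\<Theta> s' x = A * exp (C1 * (r - s')) * ((x - y)^2 + C1 * (r - s'))" for s' x
  have rb: "r < rr" "r < 1" "0 < r" using st \<eta> r1 by auto
  have yY: "\<bar>y\<bar> <= Y" using st by (auto simp: Y_def)
  have y2: "x\<^sup>2 <= 2 * (x - y)^2 + 2 * Y^2" for x
  proof -
   have "0 <= ((x - y) - y)\<^sup>2" by simp
   then have "x\<^sup>2 <= 2 * (x - y)^2 + 2 * y^2" by (simp add: power2_eq_square algebra_simps)
   moreover have "y\<^sup>2 <= Y\<^sup>2" using yY by (intro abs_le_square_iff[THEN iffD1]) auto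
   ultimately show ?thesis by simp
  qed
  have \<Theta>t: "tame (\<Theta> s')" for s'
   unfolding \<Theta>_def[abs_def] by (intro tame_cmult tame_add tame_sq tame_const)
  have \<Theta>s: "(LINT x|K s' x0 s''. \<Theta> s'' x) <= \<Theta> s' x0" if "s <= s'" "s' < s''" "s'' < r" for s' s'' x0
  proof -
   have s': "0 <= s'" "s' < s''" "s'' < 1" "s' <= rr" using that st rb by auto
   interpret Kp: prob_space "K s' x0 s''" by (rule prob_space_K[OF s'(1-3)])
   let ?dl = "s'' - s'" and ?a = "(s'' - s') / (1 - s')" and ?D = "(x0 - y)\<^sup>2"
   have a: "0 <= ?a" "?a <= q * ?dl" "?a <= q"
   proof -
    show "0 <= ?a" using s' by simp
    have "?a <= ?dl / (1 - rr)" using s' r1 by (intro divide_left_mono) auto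
    then show aq: "?a <= q * ?dl" by (simp add: q_def)
    have "q * ?dl <= q * 1" using s' q by (intro mult_left_mono) auto
    then show "?a <= q" using aq by simp
   qed
   have \<rho>b: "\<rho> s' x0 <= C * (3 + 2 * Y^2) * (1 + ?D)"
   proof -
    have "\<rho> s' x0 <= C * (1 + x0^2)" using C(2)[of s' x0] s' by simp
    also have "... <= C * ((3 + 2 * Y^2) * (1 + ?D))"
    proof (rule mult_left_mono[OF _ C(1)])
     have "0 <= Y\<^sup>2 * ?D" by simp
     moreover have "(3 + 2 * Y^2) * (1 + ?D) = 3 + 3 * ?D + 2 * Y^2 + 2 * (Y^2 * ?D)" by (simp add: algebra_simps)
     moreover have "0 <= ?D" by simp
     ultimately show "1 + x0^2 <= (3 + 2 * Y^2) * (1 + ?D)" using y2[of x0] by linarith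
    qed
    finally show ?thesis by simp
   qed
   have hb: "2 * (x0 - y) * (h s' x0 - x0) <= ?D + \<rho> s' x0"
   proof -
    have "0 <= ((x0 - y) - (h s' x0 - x0))\<^sup>2" by simp
    then have "2 * (x0 - y) * (h s' x0 - x0) <= ?D + (h s' x0 - x0)^2" by (simp add: power2_eq_square algebra_simps)
    moreover have "0 <= var s' x0" by (simp add: var_def)
    ultimately show ?thesis using \<rho>_eq_var[of s' x0] s' by simp
   qed
   have m2: "(LINT x|K s' x0 s''. (x - y)\<^sup>2) <= (1 + C1 * ?dl) * ?D + C1 * ?dl"
   proof -
    have "(LINT x|K s' x0 s''. (x - y)\<^sup>2) = ?D + 2 * ?a * (x0 - y) * (h s' x0 - x0) + ?a\<^sup>2 * \<rho> s' x0 + ?dl * (1 - s'') / (1 - s')"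
     by (rule K_second_moment[OF s'(1-3)])
    also have "2 * ?a * (x0 - y) * (h s' x0 - x0) = ?a * (2 * (x0 - y) * (h s' x0 - x0))" by (simp only: mult_ac)
    also have "... <= ?a * (?D + \<rho> s' x0)" by (rule mult_left_mono[OF hb a(1)])
    also have "?dl * (1 - s'') / (1 - s') <= ?dl" using s' by (simp add: divide_le_eq)
    also have "?a\<^sup>2 * \<rho> s' x0 = ?a * (?a * \<rho> s' x0)" by (simp add: power2_eq_square)
    also have "... <= ?a * (q * \<rho> s' x0)" using a \<rho>_nonneg by (intro mult_left_mono mult_right_mono) auto
    finally have "(LINT x|K s' x0 s''. (x - y)\<^sup>2) <= ?D + ?a * (?D + (1 + q) * \<rho> s' x0) + ?dl"
     by (simp add: algebra_simps)
    also have "?a * (?D + (1 + q) * \<rho> s' x0) <= (q * ?dl) * (?D + (1 + q) * (C * (3 + 2 * Y^2) * (1 + ?D)))"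
     using a \<rho>b q \<rho>_nonneg[of s' x0] s' by (intro mult_mono add_left_mono mult_left_mono add_nonneg_nonneg mult_nonneg_nonneg) auto
    also have "?D + (q * ?dl) * (?D + (1 + q) * (C * (3 + 2 * Y^2) * (1 + ?D))) + ?dl = ?D + ?dl * (q * ?D + q * (1 + q) * (C * (3 + 2 * Y^2)) * (1 + ?D) + 1)"
     by (simp add: algebra_simps)
    also have "... <= ?D + ?dl * (C1 * (1 + ?D))"
     using s' q by (intro add_left_mono mult_left_mono) (auto simp: C1_def algebra_simps)
    finally show ?thesis by (simp add: algebra_simps)
   qed
   have "(LINT x|K s' x0 s''. \<Theta> s'' x) = A * exp (C1 * (r - s'')) * ((LINT x|K s' x0 s''. (x - y)\<^sup>2) + C1 * (r - s''))"
    unfolding \<Theta>_def using integrable_K_power(2)[OF s'(1-3), of x0 y] Kp.prob_space by simp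
   also have "... <= A * exp (C1 * (r - s'')) * ((1 + C1 * ?dl) * (?D + C1 * (r - s')))"
   proof (rule mult_left_mono)
    have "0 <= C1 * ?dl * (C1 * (r - s'))" using C10 that by simp
    then have "(1 + C1 * ?dl) * ?D + C1 * ?dl + C1 * (r - s'') <= (1 + C1 * ?dl) * (?D + C1 * (r - s'))"
     by (simp add: algebra_simps)
    then show "(LINT x|K s' x0 s''. (x - y)\<^sup>2) + C1 * (r - s'') <= (1 + C1 * ?dl) * (?D + C1 * (r - s'))" using m2 by linarith
   qed (use A0 in simp)
   also have "... <= A * exp (C1 * (r - s'')) * (exp (C1 * ?dl) * (?D + C1 * (r - s')))"
    using A0 C10 that by (intro mult_left_mono mult_right_mono exp_ge_add_one_self) auto
   also have "... = \<Theta> s' x0"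
   proof -
    have "exp (C1 * (r - s'')) * exp (C1 * ?dl) = exp (C1 * (r - s'))" by (simp add: exp_add[symmetric] algebra_simps)
    then show ?thesis by (simp add: \<Theta>_def mult.assoc[symmetric])
   qed
   finally show ?thesis .
  qed
  have Vb: "Vn m s y <= (LINT x|K s y r. Vn m r x) + (r - s) * \<Theta> s y" if m: "max m0 N <= m" for m
  proof (rule Vn_excess[where \<Theta> = \<Theta>])
   show "grid m r" using m by (intro grid_mono[OF gr]) simp
   show "0 <= \<Theta> s' x" if "s <= s'" "s' < r" for s' x unfolding \<Theta>_def using A0 C10 that by simp
   show "x <= (LINT x'|K s' x r. Vn m r x') + (r - s') * \<Theta> s' x" if s': "s <= s'" "s' < r" for s' x
   proof (cases "\<bar>x - y\<bar> < \<eta>")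
    case True
    have b: "0 <= s'" "\<bar>s' - s0\<bar> < \<eta>" "\<bar>x - y0\<bar> < 2 * \<eta>" using s' st True by auto
    have tm: "tame (Vn m rr)" "tame (Vn N rr)" using r1 by (auto intro: tame_Vn)
    \<comment> \<open>Close to y the certificate at time rr is pulled back to r by superharmonicity,
      so stopping has no excess there.\<close>
    have "x < (LINT x'|K s' x rr. Vn N rr x')" by (rule above[OF b])
    also have "... <= (LINT x'|K s' x rr. Vn m rr x')"
    proof (rule K_mono[OF b(1) _ r1(2) tm(2,1)])
     have "incseq (%n. Vn n rr x')" for x' using Vn_mono[of rr] r1 by (intro incseq_SucI) auto
     then show "Vn N rr x' <= Vn m rr x'" for x' using m by (simp add: incseq_def)
    qed (use s' rb in auto)
    also have "... = (LINT x'|K s' x r. (LINT x''|K r x' rr. Vn m rr x''))"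
     using s' rb r1 b by (intro K_K[symmetric] tm) auto
    also have "... <= (LINT x'|K s' x r. Vn m r x')"
     using s' rb r1 b m by (intro K_mono tame_K tm tame_Vn Vn_superharmonic gN) auto
    finally have "x <= (LINT x'|K s' x r. Vn m r x')" by simp
    moreover have "0 <= (r - s') * \<Theta> s' x" unfolding \<Theta>_def using A0 C10 that by simp
    ultimately show ?thesis by simp
   next
    case False
    then have e2: "\<eta>\<^sup>2 <= (x - y)\<^sup>2" using \<eta> by (intro abs_le_square_iff[THEN iffD1]) auto
    have b: "0 <= s'" "s' < 1" "s' <= rr" using s' st rb by auto
    have "R s' x <= 2 + C * (1 + x^2)" using C(2)[of s' x] b by (intro R_le) auto
    also have "... <= (2 + C * (1 + 2 * Y^2)) + 2 * C * (x - y)^2"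
     using mult_left_mono[OF y2[of x] C(1)] by (simp add: algebra_simps)
    also have "2 + C * (1 + 2 * Y^2) <= (2 + C * (1 + 2 * Y^2)) / \<eta>\<^sup>2 * (x - y)^2"
    proof -
     have c: "0 <= (2 + C * (1 + 2 * Y^2)) / \<eta>\<^sup>2" using C by simp
     have "(2 + C * (1 + 2 * Y^2)) / \<eta>\<^sup>2 * \<eta>\<^sup>2 <= (2 + C * (1 + 2 * Y^2)) / \<eta>\<^sup>2 * (x - y)^2"
      by (rule mult_left_mono[OF e2 c])
     then show ?thesis using \<eta> by simp
    qed
    finally have Rb: "R s' x <= ((2 + C * (1 + 2 * Y^2)) / \<eta>\<^sup>2 + 2 * C) * (x - y)^2" by (simp add: algebra_simps)
    have "R s' x / (1 - r) <= R s' x * q"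
     using rb r1 R_nonneg[OF b(2), of x] by (simp add: q_def frac_le)
    also have "... <= ((2 + C * (1 + 2 * Y^2)) / \<eta>\<^sup>2 + 2 * C) * (x - y)^2 * q" using q by (intro mult_right_mono Rb) auto
    also have "... = A * 1 * ((x - y)^2 + 0)" by (simp add: A_def)
    also have "... <= \<Theta> s' x"
     unfolding \<Theta>_def using A0 C10 s' by (intro mult_mono add_left_mono) auto
    finally have "(r - s') * (R s' x / (1 - r)) <= (r - s') * \<Theta> s' x" using s' by (intro mult_left_mono) auto
    then show ?thesis using payoff_excess[OF b(1) s'(2) rb(2), of x m] by simp
   qed
  qed (use st rb \<Theta>t \<Theta>s in auto)
  have "V s y <= (LINT x|K s y r. V r x) + (r - s) * \<Theta> s y"
  proof (rule LIMSEQ_le[OF Vn_tendsto(1)])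
   show "(%m. (LINT x|K s y r. Vn m r x) + (r - s) * \<Theta> s y) \<longlonglongrightarrow> (LINT x|K s y r. V r x) + (r - s) * \<Theta> s y"
    using st rb by (intro tendsto_add K_Vn_tendsto tendsto_const) auto
   show "\<exists>N'. \<forall>m\<ge>N'. Vn m s y <= (LINT x|K s y r. Vn m r x) + (r - s) * \<Theta> s y" using Vb by blast
  qed (use st rb in auto)
  moreover have "(r - s) * \<Theta> s y <= A * exp C1 * C1 * (r - s)^2"
  proof -
   have "C1 * (r - s) <= C1 * 1" using C10 st rb by (intro mult_left_mono) auto
   then have "exp (C1 * (r - s)) <= exp C1" by simp
   then have "A * exp (C1 * (r - s)) * (C1 * (r - s)) <= A * exp C1 * (C1 * (r - s))"
    using A0 C10 st by (intro mult_right_mono mult_left_mono) auto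
   then have "(r - s) * (A * exp (C1 * (r - s)) * (C1 * (r - s))) <= (r - s) * (A * exp C1 * (C1 * (r - s)))"
    using st by (intro mult_left_mono) auto
   then show ?thesis by (simp add: \<Theta>_def power2_eq_square mult_ac)
  qed
  ultimately show ?thesis by simp
 qed
 show ?thesis
 proof (rule that[of "4 * (A * exp C1 * C1)" \<eta>])
  show "0 <= 4 * (A * exp C1 * C1)" using A0 C10 by simp
  show "s0 + \<eta> < 1" using \<eta> r1 by simp
  fix s y r assume st: "0 <= s" "\<bar>s - s0\<bar> < \<eta>" "\<bar>y - y0\<bar> < \<eta>" "s < r" "r < s0 + \<eta>"
  \<comment> \<open>A dyadic time just after r, before 2 * r - s: the step at most doubles, whence
    the factor 4.\<close>
  obtain m r' where r': "grid m r'" "r < r'" "r' < min (2 * r - s) (s0 + \<eta>)"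
   using grid_dense[of r "min (2 * r - s) (s0 + \<eta>)"] st by auto
  have b: "r' < 1" "0 <= r" "r < 1" using r' st \<eta> r1 by auto
  have tr': "tame (V r')" using b r' by (intro tame_V) auto
  have "(LINT x|K s y r'. V r' x) = (LINT x|K s y r. (LINT x'|K r x r'. V r' x'))"
   using st r' b by (intro K_K[symmetric] tr') auto
  also have "... <= (LINT x|K s y r. V r x)"
   using st r' b by (intro K_mono tame_K tr' tame_V V_superharmonic) auto
  finally have "V s y - (LINT x|K s y r. V r x) <= A * exp C1 * C1 * (r' - s)^2"
   using dyadic[OF st(1-3), of r' m] r' st by simp
  also have "... <= A * exp C1 * C1 * (2 * (r - s))\<^sup>2"
   using r' st A0 C10 by (intro mult_left_mono power_mono) auto
  also have "(2 * (r - s))\<^sup>2 = 4 * (r - s)^2" by (simp only: power_mult_distrib) simp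
  finally show "V s y - (LINT x|K s y r. V r x) <= 4 * (A * exp C1 * C1) * (r - s)^2" by (simp only: mult_ac)
 qed (use \<eta> in auto)
qed

end

subsection \<open>Optional sampling and optimality\<close>

text \<open>Bounded second moments give uniform integrability, here by truncation at level k with
  error at most C / k; Fatou's lemma carries the second moment to the limit.\<close>

lemma (in prob_space) second_moment_limit:
 fixes Y :: "nat => 'a => real"
 assumes m [measurable]: "!!n. Y n \<in> borel_measurable M" "Z \<in> borel_measurable M"
  and i: "!!n. integrable M (%om. (Y n om)\<^sup>2)" and C: "!!n. (LINT om|M. (Y n om)\<^sup>2) <= C"
  and lim: "AE om in M. (%n. Y n om) \<longlonglongrightarrow> Z om"
 shows "integrable M (%om. (Z om)\<^sup>2)" "(LINT om|M. (Z om)\<^sup>2) <= C" "integrable M Z"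
  "(%n. \<integral>om. Y n om \<partial>M) \<longlonglongrightarrow> (LINT om|M. Z om)"
proof -
 have C0: "0 <= C" by (rule order_trans[OF _ C[of 0]]) simp
 have "(\<integral>\<^sup>+om. ennreal ((Z om)^2) \<partial>M) = (\<integral>\<^sup>+om. liminf (%n. ennreal ((Y n om)^2)) \<partial>M)"
 proof (rule nn_integral_cong_AE)
  show "AE om in M. ennreal ((Z om)^2) = liminf (%n. ennreal ((Y n om)^2))"
   using lim
  proof eventually_elim
   fix om assume "(%n. Y n om) \<longlonglongrightarrow> Z om"
   then have "(%n. ennreal ((Y n om)^2)) \<longlonglongrightarrow> ennreal ((Z om)^2)" by (intro tendsto_ennrealI tendsto_power)
   then show "ennreal ((Z om)^2) = liminf (%n. ennreal ((Y n om)^2))" by (intro lim_imp_Liminf[symmetric]) simp_all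
  qed
 qed
 also have "... <= liminf (%n. \<integral>\<^sup>+om. ennreal ((Y n om)^2) \<partial>M)" by (rule nn_integral_liminf) measurable
 also have "... <= liminf (%n. ennreal C)"
  using C by (intro Liminf_mono always_eventually allI) (subst nn_integral_eq_integral, auto simp: i ennreal_leI)
 also have "... = ennreal C" by (simp add: Liminf_const)
 finally have le: "(\<integral>\<^sup>+om. ennreal ((Z om)^2) \<partial>M) <= ennreal C" .
 show iZ2: "integrable M (%om. (Z om)\<^sup>2)"
  by (rule integrableI_bounded) (use le in \<open>auto simp: le_less_trans[OF le]\<close>)
 then show CZ: "(LINT om|M. (Z om)\<^sup>2) <= C"
  using le C0 by (subst (asm) nn_integral_eq_integral) auto
 show iZ: "integrable M Z" by (rule square_integrable_imp_integrable[OF m(2) iZ2])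
 have iY: "integrable M (Y n)" for n by (rule square_integrable_imp_integrable[OF m(1) i])
 define cut where "cut k x = max (- k) (min k x)" for k x :: real
 have cut_m [measurable]: "(%om. cut k (f om)) \<in> borel_measurable M" if [measurable]: "f \<in> borel_measurable M" for k f
  unfolding cut_def by measurable
 have cut_le: "\<bar>cut k x\<bar> <= \<bar>k\<bar>" for k x by (auto simp: cut_def)
 have cut_i: "integrable M (%om. cut k (f om))" if [measurable]: "f \<in> borel_measurable M" for k f
  by (rule integrable_const_bound[of _ "\<bar>k\<bar>"]) (auto simp: cut_le)
 have tail: "\<bar>x - cut k x\<bar> <= x\<^sup>2 / k" if "0 < k" for k x
 proof (cases "\<bar>x\<bar> <= k")
  case True then show ?thesis using that by (auto simp: cut_def)
 next
  case False
  then have "\<bar>x - cut k x\<bar> <= \<bar>x\<bar>" using that by (auto simp: cut_def)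
  also have "... <= \<bar>x\<bar> * (\<bar>x\<bar> / k)" using False that mult_left_mono[of 1 "\<bar>x\<bar> / k" "\<bar>x\<bar>"] by simp
  finally show ?thesis by (simp add: power2_eq_square)
 qed
 have cut_E: "\<bar>(LINT om|M. f om) - (LINT om|M. cut k (f om))\<bar> <= C / k"
  if k: "0 < k" and f: "f \<in> borel_measurable M" "integrable M f" "integrable M (%om. (f om)\<^sup>2)" "(LINT om|M. (f om)\<^sup>2) <= C" for k f
 proof -
  have "\<bar>(LINT om|M. f om) - (LINT om|M. cut k (f om))\<bar> = \<bar>\<integral>om. f om - cut k (f om) \<partial>M\<bar>"
   using f cut_i[OF f(1)] by simp
  also have "... <= (LINT om|M. \<bar>f om - cut k (f om)\<bar>)"
   using integral_norm_bound[of M "%om. f om - cut k (f om)"] by simp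
  also have "... <= (LINT om|M. (f om)\<^sup>2 / k)"
   using f cut_i[OF f(1)] tail[OF k] by (intro integral_mono) auto
  also have "... <= C / k" using f k by (simp add: divide_right_mono)
  finally show ?thesis .
 qed
 have cut_lim: "(%n. \<integral>om. cut k (Y n om) \<partial>M) \<longlonglongrightarrow> (LINT om|M. cut k (Z om))" for k
 proof (rule integral_dominated_convergence[where w = "%_. \<bar>k\<bar>"])
  show "AE om in M. (%n. cut k (Y n om)) \<longlonglongrightarrow> cut k (Z om)"
   using lim by eventually_elim (auto simp: cut_def intro!: tendsto_intros)
 qed (auto simp: cut_le)
 show "(%n. \<integral>om. Y n om \<partial>M) \<longlonglongrightarrow> (LINT om|M. Z om)"
 proof (rule tendstoI)
  fix e :: real assume e: "0 < e"
  define k where "k = 4 * (C + 1) / e"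
  have k: "0 < k" using e C0 by (simp add: k_def)
  have Ck: "C / k < e / 4" using e C0 by (simp add: k_def field_simps)
  have "eventually (%n. dist (LINT om|M. cut k (Y n om)) (LINT om|M. cut k (Z om)) < e / 2) sequentially"
   using cut_lim e by (intro tendstoD) auto
  then show "eventually (%n. dist (LINT om|M. Y n om) (LINT om|M. Z om) < e) sequentially"
  proof eventually_elim
   case (elim n)
   then show ?case using cut_E[OF k m(1) iY i C, of n] cut_E[OF k m(2) iZ iZ2 CZ] Ck
    unfolding dist_real_def by linarith
  qed
 qed
qed

lemma integrable_indicator_mult: "A \<in> sets M ==> integrable M f ==> integrable M (%x. indicator A x * f x :: real)"
 by (simp only: mult.commute[of "indicator A _"] integrable_real_mult_indicator)

context bounded_posterior
begin

text \<open>The choice c = z and eps = V s z - z in \<open>V_le\<close>. The bound vanishes in the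
  mean near time 1: close to the horizon little can be gained.\<close>

lemma V_excess_sq:
 assumes s: "0 <= s" "s < 1" shows "(V s z - z)\<^sup>2 <= 4 * \<rho> s z + 2 * (1 - s)"
proof (cases "V s z = z")
 case True then show ?thesis using s \<rho>_nonneg[of s z] by simp
next
 case False
 then have p: "0 < V s z - z" using V_ge[OF s, of z] by simp
 have F: "Fm z s z = 4 * \<rho> s z + 2 * (1 - s)" by (simp add: Fm_def msq_def \<rho>_def)
 define q where "q = Fm z s z / (V s z - z)"
 have "V s z <= z + ((V s z - z) + q) / 2" using V_le[OF s p, of z z] unfolding q_def .
 then have "V s z - z <= Fm z s z / (V s z - z)" unfolding q_def[symmetric] by (simp add: field_simps)
 then show ?thesis using p unfolding F by (simp add: pos_le_divide_eq power2_eq_square)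
qed

lemma V_sq_le:
 assumes s: "0 <= s" "s < 1" shows "(V s z)\<^sup>2 <= 6 * Fm 0 s z"
proof -
 have "(V s z)\<^sup>2 <= 2 * (V s z - z)^2 + 2 * z^2"
  using zero_le_power2[of "V s z - 2 * z"] by (simp add: power2_eq_square algebra_simps)
 also have "... <= 2 * (4 * \<rho> s z + 2 * (1 - s)) + 2 * Fm 0 s z"
  using V_excess_sq[OF s, of z] Fm_ge[OF s, of z 0] by simp
 also have "... <= 6 * Fm 0 s z" using msq_nonneg[of 0 s z] \<rho>_nonneg[of s z] s unfolding Fm_def by (simp add: algebra_simps)
 finally show ?thesis .
qed

end

section \<open>Discretised stopping times along a solution\<close>

context bridge_sde
begin

lemma X_law:
 assumes r: "t < r" "r < 1" shows "distr M borel (X r) = K t z r"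
proof (rule measure_eqI)
 fix A assume "A \<in> sets (distr M borel (X r))"
 then have A [measurable]: "A \<in> sets borel" by simp
 have [measurable]: "X r \<in> borel_measurable M" using r by (intro X_measurable) auto
 have top: "space M \<in> sets (generated_filtration M t X (t - t))"
  using sets.top[of "generated_filtration M t X (t - t)"] by simp
 have "emeasure (distr M borel (X r)) A = (\<integral>\<^sup>+om. indicator (space M) om * indicator A (X r om) \<partial>M)"
  by (subst nn_integral_indicator[symmetric], simp, subst nn_integral_distr) (auto intro!: nn_integral_cong)
 also have "... = (\<integral>\<^sup>+om. indicator (space M) om * (\<integral>\<^sup>+x. indicator A x \<partial>K t (X t om) r) \<partial>M)"
  using r by (intro markov_nn[OF _ _ _ top]) auto
 also have "... = (\<integral>\<^sup>+om. emeasure (K t z r) A \<partial>M)"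
  using X_start by (intro nn_integral_cong_AE) (auto simp: sets_K)
 also have "... = emeasure (K t z r) A" by (simp add: P.emeasure_space_1)
 finally show "emeasure (distr M borel (X r)) A = emeasure (K t z r) A" .
qed (simp add: sets_K)

lemma
 assumes r: "t <= r" "r < 1" and f: "tame f"
 shows integrable_X: "integrable M (%om. f (X r om))"
  and integral_X: "t < r ==> (LINT om|M. f (X r om)) = (LINT y|K t z r. f y)"
  and integral_X_start: "(LINT om|M. f (X t om)) = f z"
proof -
 have m [measurable]: "f \<in> borel_measurable borel" "X t \<in> borel_measurable M" "X r \<in> borel_measurable M"
  using f r t by (auto intro: X_measurable tame_measurable)
 have s: "AE om in M. f (X t om) = f z" using X_start by eventually_elim simp
 have start: "integrable M (%om. f (X t om))"
  by (subst integrable_cong_AE[OF _ _ s]) auto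
 show "integrable M (%om. f (X r om))"
 proof (cases "t = r")
  case True then show ?thesis using start by simp
 next
  case False
  then show ?thesis using integrable_K_tame[OF t(1) _ r(2) f, of z] r X_law[of r]
   by (subst integrable_distr_eq[symmetric, of _ _ borel]) auto
 qed
 show "(LINT om|M. f (X r om)) = (LINT y|K t z r. f y)" if "t < r"
  using X_law[OF that r(2)] by (subst integral_distr[symmetric, of _ _ borel]) auto
 show "(LINT om|M. f (X t om)) = f z"
  by (subst integral_cong_AE[OF _ _ s]) (auto simp: P.prob_space)
qed

lemma markov_integral:
 assumes s: "t <= s" "s < r" "r < 1" and A: "A \<in> sets (generated_filtration M t X (s - t))" and f: "tame f"
 shows "(LINT om|M. indicator A om * f (X r om)) = (LINT om|M. indicator A om * (LINT x|K s (X s om) r. f x))"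
proof -
 have s0: "0 <= s" using s t by simp
 have AM [measurable]: "A \<in> sets M" using A filtration_sets_M by auto
 have Xm [measurable]: "X r \<in> borel_measurable M" "X s \<in> borel_measurable M" using s by (auto intro: X_measurable)
 have nn: "(LINT om|M. indicator A om * f (X r om)) = (LINT om|M. indicator A om * (LINT x|K s (X s om) r. f x))"
  if f: "tame f" and f0: "!!x. 0 <= f x" for f
 proof -
  have [measurable]: "f \<in> borel_measurable borel" using f by (rule tame_measurable)
  have "(LINT om|M. indicator A om * f (X r om)) = enn2real (\<integral>\<^sup>+om. indicator A om * ennreal (f (X r om)) \<partial>M)"
   by (subst integral_eq_nn_integral) (auto simp: f0 ennreal_mult intro!: arg_cong[of _ _ enn2real] nn_integral_cong split: split_indicator)
  also have "... = enn2real (\<integral>\<^sup>+om. indicator A om * (\<integral>\<^sup>+x. ennreal (f x) \<partial>K s (X s om) r) \<partial>M)"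
   by (subst markov_nn[OF s A, of "%x. ennreal (f x)"]) auto
  also have "... = enn2real (\<integral>\<^sup>+om. ennreal (indicator A om * (LINT x|K s (X s om) r. f x)) \<partial>M)"
   by (subst nn_integral_eq_integral[OF integrable_K_tame[OF s0 s(2,3) f]])
    (auto simp: f0 intro!: arg_cong[of _ _ enn2real] nn_integral_cong split: split_indicator)
  also have "... = (LINT om|M. indicator A om * (LINT x|K s (X s om) r. f x))"
   by (subst integral_eq_nn_integral) (auto simp: f0)
  finally show ?thesis .
 qed
 obtain c where c: "!!y. \<bar>f y\<bar> <= c * (1 + y^2)" using f by (auto simp: tame_def)
 \<comment> \<open>A quadratic majorant of |f|, so that f = (f + q) - q is a difference of
   nonnegative tame functions.\<close>
 define q where "q = (%y::real. c * (1 + (y - 0)^2))"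
 have q: "tame q" unfolding q_def by (intro tame_cmult tame_add tame_const tame_sq)
 have fq: "tame (%y. f y + q y)" by (intro tame_add f q)
 have pos: "0 <= q y" "0 <= f y + q y" for y using c[of y] by (auto simp: q_def intro: order_trans[OF abs_ge_zero])
 have i1: "integrable M (%om. indicator A om * k (X r om))" if "tame k" for k
  using integrable_X[of r k] s that integrable_indicator_mult[OF AM] by simp
 have i2: "integrable M (%om. indicator A om * (LINT x|K s (X s om) r. k x))" if "tame k" for k
  using integrable_X[OF s(1) _ tame_K[OF s0 s(2,3) that]] s integrable_indicator_mult[OF AM] by simp
 have "(LINT om|M. indicator A om * f (X r om)) = (LINT om|M. indicator A om * (f (X r om) + q (X r om)) - indicator A om * q (X r om))"
  by (intro Bochner_Integration.integral_cong) (auto simp: algebra_simps)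
 also have "... = (LINT om|M. indicator A om * (f (X r om) + q (X r om))) - (LINT om|M. indicator A om * q (X r om))"
  by (rule Bochner_Integration.integral_diff[OF i1[OF fq] i1[OF q]])
 also have "... = (LINT om|M. indicator A om * (LINT x|K s (X s om) r. f x + q x)) - (LINT om|M. indicator A om * (LINT x|K s (X s om) r. q x))"
  unfolding nn[OF fq pos(2)] nn[OF q pos(1)] ..
 also have "... = (LINT om|M. indicator A om * (LINT x|K s (X s om) r. f x + q x) - indicator A om * (LINT x|K s (X s om) r. q x))"
  by (rule Bochner_Integration.integral_diff[symmetric, OF i2[OF fq] i2[OF q]])
 also have "... = (LINT om|M. indicator A om * (LINT x|K s (X s om) r. f x))"
  by (intro Bochner_Integration.integral_cong) (auto simp: algebra_simps Bochner_Integration.integral_add[OF integrable_K_tame[OF s0 s(2,3) f] integrable_K_tame[OF s0 s(2,3) q]])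
 finally show ?thesis .
qed

text \<open>Stopping times in absolute time. The events {s < S} with s < 1 are the ones that the
  telescoping sums meet; for s >= 1 they are empty.\<close>

definition random_time :: "('w => real) => bool" where
 "random_time S \<longleftrightarrow> (\<forall>om\<in>space M. t <= S om \<and> S om <= 1) \<and>
  (\<forall>s. t <= s \<and> s < 1 --> {om \<in> space M. s < S om} \<in> sets (generated_filtration M t X (s - t)))"

definition part :: "nat => nat => real" where "part n k = t + (1 - t) * (real k / real (n + 2))"

text \<open>Index of the first partition point not before S, capped at n + 1 out of n + 2 so that
  the discretised time stays strictly below 1, where the kernel and V are defined.\<close>

definition steps :: "('w => real) => nat => 'w => nat" where
 "steps S n om = min (n + 1) (nat \<lceil>(S om - t) / (1 - t) * real (n + 2)\<rceil>)"

abbreviation disc :: "('w => real) => nat => 'w => real" where "disc S n om \<equiv> part n (steps S n om)"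

lemma part_ge: "t <= part n k" "0 <= part n k" and part_less: "k <= n + 1 ==> part n k < 1"
proof -
 show a: "t <= part n k" using t by (simp add: part_def)
 then show "0 <= part n k" using t by simp
 assume "k <= n + 1"
 then have "real k / real (n + 2) < 1" by simp
 then have "(1 - t) * (real k / real (n + 2)) < (1 - t) * 1" using t by (intro mult_strict_left_mono) auto
 then show "part n k < 1" by (simp add: part_def)
qed

lemma part_0 [simp]: "part n 0 = t" by (simp add: part_def)

lemma part_Suc: "part n (Suc k) - part n k = (1 - t) / real (n + 2)" "part n k < part n (Suc k)"
proof -
 have "real (Suc k) / real (n + 2) = real k / real (n + 2) + 1 / real (n + 2)" by (simp add: add_divide_distrib)
 then show a: "part n (Suc k) - part n k = (1 - t) / real (n + 2)" unfolding part_def by (simp only: distrib_left) simp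
 have "0 < (1 - t) / real (n + 2)" using t by simp
 then show "part n k < part n (Suc k)" using a by linarith
qed

lemma steps_le: "steps S n om <= n + 1" by (simp add: steps_def)

lemma steps_iff: "k < steps S n om \<longleftrightarrow> k < n + 1 \<and> part n k < S om"
proof -
 have "k < nat \<lceil>(S om - t) / (1 - t) * real (n + 2)\<rceil> \<longleftrightarrow> real k < (S om - t) / (1 - t) * real (n + 2)"
  by (simp add: zless_nat_eq_int_zless less_ceiling_iff)
 also have "... \<longleftrightarrow> part n k < S om" using t by (simp add: part_def field_simps)
 finally show ?thesis by (simp add: steps_def)
qed

lemma disc_dist:
 assumes "random_time S" "om \<in> space M" shows "\<bar>disc S n om - S om\<bar> <= 1 / real (n + 2)"
proof -
 define x where "x = (S om - t) / (1 - t) * real (n + 2)"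
 have S: "t <= S om" "S om <= 1" using assms by (auto simp: random_time_def)
 have "(S om - t) / (1 - t) <= 1" using S t by simp
 then have "x <= 1 * real (n + 2)" unfolding x_def by (rule mult_right_mono) simp
 moreover have "0 <= x" using S t by (simp add: x_def)
 moreover have "real (nat \<lceil>x\<rceil>) = of_int \<lceil>x\<rceil>" using \<open>0 <= x\<close> by simp
 ultimately have "\<bar>real (steps S n om) - x\<bar> <= 1" unfolding steps_def x_def[symmetric] min_def
  using ceiling_correct[of x] by auto
 moreover have "disc S n om - S om = (1 - t) / real (n + 2) * (real (steps S n om) - x)"
 proof -
  have "(1 - t) / real (n + 2) * x = S om - t" using t by (simp add: x_def)
  then show ?thesis unfolding right_diff_distrib by (simp add: part_def)
 qed
 ultimately have "\<bar>disc S n om - S om\<bar> <= (1 - t) / real (n + 2) * 1"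
  using t by (simp only: abs_mult) (intro mult_mono, auto)
 also have "... <= 1 / real (n + 2)" using t by (simp add: divide_right_mono)
 finally show ?thesis .
qed

lemma disc_tendsto: "random_time S ==> om \<in> space M ==> (%n. disc S n om) \<longlonglongrightarrow> S om"
proof (rule LIM_zero_cancel, rule Lim_null_comparison)
 assume "random_time S" "om \<in> space M"
 then show "eventually (%n. norm (disc S n om - S om) <= 1 / real (n + 2)) sequentially" using disc_dist by simp
 show "(%n. 1 / real (n + 2)) \<longlonglongrightarrow> 0"
  by (intro tendsto_divide_0[OF tendsto_const] filterlim_compose[OF filterlim_real_sequentially filterlim_add_const_nat_at_top, THEN filterlim_at_top_imp_at_infinity])
qed

text \<open>A discrete Dynkin formula. Step k is taken on the event {part n k < S}, which is known
  at time part n k, so the Markov property replaces the next value by its kernel average.\<close>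

lemma disc_expectation:
 assumes S: "random_time S" and f: "!!s. 0 <= s ==> s < 1 ==> tame (f s)"
 shows "integrable M (%om. f (disc S n om) (X (disc S n om) om))"
  and "(LINT om|M. f (disc S n om) (X (disc S n om) om)) = f t z +
   (\<Sum>k<n+1. \<integral>om. indicator {om \<in> space M. part n k < S om} om *
    ((LINT x|K (part n k) (X (part n k) om) (part n (Suc k)). f (part n (Suc k)) x) - f (part n k) (X (part n k) om)) \<partial>M)"
proof -
 define F where "F k om = f (part n k) (X (part n k) om)" for k om
 define A where "A k = {om \<in> space M. part n k < S om}" for k
 define E where "E k om = (LINT x|K (part n k) (X (part n k) om) (part n (Suc k)). f (part n (Suc k)) x)" for k om
 have F: "integrable M (F k)" if "k <= n + 1" for k
  unfolding F_def using part_ge[of n k] part_less[of k n] that by (intro integrable_X f) auto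
 have A: "A k \<in> sets (generated_filtration M t X (part n k - t))" if "k < n + 1" for k
  using S part_ge[of n k] part_less[of k n] that unfolding A_def random_time_def by simp
 have AM: "A k \<in> sets M" if "k < n + 1" for k using A[OF that] filtration_sets_M by auto
 have E: "integrable M (E k)" if "k < n + 1" for k
  unfolding E_def using part_ge[of n k] part_ge[of n "Suc k"] part_less[of k n] part_less[of "Suc k" n] part_Suc[of n k] that
  by (intro integrable_X[where f = "%y. \<integral>x. f (part n (Suc k)) x \<partial>K (part n k) y (part n (Suc k))"] tame_K f) auto
 have ind: "integrable M (%om. indicator (A k) om * Y om :: real)" if "integrable M Y" "k < n + 1" for k Y
  by (rule integrable_indicator_mult[OF AM[OF that(2)] that(1)])
 have eq: "F (steps S n om) om = F 0 om + (\<Sum>k<n+1. indicator (A k) om * (F (Suc k) om - F k om))" if om: "om \<in> space M" for om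
 proof -
  have "F (steps S n om) om - F 0 om = (\<Sum>k<steps S n om. F (Suc k) om - F k om)"
   by (rule sum_lessThan_telescope[of "%k. F k om", symmetric])
  also have "... = (\<Sum>k<n+1. indicator (A k) om * (F (Suc k) om - F k om))"
  proof (rule sum.mono_neutral_cong_left)
   have ind_eq: "indicator (A k) om = (if k < steps S n om then 1 else 0 :: real)" if "k < n + 1" for k
    using steps_iff[of k S n om] that om by (simp add: A_def indicator_def)
   show "{..<steps S n om} \<subseteq> {..<n+1}" using steps_le[of S n om] by (simp only: lessThan_subset_iff)
   show "\<forall>k\<in>{..<n+1} - {..<steps S n om}. indicator (A k) om * (F (Suc k) om - F k om) = 0"
    using ind_eq by (simp del: sum.lessThan_Suc)
   fix k assume "k \<in> {..<steps S n om}"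
   then have "k < steps S n om" "k < n + 1" using steps_le[of S n om] by (auto simp only: lessThan_iff)
   then show "F (Suc k) om - F k om = indicator (A k) om * (F (Suc k) om - F k om)" using ind_eq[of k] by simp
  qed simp
  finally show ?thesis by simp
 qed
 have i: "integrable M (%om. indicator (A k) om * (F (Suc k) om - F k om))" if "k < n + 1" for k
  using that by (intro ind Bochner_Integration.integrable_diff F) auto
 have step: "(LINT om|M. indicator (A k) om * (F (Suc k) om - F k om)) = (LINT om|M. indicator (A k) om * (E k om - F k om))" if k: "k < n + 1" for k
 proof -
  have "(LINT om|M. indicator (A k) om * F (Suc k) om) = (LINT om|M. indicator (A k) om * E k om)"
   unfolding F_def E_def using part_ge[of n k] part_ge[of n "Suc k"] part_less[of k n] part_less[of "Suc k" n] part_Suc[of n k] k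
   by (intro markov_integral[OF _ _ _ A[OF k]] f) auto
  then show ?thesis using ind[OF F[of "Suc k"] k] ind[OF F[of k] k] ind[OF E[OF k] k] k
   by (simp add: right_diff_distrib)
 qed
 have isum: "integrable M (%om. \<Sum>k<n+1. indicator (A k) om * (F (Suc k) om - F k om))"
  by (intro Bochner_Integration.integrable_sum i) (simp only: lessThan_iff)
 have "integrable M (%om. F (steps S n om) om)"
  by (subst Bochner_Integration.integrable_cong[OF refl eq]) (assumption, rule Bochner_Integration.integrable_add[OF F[of 0] isum], simp)
 then show "integrable M (%om. f (disc S n om) (X (disc S n om) om))" by (simp add: F_def)
 have "(LINT om|M. F (steps S n om) om) = (LINT om|M. F 0 om + (\<Sum>k<n+1. indicator (A k) om * (F (Suc k) om - F k om)))"
  by (rule Bochner_Integration.integral_cong[OF refl eq])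
 also have "... = (LINT om|M. F 0 om) + (LINT om|M. (\<Sum>k<n+1. indicator (A k) om * (F (Suc k) om - F k om)))"
  by (rule Bochner_Integration.integral_add[OF F[of 0] isum]) simp
 also have "(LINT om|M. F 0 om) = f t z" unfolding F_def part_0 using t f by (intro integral_X_start[OF _ t(2)]) auto
 also have "(LINT om|M. (\<Sum>k<n+1. indicator (A k) om * (F (Suc k) om - F k om))) = (\<Sum>k<n+1. \<integral>om. indicator (A k) om * (F (Suc k) om - F k om) \<partial>M)"
  by (intro Bochner_Integration.integral_sum i) (simp only: lessThan_iff)
 also have "... = (\<Sum>k<n+1. \<integral>om. indicator (A k) om * (E k om - F k om) \<partial>M)"
  by (intro sum.cong refl step) (simp only: lessThan_iff)
 finally show "(LINT om|M. f (disc S n om) (X (disc S n om) om)) = f t z +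
   (\<Sum>k<n+1. \<integral>om. indicator {om \<in> space M. part n k < S om} om *
    ((LINT x|K (part n k) (X (part n k) om) (part n (Suc k)). f (part n (Suc k)) x) - f (part n k) (X (part n k) om)) \<partial>M)"
  unfolding F_def E_def A_def .
qed

lemma disc_superharmonic:
 assumes S: "random_time S" and f: "!!s. 0 <= s ==> s < 1 ==> tame (f s)"
  and super: "!!s r y. 0 <= s ==> s < r ==> r < 1 ==> (LINT x|K s y r. f r x) <= f s y"
 shows "(LINT om|M. f (disc S n om) (X (disc S n om) om)) <= f t z"
proof -
 have "(LINT om|M. indicator {om \<in> space M. part n k < S om} om *
    ((LINT x|K (part n k) (X (part n k) om) (part n (Suc k)). f (part n (Suc k)) x) - f (part n k) (X (part n k) om))) <= 0" if "k < n + 1" for k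
 proof -
  have "(LINT x|K (part n k) y (part n (Suc k)). f (part n (Suc k)) x) - f (part n k) y <= 0" for y
   using super[of "part n k" "part n (Suc k)" y] part_ge[of n k] part_ge[of n "Suc k"] part_less[of k n] part_less[of "Suc k" n] part_Suc[of n k] that by simp
  then have "(LINT om|M. - (indicator {om \<in> space M. part n k < S om} om *
    ((LINT x|K (part n k) (X (part n k) om) (part n (Suc k)). f (part n (Suc k)) x) - f (part n k) (X (part n k) om)))) \<ge> 0"
   by (intro Bochner_Integration.integral_nonneg) (auto simp: indicator_def)
  then show ?thesis by simp
 qed
 then show ?thesis using disc_expectation(2)[where f = f and n = n, OF S f]
  by (simp only:) (intro add_decreasing2 sum_nonpos, auto)
qed

end

section \<open>Stopped values, and hitting times in the raw filtration\<close>

context bridge_sde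
begin

lemma X_at_left: "AE om in M. ((%s. X s om) \<longlongrightarrow> X 1 om) (at_left 1)"
 using sol by (simp add: bridge_solution_def)

text \<open>Before time 1 paths are continuous at every sample point; only a limit at time 1 draws
  on the almost sure left limit, hence the conditional premise \<open>left\<close>.\<close>

lemma X_tendsto:
 assumes om: "om \<in> space M" and q: "!!n. t <= q n" "!!n. q n < 1" and c: "q \<longlonglongrightarrow> c" and left: "c = 1 ==> ((%s. X s om) \<longlongrightarrow> X 1 om) (at_left 1)"
 shows "(%n. X (q n) om) \<longlonglongrightarrow> X c om"
proof (cases "c = 1")
 case True
 have "filterlim q (at_left 1) sequentially"
  unfolding filterlim_at using c q(2) True by (auto simp: less_imp_neq)
 then show ?thesis using filterlim_compose[OF left[OF True]] True by blast
next
 case False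
 have "t <= c" "c <= 1" using LIMSEQ_le_const[OF c] LIMSEQ_le_const2[OF c] q less_imp_le by blast+
 then show ?thesis using False q c by (intro continuous_on_tendsto_compose[OF X_continuous[OF om]]) auto
qed

lemma random_time_measurable:
 assumes S: "random_time S" shows "S \<in> borel_measurable M"
proof (rule borel_measurable_iff_greater[THEN iffD2], rule allI)
 fix s
 consider "s < t" | "t <= s" "s < 1" | "1 <= s" by linarith
 then show "{om \<in> space M. s < S om} \<in> sets M"
 proof cases
  case 1
  then have "{om \<in> space M. s < S om} = space M" using S by (auto simp: random_time_def)
  then show ?thesis by simp
 next
  case 2 then show ?thesis using S filtration_sets_M unfolding random_time_def by blast
 next
  case 3
  then have "{om \<in> space M. s < S om} = {}" using S by (auto simp: random_time_def)
  then show ?thesis by (simp only: sets.empty_sets)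
 qed
qed

lemma disc_less: "disc S n om < 1" by (rule part_less[OF steps_le])

text \<open>A square dominated by a multiple of the supermartingale \<open>Fm\<close> has a mean
  bounded uniformly in the discretisation, as \<open>second_moment_limit\<close> requires.\<close>

lemma disc_tame:
 fixes f :: "real => real => real"
 assumes S: "random_time S" and m: "!!s. 0 <= s ==> s < 1 ==> f s \<in> borel_measurable borel"
  and F: "!!s y. 0 <= s ==> s < 1 ==> (f s y)\<^sup>2 <= c * Fm 0 s y" and c: "0 <= c"
 shows "integrable M (%om. (f (disc S n om) (X (disc S n om) om))\<^sup>2)"
  and "(LINT om|M. (f (disc S n om) (X (disc S n om) om))\<^sup>2) <= c * Fm 0 t z"
proof -
 have tf: "tame (%y. (f s y)\<^sup>2)" if s: "0 <= s" "s < 1" for s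
  using F[OF s] m[OF s] by (intro tameI[OF _ _ tame_cmult[OF tame_Fm[OF s, of 0], of c]]) auto
 show i: "integrable M (%om. (f (disc S n om) (X (disc S n om) om))\<^sup>2)"
  by (rule disc_expectation(1)[where f = "%s y. (f s y)\<^sup>2", OF S tf])
 have iF: "integrable M (%om. Fm 0 (disc S n om) (X (disc S n om) om))"
  by (rule disc_expectation(1)[where f = "Fm 0", OF S tame_Fm])
 have "(LINT om|M. (f (disc S n om) (X (disc S n om) om))\<^sup>2) <= (LINT om|M. c * Fm 0 (disc S n om) (X (disc S n om) om))"
  using i iF F part_ge(2) disc_less by (intro integral_mono) auto
 also have "... = c * (LINT om|M. Fm 0 (disc S n om) (X (disc S n om) om))" by simp
 also have "... <= c * Fm 0 t z"
  using disc_superharmonic[where f = "Fm 0", OF S tame_Fm K_Fm_le] c by (intro mult_left_mono) auto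
 finally show "(LINT om|M. (f (disc S n om) (X (disc S n om) om))\<^sup>2) <= c * Fm 0 t z" .
qed

lemma disc_measurable:
 assumes "random_time S" "!!s. 0 <= s ==> s < 1 ==> tame (f s)"
 shows "(%om. f (disc S n om) (X (disc S n om) om)) \<in> borel_measurable M"
 using disc_expectation(1)[OF assms] by simp

lemma stopped_limit:
 assumes S: "random_time S"
 shows "(%om. X (S om) om) \<in> borel_measurable M" "AE om in M. (%n. X (disc S n om) om) \<longlonglongrightarrow> X (S om) om"
proof -
 have m [measurable]: "S \<in> borel_measurable M" "X 1 \<in> borel_measurable M"
  using random_time_measurable[OF S] t by (auto intro: X_measurable)
 have [measurable]: "(%om. X (disc S n om) om) \<in> borel_measurable M" for n
  by (rule disc_measurable[where f = "%s y. y", OF S tame_id])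
 \<comment> \<open>The left limit at time 1 exists only almost surely. Replacing the path by X 1 on
   {S = 1} gives convergence at every sample point, hence measurability of the limit without
   completing M.\<close>
 define Y where "Y n om = (if S om = 1 then X 1 om else X (disc S n om) om)" for n om
 have [measurable]: "Y n \<in> borel_measurable M" for n unfolding Y_def[abs_def] by measurable
 have lim: "(%n. X (disc S n om) om) \<longlonglongrightarrow> X (S om) om"
  if "om \<in> space M" "S om = 1 ==> ((%s. X s om) \<longlongrightarrow> X 1 om) (at_left 1)" for om
  using that by (intro X_tendsto disc_tendsto S part_ge disc_less) auto
 have "(%n. Y n om) \<longlonglongrightarrow> X (S om) om" if "om \<in> space M" for om
  using lim[OF that] by (cases "S om = 1") (auto simp: Y_def)
 then show "(%om. X (S om) om) \<in> borel_measurable M" by (rule borel_measurable_LIMSEQ_real) auto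
 show "AE om in M. (%n. X (disc S n om) om) \<longlonglongrightarrow> X (S om) om"
  using X_at_left AE_space by eventually_elim (auto intro: lim)
qed

text \<open>The last claim is the upper half of optimality: the payoff lies below V, V is
  superharmonic along each discretisation, and the means converge.\<close>

lemma stopped_moments:
 assumes S: "random_time S"
 shows "integrable M (%om. X (S om) om)" "integrable M (%om. (X (S om) om)\<^sup>2)" "(LINT om|M. (X (S om) om)\<^sup>2) <= Fm 0 t z" "(LINT om|M. X (S om) om) <= V t z"
proof -
 have F: "(y::real)\<^sup>2 <= 1 * Fm 0 s y" if "0 <= s" "s < 1" for s y using Fm_ge[OF that, of y 0] by simp
 note sq = disc_tame[where f = "%s y. y", OF S _ F, simplified]
 note L = P.second_moment_limit[OF disc_measurable[where f = "%s y. y", OF S tame_id] stopped_limit(1)[OF S] sq stopped_limit(2)[OF S]]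
 show "integrable M (%om. X (S om) om)" "integrable M (%om. (X (S om) om)\<^sup>2)" "(LINT om|M. (X (S om) om)\<^sup>2) <= Fm 0 t z"
  using L by auto
 have "(LINT om|M. X (disc S n om) om) <= V t z" for n
 proof -
  have "(LINT om|M. X (disc S n om) om) <= (LINT om|M. V (disc S n om) (X (disc S n om) om))"
   using disc_expectation(1)[where f = "%s y. y", OF S tame_id] disc_expectation(1)[where f = V, OF S tame_V]
   by (intro integral_mono V_ge part_ge disc_less) auto
  also have "... <= V t z" by (rule disc_superharmonic[OF S tame_V V_superharmonic])
  finally show ?thesis .
 qed
 then show "(LINT om|M. X (S om) om) <= V t z" by (intro LIMSEQ_le_const2[OF L(4)]) auto
qed

lemma stopping_time_random_time:
 assumes "\<tau> \<in> stopping_times M t X" shows "random_time (%om. t + \<tau> om)"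
proof -
 have st: "Measurable.pred (generated_filtration M t X u) (%om. \<tau> om <= u)" for u
  using assms by (simp add: stopping_times_def stopping_time_def)
 have "{om \<in> space M. s < t + \<tau> om} \<in> sets (generated_filtration M t X (s - t))" for s
 proof -
  have "{om \<in> space M. s < t + \<tau> om} = space (generated_filtration M t X (s - t)) - {om \<in> space (generated_filtration M t X (s - t)). \<tau> om <= s - t}"
   by auto
  then show ?thesis using st[of "s - t"] by (simp only:) (intro sets.Diff sets.top, simp add: pred_def)
 qed
 moreover have "\<forall>om\<in>space M. \<tau> om \<in> {0..1 - t}" using assms by (simp add: stopping_times_def)
 ultimately show ?thesis unfolding random_time_def by force
qed

text \<open>{S - t <= u} is empty for u < 0, the complement of {t + u < S} while t + u < 1, and the
  whole space afterwards.\<close>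

lemma random_time_stopping_time:
 assumes S: "random_time S" shows "(%om. S om - t) \<in> stopping_times M t X"
proof -
 have S1: "t <= S om" "S om <= 1" if "om \<in> space M" for om using S that by (auto simp: random_time_def)
 have "{om \<in> space M. S om - t <= u} \<in> sets (generated_filtration M t X u)" for u
 proof -
  consider "u < 0" | "0 <= u" "t + u < 1" | "1 <= t + u" by linarith
  then show ?thesis
  proof cases
   case 1
   then have "{om \<in> space M. S om - t <= u} = {}" using S1 by force
   then show ?thesis by (simp only: sets.empty_sets)
  next
   case 2
   then have "{om \<in> space M. t + u < S om} \<in> sets (generated_filtration M t X (t + u - t))"
    using S[unfolded random_time_def, THEN conjunct2, rule_format, of "t + u"] by simp
   then have "space (generated_filtration M t X u) - {om \<in> space M. t + u < S om} \<in> sets (generated_filtration M t X u)"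
    by (intro sets.Diff sets.top) simp
   moreover have "space (generated_filtration M t X u) - {om \<in> space M. t + u < S om} = {om \<in> space M. S om - t <= u}" by auto
   ultimately show ?thesis by simp
  next
   case 3
   then have "{om \<in> space M. S om - t <= u} = space (generated_filtration M t X u)" using S1 by force
   then show ?thesis by (simp only: sets.top)
  qed
 qed
 then show ?thesis using S1 unfolding stopping_times_def stopping_time_def by (auto simp: pred_def)
qed

text \<open>In absolute time. Time 1 always belongs to the set, so the infimum is over a nonempty
  set, and \<phi> is consulted only below 1.\<close>

definition hit :: "(real => real => real) => 'w => real" where
 "hit \<phi> om = Inf {s. t <= s \<and> s <= 1 \<and> (s < 1 --> \<phi> s (X s om) <= 0)}"

context
 fixes \<phi> :: "real => real => real" assumes \<phi>: "continuous_on ({0..<1} \<times> UNIV) (%p. \<phi> (fst p) (snd p))"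
begin

lemma continuous_path: "om \<in> space M ==> continuous_on {t..<1} (%s. \<phi> s (X s om))"
 using continuous_on_compose2[OF \<phi> continuous_on_Pair[OF continuous_on_id X_continuous[of om]]] t
 by (simp add: subset_eq image_iff Ball_def)

lemma hit:
 assumes om: "om \<in> space M"
 shows "t <= hit \<phi> om" "hit \<phi> om <= 1" "hit \<phi> om < 1 ==> \<phi> (hit \<phi> om) (X (hit \<phi> om) om) <= 0"
  "t <= s ==> s < hit \<phi> om ==> 0 < \<phi> s (X s om)"
proof -
 define A where "A = {s. t <= s \<and> s <= 1 \<and> (s < 1 --> \<phi> s (X s om) <= 0)}"
 have h: "hit \<phi> om = Inf A" by (simp add: hit_def A_def)
 have A1: "1 \<in> A" using t by (simp add: A_def)
 have bd: "bdd_below A" by (auto simp: A_def intro: bdd_belowI)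
 show ge: "t <= hit \<phi> om" unfolding h using A1 by (intro cInf_greatest) (auto simp: A_def)
 show le: "hit \<phi> om <= 1" unfolding h using A1 bd by (rule cInf_lower)
 show "0 < \<phi> s (X s om)" if "t <= s" "s < hit \<phi> om"
 proof (rule ccontr)
  assume "\<not> 0 < \<phi> s (X s om)"
  then have "s \<in> A" using that le by (simp add: A_def)
  then show False using cInf_lower[OF _ bd, of s] that h by simp
 qed
 show "\<phi> (hit \<phi> om) (X (hit \<phi> om) om) <= 0" if lt: "hit \<phi> om < 1"
 proof (rule ccontr)
  assume "\<not> \<phi> (hit \<phi> om) (X (hit \<phi> om) om) <= 0"
  then obtain d where d: "0 < d" "!!s. s \<in> {t..<1} ==> dist s (hit \<phi> om) < d ==> dist (\<phi> s (X s om)) (\<phi> (hit \<phi> om) (X (hit \<phi> om) om)) < \<phi> (hit \<phi> om) (X (hit \<phi> om) om)"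
   using continuous_path[OF om] ge lt unfolding continuous_on_iff by (metis atLeastLessThan_iff not_le)
  obtain a where a: "a \<in> A" "a < hit \<phi> om + min d (1 - hit \<phi> om)"
   using cInf_lessD[of A "hit \<phi> om + min d (1 - hit \<phi> om)"] A1 h lt d(1) by auto
  then have "hit \<phi> om <= a" using cInf_lower[OF _ bd] h by simp
  then have "dist (\<phi> a (X a om)) (\<phi> (hit \<phi> om) (X (hit \<phi> om) om)) < \<phi> (hit \<phi> om) (X (hit \<phi> om) om)"
   using a ge by (intro d(2)) (auto simp: dist_real_def)
  moreover have "\<phi> a (X a om) <= 0" using a by (simp add: A_def)
  ultimately show False unfolding dist_real_def by linarith
 qed
qed

text \<open>By continuity and compactness, \<phi> is positive along the path on [t,s] iff it is at
  least some 1 / (j + 1) on a countable dense subset of [t,s]. That is an event of the filtration at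
  time s itself, so no right-continuity enters.\<close>

lemma hit_random_time: "random_time (hit \<phi>)"
 unfolding random_time_def
proof (intro conjI ballI allI impI)
 fix s assume s: "t <= s \<and> s < 1"
 let ?F = "generated_filtration M t X (s - t)"
 obtain T where T: "countable T" "T \<subseteq> {t..s}" "{t..s} \<subseteq> closure T" using separable by blast
 have cl: "closure T = {t..s}" using T closure_minimal[OF T(2)] by auto
 have "{om \<in> space M. s < hit \<phi> om} = (\<Union>j::nat. \<Inter>q\<in>T. {om \<in> space ?F. 1 / real (Suc j) <= \<phi> q (X q om)})" (is "?L = ?R")
 proof (intro equalityI subsetI)
  fix om assume "om \<in> ?L"
  then have om: "om \<in> space M" "s < hit \<phi> om" by auto
  have "continuous_on {t..s} (%q. \<phi> q (X q om))"
   using s by (intro continuous_on_subset[OF continuous_path[OF om(1)]]) auto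
  then obtain q0 where q0: "q0 \<in> {t..s}" "!!q. q \<in> {t..s} ==> \<phi> q0 (X q0 om) <= \<phi> q (X q om)"
   using continuous_attains_inf[of "{t..s}" "%q. \<phi> q (X q om)"] s by auto
  have "0 < \<phi> q0 (X q0 om)" using hit(4)[OF om(1), of q0] q0(1) om(2) by auto
  then obtain j where "1 / real (Suc j) < \<phi> q0 (X q0 om)" using nat_approx_posE by blast
  then show "om \<in> ?R" using q0(2) T(2) om(1) by (force intro: order_trans[OF less_imp_le])
 next
  fix om assume "om \<in> ?R"
  moreover have "T ~= {}" using cl s by auto
  ultimately obtain j where om: "om \<in> space M" and j: "!!q. q \<in> T ==> 1 / real (Suc j) <= \<phi> q (X q om)" by auto
  have cont: "continuous_on (closure T) (%q. \<phi> q (X q om))"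
   unfolding cl using s by (intro continuous_on_subset[OF continuous_path[OF om]]) auto
  have pos: "1 / real (Suc j) <= \<phi> q (X q om)" if "q \<in> {t..s}" for q
   by (rule continuous_ge_on_closure[OF cont _ j]) (use that cl in simp)
  have "s < hit \<phi> om"
  proof (rule ccontr)
   assume "\<not> s < hit \<phi> om"
   then have "hit \<phi> om \<in> {t..s}" "hit \<phi> om < 1" using hit(1)[OF om] s by auto
   then have "1 / real (Suc j) <= 0" by (intro order_trans[OF pos hit(3)[OF om]])
   then show False by simp
  qed
  then show "om \<in> ?L" using om by simp
 qed
 also have "... \<in> sets ?F"
 proof (intro sets.countable_UN sets.countable_INT' T(1) image_subsetI)
  have "T ~= {}" using cl s by auto
  then show "T ~= {}" .
  fix q assume "q \<in> T"
  then have q: "t <= q" "q <= s" "q < 1" using T(2) s by auto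
  have [measurable]: "X q \<in> borel_measurable ?F" using q by (intro filtration_X_measurable) auto
  have "continuous_on UNIV (%y. (q, y :: real))" by (intro continuous_on_Pair continuous_on_const continuous_on_id)
  from continuous_on_compose2[OF \<phi> this] have "continuous_on UNIV (\<phi> q)" using q t by (simp add: image_subset_iff)
  then have [measurable]: "\<phi> q \<in> borel_measurable borel" by (rule borel_measurable_continuous_onI)
  show "{om \<in> space ?F. 1 / real (Suc j) <= \<phi> q (X q om)} \<in> sets ?F" for j by measurable
 qed
 finally show "{om \<in> space M. s < hit \<phi> om} \<in> sets ?F" .
qed (use hit in auto)

end

end

section \<open>Optimality of the hitting time of the stopping set\<close>

context bounded_posterior
begin

text \<open>The part of a closed box where the gain is at least e is compact, so finitely many of
  the local constants of \<open>local_harmonic\<close> suffice.\<close>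

lemma uniform_harmonic:
 assumes e: "0 < e"
 obtains A \<eta> where "0 <= A" "0 < \<eta>"
  "!!s y r. 0 <= s ==> s <= 1 - e ==> \<bar>y\<bar> <= 1 / e ==> y + e <= V s y ==> s < r ==> r < s + \<eta> ==> V s y - (LINT x|K s y r. V r x) <= A * (r - s)^2"
proof -
 define B where "B = {0..1 - e} \<times> {- (1 / e)..1 / e}"
 define L where "L = B \<inter> (%p. V (fst p) (snd p) - snd p) -` {e..}"
 have cB: "compact B" unfolding B_def by (intro compact_Times) auto
 have "closed L" unfolding L_def
  using e by (intro continuous_closed_preimage continuous_on_diff continuous_on_subset[OF continuous_V] continuous_on_snd continuous_on_id compact_imp_closed[OF cB])
   (auto simp: B_def)
 then have cL: "compact L" using compact_Int_closed[OF cB, of L] by (simp add: L_def Int_absorb1)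
 define good where "good p A \<eta> \<longleftrightarrow> 0 <= A \<and> 0 < \<eta> \<and> (\<forall>s y r. 0 <= s \<and> \<bar>s - fst p\<bar> < \<eta> \<and> \<bar>y - snd p\<bar> < \<eta> \<and> s < r \<and> r < fst p + \<eta> --> V s y - (LINT x|K s y r. V r x) <= A * (r - s)^2)" for p A \<eta>
 have "\<forall>p\<in>L. \<exists>A \<eta>. good p A \<eta>"
 proof
  fix p assume "p \<in> L"
  then have p: "0 <= fst p" "fst p < 1" "snd p < V (fst p) (snd p)" using e by (auto simp: L_def B_def)
  show "\<exists>A \<eta>. good p A \<eta>"
  proof (rule local_harmonic[OF p])
   fix A \<eta> assume "0 <= A" "0 < \<eta>" and *: "!!s y r. 0 <= s ==> \<bar>s - fst p\<bar> < \<eta> ==> \<bar>y - snd p\<bar> < \<eta> ==> s < r ==> r < fst p + \<eta> ==> V s y - (LINT x|K s y r. V r x) <= A * (r - s)^2"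
   then show "\<exists>A \<eta>. good p A \<eta>" unfolding good_def by (intro exI[of _ A] exI[of _ \<eta>] conjI allI impI *) auto
  qed
 qed
 then obtain A \<eta> where g: "!!p. p \<in> L ==> good p (A p) (\<eta> p)" by metis
 \<comment> \<open>Half the radius in time; the other half is room for the step from s to r.\<close>
 define U where "U p = {fst p - \<eta> p / 2<..<fst p + \<eta> p / 2} \<times> {snd p - \<eta> p<..<snd p + \<eta> p}" for p
 have cov: "L \<subseteq> (\<Union>p\<in>L. U p)" using g by (force simp: U_def good_def)
 have oU: "open (U p)" for p unfolding U_def by (intro open_Times open_greaterThanLessThan)
 obtain C where C: "C \<subseteq> L" "finite C" "L \<subseteq> (\<Union>p\<in>C. U p)" using compactE_image[OF cL oU cov] by blast
 define \<eta>0 where "\<eta>0 = Min (insert 1 ((%p. \<eta> p / 2) ` C))"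
 show ?thesis
 proof (rule that[of "\<Sum>p\<in>C. A p" \<eta>0])
  show "0 <= (\<Sum>p\<in>C. A p)" using g C(1) by (intro sum_nonneg) (auto simp: good_def)
  show "0 < \<eta>0" unfolding \<eta>0_def using g C by (auto simp: good_def)
  fix s y r assume a: "0 <= s" "s <= 1 - e" "\<bar>y\<bar> <= 1 / e" "y + e <= V s y" "s < r" "r < s + \<eta>0"
  have "(s, y) \<in> L" using a by (auto simp: L_def B_def)
  then obtain p where p: "p \<in> C" "(s, y) \<in> U p" using C(3) by blast
  have "\<eta>0 <= \<eta> p / 2" unfolding \<eta>0_def using p(1) C(2) by (intro Min_le) auto
  then have n: "\<bar>s - fst p\<bar> < \<eta> p" "\<bar>y - snd p\<bar> < \<eta> p" "r < fst p + \<eta> p" using p(2) a(6) by (auto simp: U_def)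
  have gp: "good p (A p) (\<eta> p)" using g C(1) p(1) by blast
  then have "V s y - (LINT x|K s y r. V r x) <= A p * (r - s)^2" unfolding good_def using n a(1,5) by blast
  also have "A p * (r - s)^2 <= (\<Sum>p\<in>C. A p) * (r - s)^2"
   using g C p(1) by (intro mult_right_mono member_le_sum) (auto simp: good_def)
  finally show "V s y - (LINT x|K s y r. V r x) <= (\<Sum>p\<in>C. A p) * (r - s)^2" .
 qed
qed

end

context bridge_sde
begin

text \<open>Positive exactly in the interior of the region of \<open>uniform_harmonic\<close>: gain
  above e, position within 1 / e, time before 1 - e. As e decreases to 0, its hitting time
  approaches that of the stopping set from below.\<close>

definition barrier :: "real => real => real => real" where
 "barrier e s y = min (V s y - y - e) (min (1 / e - \<bar>y\<bar>) (1 - e - s))"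

lemma continuous_barrier: "continuous_on ({0..<1} \<times> UNIV) (%p. barrier e (fst p) (snd p))"
 unfolding barrier_def
 by (intro continuous_on_min continuous_on_diff continuous_V continuous_on_const continuous_on_fst continuous_on_snd continuous_on_id continuous_on_rabs)

lemma continuous_gain: "continuous_on ({0..<1} \<times> UNIV) (%p. V (fst p) (snd p) - snd p)"
 by (intro continuous_on_diff continuous_V continuous_on_snd continuous_on_id)

abbreviation hitb :: "real => 'w => real" where "hitb e \<equiv> hit (barrier e)"
abbreviation hitD :: "'w => real" where "hitD \<equiv> hit (%s y. V s y - y)"

lemmas hitb = hit[OF continuous_barrier] and hitD = hit[OF continuous_gain]
lemmas rt_hitb = hit_random_time[OF continuous_barrier] and rt_hitD = hit_random_time[OF continuous_gain]

lemma hitb_le: "om \<in> space M ==> 0 < e ==> hitb e om <= max t (1 - e)"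
proof (rule ccontr)
 assume a: "om \<in> space M" "0 < e" "\<not> hitb e om <= max t (1 - e)"
 then have "0 < barrier e (max t (1 - e)) (X (max t (1 - e)) om)" by (intro hitb(4)) auto
 then show False by (simp add: barrier_def)
qed

lemma hitb_less: "om \<in> space M ==> 0 < e ==> hitb e om < 1"
 using hitb_le[of om e] t by auto

text \<open>Before the barrier is hit each of the n + 1 steps loses at most A * d^2, with d of order
  1 / n. The total loss tends to 0, so V keeps its mean up to the barrier.\<close>

lemma V_hitb:
 assumes e: "0 < e"
 shows "integrable M (%om. V (hitb e om) (X (hitb e om) om))" "integrable M (%om. (V (hitb e om) (X (hitb e om) om))\<^sup>2)"
  "(LINT om|M. (V (hitb e om) (X (hitb e om) om))\<^sup>2) <= 6 * Fm 0 t z" "V t z <= (LINT om|M. V (hitb e om) (X (hitb e om) om))"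
proof -
 let ?S = "hitb e"
 note S = rt_hitb[of e]
 have m: "(%om. V (disc ?S n om) (X (disc ?S n om) om)) \<in> borel_measurable M" for n
  by (rule disc_measurable[where f = V, OF S tame_V])
 have lim: "(%n. V (disc ?S n om) (X (disc ?S n om) om)) \<longlonglongrightarrow> V (?S om) (X (?S om) om)" if om: "om \<in> space M" for om
  using continuous_on_tendsto_compose[OF continuous_path[OF continuous_V om] disc_tendsto[OF S om]] hitb(1)[OF om] hitb_less[OF om e] part_ge disc_less
  by simp
 have sq: "integrable M (%om. (V (disc ?S n om) (X (disc ?S n om) om))\<^sup>2)" "(LINT om|M. (V (disc ?S n om) (X (disc ?S n om) om))\<^sup>2) <= 6 * Fm 0 t z" for n
  by (rule disc_tame[where f = V, OF S V_measurable V_sq_le]; simp)+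
 have L: "AE om in M. (%n. V (disc ?S n om) (X (disc ?S n om) om)) \<longlonglongrightarrow> V (?S om) (X (?S om) om)"
  using lim by (intro AE_I2) auto
 note R = P.second_moment_limit[OF m borel_measurable_LIMSEQ_real[OF lim m] sq L]
 show "integrable M (%om. V (hitb e om) (X (hitb e om) om))" "integrable M (%om. (V (hitb e om) (X (hitb e om) om))\<^sup>2)"
  "(LINT om|M. (V (hitb e om) (X (hitb e om) om))\<^sup>2) <= 6 * Fm 0 t z" using R by auto
 obtain A \<eta> where A: "0 <= A" "0 < \<eta>" "!!s y r. 0 <= s ==> s <= 1 - e ==> \<bar>y\<bar> <= 1 / e ==> y + e <= V s y ==> s < r ==> r < s + \<eta> ==> V s y - (LINT x|K s y r. V r x) <= A * (r - s)^2"
  using uniform_harmonic[OF e] by blast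
 have ge: "V t z - A * (1 / real (n + 2)) <= (LINT om|M. V (disc ?S n om) (X (disc ?S n om) om))" if n: "1 / real (n + 2) < \<eta>" for n
 proof -
  define d where "d = (1 - t) / real (n + 2)"
  have d: "0 <= d" "d <= 1 / real (n + 2)" using t by (auto simp: d_def divide_right_mono)
  let ?J = "%k om. indicator {om \<in> space M. part n k < ?S om} om *
    ((LINT x|K (part n k) (X (part n k) om) (part n (Suc k)). V (part n (Suc k)) x) - V (part n k) (X (part n k) om))"
  have "- (A * d^2) <= (LINT om|M. ?J k om)" for k
  proof -
   have pw: "- (A * d^2) <= ?J k om" if om: "om \<in> space M" for om
   proof (cases "part n k < ?S om")
    case True
    then have "0 < barrier e (part n k) (X (part n k) om)" using om part_ge by (intro hitb(4)) auto
    then have "V (part n k) (X (part n k) om) - (LINT x|K (part n k) (X (part n k) om) (part n (Suc k)). V (part n (Suc k)) x) <= A * (part n (Suc k) - part n k)\<^sup>2"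
     using part_ge part_Suc[of n k] d n by (intro A(3)) (auto simp: barrier_def d_def)
    then show ?thesis using True om part_Suc(1)[of n k] by (simp add: d_def)
   next
    case False then show ?thesis using A(1) by simp
   qed
   show ?thesis
   proof (cases "integrable M (?J k)")
    case True then show ?thesis using pw by (intro P.integral_ge_const AE_I2) auto
   next
    \<comment> \<open>The Bochner integral of a non-integrable function is 0 and satisfies the lower
      bound too.\<close>
    case False then show ?thesis using not_integrable_integral_eq[OF False] A(1) by simp
   qed
  qed
  then have "(\<Sum>k<n+1. - (A * d^2)) <= (\<Sum>k<n+1. \<integral>om. ?J k om \<partial>M)" by (intro sum_mono)
  moreover have "A * (real (n + 1) * d^2) <= A * (1 / real (n + 2))"
  proof (rule mult_left_mono[OF _ A(1)])
   have "real (n + 1) * d^2 <= real (n + 2) * (1 / real (n + 2))\<^sup>2" using d by (intro mult_mono power_mono) auto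
   also have "... = 1 / real (n + 2)" by (simp add: power2_eq_square)
   finally show "real (n + 1) * d^2 <= 1 / real (n + 2)" .
  qed
  moreover have "(\<Sum>k<n+1. - (A * d^2)) = - (A * (real (n + 1) * d^2))"
   by (simp only: sum_constant card_lessThan mult_minus_right mult.left_commute)
  ultimately have "- (A * (1 / real (n + 2))) <= (\<Sum>k<n+1. \<integral>om. ?J k om \<partial>M)" by linarith
  then show ?thesis using disc_expectation(2)[where f = V and n = n, OF S tame_V] by linarith
 qed
 have l0: "(%n. 1 / real (n + 2)) \<longlonglongrightarrow> 0"
  by (intro tendsto_divide_0[OF tendsto_const] filterlim_compose[OF filterlim_real_sequentially filterlim_add_const_nat_at_top, THEN filterlim_at_top_imp_at_infinity])
 have l1: "(%n. V t z - A * (1 / real (n + 2))) \<longlonglongrightarrow> V t z - A * 0" by (intro tendsto_intros l0)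
 have "eventually (%n. V t z - A * (1 / real (n + 2)) <= (LINT om|M. V (disc ?S n om) (X (disc ?S n om) om))) sequentially"
  using order_tendstoD(2)[OF l0 A(2)] by eventually_elim (rule ge)
 from tendsto_le[OF sequentially_bot R(4) l1 this] show "V t z <= (LINT om|M. V (hitb e om) (X (hitb e om) om))" by simp
qed

text \<open>On [t,c] with c before \<open>hitD\<close>, the gain along the path has a positive
  minimum, the path is bounded and the time keeps away from 1; so the barrier for small e is not hit
  by time c.\<close>

lemma hitb_tendsto:
 assumes om: "om \<in> space M"
 shows "(%m. hitb (inverse (real (Suc m))) om) \<longlonglongrightarrow> hitD om"
proof (rule order_tendstoI)
 let ?e = "%m. inverse (real (Suc m))"
 have le: "hitb (?e m) om <= hitD om" for m
 proof (rule ccontr)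
  assume a: "\<not> hitb (?e m) om <= hitD om"
  then have "0 < barrier (?e m) (hitD om) (X (hitD om) om)" by (intro hitb(4)[OF om] hitD(1)[OF om]) auto
  then have "0 < V (hitD om) (X (hitD om) om) - X (hitD om) om - ?e m" by (simp add: barrier_def)
  moreover have "V (hitD om) (X (hitD om) om) - X (hitD om) om <= 0" using a hitb(2)[OF om, of "?e m"] by (intro hitD(3)[OF om]) auto
  moreover have "0 < ?e m" by simp
  ultimately show False by linarith
 qed
 show "eventually (%m. hitb (?e m) om < c) sequentially" if "hitD om < c" for c
  by (intro always_eventually allI le_less_trans[OF le that])
 fix c assume c: "c < hitD om"
 show "eventually (%m. c < hitb (?e m) om) sequentially"
 proof (cases "c < t")
  case True then show ?thesis by (intro always_eventually allI less_le_trans[OF True hitb(1)[OF om]])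
 next
  case False
  then have tc: "t <= c" "c < 1" using c hitD(2)[OF om] by auto
  have sub: "{t..c} \<subseteq> {t..<1}" using tc by auto
  obtain q0 where q0: "q0 \<in> {t..c}" "!!q. q \<in> {t..c} ==> V q0 (X q0 om) - X q0 om <= V q (X q om) - X q om"
   using continuous_attains_inf[OF compact_Icc _ continuous_on_subset[OF continuous_path[OF continuous_gain om] sub]] tc(1) by auto
  have pos: "0 < V q0 (X q0 om) - X q0 om" using q0(1) c by (intro hitD(4)[OF om]) auto
  obtain q1 where q1: "\<forall>q\<in>{t..c}. \<bar>X q om\<bar> <= \<bar>X q1 om\<bar>"
   using continuous_attains_sup[OF compact_Icc _ continuous_on_rabs[OF continuous_on_subset[OF X_continuous[OF om] sub]]] tc(1) by auto
  define d where "d = min (V q0 (X q0 om) - X q0 om) (min (1 / (\<bar>X q1 om\<bar> + 1)) (1 - c))"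
  have "0 < \<bar>X q1 om\<bar> + 1" by simp
  then have d: "0 < d" using pos tc by (simp add: d_def)
  have "eventually (%m. ?e m < d) sequentially"
   by (rule order_tendstoD(2)[OF LIMSEQ_inverse_real_of_nat d])
  then show ?thesis
  proof eventually_elim
   fix m assume "?e m < d"
   then have m: "?e m < V q0 (X q0 om) - X q0 om" "?e m < 1 / (\<bar>X q1 om\<bar> + 1)" "?e m < 1 - c" by (auto simp: d_def)
   show "c < hitb (?e m) om"
   proof (rule ccontr)
    assume "\<not> c < hitb (?e m) om"
    then have h: "hitb (?e m) om \<in> {t..c}" "hitb (?e m) om < 1" using hitb(1)[OF om, of "?e m"] tc by auto
    have "?e m < V (hitb (?e m) om) (X (hitb (?e m) om) om) - X (hitb (?e m) om) om" using q0(2)[OF h(1)] m(1) by linarith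
    moreover have "\<bar>X q1 om\<bar> + 1 < 1 / ?e m" using m(2) by (simp add: field_simps)
    then have "\<bar>X (hitb (?e m) om) om\<bar> < 1 / ?e m" using q1[rule_format, OF h(1)] by linarith
    moreover have "?e m < 1 - hitb (?e m) om" using h(1) m(3) by auto
    ultimately have "0 < barrier (?e m) (hitb (?e m) om) (X (hitb (?e m) om) om)" unfolding barrier_def min_less_iff_conj by linarith
    then show False using hitb(3)[OF om h(2)] by simp
   qed
  qed
 qed
qed

text \<open>At the barrier one of three things happens: the gain is at most e; the position is
  large, which a Chebyshev argument with 1 <= e * |Y| makes cheap; or the time is 1 - e, where
  \<open>V_excess_sq\<close> bounds the gain and its bound has mean of order e.\<close>

lemma hitb_payoff:
 assumes e: "0 < e" "e < 1 - t" and eps: "0 < eps"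
 shows "V t z - e * (1 + 8 * Fm 0 t z + (4 * (\<rho> t z / (1 - t) + 1) + 2) / (2 * eps)) - eps / 2 <= (LINT om|M. X (hitb e om) om)"
proof -
 define q where "q y = 4 * \<rho> (1 - e) y + 2 * e" for y
 have e1: "t < 1 - e" "1 - e < 1" "0 <= 1 - e" using e t by auto
 have tq: "tame q" unfolding q_def using e1 by (intro tame_add tame_cmult tame_\<rho> tame_const)
 have q0: "0 <= q y" for y using \<rho>_nonneg[of "1 - e" y] e by (simp add: q_def)
 have iq: "integrable M (%om. q (X (1 - e) om))" using e1 by (intro integrable_X tq) auto
 have Eq: "(LINT om|M. q (X (1 - e) om)) <= e * (4 * (\<rho> t z / (1 - t) + 1) + 2)"
 proof -
  interpret Kp: prob_space "K t z (1 - e)" by (rule prob_space_K[OF t(1) e1(1,2)])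
  have "(LINT om|M. q (X (1 - e) om)) = (LINT y|K t z (1 - e). q y)" using e1 by (intro integral_X tq) auto
  also have "... = 4 * (((1 - (1 - e)) / (1 - t))\<^sup>2 * \<rho> t z + (1 - e - t) * (1 - (1 - e)) / (1 - t)) + 2 * e"
   unfolding q_def using integrable_K_\<rho>[OF t(1) e1(1,2)] Kp.prob_space by (simp add: K_\<rho>[OF t(1) e1(1,2)])
  also have "... <= 4 * (e / (1 - t) * \<rho> t z + e) + 2 * e"
  proof -
   have "((1 - (1 - e)) / (1 - t))\<^sup>2 <= e / (1 - t) * 1"
    unfolding power2_eq_square using e t by (intro mult_mono) auto
   then have "((1 - (1 - e)) / (1 - t))\<^sup>2 * \<rho> t z <= e / (1 - t) * \<rho> t z" using \<rho>_nonneg[of t z] by (intro mult_right_mono) auto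
   moreover have "(1 - e - t) * (1 - (1 - e)) / (1 - t) <= e" using e t by (simp add: divide_le_eq mult.commute)
   ultimately show ?thesis by simp
  qed
  also have "... = e * (4 * (\<rho> t z / (1 - t) + 1) + 2)" by (simp add: algebra_simps)
  finally show ?thesis .
 qed
 define Y where "Y om = X (hitb e om) om" for om
 define U where "U om = V (hitb e om) (Y om)" for om
 have U: "integrable M U" "integrable M (%om. (U om)\<^sup>2)" "(LINT om|M. (U om)\<^sup>2) <= 6 * Fm 0 t z" "V t z <= (LINT om|M. U om)"
  using V_hitb[OF e(1)] by (simp_all add: U_def[abs_def] Y_def)
 have Y: "integrable M Y" "integrable M (%om. (Y om)\<^sup>2)" "(LINT om|M. (Y om)\<^sup>2) <= Fm 0 t z"
  using stopped_moments[OF rt_hitb[of e]] by (simp_all add: Y_def[abs_def])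
 have pw: "U om - Y om <= e + e * ((U om)^2 + 2 * (Y om)^2) + (eps + q (X (1 - e) om) / eps) / 2" if om: "om \<in> space M" for om
 proof -
  have n2: "0 <= e * ((U om)^2 + 2 * (Y om)^2)" using e by simp
  have n3: "0 <= (eps + q (X (1 - e) om) / eps) / 2" using eps q0 by simp
  have lt: "hitb e om < 1" and ge: "0 <= hitb e om" using hitb_less[OF om e(1)] hitb(1)[OF om, of e] t by auto
  have "barrier e (hitb e om) (Y om) <= 0" unfolding Y_def by (rule hitb(3)[OF om lt])
  then consider "U om - Y om <= e" | "1 / e <= \<bar>Y om\<bar>" | "1 - e <= hitb e om"
   unfolding barrier_def U_def min_le_iff_disj by force
  then show ?thesis
  proof cases
   case 1 then show ?thesis using n2 n3 by linarith
  next
   case 2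
   then have Y1: "1 <= e * \<bar>Y om\<bar>" using e by (simp add: field_simps)
   have "U om - Y om <= (\<bar>U om\<bar> + \<bar>Y om\<bar>) * 1" by simp
   also have "... <= (\<bar>U om\<bar> + \<bar>Y om\<bar>) * (e * \<bar>Y om\<bar>)" by (intro mult_left_mono Y1) simp
   also have "... = e * (\<bar>U om\<bar> * \<bar>Y om\<bar> + \<bar>Y om\<bar> * \<bar>Y om\<bar>)" by (simp only: distrib_left distrib_right mult_ac)
   also have "... <= e * ((U om)^2 + 2 * (Y om)^2)"
   proof (rule mult_left_mono)
    have "0 <= (\<bar>U om\<bar> - \<bar>Y om\<bar> / 2)\<^sup>2" by simp
    then show "\<bar>U om\<bar> * \<bar>Y om\<bar> + \<bar>Y om\<bar> * \<bar>Y om\<bar> <= (U om)\<^sup>2 + 2 * (Y om)^2"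
     using zero_le_square[of "Y om"] unfolding power2_diff power_divide abs_mult_self_eq power2_abs by (simp only: power2_eq_square)
   qed (use e in simp)
   finally show ?thesis using n3 e by linarith
  next
   case 3
   then have h: "hitb e om = 1 - e" using hitb_le[OF om e(1)] e1 by auto
   have YX: "Y om = X (1 - e) om" unfolding Y_def h ..
   have "(U om - Y om)\<^sup>2 <= q (X (1 - e) om)"
    using V_excess_sq[of "1 - e" "Y om"] e1 unfolding U_def h YX q_def by simp
   then have "2 * eps * (U om - Y om) <= eps\<^sup>2 + q (X (1 - e) om)" using zero_le_power2[of "eps - (U om - Y om)"] by (simp add: power2_diff)
   then have "U om - Y om <= (eps + q (X (1 - e) om) / eps) / 2" using eps by (simp add: field_simps power2_eq_square)
   then show ?thesis using n2 e by linarith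
  qed
 qed
 have "(LINT om|M. U om - Y om) <= (LINT om|M. e + e * ((U om)^2 + 2 * (Y om)^2) + (eps + q (X (1 - e) om) / eps) / 2)"
  using U Y iq pw by (intro integral_mono) auto
 also have "... = e + e * ((LINT om|M. (U om)\<^sup>2) + 2 * (LINT om|M. (Y om)\<^sup>2)) + (eps + (LINT om|M. q (X (1 - e) om)) / eps) / 2"
  using U Y iq by (simp add: P.prob_space)
 also have "... <= e + e * (6 * Fm 0 t z + 2 * Fm 0 t z) + (eps + e * (4 * (\<rho> t z / (1 - t) + 1) + 2) / eps) / 2"
  using U(3) Y(3) Eq e eps by (intro add_mono mult_left_mono divide_right_mono) auto
 also have "... = e * (1 + 8 * Fm 0 t z + (4 * (\<rho> t z / (1 - t) + 1) + 2) / (2 * eps)) + eps / 2"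
  by (simp add: distrib_left add_divide_distrib mult_ac)
 finally have "(LINT om|M. U om) - (LINT om|M. Y om) <= e * (1 + 8 * Fm 0 t z + (4 * (\<rho> t z / (1 - t) + 1) + 2) / (2 * eps)) + eps / 2"
  using U(1) Y(1) by simp
 then show ?thesis using U(4) unfolding Y_def by linarith
qed

text \<open>For fixed eps the loss in \<open>hitb_payoff\<close> tends to eps / 2 as e tends to 0;
  only then is eps released.\<close>

lemma V_hitD: "V t z = (LINT om|M. X (hitD om) om)"
proof (rule antisym)
 let ?e = "%m. inverse (real (Suc m))"
 show "(LINT om|M. X (hitD om) om) <= V t z" by (rule stopped_moments(4)[OF rt_hitD])
 have "AE om in M. (%m. X (hitb (?e m) om) om) \<longlonglongrightarrow> X (hitD om) om"
  using X_at_left AE_space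
 proof eventually_elim
  fix om assume "((%s. X s om) \<longlongrightarrow> X 1 om) (at_left 1)" "om \<in> space M"
  then show "(%m. X (hitb (?e m) om) om) \<longlonglongrightarrow> X (hitD om) om"
   by (intro X_tendsto[where q = "%m. hitb (?e m) om"] hitb(1) hitb_less hitb_tendsto) auto
 qed
 then have lim: "(%m. \<integral>om. X (hitb (?e m) om) om \<partial>M) \<longlonglongrightarrow> (LINT om|M. X (hitD om) om)"
  by (intro P.second_moment_limit(4)[OF stopped_limit(1)[OF rt_hitb] stopped_limit(1)[OF rt_hitD] stopped_moments(2)[OF rt_hitb] stopped_moments(3)[OF rt_hitb]])
 show "V t z <= (LINT om|M. X (hitD om) om)"
 proof (rule field_le_epsilon)
  fix eps :: real assume eps: "0 < eps"
  define B where "B = 1 + 8 * Fm 0 t z + (4 * (\<rho> t z / (1 - t) + 1) + 2) / (2 * eps)"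
  have "(%m. V t z - ?e m * B - eps / 2) \<longlonglongrightarrow> V t z - 0 * B - eps / 2"
   by (intro tendsto_diff tendsto_mult tendsto_const LIMSEQ_inverse_real_of_nat)
  moreover have "eventually (%m. V t z - ?e m * B - eps / 2 <= (LINT om|M. X (hitb (?e m) om) om)) sequentially"
  proof -
   have "eventually (%m. ?e m < 1 - t) sequentially"
    by (rule order_tendstoD(2)[OF LIMSEQ_inverse_real_of_nat]) (use t in simp)
   then show ?thesis unfolding B_def by eventually_elim (rule hitb_payoff[OF _ _ eps], simp)
  qed
  ultimately have "V t z - 0 * B - eps / 2 <= (LINT om|M. X (hitD om) om)"
   by (rule tendsto_le[OF sequentially_bot lim])
  then show "V t z <= (LINT om|M. X (hitD om) om) + eps" using eps by simp
 qed
qed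

lemma
 shows hitD_stopping_time: "(%om. hitD om - t) \<in> stopping_times M t X"
  and integrable_stopped: "\<tau> \<in> stopping_times M t X ==> integrable M (stopped t X \<tau>)"
  and stopped_le_V: "\<tau> \<in> stopping_times M t X ==> (LINT om|M. stopped t X \<tau> om) <= V t z"
  and stopped_hitD: "(LINT om|M. stopped t X (%om. hitD om - t) om) = V t z"
proof -
 show "(%om. hitD om - t) \<in> stopping_times M t X" by (rule random_time_stopping_time[OF rt_hitD])
 show "(LINT om|M. stopped t X (%om. hitD om - t) om) = V t z" using V_hitD by (simp add: stopped_def)
 assume "\<tau> \<in> stopping_times M t X"
 then have "random_time (%om. t + \<tau> om)" by (rule stopping_time_random_time)
 from stopped_moments(1,4)[OF this] show "integrable M (stopped t X \<tau>)" "(LINT om|M. stopped t X \<tau> om) <= V t z"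
  by (simp_all add: stopped_def[abs_def])
qed

lemma stopping_value: "(SUP \<tau>\<in>stopping_times M t X. \<integral>om. stopped t X \<tau> om \<partial>M) = V t z"
 using hitD_stopping_time stopped_hitD stopped_le_V by (intro cSup_eq_maximum) (auto intro!: image_eqI[of _ _ "%om. hitD om - t"])

end

subsection \<open>Analyticity of the value function in the space variable\<close>

definition cheat :: "real => complex => complex" where
 "cheat \<tau> w = exp (- w\<^sup>2 / of_real (2 * \<tau>)) / of_real (sqrt (2 * pi * \<tau>))"

lemma cheat_of_real: "0 < \<tau> ==> cheat \<tau> (of_real x) = of_real (heat \<tau> x)"
 unfolding cheat_def heat_eq of_real_divide exp_of_real[symmetric] of_real_minus of_real_power ..

lemma cheat_measurable [measurable]:
 assumes [measurable]: "f \<in> borel_measurable N" shows "(%x. cheat \<tau> (f x)) \<in> borel_measurable N"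
 unfolding cheat_def by measurable

text \<open>Off the real axis the modulus carries a factor that explodes as \<tau> tends to 0.
  Short-time heat integrals therefore stay bounded only at points far from the support of the
  integrand.\<close>

lemma norm_cheat: "0 < \<tau> ==> cmod (cheat \<tau> w) = exp ((Im w)^2 / (2 * \<tau>)) * heat \<tau> (Re w)"
proof -
 assume \<tau>: "0 < \<tau>"
 have "Re (- w\<^sup>2 / of_real (2 * \<tau>)) = (Im w)^2 / (2 * \<tau>) + - (Re w)\<^sup>2 / (2 * \<tau>)"
  unfolding Re_divide_of_real by (simp add: Re_power2 diff_divide_distrib)
 then have "cmod (exp (- w\<^sup>2 / of_real (2 * \<tau>))) = exp ((Im w)^2 / (2 * \<tau>)) * exp (- (Re w)\<^sup>2 / (2 * \<tau>))"
  unfolding norm_exp_eq_Re by (simp only: exp_add)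
 then show ?thesis using \<tau> by (simp add: cheat_def norm_divide heat_eq)
qed

text \<open>A power series with the moments of w as coefficients; exponential integrability permits
  termwise integration.\<close>

lemma holomorphic_exp_transform:
 fixes w :: "real => real"
 assumes [measurable]: "w \<in> borel_measurable borel" and i: "!!c. integrable lborel (%y. exp (c * y) * w y)"
 shows "(%ze. \<integral>y. exp (ze * of_real y) * of_real (w y) \<partial>lborel) holomorphic_on UNIV"
proof -
 have ia: "integrable lborel (%y. exp (c * \<bar>y\<bar>) * \<bar>w y\<bar>)" for c
 proof (rule Bochner_Integration.integrable_bound[OF Bochner_Integration.integrable_add[OF integrable_abs[OF i[of c]] integrable_abs[OF i[of "- c"]]]])
  have "exp (c * \<bar>y\<bar>) * \<bar>w y\<bar> <= exp (c * y) * \<bar>w y\<bar> + exp (- c * y) * \<bar>w y\<bar>" for y by (cases "0 <= y") auto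
  then show "AE y in lborel. norm (exp (c * \<bar>y\<bar>) * \<bar>w y\<bar>) <= norm (\<bar>exp (c * y) * w y\<bar> + \<bar>exp (- c * y) * w y\<bar>)"
   by (simp add: abs_mult)
 qed measurable
 have ik: "integrable lborel (%y. complex_of_real (y ^ k * w y))" for k
 proof (rule Bochner_Integration.integrable_bound[OF integrable_mult_right[OF ia[of 1], of "fact k"]])
  have "\<bar>y\<bar> ^ k * \<bar>w y\<bar> <= (fact k * exp \<bar>y\<bar>) * \<bar>w y\<bar>" for y
   using power_div_fact_le_exp[of "\<bar>y\<bar>" k] by (intro mult_right_mono) (simp_all add: divide_le_eq mult.commute)
  then show "AE y in lborel. norm (complex_of_real (y ^ k * w y)) <= norm (fact k * (exp (1 * \<bar>y\<bar>) * \<bar>w y\<bar>))"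
   unfolding norm_of_real by (simp add: abs_mult power_abs mult.assoc)
 qed measurable
 define a where "a n = (1 / fact n) * (LINT y|lborel. complex_of_real (y ^ n * w y))" for n
 define F where "F ze = (LINT y|lborel. exp (ze * of_real y) * of_real (w y))" for ze :: complex
 have S: "(%n. a n * (ze - 0) ^ n) sums F ze" for ze
 proof -
  define f where "f n y = (ze ^ n / fact n) * complex_of_real (y ^ n * w y)" for n y
  define N where "N n y = (cmod ze * \<bar>y\<bar>) ^ n / fact n * \<bar>w y\<bar>" for n y
  have nf: "norm (f n y) = N n y" for n y
   unfolding f_def N_def norm_mult norm_of_real by (simp add: norm_divide norm_power power_mult_distrib abs_mult power_abs)
  have fs: "(%n. f n y) sums (exp (ze * of_real y) * of_real (w y))" for y
   using sums_mult2[OF exp_converges[of "ze * of_real y"], of "of_real (w y)"]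
   by (simp add: f_def scaleR_conv_of_real power_mult_distrib divide_inverse mult_ac)
  have Ns: "(%n. N n y) sums (exp (cmod ze * \<bar>y\<bar>) * \<bar>w y\<bar>)" for y
   using sums_mult2[OF exp_converges[of "cmod ze * \<bar>y\<bar>"], of "\<bar>w y\<bar>"]
   by (simp add: N_def divide_inverse mult.commute)
  have fi: "integrable lborel (f n)" for n unfolding f_def by (intro integrable_mult_right ik)
  have Ni: "integrable lborel (N n)" for n using integrable_norm[OF fi[of n]] by (simp add: nf)
  have "(%n. \<integral>y. f n y \<partial>lborel) sums (LINT y|lborel. (\<Sum>n. f n y))"
  proof (rule sums_integral[OF fi])
   show "AE y in lborel. summable (%n. norm (f n y))" unfolding nf using Ns by (intro AE_I2 sums_summable)
   show "summable (%n. \<integral>y. norm (f n y) \<partial>lborel)" unfolding nf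
   proof (rule summableI_nonneg_bounded)
    show "0 <= (LINT y|lborel. N n y)" for n by (intro Bochner_Integration.integral_nonneg) (simp add: N_def)
    fix n
    have "(\<Sum>i<n. \<integral>y. N i y \<partial>lborel) = (LINT y|lborel. (\<Sum>i<n. N i y))" using Ni by simp
    also have "... <= (LINT y|lborel. exp (cmod ze * \<bar>y\<bar>) * \<bar>w y\<bar>)"
    proof (rule integral_mono)
     show "(\<Sum>i<n. N i y) <= exp (cmod ze * \<bar>y\<bar>) * \<bar>w y\<bar>" for y
      using sum_le_suminf[OF sums_summable[OF Ns[of y]], of "{..<n}"] sums_unique[OF Ns[of y]] by (simp add: N_def)
    qed (use Ni ia in auto)
    finally show "(\<Sum>i<n. \<integral>y. N i y \<partial>lborel) <= (LINT y|lborel. exp (cmod ze * \<bar>y\<bar>) * \<bar>w y\<bar>)" .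
   qed
  qed
  moreover have "(LINT y|lborel. f n y) = a n * (ze - 0) ^ n" for n
   unfolding f_def a_def by (subst integral_mult_right_zero) simp
  ultimately show ?thesis using sums_unique[OF fs] by (simp add: F_def)
 qed
 have "F field_differentiable (at ze)" for ze
  using holomorphic_on_imp_differentiable_at[OF power_series_holomorphic[of 0 "cmod ze + 1", OF S] open_ball, of ze] by simp
 then show ?thesis unfolding F_def[symmetric] by (simp add: holomorphic_on_def field_differentiable_at_within)
qed

text \<open>Expanding the square leaves a Gaussian factor in ze times an exponential transform of
  \<open>heat \<tau> y * f y\<close>.\<close>

lemma holomorphic_heat_transform:
 fixes f :: "real => real"
 assumes \<tau>: "0 < \<tau>" and [measurable]: "f \<in> borel_measurable borel" and i: "!!z. integrable lborel (%y. heat \<tau> (y - z) * f y)"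
 shows "(%ze. \<integral>y. cheat \<tau> (of_real y - ze) * of_real (f y) \<partial>lborel) holomorphic_on UNIV"
proof -
 define w where "w y = heat \<tau> y * f y" for y
 have wm: "w \<in> borel_measurable borel" unfolding w_def[abs_def] by measurable
 have "exp (c * y) * w y = exp (\<tau> * c^2 / 2) * (heat \<tau> (y - c * \<tau>) * f y)" for c y
 proof -
  have "c * y + - y\<^sup>2 / (2 * \<tau>) = \<tau> * c^2 / 2 + - (y - c * \<tau>)\<^sup>2 / (2 * \<tau>)" using \<tau> by (simp add: field_simps power2_eq_square)
  then have "exp (c * y) * exp (- y\<^sup>2 / (2 * \<tau>)) = exp (\<tau> * c^2 / 2) * exp (- (y - c * \<tau>)\<^sup>2 / (2 * \<tau>))" by (simp only: exp_add[symmetric])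
  then show ?thesis unfolding w_def heat_eq[OF \<tau>] by (simp only: mult.assoc[symmetric] times_divide_eq_right times_divide_eq_left)
 qed
 then have wi: "integrable lborel (%y. exp (c * y) * w y)" for c using i by simp
 have eq: "(LINT y|lborel. cheat \<tau> (of_real y - ze) * of_real (f y)) = exp (- ze\<^sup>2 / of_real (2 * \<tau>)) * (LINT y|lborel. exp ((ze / of_real \<tau>) * of_real y) * of_real (w y))" for ze
 proof -
  have "cheat \<tau> (of_real y - ze) = exp (- ze\<^sup>2 / of_real (2 * \<tau>)) * (exp ((ze / of_real \<tau>) * of_real y) * of_real (heat \<tau> y))" for y
  proof -
   have "- (of_real y - ze)\<^sup>2 / of_real (2 * \<tau>) = - ze\<^sup>2 / of_real (2 * \<tau>) + ((ze / of_real \<tau>) * of_real y + - (of_real y)\<^sup>2 / of_real (2 * \<tau>))"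
    using \<tau> by (simp add: field_simps power2_eq_square)
   then have "exp (- (of_real y - ze)\<^sup>2 / of_real (2 * \<tau>)) = exp (- ze\<^sup>2 / of_real (2 * \<tau>)) * (exp ((ze / of_real \<tau>) * of_real y) * exp (- (of_real y)\<^sup>2 / of_real (2 * \<tau>)))"
    by (simp only: exp_add)
   then show ?thesis unfolding cheat_of_real[OF \<tau>, symmetric] cheat_def by (simp only: mult.assoc[symmetric] times_divide_eq_right)
  qed
  then show ?thesis unfolding w_def of_real_mult by (subst integral_mult_right_zero[symmetric]) (simp only: mult.assoc)
 qed
 have "(%ze. ze / of_real \<tau>) holomorphic_on UNIV" using \<tau> by (intro holomorphic_intros) auto
 from holomorphic_on_compose_gen[OF this holomorphic_exp_transform[OF wm wi]]
 have "(%ze. \<integral>y. exp ((ze / of_real \<tau>) * of_real y) * of_real (w y) \<partial>lborel) holomorphic_on UNIV" by (simp add: o_def)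
 then show ?thesis unfolding eq using \<tau> by (intro holomorphic_intros) auto
qed

context bounded_posterior
begin

text \<open>Continues \<open>g s z * (LINT y|K s z r. f y)\<close> to complex z: multiplication by
  \<open>g s z\<close> undoes the normalisation of the kernel and leaves a plain heat
  integral.\<close>

definition \<Phi> :: "real => real => (real => real) => complex => complex" where
 "\<Phi> s r f ze = (LINT y|lborel. cheat (r - s) (of_real y - ze) * of_real (g r y * f y))"

lemma tame_abs: "tame f ==> tame (%y. \<bar>f y\<bar>)" by (auto simp: tame_def)

context
 fixes s r :: real and f :: "real => real" assumes s: "0 <= s" "s < r" "r < 1" and f: "tame f"
begin

lemma K_heat:
 shows "integrable lborel (%y. heat (r - s) (y - z) * (g r y * f y))"
  and "(LINT y|lborel. heat (r - s) (y - z) * (g r y * f y)) = g s z * (LINT y|K s z r. f y)"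
proof -
 have [measurable]: "f \<in> borel_measurable borel" using f by (rule tame_measurable)
 have gp: "0 < g s z" using s by (intro g_pos) auto
 have eq: "(%y. heat (r - s) (y - z) * (g r y * f y)) = (%y. g s z * (ker s z r y *\<^sub>R f y))"
  using gp by (auto simp: ker_def)
 show "integrable lborel (%y. heat (r - s) (y - z) * (g r y * f y))"
  unfolding eq using integrable_K_tame[OF s f] by (intro integrable_mult_right) (simp add: integral_K(2))
 show "(LINT y|lborel. heat (r - s) (y - z) * (g r y * f y)) = g s z * (LINT y|K s z r. f y)"
  unfolding eq by (simp add: integral_K(1))
qed

lemma holomorphic_\<Phi>: "\<Phi> s r f holomorphic_on UNIV"
proof -
 have [measurable]: "f \<in> borel_measurable borel" using f by (rule tame_measurable)
 show ?thesis unfolding \<Phi>_def[abs_def] using s by (intro holomorphic_heat_transform K_heat(1)) auto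
qed

lemma \<Phi>_of_real: "\<Phi> s r f (of_real z) = of_real (g s z * (LINT y|K s z r. f y))"
proof -
 have "\<Phi> s r f (of_real z) = (LINT y|lborel. complex_of_real (heat (r - s) (y - z) * (g r y * f y)))"
  using s unfolding \<Phi>_def of_real_diff[symmetric] by (subst cheat_of_real) (simp_all only: of_real_mult)
 then show ?thesis by (simp only: integral_complex_of_real K_heat(2))
qed

end

lemma norm_\<Phi>:
 assumes s: "0 <= s" "s < r" "r < 1" and f: "tame f"
 shows "cmod (\<Phi> s r f ze) <= exp ((Im ze)^2 / (2 * (r - s))) * (g s (Re ze) * (LINT y|K s (Re ze) r. \<bar>f y\<bar>))"
proof -
 have "cmod (\<Phi> s r f ze) <= (LINT y|lborel. cmod (cheat (r - s) (of_real y - ze) * of_real (g r y * f y)))"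
  unfolding \<Phi>_def by (rule integral_norm_bound)
 also have "... = (LINT y|lborel. exp ((Im ze)^2 / (2 * (r - s))) * (heat (r - s) (y - Re ze) * (g r y * \<bar>f y\<bar>)))"
  using s by (intro Bochner_Integration.integral_cong refl) (simp only: norm_mult norm_of_real norm_cheat abs_mult abs_of_nonneg[OF g_nonneg] minus_complex.sel Re_complex_of_real Im_complex_of_real diff_0 power2_minus mult.assoc diff_gt_0_iff_gt)
 also have "... = exp ((Im ze)^2 / (2 * (r - s))) * (g s (Re ze) * (LINT y|K s (Re ze) r. \<bar>f y\<bar>))"
  using K_heat(2)[OF s tame_abs[OF f]] by simp
 finally show ?thesis .
qed

text \<open>Away from the real neighbourhood where \<open>f\<close> vanishes, the Gaussian kernel at a complex point
 is dominated by its values at two real points.\<close>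
lemma norm_\<Phi>_far:
 assumes s: "0 <= s" "s < r" "r < 1" and f: "tame f" "!!y. 0 <= f y" "!!y. \<bar>y - y0\<bar> < 8 * eps ==> f y = 0"
  and ze: "cmod (ze - of_real y0) < eps"
 shows "cmod (\<Phi> s r f ze) <= g s (y0 + 3 * eps) * (LINT y|K s (y0 + 3 * eps) r. f y) + g s (y0 - 3 * eps) * (LINT y|K s (y0 - 3 * eps) r. f y)"
proof -
 define q v where "q = Re ze - y0" and "v = Im ze"
 have eps: "0 < eps" using ze by (rule le_less_trans[OF norm_ge_zero])
 have qv: "\<bar>q\<bar> < eps" "\<bar>v\<bar> < eps"
  using ze abs_Re_le_cmod[of "ze - of_real y0"] abs_Im_le_cmod[of "ze - of_real y0"] by (auto simp: q_def v_def)
 have v2: "v\<^sup>2 <= 2 * eps * eps"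
  using mult_mono[of "\<bar>v\<bar>" eps "\<bar>v\<bar>" "2 * eps"] qv eps by (simp add: power2_eq_square mult.commute)
 \<comment> \<open>For a target at distance at least 8 * eps, moving the base point from the real
   part of ze to 3 * eps on the side of the target shortens the squared distance by at least 2 *
   eps^2. This pays for the factor exp of v^2 in \<open>norm_cheat\<close>.\<close>
 have sq: "(p - 3 * eps)\<^sup>2 <= (p - x)\<^sup>2 - v\<^sup>2" if "8 * eps <= p" "\<bar>x\<bar> < eps" for p x
 proof -
  have "2 * eps * eps <= (3 * eps - x) * (2 * p - x - 3 * eps)" using that eps by (intro mult_mono) auto
  then have "v\<^sup>2 <= (3 * eps - x) * (2 * p - x - 3 * eps)" using v2 by linarith
  moreover have "(p - x)\<^sup>2 - (p - 3 * eps)\<^sup>2 = (3 * eps - x) * (2 * p - x - 3 * eps)" by (simp add: power2_eq_square algebra_simps)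
  ultimately show ?thesis by linarith
 qed
 let ?H = "%z y. heat (r - s) (y - z) * (g r y * f y)"
 have pw: "cmod (cheat (r - s) (of_real y - ze) * of_real (g r y * f y)) <= ?H (y0 + 3 * eps) y + ?H (y0 - 3 * eps) y" for y
 proof (cases "\<bar>y - y0\<bar> < 8 * eps")
  case True then show ?thesis using f(3) by simp
 next
  case False
  have rs: "0 < r - s" using s by simp
  have "cmod (cheat (r - s) (of_real y - ze)) = exp (v^2 / (2 * (r - s)) + - (y - y0 - q)\<^sup>2 / (2 * (r - s))) / sqrt (2 * pi * (r - s))"
   using norm_cheat[OF rs, of "of_real y - ze"] unfolding heat_eq[OF rs] exp_add by (simp add: v_def q_def algebra_simps)
  also have "v\<^sup>2 / (2 * (r - s)) + - (y - y0 - q)\<^sup>2 / (2 * (r - s)) = - ((y - y0 - q)^2 - v\<^sup>2) / (2 * (r - s))"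
   by (simp add: diff_divide_distrib)
  finally have n: "cmod (cheat (r - s) (of_real y - ze)) = exp (- ((y - y0 - q)^2 - v\<^sup>2) / (2 * (r - s))) / sqrt (2 * pi * (r - s))" .
  have le: "cmod (cheat (r - s) (of_real y - ze)) <= heat (r - s) (y - z)" if "(y - z)\<^sup>2 <= (y - y0 - q)\<^sup>2 - v\<^sup>2" for z
   unfolding n heat_eq[OF rs] using that rs by (intro divide_right_mono exp_le_cancel_iff[THEN iffD2]) auto
  have "cmod (cheat (r - s) (of_real y - ze)) <= heat (r - s) (y - (y0 + 3 * eps)) + heat (r - s) (y - (y0 - 3 * eps))"
  proof (cases "8 * eps <= y - y0")
   case True
   have "cmod (cheat (r - s) (of_real y - ze)) <= heat (r - s) (y - (y0 + 3 * eps))"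
    using sq[OF True qv(1)] by (intro le) (simp add: algebra_simps)
   then show ?thesis using heat_nonneg[of "r - s" "y - (y0 - 3 * eps)"] by linarith
  next
   case False
   then have F: "8 * eps <= - (y - y0)" using \<open>\<not> \<bar>y - y0\<bar> < 8 * eps\<close> by linarith
   have "(- (y - y0) - 3 * eps)\<^sup>2 = (y - (y0 - 3 * eps))\<^sup>2" "(- (y - y0) - - q)\<^sup>2 = (y - y0 - q)^2"
    by (simp_all add: power2_eq_square algebra_simps)
   then have "cmod (cheat (r - s) (of_real y - ze)) <= heat (r - s) (y - (y0 - 3 * eps))"
    using sq[OF F, of "- q"] qv(1) by (intro le) simp
   then show ?thesis using heat_nonneg[of "r - s" "y - (y0 + 3 * eps)"] by linarith
  qed
  then have "cmod (cheat (r - s) (of_real y - ze)) * (g r y * f y) <= (heat (r - s) (y - (y0 + 3 * eps)) + heat (r - s) (y - (y0 - 3 * eps))) * (g r y * f y)"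
   using g_nonneg f(2) by (intro mult_right_mono) auto
  then show ?thesis using g_nonneg[of r y] f(2)[of y]
   by (simp only: norm_mult norm_of_real abs_mult abs_of_nonneg distrib_right)
 qed
 have [measurable]: "f \<in> borel_measurable borel" using f(1) by (rule tame_measurable)
 have iH: "integrable lborel (?H z)" for z by (rule K_heat(1)[OF s f(1)])
 have "integrable lborel (%y. cheat (r - s) (of_real y - ze) * of_real (g r y * f y))"
  by (rule Bochner_Integration.integrable_bound[OF Bochner_Integration.integrable_add[OF iH iH]]) (use pw in \<open>auto intro!: order_trans[OF _ abs_ge_self]\<close>)
 then have "cmod (\<Phi> s r f ze) <= (LINT y|lborel. ?H (y0 + 3 * eps) y + ?H (y0 - 3 * eps) y)"
  unfolding \<Phi>_def using iH pw by (intro order_trans[OF integral_norm_bound] integral_mono) auto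
 also have "... = (LINT y|lborel. ?H (y0 + 3 * eps) y) + (LINT y|lborel. ?H (y0 - 3 * eps) y)"
  by (rule Bochner_Integration.integral_add[OF iH iH])
 finally show ?thesis unfolding K_heat(2)[OF s f(1)] .
qed

end

text \<open>Cauchy's estimate bounds the derivative of G by 2 * B / eps, so G keeps half of its
  lower bound m on a ball whose radius depends only on B, m and eps.\<close>

lemma holomorphic_quotient_bound:
 fixes F G :: "complex => complex"
 assumes F: "F holomorphic_on ball c eps" and G: "G holomorphic_on ball c eps"
  and B: "!!w. w \<in> ball c eps ==> cmod (F w) <= B" "!!w. w \<in> ball c eps ==> cmod (G w) <= B"
  and m: "0 < m" "m <= cmod (G c)" and eps: "0 < eps" and dl: "dl <= eps / 2" "4 * B * dl <= m * eps"
 shows "(%w. F w / G w) holomorphic_on ball c dl" "!!w. w \<in> ball c dl ==> cmod (F w / G w) <= B / (m / 2)"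
  "!!w. w \<in> ball c dl ==> G w ~= 0"
proof -
 have sub: "ball c dl \<subseteq> ball c eps" using dl(1) eps by (intro subset_ball) auto
 have B0: "0 <= B" using order_trans[OF norm_ge_zero B(2)[of c]] eps by simp
 have d: "cmod (deriv G w) <= 2 * B / eps" if w: "w \<in> ball c dl" for w
 proof -
  have "w \<in> ball c (eps / 2)" using w dl(1) by auto
  then have sub2: "cball w (eps / 2) \<subseteq> ball c eps" by (intro cball_subset_ball_iff[THEN iffD2]) (auto simp: dist_commute)
  have "cmod ((deriv ^^ 1) G w) <= fact 1 * B / (eps / 2) ^ 1"
  proof (rule Cauchy_inequality)
   show "G holomorphic_on ball w (eps / 2)" using sub2 by (intro holomorphic_on_subset[OF G]) (auto dest: less_imp_le)
   show "continuous_on (cball w (eps / 2)) G" by (rule holomorphic_on_imp_continuous_on[OF holomorphic_on_subset[OF G sub2]])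
   show "cmod (G x) <= B" if "cmod (w - x) = eps / 2" for x
    using sub2 that by (intro B(2)) (auto simp: dist_norm)
  qed (use eps in simp)
  then show ?thesis by (simp add: mult.commute)
 qed
 have low: "m / 2 <= cmod (G w)" if w: "w \<in> ball c dl" for w
 proof -
  have c: "c \<in> ball c dl" using w by (auto intro: le_less_trans[OF zero_le_dist])
  have "cmod (G w - G c) <= 2 * B / eps * cmod (w - c)"
   using holomorphic_derivI[OF G open_ball] sub d
   by (intro field_differentiable_bound[OF convex_ball _ _ w c, of G "deriv G"]) (auto intro: has_field_derivative_at_within)
  also have "... <= 2 * B / eps * dl" using w B0 eps by (intro mult_left_mono) (auto simp: dist_norm norm_minus_commute)
  also have "... <= m / 2" using dl(2) eps by (simp add: field_simps)
  finally show ?thesis using m(2) norm_triangle_ineq2[of "G c" "G w"] by (simp add: norm_minus_commute)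
 qed
 show nz: "G w ~= 0" if "w \<in> ball c dl" for w using low[OF that] m(1) by auto
 show "(%w. F w / G w) holomorphic_on ball c dl"
  by (intro holomorphic_on_divide holomorphic_on_subset[OF F sub] holomorphic_on_subset[OF G sub] nz)
 show "cmod (F w / G w) <= B / (m / 2)" if "w \<in> ball c dl" for w
  unfolding norm_divide using low[OF that] B(1)[of w] B0 sub that m by (intro frac_le) auto
qed

lemma real_derivative_of_holomorphic:
 assumes D: "(F has_field_derivative D) (at (complex_of_real y))" and S: "open S" "y \<in> S" "!!x. x \<in> S ==> v x = Re (F (of_real x))"
 shows "(v has_real_derivative Re D) (at y)"
proof -
 have "((%x. Re (F (of_real x))) has_vector_derivative Re D) (at y)"
  by (rule bounded_linear.has_vector_derivative[OF bounded_linear_Re has_vector_derivative_real_field[OF D]])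
 then show ?thesis unfolding has_real_derivative_iff_has_vector_derivative[symmetric]
  by (rule has_field_derivative_transform_within_open[OF _ S(1,2)]) (simp add: S(3))
qed

text \<open>Cauchy estimates transferred to the real line. The constants involve only B and eps,
  hence are uniform over functions with a common bound on their extensions.\<close>

lemma real_Taylor_of_holomorphic:
 assumes F: "F holomorphic_on ball (complex_of_real y0) eps" and B: "!!w. w \<in> ball (of_real y0) eps ==> cmod (F w) <= B"
  and v: "!!y. \<bar>y - y0\<bar> < eps ==> F (of_real y) = of_real (v y)" and eps: "0 < eps"
 shows "!!y. \<bar>y - y0\<bar> < eps ==> (v has_real_derivative deriv v y) (at y)"
  and "(deriv v has_real_derivative deriv (deriv v) y0) (at y0)"
  and "\<bar>deriv v y0\<bar> <= B / (eps / 2)" "\<bar>deriv (deriv v) y0\<bar> <= 2 * B / (eps / 2)^2"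
  and "!!x. \<bar>x\<bar> < eps / 2 ==> \<bar>v (y0 + x) - v y0 - deriv v y0 * x - deriv (deriv v) y0 * x^2 / 2\<bar> <= 3 * B / (eps / 2) ^ 3 * \<bar>x\<bar> ^ 3"
proof -
 let ?c = "complex_of_real y0"
 define S where "S = {y0 - eps<..<y0 + eps}"
 have oS: "open S" and yS: "y0 \<in> S" using eps by (auto simp: S_def)
 have inS: "x \<in> S \<longleftrightarrow> \<bar>x - y0\<bar> < eps" for x by (auto simp: S_def abs_less_iff)
 have inb: "of_real x \<in> ball ?c eps" if "x \<in> S" for x
  using that unfolding inS mem_ball dist_norm of_real_diff[symmetric] norm_of_real by (simp add: abs_minus_commute)
 have hd: "((deriv ^^ i) F has_field_derivative (deriv ^^ Suc i) F w) (at w)" if "w \<in> ball ?c eps" for i w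
  using holomorphic_derivI[OF holomorphic_higher_deriv[OF F open_ball] open_ball that, of i] by simp
 have d1: "(v has_real_derivative Re (deriv F (of_real y))) (at y)" if "y \<in> S" for y
  using hd[OF inb[OF that], of 0] oS that v by (intro real_derivative_of_holomorphic[of F _ _ S]) (auto simp: inS)
 then have dv: "deriv v y = Re (deriv F (of_real y))" if "y \<in> S" for y using that by (intro DERIV_imp_deriv)
 show "!!y. \<bar>y - y0\<bar> < eps ==> (v has_real_derivative deriv v y) (at y)" using d1 dv by (simp add: inS)
 have d2: "(deriv v has_real_derivative Re ((deriv ^^ 2) F ?c)) (at y0)"
  using hd[OF inb[OF yS], of 1] oS yS dv by (intro real_derivative_of_holomorphic[of "deriv F" _ _ S]) (auto simp: numeral_2_eq_2)
 then have dv2: "deriv (deriv v) y0 = Re ((deriv ^^ 2) F ?c)" by (rule DERIV_imp_deriv)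
 show "(deriv v has_real_derivative deriv (deriv v) y0) (at y0)" using d2 unfolding dv2 .
 have cauchy: "cmod ((deriv ^^ n) F w) <= fact n * B / (eps / 2) ^ n" if w: "w \<in> ball ?c (eps / 2)" for n w
 proof (rule Cauchy_inequality)
  have sub: "cball w (eps / 2) \<subseteq> ball ?c eps" using w by (intro cball_subset_ball_iff[THEN iffD2]) (auto simp: dist_commute)
  show "F holomorphic_on ball w (eps / 2)" using sub by (intro holomorphic_on_subset[OF F]) (auto dest: less_imp_le)
  show "continuous_on (cball w (eps / 2)) F" by (rule holomorphic_on_imp_continuous_on[OF holomorphic_on_subset[OF F sub]])
  show "cmod (F x) <= B" if "cmod (w - x) = eps / 2" for x using sub that by (intro B) (auto simp: dist_norm)
 qed (use eps in simp)
 have c0: "?c \<in> ball ?c (eps / 2)" using eps by simp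
 show "\<bar>deriv v y0\<bar> <= B / (eps / 2)"
  using cauchy[OF c0, of 1] abs_Re_le_cmod[of "deriv F ?c"] unfolding dv[OF yS] by simp
 show "\<bar>deriv (deriv v) y0\<bar> <= 2 * B / (eps / 2)^2"
  using cauchy[OF c0, of 2] abs_Re_le_cmod[of "(deriv ^^ 2) F ?c"] unfolding dv2 by (simp add: fact_numeral)
 fix x assume x: "\<bar>x\<bar> < eps / 2"
 let ?z = "complex_of_real (y0 + x)"
 have z: "?z \<in> ball ?c (eps / 2)" using x by (simp add: dist_norm)
 have "cmod ((deriv ^^ 0) F ?z - (\<Sum>i\<le>2. (deriv ^^ i) F ?c * (?z - ?c) ^ i / fact i)) <= fact 3 * B / (eps / 2) ^ 3 * cmod (?z - ?c) ^ Suc 2 / fact 2"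
 proof (rule complex_Taylor[where f = "%i. (deriv ^^ i) F" and n = 2, OF convex_ball _ _ c0 z])
  fix i w assume "w \<in> ball ?c (eps / 2)"
  then have "w \<in> ball ?c eps" using eps by simp
  then show "((deriv ^^ i) F has_field_derivative (deriv ^^ Suc i) F w) (at w within ball ?c (eps / 2))"
   by (rule has_field_derivative_at_within[OF hd])
 next
  show "cmod ((deriv ^^ Suc 2) F w) <= fact 3 * B / (eps / 2) ^ 3" if "w \<in> ball ?c (eps / 2)" for w
   using cauchy[OF that, of 3] by (simp only: numeral_3_eq_3 numeral_2_eq_2)
 qed
 moreover have "?z - ?c = of_real x" by simp
 ultimately have T: "cmod (F ?z - (\<Sum>i\<le>2. (deriv ^^ i) F ?c * of_real x ^ i / fact i)) <= fact 3 * B / (eps / 2) ^ 3 * \<bar>x\<bar> ^ Suc 2 / fact 2"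
  by (simp only: funpow_0 norm_of_real)
 have "sum f {..2::nat} = f 0 + f 1 + f 2" for f :: "nat => complex" by (simp add: numeral_2_eq_2)
 then have s: "(\<Sum>i\<le>2. (deriv ^^ i) F ?c * of_real x ^ i / fact i) = F ?c + deriv F ?c * of_real x + (deriv ^^ 2) F ?c * of_real (x^2 / 2)"
  by (simp add: fact_numeral)
 have Fz: "F ?z = of_real (v (y0 + x))" and Fc: "F ?c = of_real (v y0)" using v[of "y0 + x"] v[of y0] x eps by auto
 have Re_mult: "Re (w * of_real p) = Re w * p" for w p by simp
 have "Re (F ?z - (\<Sum>i\<le>2. (deriv ^^ i) F ?c * of_real x ^ i / fact i)) = v (y0 + x) - v y0 - deriv v y0 * x - deriv (deriv v) y0 * x^2 / 2"
  unfolding dv2 dv[OF yS] s Fz Fc by (simp only: minus_complex.sel plus_complex.sel Re_mult Re_complex_of_real)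
 moreover have "fact 3 * B / (eps / 2) ^ 3 * \<bar>x\<bar> ^ Suc 2 / fact 2 = 3 * B / (eps / 2) ^ 3 * \<bar>x\<bar> ^ 3"
  by (simp add: fact_numeral eval_nat_numeral(3)[symmetric] del: power_Suc)
 ultimately show "\<bar>v (y0 + x) - v y0 - deriv v y0 * x - deriv (deriv v) y0 * x^2 / 2\<bar> <= 3 * B / (eps / 2) ^ 3 * \<bar>x\<bar> ^ 3"
  using order_trans[OF abs_Re_le_cmod T] by (simp only:)

qed

text \<open>Both coefficients can be read off from the values at 0, k and -k up to an error C * k^3;
  so convergence of values at fixed small k forces convergence of the coefficients. The choice of k
  makes 8 * C * k at most the tolerance d.\<close>

lemma Taylor_coefficients_tendsto:
 fixes w :: "'a => real => real"
 assumes T: "eventually (%r. \<forall>x. \<bar>x\<bar> < e --> \<bar>w r x - w r 0 - a r * x - c r * x^2 / 2\<bar> <= C * \<bar>x\<bar> ^ 3) F"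
  and T0: "!!x. \<bar>x\<bar> < e ==> \<bar>w0 x - w0 0 - a0 * x - c0 * x^2 / 2\<bar> <= C * \<bar>x\<bar> ^ 3"
  and l: "!!x. \<bar>x\<bar> < e ==> ((%r. w r x) \<longlongrightarrow> w0 x) F" and e: "0 < e"
 shows "(a \<longlongrightarrow> a0) F" "(c \<longlongrightarrow> c0) F"
proof -
 have C0: "0 <= C" using order_trans[OF abs_ge_zero T0[of "e / 2"]] e by (simp add: zero_le_mult_iff)
 have "(a \<longlongrightarrow> a0) F \<and> (c \<longlongrightarrow> c0) F"
 proof (intro conjI tendstoI)
  fix d :: real assume d: "0 < d"
  define k where "k = min (e / 2) (min 1 (d / (8 * (C + 1))))"
  have k: "0 < k" "k < e" "k <= 1" "k <= d / (8 * (C + 1))" using e d C0 by (auto simp: k_def)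
  have Ck: "8 * C * k <= d"
  proof -
   have "k * (8 * (C + 1)) <= d" using k(4) C0 by (simp add: pos_le_divide_eq)
   then show ?thesis using k(1) by (simp add: algebra_simps)
  qed
  have kk: "k ^ 3 = k * (k * k)" "k * k <= k" using k mult_left_mono[of k 1 k] by (simp_all add: power3_eq_cube)
  have Ckk: "8 * (C * k ^ 3) <= d * (k * k)"
   using mult_right_mono[OF Ck, of "k * k"] by (simp add: power3_eq_cube mult_ac)
  have dk: "d * (k * k) <= d * k" using kk d by simp
  have ev: "eventually (%r. \<bar>w r x - w0 x\<bar> < d * (k * k) / 32) F" if "\<bar>x\<bar> < e" for x
   using tendstoD[OF l[OF that], of "d * (k * k) / 32"] d k by (simp add: dist_real_def)
  have ek: "\<bar>k\<bar> < e" "\<bar>- k\<bar> < e" "\<bar>0\<bar> < e" using k e by auto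
  have main: "eventually (%r. \<bar>a r - a0\<bar> < d \<and> \<bar>c r - c0\<bar> < d) F"
   using T ev[OF ek(1)] ev[OF ek(2)] ev[OF ek(3)]
  proof eventually_elim
   case (elim r)
   have p: "\<bar>w r k - w r 0 - a r * k - c r * (k * k) / 2\<bar> <= C * k ^ 3" "\<bar>w r (- k) - w r 0 + a r * k - c r * (k * k) / 2\<bar> <= C * k ^ 3"
    using elim(1)[rule_format, of k] elim(1)[rule_format, of "- k"] k by (simp_all add: power2_eq_square)
   have q: "\<bar>w0 k - w0 0 - a0 * k - c0 * (k * k) / 2\<bar> <= C * k ^ 3" "\<bar>w0 (- k) - w0 0 + a0 * k - c0 * (k * k) / 2\<bar> <= C * k ^ 3"
    using T0[of k] T0[of "- k"] k by (simp_all add: power2_eq_square)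
   have l3: "\<bar>w r k - w0 k\<bar> < d * (k * k) / 32" "\<bar>w r (- k) - w0 (- k)\<bar> < d * (k * k) / 32" "\<bar>w r 0 - w0 0\<bar> < d * (k * k) / 32"
    using elim by auto
   have "\<bar>(a r - a0) * k\<bar> < d * k" unfolding left_diff_distrib using p q l3 Ckk dk by (simp only: abs_less_iff abs_le_iff) linarith
   moreover have "\<bar>(c r - c0) * (k * k)\<bar> < d * (k * k)" unfolding left_diff_distrib using p q l3 Ckk by (simp only: abs_less_iff abs_le_iff) linarith
   ultimately show ?case using k by (simp add: abs_mult)
  qed
  show "eventually (%r. dist (a r) a0 < d) F" "eventually (%r. dist (c r) c0 < d) F"
   using main by (auto elim!: eventually_mono simp: dist_real_def)
 qed
 then show "(a \<longlongrightarrow> a0) F" "(c \<longlongrightarrow> c0) F" by auto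
qed

section \<open>Complex extension of the value function\<close>

context bounded_posterior
begin

lemma V_abs_le: "0 <= s ==> s < 1 ==> \<bar>V s y\<bar> <= 3 / 2 * (1 + Fm 0 s y)"
 using V_envelope[of s y] Fm_ge[of s y 0] by (simp add: field_simps)

lemma Fm_growth:
 assumes "T < 1" obtains C where "0 <= C" "!!s z. 0 <= s ==> s <= T ==> Fm 0 s z <= C * (1 + z^2)"
proof -
 obtain C where C: "0 <= C" "!!s z. 0 <= s ==> s <= T ==> \<rho> s z <= C * (1 + z^2)" using \<rho>_growth[OF assms] by blast
 show ?thesis
 proof (rule that[of "6 * C + 4"])
  fix s z :: real assume s: "0 <= s" "s <= T"
  have "Fm 0 s z <= 6 * \<rho> s z + 2 + 4 * z^2"
   using sq_le_\<rho>_msq(2)[of s 0 z] s assms unfolding Fm_def by (simp add: algebra_simps)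
  also have "... <= 6 * (C * (1 + z^2)) + 4 * (1 + z^2)" using C(2)[OF s, of z] by simp
  finally show "Fm 0 s z <= (6 * C + 4) * (1 + z^2)" by (simp add: algebra_simps)
 qed (use C in simp)
qed

text \<open>The majorant 3 / 2 * (1 + Fm) of |V| is superharmonic, so it may be evaluated at the
  starting point.\<close>

lemma integral_abs_V_le:
 assumes s: "0 <= s" "s < r" "r < 1" shows "(LINT y|K s z r. \<bar>V r y\<bar>) <= 3 / 2 * (1 + Fm 0 s z)"
proof -
 interpret Kp: prob_space "K s z r" by (rule prob_space_K[OF s])
 have r: "0 <= r" "r < 1" using s by auto
 have "(LINT y|K s z r. \<bar>V r y\<bar>) <= (LINT y|K s z r. 3 / 2 * (1 + Fm 0 r y))"
  by (intro K_mono[OF s] tame_abs tame_V[OF r] tame_cmult tame_add tame_const tame_Fm[OF r] V_abs_le[OF r])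
 also have "... <= 3 / 2 * (1 + Fm 0 s z)" using K_Fm_le[OF s, of z 0] integrable_K_tame[OF s tame_Fm[OF r]] Kp.prob_space by simp
 finally show ?thesis .
qed

text \<open>Iterating the kernel over a partition writes V s as the average of V \<beta> plus
  averaged defects. Defects within 8 * eps of y0 total order 1 / n and are dropped. The remaining
  ones are dominated at complex points by their averages from two real points, and there the sum
  telescopes to at most V s minus the average of V \<beta>, independently of n.\<close>

lemma gV_extension:
 assumes eps: "0 < eps" and s: "0 <= s" "s + 2 * eps <= \<beta>" "\<beta> < 1" and A: "0 <= A"
  and H: "!!q y r. s <= q ==> q < r ==> r <= \<beta> ==> \<bar>y - y0\<bar> < 8 * eps ==> V q y - (LINT x|K q y r. V r x) <= A * (r - q)^2"
  and bd: "!!x. \<bar>x - y0\<bar> <= 8 * eps ==> g s x <= G1 \<and> \<bar>V s x\<bar> <= V1 \<and> (LINT y|K s x \<beta>. \<bar>V \<beta> y\<bar>) <= I1"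
 obtains F where "F holomorphic_on ball (of_real y0) eps"
  "!!w. w \<in> ball (of_real y0) eps ==> cmod (F w) <= exp (eps / 4) * (G1 * I1) + (G1 * (V1 + I1) + G1 * (V1 + I1))"
  "!!y. \<bar>y - y0\<bar> < eps ==> F (of_real y) = of_real (g s y * V s y)"
proof -
 have s\<beta>: "s < \<beta>" "s < 1" "0 <= \<beta>" using s eps by auto
 define dl where "dl n = (\<beta> - s) / real (Suc n)" for n
 define r where "r n k = s + real k * dl n" for n k
 have dl: "0 < dl n" for n using s\<beta> by (simp add: dl_def)
 have rSuc: "r n (Suc k) = r n k + dl n" for n k by (simp add: r_def algebra_simps)
 have r\<beta>: "r n (Suc n) = \<beta>" for n by (simp add: r_def dl_def)
 have rle: "r n k <= \<beta>" if "k <= Suc n" for n k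
 proof -
  have "real k * dl n <= real (Suc n) * dl n" using that dl[of n] by (intro mult_right_mono) auto
  then show ?thesis using r\<beta>[of n] by (simp add: r_def)
 qed
 have rge: "s <= r n k" "s < r n (Suc k)" for n k using dl[of n] by (auto simp: r_def)
 define E where "E n k y = V (r n k) y - (LINT x|K (r n k) y (r n (Suc k)). V (r n (Suc k)) x)" for n k y
 define E' where "E' n k y = (if \<bar>y - y0\<bar> < 8 * eps then 0 else E n k y)" for n k y
 have br: "0 <= r n k" "r n k < r n (Suc k)" "r n (Suc k) < 1" "r n k < 1" "0 <= r n (Suc k)" if "k <= n" for n k
  using rge[of n k] s rle[of "Suc k" n] that rSuc[of n k] dl[of n] by auto
 have E0: "0 <= E n k y" if "k <= n" for n k y unfolding E_def using V_superharmonic[OF br(1-3)[OF that], of y] by simp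
 have EA: "E n k y <= A * (dl n)^2" if "k <= n" "\<bar>y - y0\<bar> < 8 * eps" for n k y
  using H[of "r n k" "r n (Suc k)" y] rge[of n k] rle[of "Suc k" n] that br(2)[of k n] by (simp add: E_def rSuc)
 have PV: "tame (%y. \<integral>x. V (r n (Suc k)) x \<partial>K (r n k) y (r n (Suc k)))" if "k <= n" for n k
  using br[OF that] by (intro tame_K tame_V)
 have tE: "tame (E n k)" if "k <= n" for n k
  using tame_add[OF tame_V[OF br(1,4)[OF that]] tame_cmult[OF PV[OF that], of "- 1"]] by (simp add: E_def[abs_def])
 have tE': "tame (E' n k)" if "k <= n" for n k
 proof (rule tameI[OF _ _ tame_abs[OF tE[OF that]]])
  have [measurable]: "E n k \<in> borel_measurable borel" by (rule tame_measurable[OF tE[OF that]])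
  show "E' n k \<in> borel_measurable borel" unfolding E'_def[abs_def] by measurable
 qed (simp add: E'_def)
 have E'0: "0 <= E' n k y" "E' n k y <= E n k y" "E n k y <= E' n k y + A * (dl n)^2" if "k <= n" for n k y
  using E0[OF that] EA[OF that] A by (auto simp: E'_def)
 define P where "P n x k = (LINT y|K s x (r n (Suc k)). V (r n (Suc k)) y)" for n x k
 have EP: "(LINT y|K s x (r n (Suc k)). E n (Suc k) y) = P n x k - P n x (Suc k)" if k: "k < n" for n x k
 proof -
  have sr: "0 <= s" "s < r n (Suc k)" "r n (Suc k) < 1" using s rge br(3)[of k n] k by auto
  have k': "Suc k <= n" using k by simp
  show ?thesis unfolding E_def P_def
   using K_K[OF sr(1,2) br(2,3)[OF k'] tame_V[OF br(5,3)[OF k']], of x] integrable_K_tame[OF sr PV[OF k']] integrable_K_tame[OF sr tame_V[OF br(1,4)[OF k']]]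
   by simp
 qed
 \<comment> \<open>By Chapman-Kolmogorov each averaged defect is a difference of consecutive
   averages of V (fact \<open>EP\<close>).\<close>
 have tele: "(\<Sum>k<n. \<integral>y. E n (Suc k) y \<partial>K s x (r n (Suc k))) = P n x 0 - (LINT y|K s x \<beta>. V \<beta> y)" for n x
 proof -
  have "(\<Sum>k<n. \<integral>y. E n (Suc k) y \<partial>K s x (r n (Suc k))) = (\<Sum>k<n. P n x k - P n x (Suc k))" using EP by (intro sum.cong) auto
  also have "... = P n x 0 - P n x n" by (rule sum_lessThan_telescope')
  also have "P n x n = (LINT y|K s x \<beta>. V \<beta> y)" unfolding P_def r\<beta> ..
  finally show ?thesis .
 qed
 have P0: "P n x 0 <= V s x" for n x
  unfolding P_def using V_superharmonic[OF s(1) rge(2)[of n 0] br(3)[of 0 n], of x] by simp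
 have r0: "r n 0 = s" for n by (simp add: r_def)
 have P0': "V s x <= P n x 0 + A * (dl n)^2" if "\<bar>x - y0\<bar> < 8 * eps" for n x
  using EA[OF _ that, of 0 n] unfolding E_def P_def r0 by simp
 \<comment> \<open>The defect of the first cell sits at time s and is not smoothed by any kernel. It
   is left out; near y0 it is at most A * dl^2 (fact \<open>P0'\<close>).\<close>
 define F where "F n ze = \<Phi> s \<beta> (V \<beta>) ze + (\<Sum>k<n. \<Phi> s (r n (Suc k)) (E' n (Suc k)) ze)" for n ze
 have sr: "0 <= s" "s < r n (Suc k)" "r n (Suc k) < 1" if "k < n" for n k using s rge br(3)[of k n] that by auto
 have holF: "F n holomorphic_on ball (of_real y0) eps" for n
  unfolding F_def[abs_def]
  by (intro holomorphic_on_add holomorphic_on_sum holomorphic_on_subset[OF holomorphic_\<Phi>[OF s(1) s\<beta>(1) s(3) tame_V[OF s\<beta>(3) s(3)]]] holomorphic_on_subset[OF holomorphic_\<Phi>[OF sr tE']]) auto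
 have bound: "cmod (F n w) <= exp (eps / 4) * (G1 * I1) + (G1 * (V1 + I1) + G1 * (V1 + I1))" if w: "w \<in> ball (of_real y0) eps" for n w
 proof -
  have w': "cmod (w - of_real y0) < eps" using w by (simp add: dist_norm norm_minus_commute)
  have Iw: "\<bar>Im w\<bar> < eps" "\<bar>Re w - y0\<bar> < eps" using w' abs_Im_le_cmod[of "w - of_real y0"] abs_Re_le_cmod[of "w - of_real y0"] by auto
  have I0: "0 <= (LINT y|K s x \<beta>. \<bar>V \<beta> y\<bar>)" for x by (intro Bochner_Integration.integral_nonneg) simp
  \<comment> \<open>The gap of at least 2 * eps between s and \<beta> keeps the factor of
    \<open>norm_cheat\<close> for the terminal value below exp (eps / 4).\<close>
  have "(Im w)\<^sup>2 <= eps\<^sup>2" using Iw(1) by (simp add: abs_le_square_iff[symmetric])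
  then have "(Im w)\<^sup>2 / (2 * (\<beta> - s)) <= eps\<^sup>2 / (2 * (2 * eps))" using s eps by (intro frac_le) auto
  then have e: "exp ((Im w)^2 / (2 * (\<beta> - s))) <= exp (eps / 4)" using eps by (simp add: power2_eq_square)
  have x: "\<bar>Re w - y0\<bar> <= 8 * eps" using Iw eps by simp
  have 1: "cmod (\<Phi> s \<beta> (V \<beta>) w) <= exp (eps / 4) * (G1 * I1)"
  proof (rule order_trans[OF norm_\<Phi>[OF s(1) s\<beta>(1) s(3) tame_V[OF s\<beta>(3) s(3)]]])
   show "exp ((Im w)^2 / (2 * (\<beta> - s))) * (g s (Re w) * (LINT y|K s (Re w) \<beta>. \<bar>V \<beta> y\<bar>)) <= exp (eps / 4) * (G1 * I1)"
    using bd[OF x] e I0 g_nonneg by (intro mult_mono mult_nonneg_nonneg) (auto intro: order_trans[OF g_nonneg])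
  qed
  have side: "g s x * (\<Sum>k<n. \<integral>y. E' n (Suc k) y \<partial>K s x (r n (Suc k))) <= G1 * (V1 + I1)" if x: "\<bar>x - y0\<bar> <= 8 * eps" for x
  proof -
   have "(\<Sum>k<n. \<integral>y. E' n (Suc k) y \<partial>K s x (r n (Suc k))) <= (\<Sum>k<n. \<integral>y. E n (Suc k) y \<partial>K s x (r n (Suc k)))"
    using E'0(2) by (intro sum_mono K_mono[OF sr tE' tE]) auto
   also have "... <= V1 + I1"
   proof -
    have "\<bar>\<integral>y. V \<beta> y \<partial>K s x \<beta>\<bar> <= (LINT y|K s x \<beta>. \<bar>V \<beta> y\<bar>)" using integral_norm_bound[of "K s x \<beta>" "V \<beta>"] by simp
    then show ?thesis unfolding tele using P0[of n x] bd[OF x] by linarith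
   qed
   finally have le: "(\<Sum>k<n. \<integral>y. E' n (Suc k) y \<partial>K s x (r n (Suc k))) <= V1 + I1" .
   have "0 <= (\<Sum>k<n. \<integral>y. E' n (Suc k) y \<partial>K s x (r n (Suc k)))"
    using E'0(1) by (intro sum_nonneg Bochner_Integration.integral_nonneg) auto
   then show ?thesis using bd[OF x] le g_nonneg by (intro mult_mono) (auto intro: order_trans[OF g_nonneg])
  qed
  have "cmod (\<Sum>k<n. \<Phi> s (r n (Suc k)) (E' n (Suc k)) w) <= (\<Sum>k<n. cmod (\<Phi> s (r n (Suc k)) (E' n (Suc k)) w))" by (rule norm_sum)
  also have "... <= (\<Sum>k<n. g s (y0 + 3 * eps) * (LINT y|K s (y0 + 3 * eps) (r n (Suc k)). E' n (Suc k) y) + g s (y0 - 3 * eps) * (LINT y|K s (y0 - 3 * eps) (r n (Suc k)). E' n (Suc k) y))"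
  proof (rule sum_mono)
   fix k assume "k \<in> {..<n}"
   then have k: "k < n" "Suc k <= n" by auto
   show "cmod (\<Phi> s (r n (Suc k)) (E' n (Suc k)) w) <= g s (y0 + 3 * eps) * (LINT y|K s (y0 + 3 * eps) (r n (Suc k)). E' n (Suc k) y) + g s (y0 - 3 * eps) * (LINT y|K s (y0 - 3 * eps) (r n (Suc k)). E' n (Suc k) y)"
    by (rule norm_\<Phi>_far[OF sr[OF k(1)] tE'[OF k(2)] E'0(1)[OF k(2)] _ w']) (simp add: E'_def)
  qed
  also have "... <= G1 * (V1 + I1) + G1 * (V1 + I1)"
   unfolding sum.distrib sum_distrib_left[symmetric] using eps by (intro add_mono side) auto
  finally show ?thesis unfolding F_def using 1 by (intro order_trans[OF norm_triangle_ineq] add_mono)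
 qed
 have lim: "(%n. F n (of_real y)) \<longlonglongrightarrow> of_real (g s y * V s y)" if y: "\<bar>y - y0\<bar> < eps" for y
 proof -
  define J where "J n = (\<Sum>k<n. \<integral>x. E' n (Suc k) x \<partial>K s y (r n (Suc k)))" for n
  have Fr: "F n (of_real y) = of_real (g s y * ((LINT x|K s y \<beta>. V \<beta> x) + J n))" for n
   unfolding F_def J_def \<Phi>_of_real[OF s(1) s\<beta>(1) s(3) tame_V[OF s\<beta>(3) s(3)]] distrib_left sum_distrib_left of_real_add of_real_sum
   by (intro arg_cong2[where f = "(+)"] refl sum.cong \<Phi>_of_real sr tE') auto
  have up: "J n <= V s y - (LINT x|K s y \<beta>. V \<beta> x)" for n
  proof -
   have "J n <= (\<Sum>k<n. \<integral>x. E n (Suc k) x \<partial>K s y (r n (Suc k)))" unfolding J_def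
    using E'0(2) by (intro sum_mono K_mono[OF sr tE' tE]) auto
   then show ?thesis unfolding tele using P0[of n y] by linarith
  qed
  have low: "V s y - (LINT x|K s y \<beta>. V \<beta> x) - A * (\<beta> - s)^2 * inverse (real (Suc n)) <= J n" for n
  proof -
   have "(\<Sum>k<n. \<integral>x. E n (Suc k) x \<partial>K s y (r n (Suc k))) <= (\<Sum>k<n. (LINT x|K s y (r n (Suc k)). E' n (Suc k) x) + A * (dl n)^2)"
   proof (rule sum_mono)
    fix k assume "k \<in> {..<n}"
    then have k: "k < n" "Suc k <= n" by auto
    interpret Kp: prob_space "K s y (r n (Suc k))" by (rule prob_space_K[OF sr[OF k(1)]])
    have "(LINT x|K s y (r n (Suc k)). E n (Suc k) x) <= (LINT x|K s y (r n (Suc k)). E' n (Suc k) x + A * (dl n)^2)"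
     using E'0(3) k by (intro K_mono[OF sr[OF k(1)] tE[OF k(2)]] tame_add tE' tame_const) auto
    then show "(LINT x|K s y (r n (Suc k)). E n (Suc k) x) <= (LINT x|K s y (r n (Suc k)). E' n (Suc k) x) + A * (dl n)^2"
     using integrable_K_tame[OF sr[OF k(1)] tE'[OF k(2)]] Kp.prob_space by simp
   qed
   then have "P n y 0 - (LINT x|K s y \<beta>. V \<beta> x) <= J n + real n * (A * (dl n)^2)" unfolding tele sum.distrib J_def by simp
   moreover have "V s y <= P n y 0 + A * (dl n)^2" using y eps by (intro P0') simp
   moreover have "real n * (A * (dl n)^2) + A * (dl n)^2 = A * (\<beta> - s)^2 * inverse (real (Suc n))"
   proof -
    have "real n * (A * (dl n)^2) + A * (dl n)^2 = A * (real (Suc n) * dl n) * dl n" by (simp add: power2_eq_square algebra_simps)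
    also have "real (Suc n) * dl n = \<beta> - s" by (simp add: dl_def)
    finally show ?thesis by (simp add: dl_def power2_eq_square divide_inverse mult_ac)
   qed
   ultimately show ?thesis by linarith
  qed
  have "(%n. V s y - (LINT x|K s y \<beta>. V \<beta> x) - A * (\<beta> - s)^2 * inverse (real (Suc n))) \<longlonglongrightarrow> V s y - (LINT x|K s y \<beta>. V \<beta> x) - A * (\<beta> - s)^2 * 0"
   by (intro tendsto_diff tendsto_mult tendsto_const LIMSEQ_inverse_real_of_nat)
  then have "J \<longlonglongrightarrow> V s y - (LINT x|K s y \<beta>. V \<beta> x)"
   by (intro tendsto_sandwich[OF always_eventually[OF allI[OF low]] always_eventually[OF allI[OF up]] _ tendsto_const]) simp
  then have "(%n. complex_of_real (g s y * ((LINT x|K s y \<beta>. V \<beta> x) + J n))) \<longlonglongrightarrow> of_real (g s y * ((LINT x|K s y \<beta>. V \<beta> x) + (V s y - (LINT x|K s y \<beta>. V \<beta> x))))"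
   by (intro tendsto_of_real tendsto_mult tendsto_add tendsto_const)
  then show ?thesis unfolding Fr by simp
 qed
 obtain f q where f: "f holomorphic_on ball (of_real y0) eps" "strict_mono (q :: nat => nat)" "!!x. x \<in> ball (of_real y0) eps ==> (%n. F (q n) x) \<longlonglongrightarrow> f x"
 proof (rule Montel[of "ball (of_real y0) eps" "range F" F])
  show "\<exists>B. \<forall>h\<in>range F. \<forall>z\<in>L. cmod (h z) <= B" if "L \<subseteq> ball (of_real y0) eps" for L
   using bound that by blast
 qed (use holF in auto)
 show ?thesis
 proof (rule that[OF f(1)])
  show "cmod (f w) <= exp (eps / 4) * (G1 * I1) + (G1 * (V1 + I1) + G1 * (V1 + I1))" if "w \<in> ball (of_real y0) eps" for w
   by (rule LIMSEQ_le_const2[OF tendsto_norm[OF f(3)[OF that]]]) (use bound[OF that] in auto)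
  fix y assume y: "\<bar>y - y0\<bar> < eps"
  then have "complex_of_real y \<in> ball (of_real y0) eps"
   unfolding mem_ball dist_norm of_real_diff[symmetric] norm_of_real by (simp add: abs_minus_commute)
  from f(3)[OF this] LIMSEQ_subseq_LIMSEQ[OF lim[OF y] f(2)] show "f (of_real y) = of_real (g s y * V s y)"
   by (intro LIMSEQ_unique) (simp_all add: o_def)
 qed
qed

end

section \<open>Derivatives of the value function and the equation\<close>

context bounded_posterior
begin

text \<open>\<open>gV_extension\<close> continues the product g V. Dividing by the continuation of
  g, bounded below at y0 by compactness, gives V itself on a ball whose radius and bound do not
  depend on s.\<close>

lemma V_extension:
 assumes s0: "0 <= s0" "s0 < 1" and gt: "y0 < V s0 y0"
 obtains eps B A where "0 < eps" "0 <= B" "0 <= A" "s0 + eps < 1"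
  "!!s. 0 <= s ==> \<bar>s - s0\<bar> < eps ==> \<exists>F. F holomorphic_on ball (of_real y0) eps \<and> (\<forall>w\<in>ball (of_real y0) eps. cmod (F w) <= B) \<and> (\<forall>y. \<bar>y - y0\<bar> < eps --> F (of_real y) = of_real (V s y))"
  "!!s r. 0 <= s ==> \<bar>s - s0\<bar> < eps ==> s < r ==> r < s0 + eps ==> V s y0 - (LINT x|K s y0 r. V r x) <= A * (r - s)^2"
proof -
 obtain A \<eta> where A: "0 <= A" "0 < \<eta>" "s0 + \<eta> < 1"
  and H: "!!s y r. 0 <= s ==> \<bar>s - s0\<bar> < \<eta> ==> \<bar>y - y0\<bar> < \<eta> ==> s < r ==> r < s0 + \<eta> ==> V s y - (LINT x|K s y r. V r x) <= A * (r - s)^2"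
  using local_harmonic[OF s0 gt] by blast
 define eps where "eps = \<eta> / 8"
 \<comment> \<open>More than 2 * eps after every s considered, yet inside the window of width \<eta>
   = 8 * eps from \<open>local_harmonic\<close>.\<close>
 define \<beta> where "\<beta> = s0 + 4 * eps"
 have \<eta>: "\<eta> = 8 * eps" and eps: "0 < eps" using A by (auto simp: eps_def)
 define Q where "Q = {max 0 (s0 - eps)..s0 + eps} \<times> {y0 - 8 * eps..y0 + 8 * eps}"
 have cQ: "compact Q" unfolding Q_def by (intro compact_Times) auto
 have sub: "Q \<subseteq> {0..<1} \<times> UNIV" using A \<eta> by (auto simp: Q_def)
 have "(s0, y0) \<in> Q" using eps s0 by (auto simp: Q_def)
 then have ne: "Q ~= {}" by auto
 obtain p1 where p1: "p1 \<in> Q" "\<forall>p\<in>Q. g (fst p) (snd p) <= g (fst p1) (snd p1)"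
  using continuous_attains_sup[OF cQ ne continuous_on_subset[OF continuous_g sub]] by blast
 obtain p2 where p2: "p2 \<in> Q" "\<forall>p\<in>Q. g (fst p2) (snd p2) <= g (fst p) (snd p)"
  using continuous_attains_inf[OF cQ ne continuous_on_subset[OF continuous_g sub]] by blast
 obtain p3 where p3: "\<forall>p\<in>Q. \<bar>V (fst p) (snd p)\<bar> <= \<bar>V (fst p3) (snd p3)\<bar>"
  using continuous_attains_sup[OF cQ ne continuous_on_rabs[OF continuous_on_subset[OF continuous_V sub]]] by blast
 define G1 m V1 where "G1 = g (fst p1) (snd p1)" and "m = g (fst p2) (snd p2)" and "V1 = \<bar>V (fst p3) (snd p3)\<bar>"
 have "fst p2 \<in> {0..<1}" using p2(1) sub by auto
 then have m: "0 < m" unfolding m_def by (intro g_pos) auto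
 have G10: "0 <= G1" unfolding G1_def by (rule g_nonneg)
 have "s0 + eps < 1" using A \<eta> by simp
 then obtain C where C: "0 <= C" "!!s z. 0 <= s ==> s <= s0 + eps ==> Fm 0 s z <= C * (1 + z^2)" using Fm_growth by blast
 define I1 where "I1 = 3 / 2 * (1 + C * (1 + (\<bar>y0\<bar> + 8 * eps)^2))"
 have I10: "0 <= I1" using C by (simp add: I1_def)
 have bd: "g s x <= G1 \<and> \<bar>V s x\<bar> <= V1 \<and> (LINT y|K s x \<beta>. \<bar>V \<beta> y\<bar>) <= I1"
  if s: "0 <= s" "\<bar>s - s0\<bar> < eps" and x: "\<bar>x - y0\<bar> <= 8 * eps" for s x
 proof -
  have q: "(s, x) \<in> Q" using s x by (auto simp: Q_def)
  have "\<bar>x\<bar> <= \<bar>y0\<bar> + 8 * eps" using x by linarith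
  then have "x\<^sup>2 <= (\<bar>y0\<bar> + 8 * eps)\<^sup>2" using power_mono[of "\<bar>x\<bar>" _ 2] by simp
  then have "C * (1 + x^2) <= C * (1 + (\<bar>y0\<bar> + 8 * eps)^2)" using C(1) by (intro mult_left_mono) auto
  moreover have "Fm 0 s x <= C * (1 + x^2)" using s by (intro C(2)) auto
  ultimately have "3 / 2 * (1 + Fm 0 s x) <= I1" unfolding I1_def by (intro mult_left_mono add_left_mono) auto
  moreover have "(LINT y|K s x \<beta>. \<bar>V \<beta> y\<bar>) <= 3 / 2 * (1 + Fm 0 s x)"
   using s A \<eta> eps unfolding \<beta>_def by (intro integral_abs_V_le) auto
  ultimately show ?thesis using p1(2)[rule_format, OF q] p3[rule_format, OF q] by (simp add: G1_def V1_def)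
 qed
 define B where "B = exp (eps / 4) * (G1 * I1) + (G1 * (V1 + I1) + G1 * (V1 + I1)) + exp (eps / 4) * G1"
 have B0: "0 <= B" using G10 I10 by (simp add: B_def V1_def)
 define dl where "dl = min (eps / 2) (m * eps / (4 * (B + 1)))"
 have dl0: "0 < dl" using eps m B0 by (simp add: dl_def)
 have "dl <= eps / 2" "dl <= m * eps / (4 * (B + 1))" by (simp_all only: dl_def min.cobounded1 min.cobounded2)
 note dl = dl0 this
 have Bdl: "4 * B * dl <= m * eps"
 proof -
  have "dl * (4 * (B + 1)) <= m * eps" using dl(3) B0 by (simp add: pos_le_divide_eq)
  then show ?thesis using dl(1) by (simp add: algebra_simps)
 qed
 show ?thesis
 proof (rule that[of dl "B / (m / 2)" A])
  show "0 <= B / (m / 2)" using B0 m by simp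
  show "s0 + dl < 1" using A \<eta> dl eps by simp
  show "V s y0 - (LINT x|K s y0 r. V r x) <= A * (r - s)^2" if "0 <= s" "\<bar>s - s0\<bar> < dl" "s < r" "r < s0 + dl" for s r
   using that dl(2) eps \<eta> by (intro H) auto
  fix s assume s: "0 <= s" "\<bar>s - s0\<bar> < dl"
  then have sw: "\<bar>s - s0\<bar> < eps" using dl(2) eps by linarith
  have s\<beta>: "s + 2 * eps <= \<beta>" "\<beta> < 1" "s < \<beta>" using sw eps A \<eta> by (auto simp: \<beta>_def)
  obtain F where F: "F holomorphic_on ball (of_real y0) eps"
   "!!w. w \<in> ball (of_real y0) eps ==> cmod (F w) <= exp (eps / 4) * (G1 * I1) + (G1 * (V1 + I1) + G1 * (V1 + I1))"
   "!!y. \<bar>y - y0\<bar> < eps ==> F (of_real y) = of_real (g s y * V s y)"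
  proof (rule gV_extension[OF eps s(1) s\<beta>(1,2) A(1) _ bd[OF s(1) sw]])
   show "V q y - (LINT x|K q y r. V r x) <= A * (r - q)^2" if "s <= q" "q < r" "r <= \<beta>" "\<bar>y - y0\<bar> < 8 * eps" for q y r
    using that s(1) sw eps unfolding \<beta>_def by (intro H) (auto simp: \<eta>)
  qed blast+
  define G where "G = \<Phi> s \<beta> (%_. 1)"
  have G: "G holomorphic_on ball (of_real y0) eps"
   unfolding G_def by (rule holomorphic_on_subset[OF holomorphic_\<Phi>[OF s(1) s\<beta>(3,2) tame_const]]) simp
  have G_real: "G (of_real y) = of_real (g s y)" for y
  proof -
   interpret Kp: prob_space "K s y \<beta>" by (rule prob_space_K[OF s(1) s\<beta>(3,2)])
   show ?thesis unfolding G_def \<Phi>_of_real[OF s(1) s\<beta>(3,2) tame_const] using Kp.prob_space by simp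
  qed
  have G_le: "cmod (G w) <= exp (eps / 4) * G1" if w: "w \<in> ball (of_real y0) eps" for w
  proof -
   interpret Kp: prob_space "K s (Re w) \<beta>" by (rule prob_space_K[OF s(1) s\<beta>(3,2)])
   have w': "cmod (w - of_real y0) < eps" using w by (simp add: dist_norm norm_minus_commute)
   have Iw: "\<bar>Im w\<bar> < eps" "\<bar>Re w - y0\<bar> < eps" using w' abs_Im_le_cmod[of "w - of_real y0"] abs_Re_le_cmod[of "w - of_real y0"] by auto
   have "(Im w)\<^sup>2 <= eps\<^sup>2" using Iw(1) by (simp add: abs_le_square_iff[symmetric])
   then have "(Im w)\<^sup>2 / (2 * (\<beta> - s)) <= eps\<^sup>2 / (2 * (2 * eps))" using s\<beta> eps by (intro frac_le) auto
   then have e: "exp ((Im w)^2 / (2 * (\<beta> - s))) <= exp (eps / 4)" using eps by (simp add: power2_eq_square)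
   have "cmod (G w) <= exp ((Im w)^2 / (2 * (\<beta> - s))) * (g s (Re w) * (LINT y|K s (Re w) \<beta>. \<bar>1\<bar>))"
    unfolding G_def by (rule norm_\<Phi>[OF s(1) s\<beta>(3,2) tame_const])
   also have "... = exp ((Im w)^2 / (2 * (\<beta> - s))) * g s (Re w)" using Kp.prob_space by simp
   also have "... <= exp (eps / 4) * G1" using e bd[OF s(1) sw, of "Re w"] Iw(2) eps g_nonneg by (intro mult_mono) auto
   finally show ?thesis .
  qed
  have "(s, y0) \<in> Q" using s sw eps by (auto simp: Q_def)
  then have low: "m <= cmod (G (of_real y0))" using p2(2) unfolding G_real m_def by force
  have FB: "cmod (F w) <= B" "cmod (G w) <= B" if "w \<in> ball (of_real y0) eps" for w
   using F(2)[OF that] G_le[OF that] G10 I10 unfolding B_def V1_def by (auto intro: order_trans add_increasing add_increasing2)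
  note q = holomorphic_quotient_bound[OF F(1) G FB m low eps dl(2) Bdl]
  show "\<exists>F. F holomorphic_on ball (of_real y0) dl \<and> (\<forall>w\<in>ball (of_real y0) dl. cmod (F w) <= B / (m / 2)) \<and> (\<forall>y. \<bar>y - y0\<bar> < dl --> F (of_real y) = of_real (V s y))"
  proof (intro exI[of _ "%w. F w / G w"] conjI ballI allI impI q)
   fix y assume y: "\<bar>y - y0\<bar> < dl"
   have "g s y ~= 0" using g_pos[of s y] s(1) s\<beta> by simp
   then show "F (of_real y) / G (of_real y) = of_real (V s y)" using F(3)[of y] y dl(2) eps unfolding G_real by simp
  qed
 qed (use dl A in auto)
qed

text \<open>At y0 the difference V s - V r is the defect over [s, r], of order (r - s)^2, plus the
  kernel average of V r minus its value at y0, which a Taylor expansion in space evaluates up to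
  order (r - s)^(3/2). Dividing by r - s yields the time derivative in terms of the space
  derivatives.\<close>

lemma V_derivatives:
 assumes s0: "0 <= s0" "s0 < 1" and gt: "y0 < V s0 y0"
 shows "(V s0 has_real_derivative deriv (V s0) y0) (at y0)"
  and "(deriv (V s0) has_real_derivative deriv (deriv (V s0)) y0) (at y0)"
  and "((%s. V s y0) has_real_derivative - (b s0 y0 * deriv (V s0) y0 + deriv (deriv (V s0)) y0 / 2)) (at s0 within {0..<1})"
proof -
 obtain eps B A where eps: "0 < eps" and B: "0 <= B" and A: "0 <= A" and T: "s0 + eps < 1"
  and ext: "!!s. 0 <= s ==> \<bar>s - s0\<bar> < eps ==> \<exists>F. F holomorphic_on ball (of_real y0) eps \<and> (\<forall>w\<in>ball (of_real y0) eps. cmod (F w) <= B) \<and> (\<forall>y. \<bar>y - y0\<bar> < eps --> F (of_real y) = of_real (V s y))"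
  and H: "!!s r. 0 <= s ==> \<bar>s - s0\<bar> < eps ==> s < r ==> r < s0 + eps ==> V s y0 - (LINT x|K s y0 r. V r x) <= A * (r - s)^2"
  using V_extension[OF s0 gt] by blast
 define a c where "a s = deriv (V s) y0" and "c s = deriv (deriv (V s)) y0" for s
 define e where "e = eps / 2"
 define C a1 c1 where "C = 3 * B / e ^ 3" and "a1 = B / e" and "c1 = 2 * B / e^2"
 have e: "0 < e" and nn: "0 <= C" "0 <= a1" "0 <= c1" using eps B by (auto simp: e_def C_def a1_def c1_def)
 have TL: "(V s has_real_derivative a s) (at y0) \<and> (deriv (V s) has_real_derivative c s) (at y0) \<and> \<bar>a s\<bar> <= a1 \<and> \<bar>c s\<bar> <= c1 \<and>
   (\<forall>x. \<bar>x\<bar> < e --> \<bar>V s (y0 + x) - V s y0 - a s * x - c s * x^2 / 2\<bar> <= C * \<bar>x\<bar> ^ 3)" if s: "0 <= s" "\<bar>s - s0\<bar> < eps" for s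
 proof -
  obtain F where F: "F holomorphic_on ball (of_real y0) eps" "!!w. w \<in> ball (of_real y0) eps ==> cmod (F w) <= B" "!!y. \<bar>y - y0\<bar> < eps ==> F (of_real y) = of_real (V s y)"
   using ext[OF s] by blast
  note R = real_Taylor_of_holomorphic[OF F eps]
  show ?thesis using R(1)[of y0] R(2,3,4,5) eps unfolding a_def c_def a1_def c1_def C_def e_def by auto
 qed
 show "(V s0 has_real_derivative deriv (V s0) y0) (at y0)" "(deriv (V s0) has_real_derivative deriv (deriv (V s0)) y0) (at y0)"
  using TL[of s0] s0 eps by (auto simp: a_def c_def)
 obtain CF where CF: "0 <= CF" "!!s z. 0 <= s ==> s <= s0 + eps ==> Fm 0 s z <= CF * (1 + z^2)" using Fm_growth[OF T] by blast
 obtain C\<rho> where C\<rho>: "0 <= C\<rho>" "!!s z. 0 <= s ==> s <= s0 + eps ==> \<rho> s z <= C\<rho> * (1 + z^2)" using \<rho>_growth[OF T] by blast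
 obtain C4 where C4: "0 <= C4" "!!s dl y. 0 <= s ==> 0 < dl ==> s + dl <= s0 + eps ==> (LINT x|K s y (s + dl). (x - y) ^ 4) <= dl\<^sup>2 * C4 * (1 + y\<^sup>2)^2"
  using K_increment_power4[OF T] by blast
 define Cv where "Cv = 3 / 2 * (1 + CF)"
 have Cv0: "0 <= Cv" using CF by (simp add: Cv_def)
 have Vb: "\<bar>V s y\<bar> <= Cv * (1 + y^2)" if "0 <= s" "s <= s0 + eps" for s y
 proof -
  have "\<bar>V s y\<bar> <= 3 / 2 * (1 + Fm 0 s y)" using that T by (intro V_abs_le) auto
  also have "... <= 3 / 2 * ((1 + y^2) + CF * (1 + y^2))" using CF(2)[OF that, of y]
   by (intro mult_left_mono add_mono) auto
  finally show ?thesis by (simp add: Cv_def algebra_simps)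
 qed
 \<comment> \<open>For |x| >= e each term of the Taylor remainder is at most a multiple of x^4,
   since |x| / e >= 1; the fourth moment under the kernel is of order (r - s)^2.\<close>
 define C' where "C' = Cv * (2 + 3 * y0^2) / e ^ 4 + a1 / e ^ 3 + (2 * Cv + c1 / 2) / e^2"
 have C'0: "0 <= C'" using Cv0 nn e by (simp add: C'_def)
 have glob: "\<bar>V s (y0 + x) - V s y0 - a s * x - c s * x^2 / 2\<bar> <= C * \<bar>x\<bar> ^ 3 + C' * x ^ 4" if s: "0 <= s" "\<bar>s - s0\<bar> < eps" for s x
 proof (cases "\<bar>x\<bar> < e")
  case True
  have "0 <= C' * x ^ 4" using C'0 by simp
  then show ?thesis using TL[OF s] True by (intro add_increasing2) auto
 next
  case False
  then have X: "1 <= \<bar>x\<bar> / e" using e by simp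
  have P: "\<bar>x\<bar> ^ j <= x ^ 4 / e ^ (4 - j)" if "j <= 4" for j
  proof -
   have "\<bar>x\<bar> ^ j * 1 <= \<bar>x\<bar> ^ j * (\<bar>x\<bar> / e) ^ (4 - j)" using X by (intro mult_left_mono one_le_power) auto
   also have "... = \<bar>x\<bar> ^ (j + (4 - j)) / e ^ (4 - j)" by (simp only: power_divide power_add times_divide_eq_right)
   also have "... = x ^ 4 / e ^ (4 - j)" using that by simp
   finally show ?thesis by simp
  qed
  have sT: "s <= s0 + eps" using s by simp
  have "\<bar>V s (y0 + x)\<bar> <= Cv * (1 + (y0 + x)^2)" by (rule Vb[OF s(1) sT])
  also have "... <= Cv * (1 + (2 * y0^2 + 2 * x^2))"
   using Cv0 zero_le_power2[of "y0 - x"] by (intro mult_left_mono) (simp_all add: power2_eq_square algebra_simps)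
  finally have v1: "\<bar>V s (y0 + x)\<bar> <= Cv * (1 + (2 * y0^2 + 2 * x^2))" .
  have v2: "\<bar>a s * x\<bar> <= a1 * \<bar>x\<bar>" "\<bar>c s * x^2 / 2\<bar> <= c1 * x^2 / 2"
   using TL[OF s] by (auto simp: abs_mult intro!: mult_right_mono)
  have "\<bar>V s (y0 + x) - V s y0 - a s * x - c s * x^2 / 2\<bar> <= \<bar>V s (y0 + x)\<bar> + \<bar>V s y0\<bar> + \<bar>a s * x\<bar> + \<bar>c s * x^2 / 2\<bar>" by linarith
  also have "... <= Cv * (1 + (2 * y0^2 + 2 * x^2)) + Cv * (1 + y0^2) + a1 * \<bar>x\<bar> + c1 * x^2 / 2"
   by (intro add_mono v1 v2 Vb[OF s(1) sT])
  also have "... = Cv * (2 + 3 * y0^2) * \<bar>x\<bar> ^ 0 + a1 * \<bar>x\<bar> ^ 1 + (2 * Cv + c1 / 2) * \<bar>x\<bar> ^ 2" by (simp add: algebra_simps)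
  also have "... <= Cv * (2 + 3 * y0^2) * (x ^ 4 / e ^ (4 - 0)) + a1 * (x ^ 4 / e ^ (4 - 1)) + (2 * Cv + c1 / 2) * (x ^ 4 / e ^ (4 - 2))"
   using Cv0 nn by (intro add_mono mult_left_mono P) auto
  also have "... = C' * x ^ 4" by (simp add: C'_def distrib_right)
  finally show ?thesis using nn by (intro add_increasing) auto
 qed
 define L M2 M4 where "L = 1 / (1 - (s0 + eps))" and "M2 = L^2 * (C\<rho> * (1 + y0^2)) + L" and "M4 = C4 * (1 + y0\<^sup>2)^2"
 define M where "M = A + (C * (((1 + M2) + M4) / 2) + C' * M4) + c1 / 2 * M2"
 have L0: "0 <= L" "0 <= M2" "0 <= M4" using T C\<rho>(1) C4(1) by (auto simp: L_def M2_def M4_def)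
 have main: "\<bar>V s y0 - V r y0 - (r - s) * (a r * b s y0 + c r / 2)\<bar> <= M * ((r - s) * sqrt (r - s))"
  if s: "0 <= s" "\<bar>s - s0\<bar> < eps" "s < r" "r < s0 + eps" "r - s <= 1" for s r
 proof -
  define dl where "dl = r - s"
  have sr: "0 <= s" "s < r" "r < 1" and rw: "0 <= r" "\<bar>r - s0\<bar> < eps" using s T by auto
  interpret Kp: prob_space "K s y0 r" by (rule prob_space_K[OF sr])
  have dl: "0 < dl" "dl <= 1" "r = s + dl" using s by (auto simp: dl_def)
  define \<kappa> where "\<kappa> = sqrt dl"
  have \<kappa>: "0 < \<kappa>" "\<kappa> * \<kappa> = dl" "\<kappa> <= 1" using dl by (auto simp: \<kappa>_def)
  have dk: "dl\<^sup>2 <= dl * \<kappa>" "dl\<^sup>2 / \<kappa> = dl * \<kappa>"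
  proof -
   have "dl <= \<kappa>" using \<kappa> mult_left_mono[of \<kappa> 1 \<kappa>] by simp
   then show "dl\<^sup>2 <= dl * \<kappa>" using dl by (simp add: power2_eq_square)
   show "dl\<^sup>2 / \<kappa> = dl * \<kappa>" using \<kappa> by (simp add: power2_eq_square divide_eq_eq mult.assoc)
  qed
  define S2 S4 where "S2 = (LINT y|K s y0 r. (y - y0)\<^sup>2)" and "S4 = (LINT y|K s y0 r. (y - y0) ^ 4)"
  have iV: "integrable (K s y0 r) (V r)" using sr by (intro integrable_K_tame tame_V) auto
  have i1: "integrable (K s y0 r) (%y. y - y0)" and i2: "integrable (K s y0 r) (%y. (y - y0)\<^sup>2)" and i4: "integrable (K s y0 r) (%y. (y - y0) ^ 4)"
   using integrable_K_tame[OF sr tame_id] integrable_K_tame[OF sr tame_sq] integrable_K_power4[OF sr] by auto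
  have sL: "1 / (1 - s) <= L" using s T unfolding L_def by (intro frac_le) auto
  have "S2 = (dl / (1 - s))\<^sup>2 * \<rho> s y0 + dl * (1 - r) / (1 - s)"
   unfolding S2_def K_second_moment[OF sr] dl_def by simp
  also have "dl * (1 - r) / (1 - s) = dl - dl\<^sup>2 * (1 / (1 - s))" using sr dl by (simp add: field_simps power2_eq_square)
  finally have S2: "S2 - dl = dl^2 * ((1 / (1 - s))\<^sup>2 * \<rho> s y0 - 1 / (1 - s))" by (simp add: power_divide algebra_simps)
  have S2': "\<bar>S2 - dl\<bar> <= dl\<^sup>2 * M2"
  proof -
   have "(1 / (1 - s))\<^sup>2 * \<rho> s y0 <= L\<^sup>2 * (C\<rho> * (1 + y0^2))"
    using sL sr C\<rho>(2)[of s y0] s \<rho>_nonneg by (intro mult_mono power_mono) auto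
   moreover have "0 <= (1 / (1 - s))\<^sup>2 * \<rho> s y0" "0 <= 1 / (1 - s)" "0 <= L\<^sup>2 * (C\<rho> * (1 + y0^2))" using sr \<rho>_nonneg C\<rho>(1) by auto
   ultimately have "\<bar>(1 / (1 - s))\<^sup>2 * \<rho> s y0 - 1 / (1 - s)\<bar> <= M2" using sL L0 unfolding M2_def by linarith
   then show ?thesis unfolding S2 abs_mult by (simp add: mult_left_mono)
  qed
  have S2le: "S2 <= (1 + M2) * dl"
  proof -
   have "dl\<^sup>2 * M2 <= dl * M2" using dl L0 by (intro mult_right_mono) (auto simp: power2_eq_square)
   then show ?thesis using S2' by (simp add: algebra_simps)
  qed
  have S4le: "S4 <= dl\<^sup>2 * M4" using C4(2)[of s dl y0] s dl unfolding S4_def M4_def by (simp add: mult.assoc)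
  define R where "R y = V r y - V r y0 - a r * (y - y0) - c r / 2 * (y - y0)^2" for y
  have "(LINT y|K s y0 r. R y) = (LINT y|K s y0 r. V r y) - V r y0 - a r * ((LINT y|K s y0 r. y) - y0) - c r / 2 * S2"
   unfolding R_def S2_def using iV i1 i2 integrable_K_tame[OF sr tame_id] Kp.prob_space by simp
  also have "(LINT y|K s y0 r. y) - y0 = dl * b s y0" unfolding K_mean[OF sr] b_eq dl_def by simp
  finally have ER: "(LINT y|K s y0 r. R y) = (LINT y|K s y0 r. V r y) - V r y0 - a r * (dl * b s y0) - c r / 2 * S2" .
  have pw: "\<bar>R y\<bar> <= C * ((\<kappa> * (y - y0)^2 + (y - y0) ^ 4 / \<kappa>) / 2) + C' * (y - y0) ^ 4" for y
  proof -
   define x where "x = y - y0"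
   \<comment> \<open>Trades the cubic remainder for second and fourth moments; \<kappa> = sqrt dl
     balances their orders.\<close>
   have "0 <= (\<kappa> * \<bar>x\<bar> - x\<^sup>2)\<^sup>2 / \<kappa>" using \<kappa> by simp
   also have "... = \<kappa> * x^2 + x ^ 4 / \<kappa> - 2 * \<bar>x\<bar> ^ 3"
    using \<kappa>(1) by (simp add: power2_diff power_mult_distrib diff_divide_distrib add_divide_distrib)
     (simp add: power2_eq_square power3_eq_cube power4_eq_xxxx field_simps)
   finally have "\<bar>x\<bar> ^ 3 <= (\<kappa> * x^2 + x ^ 4 / \<kappa>) / 2" by simp
   then have "C * \<bar>x\<bar> ^ 3 <= C * ((\<kappa> * x^2 + x ^ 4 / \<kappa>) / 2)" using nn by (intro mult_left_mono) auto
   moreover have "\<bar>R y\<bar> <= C * \<bar>x\<bar> ^ 3 + C' * x ^ 4" using glob[OF rw, of x] by (simp add: R_def x_def)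
   ultimately show ?thesis unfolding x_def[symmetric] by linarith
  qed
  have iR: "integrable (K s y0 r) R" unfolding R_def[abs_def] using iV i1 i2 by simp
  have "\<bar>\<integral>y. R y \<partial>K s y0 r\<bar> <= (LINT y|K s y0 r. \<bar>R y\<bar>)" using integral_norm_bound[of "K s y0 r" R] by simp
  also have "... <= (LINT y|K s y0 r. C * ((\<kappa> * (y - y0)^2 + (y - y0) ^ 4 / \<kappa>) / 2) + C' * (y - y0) ^ 4)"
   using iR i2 i4 by (intro integral_mono pw) auto
  also have "... = C * ((\<kappa> * S2 + S4 / \<kappa>) / 2) + C' * S4" unfolding S2_def S4_def using i2 i4 by simp
  also have "... <= C * (((1 + M2) * (dl * \<kappa>) + M4 * (dl * \<kappa>)) / 2) + C' * (M4 * (dl * \<kappa>))"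
  proof (intro add_mono mult_left_mono divide_right_mono)
   show "\<kappa> * S2 <= (1 + M2) * (dl * \<kappa>)" using mult_left_mono[OF S2le, of \<kappa>] \<kappa> by (simp add: mult_ac)
   have "S4 / \<kappa> <= dl\<^sup>2 * M4 / \<kappa>" using S4le \<kappa> by (intro divide_right_mono) auto
   also have "... = M4 * (dl^2 / \<kappa>)" by simp
   finally show "S4 / \<kappa> <= M4 * (dl * \<kappa>)" unfolding dk(2) .
   show "S4 <= M4 * (dl * \<kappa>)" using S4le mult_right_mono[OF dk(1) L0(3)] by (simp add: mult.commute)
  qed (use nn C'0 in auto)
  also have "... = (C * (((1 + M2) + M4) / 2) + C' * M4) * (dl * \<kappa>)" by (simp add: algebra_simps add_divide_distrib)
  finally have e1: "\<bar>\<integral>y. R y \<partial>K s y0 r\<bar> <= (C * (((1 + M2) + M4) / 2) + C' * M4) * (dl * \<kappa>)" .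
  have e2: "\<bar>V s y0 - (LINT y|K s y0 r. V r y)\<bar> <= A * (dl * \<kappa>)"
   using H[OF s(1-4)] V_superharmonic[OF sr, of y0] mult_left_mono[OF dk(1) A] by (simp add: dl_def)
  have e3: "\<bar>c r / 2 * (S2 - dl)\<bar> <= c1 / 2 * M2 * (dl * \<kappa>)"
  proof -
   have "\<bar>c r / 2\<bar> * \<bar>S2 - dl\<bar> <= c1 / 2 * (dl^2 * M2)" using TL[OF rw] S2' nn by (intro mult_mono) auto
   also have "... <= c1 / 2 * ((dl * \<kappa>) * M2)" using nn L0 dk(1) by (intro mult_left_mono mult_right_mono) auto
   finally show ?thesis by (simp add: abs_mult mult_ac)
  qed
  have "V s y0 - V r y0 - dl * (a r * b s y0 + c r / 2) = (V s y0 - (LINT y|K s y0 r. V r y)) + (LINT y|K s y0 r. R y) + c r / 2 * (S2 - dl)"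
   unfolding ER by ((simp add: right_diff_distrib distrib_left mult_ac; fail) | (simp add: algebra_simps diff_divide_distrib; fail) | (simp add: field_simps; fail))
  also have "\<bar>...\<bar> <= A * (dl * \<kappa>) + (C * (((1 + M2) + M4) / 2) + C' * M4) * (dl * \<kappa>) + c1 / 2 * M2 * (dl * \<kappa>)"
   using e1 e2 e3 by linarith
  finally show ?thesis unfolding M_def \<kappa>_def dl_def by (simp only: distrib_right)
 qed
 let ?F = "at s0 within {0..<1}"
 have near: "eventually (%r. 0 <= r \<and> \<bar>r - s0\<bar> < eps \<and> \<bar>r - s0\<bar> <= 1 \<and> r ~= s0) ?F"
  unfolding eventually_at using eps by (intro exI[of _ "min eps 1"]) (auto simp: dist_real_def)
 have pair: "continuous_on {0..<1} (%r::real. (r, y::real))" for y by (intro continuous_on_Pair continuous_on_id continuous_on_const)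
 have "continuous_on {0..<1} (%r. V r y)" for y
  using continuous_on_compose2[OF continuous_V pair[of y]] by (simp add: image_subset_iff)
 then have Vlim: "((%r. V r (y0 + x)) \<longlongrightarrow> V s0 (y0 + x)) ?F" for x
  using s0 by (simp add: continuous_on_def)
 have acl: "(a \<longlongrightarrow> a s0) ?F" "(c \<longlongrightarrow> c s0) ?F"
 proof -
  have ev: "eventually (%r. \<forall>x. \<bar>x\<bar> < e --> \<bar>V r (y0 + x) - V r (y0 + 0) - a r * x - c r * x^2 / 2\<bar> <= C * \<bar>x\<bar> ^ 3) ?F"
   using near by eventually_elim (use TL in auto)
  have T0: "\<bar>V s0 (y0 + x) - V s0 (y0 + 0) - a s0 * x - c s0 * x^2 / 2\<bar> <= C * \<bar>x\<bar> ^ 3" if "\<bar>x\<bar> < e" for x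
   using TL[of s0] that s0 eps by simp
  show "(a \<longlongrightarrow> a s0) ?F" "(c \<longlongrightarrow> c s0) ?F"
   using Taylor_coefficients_tendsto[where w = "%r x. V r (y0 + x)" and ?w0.0 = "%x. V s0 (y0 + x)", OF ev T0 Vlim e] by auto
 qed
 have "continuous_on {0..<1} (%r. b r y0)"
  using continuous_on_compose2[OF continuous_b pair[of y0]] by (simp add: image_subset_iff)
 then have bl: "((%r. b r y0) \<longlongrightarrow> b s0 y0) ?F" using s0 by (simp add: continuous_on_def)
 \<comment> \<open>\<open>main\<close> takes the coefficients at the later time and the drift at the
   earlier one. To the right of s0 the later time is r, to the left it is s0: two formulas, with a
   common limit by \<open>acl\<close> and \<open>bl\<close>.\<close>
 define D where "D r = (if s0 < r then a r * b s0 y0 + c r / 2 else a s0 * b r y0 + c s0 / 2)" for r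
 have Dl: "(D \<longlongrightarrow> a s0 * b s0 y0 + c s0 / 2) ?F"
  unfolding D_def[abs_def]
  by (rule filterlim_If; rule tendsto_mono[OF inf_le1]; intro tendsto_intros acl bl) simp_all
 have "((%r. (V r y0 - V s0 y0) / (r - s0) + D r) \<longlongrightarrow> 0) ?F"
 proof (rule Lim_null_comparison)
  show "eventually (%r. norm ((V r y0 - V s0 y0) / (r - s0) + D r) <= M * sqrt \<bar>r - s0\<bar>) ?F"
   using near
  proof eventually_elim
   case (elim r)
   show ?case
   proof (cases "s0 < r")
    case True
    have "(V r y0 - V s0 y0) / (r - s0) + D r = - (V s0 y0 - V r y0 - (r - s0) * (a r * b s0 y0 + c r / 2)) / (r - s0)"
     using True by (simp add: D_def field_simps)
    moreover have "\<bar>- (V s0 y0 - V r y0 - (r - s0) * (a r * b s0 y0 + c r / 2)) / (r - s0)\<bar> <= M * ((r - s0) * sqrt (r - s0)) / (r - s0)"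
     unfolding abs_divide abs_minus using divide_right_mono[OF main[of s0 r], of "r - s0"] True elim s0 eps by simp
    ultimately show ?thesis using True by simp
   next
    case False
    then have lt: "r < s0" using elim by simp
    have "(V r y0 - V s0 y0) / (r - s0) + D r = - (V r y0 - V s0 y0 - (s0 - r) * (a s0 * b r y0 + c s0 / 2)) / (s0 - r)"
     using lt by (simp add: D_def field_simps)
    moreover have "\<bar>- (V r y0 - V s0 y0 - (s0 - r) * (a s0 * b r y0 + c s0 / 2)) / (s0 - r)\<bar> <= M * ((s0 - r) * sqrt (s0 - r)) / (s0 - r)"
     unfolding abs_divide abs_minus using divide_right_mono[OF main[of r s0], of "s0 - r"] lt elim s0 eps by simp
    ultimately show ?thesis using lt by simp
   qed
  qed
  have "((%r. M * sqrt \<bar>r - s0\<bar>) \<longlongrightarrow> M * sqrt \<bar>s0 - s0\<bar>) ?F" by (intro tendsto_intros)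
  then show "((%r. M * sqrt \<bar>r - s0\<bar>) \<longlongrightarrow> 0) ?F" by simp
 qed
 from tendsto_diff[OF this Dl] show "((%s. V s y0) has_real_derivative - (b s0 y0 * deriv (V s0) y0 + deriv (deriv (V s0)) y0 / 2)) (at s0 within {0..<1})"
  unfolding has_field_derivative_iff by (simp add: a_def c_def mult.commute)
qed

end

theorem theorem2p5:
  fixes \<mu> :: "real measure"
    and M :: "'w measure"
    and W :: "real \<Rightarrow> 'w \<Rightarrow> real"
    and Z :: "real \<Rightarrow> real \<Rightarrow> real \<Rightarrow> 'w \<Rightarrow> real"
  assumes "real_distribution \<mu>"
    and "integrable \<mu> (\<lambda>u. u)"
    and "bounded_posterior_variance \<mu>"
    and "standard_brownian_motion M W"
    and "\<forall>t\<in>{0..<1}. \<forall>z. bridge_solution \<mu> M W t z (Z t z)"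
  defines "v \<equiv> value_fun M Z"
    and "\<C> \<equiv> continuation_set M Z"
    and "\<D> \<equiv> stopping_set M Z"
    and "\<tau>D \<equiv> hitting_time M Z"
  shows
    \<comment> \<open>all expectations exist and the supremum defining \<open>v\<close> is finite\<close>
    "(\<forall>t\<in>{0..<1}. \<forall>z.
        (\<forall>\<tau>\<in>stopping_times M t (Z t z). integrable M (stopped t (Z t z) \<tau>)) \<and>
        bdd_above ((\<lambda>\<tau>. \<integral>\<omega>. stopped t (Z t z) \<tau> \<omega> \<partial>M) ` stopping_times M t (Z t z)))
     \<and>
     (\<forall>t\<in>{0..<1}. \<forall>z.
        \<tau>D t z \<in> stopping_times M t (Z t z) \<and>
        v t z = (\<integral>\<omega>. stopped t (Z t z) (\<tau>D t z) \<omega> \<partial>M))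
     \<and>
     continuous_on ({0..<1} \<times> UNIV) (\<lambda>(t, z). v t z)
     \<and>
     (\<exists>v1 v2 v22 :: real \<Rightarrow> real \<Rightarrow> real. \<forall>(t, z)\<in>\<C>.
        ((\<lambda>s. v s z) has_real_derivative v1 t z) (at t within {0..<1}) \<and>
        ((\<lambda>y. v t y) has_real_derivative v2 t z) (at z) \<and>
        ((\<lambda>y. v2 t y) has_real_derivative v22 t z) (at z) \<and>
        v1 t z + ((posterior_mean \<mu> t z - z) / (1 - t) * v2 t z + 1 / 2 * v22 t z) = 0)
     \<and>
     (\<forall>(t, z)\<in>\<D>. t < 1 \<longrightarrow> v t z = z)"
proof -
 interpret bounded_posterior \<mu> by (rule bounded_posterior.intro[OF assms(1,3)])
 have sde: "bridge_sde \<mu> M W t z (Z t z)" if "t \<in> {0..<1}" for t z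
  using assms(4,5) that by (intro bridge_sde.intro bridge_sde_axioms.intro bounded_posterior_axioms) auto
 have v: "v t z = V t z" if "t \<in> {0..<1}" for t z
  using bridge_sde.stopping_value[OF sde[OF that]] by (simp add: v_def value_fun_def)
 have C: "(t, z) \<in> \<C> \<longleftrightarrow> t \<in> {0..<1} \<and> z < V t z" for t z
  using v[of t z] by (auto simp: \<C>_def continuation_set_def v_def)
 have D: "(t, z) \<in> \<D> \<longleftrightarrow> 0 <= t \<and> t <= 1 \<and> (t < 1 --> V t z <= z)" for t z
  using C[of t z] by (auto simp: \<D>_def \<C>_def stopping_set_def)
 have opt: "(\<forall>\<tau>\<in>stopping_times M t (Z t z). integrable M (stopped t (Z t z) \<tau>)) \<and>
   bdd_above ((%\<tau>. \<integral>om. stopped t (Z t z) \<tau> om \<partial>M) ` stopping_times M t (Z t z)) \<and>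
   \<tau>D t z \<in> stopping_times M t (Z t z) \<and> v t z = (LINT om|M. stopped t (Z t z) (\<tau>D t z) om)" if t: "t \<in> {0..<1}" for t z
 proof -
  interpret S: bridge_sde \<mu> M W t z "Z t z" by (rule sde[OF t])
  \<comment> \<open>\<open>hitting_time\<close> counts elapsed time and refers to the abstract
    stopping set. Since V is the value, that set is described by V <= z before time 1 and contains
    all of time 1, so the infimum is a minimum, attained at \<open>hitD - t\<close>.\<close>
  have hit: "\<tau>D t z om = S.hitD om - t" if om: "om \<in> space M" for om
   unfolding \<tau>D_def hitting_time_def
  proof (rule cInf_eq_minimum)
   show "S.hitD om - t \<in> {s. 0 <= s \<and> (t + s, Z t z (t + s) om) \<in> stopping_set M Z}"
    using S.hitD(1-3)[OF om] t D[of "S.hitD om" "Z t z (S.hitD om) om"] by (auto simp: \<D>_def)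
   fix s assume s: "s \<in> {s. 0 <= s \<and> (t + s, Z t z (t + s) om) \<in> stopping_set M Z}"
   show "S.hitD om - t <= s"
   proof (rule ccontr)
    assume "\<not> S.hitD om - t <= s"
    then have "0 < V (t + s) (Z t z (t + s) om) - Z t z (t + s) om" "t + s < 1"
     using S.hitD(4)[OF om, of "t + s"] S.hitD(2)[OF om] s by auto
    then show False using s D[of "t + s" "Z t z (t + s) om"] by (simp add: \<D>_def)
   qed
  qed
  \<comment> \<open>The two times are known to agree only on \<open>space M\<close>, which suffices
    for the stopping time property.\<close>
  have "stopping_time (generated_filtration M t (Z t z)) (\<tau>D t z) = stopping_time (generated_filtration M t (Z t z)) (%om. S.hitD om - t)"
   using hit by (intro stopping_time_cong) simp
  then have st: "\<tau>D t z \<in> stopping_times M t (Z t z)" using S.hitD_stopping_time hit by (simp add: stopping_times_def)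
  have "(LINT om|M. stopped t (Z t z) (\<tau>D t z) om) = (LINT om|M. stopped t (Z t z) (%om. S.hitD om - t) om)"
   by (intro Bochner_Integration.integral_cong) (simp_all add: stopped_def hit)
  then have "v t z = (LINT om|M. stopped t (Z t z) (\<tau>D t z) om)" using S.stopped_hitD v[OF t] by simp
  moreover have "bdd_above ((%\<tau>. \<integral>om. stopped t (Z t z) \<tau> om \<partial>M) ` stopping_times M t (Z t z))"
   by (rule bdd_aboveI[of _ "V t z"]) (use S.stopped_le_V in auto)
  ultimately show ?thesis using st S.integrable_stopped by blast
 qed
 have cont: "continuous_on ({0..<1} \<times> UNIV) (%(t, z). v t z)"
  by (rule continuous_on_eq[OF continuous_V]) (auto simp: v)
 have pde: "((%s. v s z) has_real_derivative - (b t z * deriv (V t) z + deriv (deriv (V t)) z / 2)) (at t within {0..<1}) \<and>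
   ((%y. v t y) has_real_derivative deriv (V t) z) (at z) \<and> (deriv (V t) has_real_derivative deriv (deriv (V t)) z) (at z)"
  if "(t, z) \<in> \<C>" for t z
 proof -
  have t: "t \<in> {0..<1}" "0 <= t" "t < 1" "z < V t z" using that C by auto
  have "(%y. v t y) = V t" using v[OF t(1)] by auto
  moreover have "((%s. v s z) has_real_derivative - (b t z * deriv (V t) z + deriv (deriv (V t)) z / 2)) (at t within {0..<1})"
   by (rule has_field_derivative_transform_within[OF V_derivatives(3)[OF t(2-4)] zero_less_one t(1)]) (simp add: v)
  ultimately show ?thesis using V_derivatives(1,2)[OF t(2-4)] by simp
 qed
 have D': "v t z = z" if "(t, z) \<in> \<D>" "t < 1" for t z
  using that D[of t z] V_ge[of t z] v[of t z] by simp
 have ex: "\<exists>v1 v2 v22 :: real => real => real. \<forall>(t, z)\<in>\<C>.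
    ((%s. v s z) has_real_derivative v1 t z) (at t within {0..<1}) \<and>
    ((%y. v t y) has_real_derivative v2 t z) (at z) \<and>
    ((%y. v2 t y) has_real_derivative v22 t z) (at z) \<and>
    v1 t z + ((posterior_mean \<mu> t z - z) / (1 - t) * v2 t z + 1 / 2 * v22 t z) = 0"
  by (rule exI[of _ "%t z. - (b t z * deriv (V t) z + deriv (deriv (V t)) z / 2)"], rule exI[of _ "%t. deriv (V t)"], rule exI[of _ "%t z. deriv (deriv (V t)) z"])
   (use pde in \<open>auto simp: b_def drift_def\<close>)
 show ?thesis
  by (intro conjI ballI allI; ((rule cont ex opt[THEN conjunct1, THEN bspec] opt[THEN conjunct2, THEN conjunct1]
   opt[THEN conjunct2, THEN conjunct2, THEN conjunct1] opt[THEN conjunct2, THEN conjunct2, THEN conjunct2]; assumption) | clarsimp simp: D'))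
qed

end
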